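(* Let $\Lambda^\vee$ be a lattice, $J$ an integral bilinear form on $\Lambda^\vee$, $I=J+J^t$, and assume that $I^\sharp:\Lambda^\vee\to\Lambda=\operatorname{Hom}(\Lambda^\vee,\mathbb Z)$, $m\mapsto I(m,-)$, is an isomorphism. Let $\mathcal T\rtimes\{\pm1\}=\mathcal S(\Theta')$. The categorical group $\mathcal S(wAct^+(\Theta'))$ of centre-preserving weak automorphisms of $\mathcal T\rtimes\{\pm1\}$ is equivalent to the strict categorical group $\mathcal S(\Xi')$, where $\Xi'$ is the crossed module $$\xi':\widetilde{\Lambda^\vee}/2\Lambda^\vee\longrightarrow T\rtimes E,\qquad([n],\iota)\longmapsto\left(\exp\left(\tfrac n2\right),\operatorname{id},B\right),\quad\text{where } I^\sharp(n)\equiv\phi_B\bmod 2,$$ with the action of $T\rtimes E$ on $\widetilde{\Lambda^\vee}/2\Lambda^\vee$ given by $$([n],\iota)^{(t,f,B)}=\left([f^{-1}n],\ \iota+B(f^{-1}n,f^{-1}n)\right).$$ (All objects are defined in the context.)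
   Context: **Crossed modules and categorical groups.** A crossed module $\Psi$ is a homomorphism $\psi:G_1\to G_0$, $\alpha\mapsto\underline\alpha$, with a right action of $G_0$ on $G_1$ with $\underline{\alpha^x}=x^{-1}\underline\alpha x$, $\beta^{\underline\alpha}=\alpha^{-1}\beta\alpha$; $\pi_1(\Psi)=\ker\psi$. Its strict categorical group $\mathcal S(\Psi)$ is the strict monoidal groupoid with objects $G_0$, arrows $(x,\alpha):x\to x\underline\alpha$, composition by multiplication of the $\alpha$'s, and monoidal structure $(x,\alpha)(y,\beta)=(xy,\alpha^y\beta)$. Equivalence means monoidal equivalence. **Weak automorphisms.** A weak endomorphism of $\Psi$ is $(p,\kappa)$ with pointed maps $p_i:G_i\to G_i$ ($i=0,1$) and $\kappa:G_0\times G_0\to G_1$ satisfying: $p_0(\underline\alpha)=\underline{p_1(\alpha)}$; $p_0(x)p_0(y)\underline{\kappa_{x,y}}=p_0(xy)$; $p_1(\alpha)p_1(\beta)\kappa_{\underline\alpha,\underline\beta}=p_1(\alpha\beta)$; $\kappa_{x,y}^{p_0(z)}\kappa_{xy,z}=\kappa_{y,z}\kappa_{x,yz}$ (either side is denoted $\kappa_{x,y,z}$); $p_1(\alpha)^{p_0(x)}\kappa_{\underline\alpha,x}=p_1(\alpha^x)\kappa_{x,\underline{\alpha^x}}$. Composition: $(f,\kappa)(g,\gamma)=(f\circ g,\beta)$, $\beta_{x,y}=f_1(\gamma_{x,y})\kappa_{g_0(x),g_0(y),\underline{\gamma_{x,y}}}$. The weak actor $wAct(\Psi)$ is the crossed module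 with degree-0 group the weak endomorphisms with $f_0,f_1$ bijective, and degree-1 group the invertible elements of the semigroup of pointed maps $\eta:G_0\to G_1$ under $(\eta_1\circ\eta_2)(x)=\eta_2(x)\,\eta_1(x\underline{\eta_2(x)})$. The structure map sends $\eta$ to $(f,\kappa)$ with $f_0(x)=x\underline{\eta(x)}$, $f_1(\alpha)=\alpha\eta(\underline\alpha)$, $\kappa_{x,y}=\eta(y)^{-1}(\eta(x)^y)^{-1}\eta(xy)$. The action is $\eta^{(f,\kappa)}(x)=f_1^{-1}\big(\eta(f_0(x))\,\kappa_{x,u}^{-1}\big)$ with $u=x^{-1}f_0^{-1}(f_0(x)\underline{\eta(f_0(x))})$. $wAct^+(\Psi)$ is the sub-crossed module with the same degree-1 group and with degree-0 group the $(f,\kappa)$ for which $f_1$ is the identity on $\pi_1(\Psi)$ (centre-preserving). For the Lie crossed module $\Theta'$ below, all maps $f_0,f_1,\kappa,\eta$ (and inverses) are required to be analytic. **$\Theta'$.** $\mathfrak t=\Lambda^\vee\otimes\mathbb R$, $T=\Lambda^\vee\otimes U(1)$, $\exp:\mathfrak t\to T$, $\exp=\Lambda^\vee\otimes e^{2\pi i(-)}$; $J$ extended bilinearly. $\Theta'$ is $\theta':\Lambda^\vee\times\mathbb R/\mathbb Z\to\mathfrak t\rtimes\{\pm1\}$, $(m,[a])\mapsto(m,1)$ ($\Lambda^\vee$ discrete), where $(x,\epsilon)(y,\delta)=(x+\epsilon y,\epsilon\delta)$, with action $(m,[a])^{(x,\epsilon)}=(\epsilon m,[a+J(m,x)])$.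 **$E$.** $\Lambda\otimes\Lambda$ is the group of integral bilinear forms on $\Lambda^\vee$; $\Gamma_2\Lambda$ the symmetric ones; $(\Gamma_2\Lambda)_{ev}$ the even symmetric ones. For $B\in\Gamma_2\Lambda$, $\phi_B(m)=B(m,m)$, which modulo $2$ is an element of $\Lambda/2\Lambda$. $O(\Lambda^\vee,I)$ is the isometry group of $I$; $f^*$ is precomposition with $f$. In $O(\Lambda^\vee,I)\ltimes(\Lambda\otimes\Lambda)$, with $(f,B)(g,B')=(fg,g^*B+B')$, let $\widetilde{O(\Lambda^\vee,I)}=\{(f,B)\mid B-B^t=J-f^*J\}$, and $E=\widetilde{O(\Lambda^\vee,I)}/(\Gamma_2\Lambda)_{ev}$. $E$ acts on $T$ through $O(\Lambda^\vee,I)$, giving $T\rtimes E$ with elements $(t,f,B)$. In the definition of $\xi'$, $B$ denotes the class of any $B\in\Gamma_2\Lambda$ with $\phi_B\equiv I^\sharp(n)\bmod2$. **$\widetilde{\Lambda^\vee}$.** The central extension of $\Lambda^\vee$ by $\mathbb Z/2\mathbb Z$ (additive) with cocycle $J^t$ mod $2$: $(n,\iota)(n',\iota')=(n+n',\iota+\iota'+[J(n',n)])$. $2\Lambda^\vee$ is the normal subgroup of elements $(2m,0)$. In the action, $B(f^{-1}n,f^{-1}n)$ is taken modulo $2$. *)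

theory Defs
  imports
    "HOL-Analysis.Infinite_Sum"
    "HOL-Algebra.Coset"
    "HOL-Library.Poly_Mapping"
    "HOL-Library.Z2"
begin

section \<open>Crossed modules and strict monoidal categories\<close>

record ('a, 'b) xmod =
  deg1 :: "'a monoid"
  deg0 :: "'b monoid"
  bdry :: "'a \<Rightarrow> 'b"
  act :: "'a \<Rightarrow> 'b \<Rightarrow> 'a"

definition crossed_module :: "('a, 'b, 'z) xmod_scheme \<Rightarrow> bool" where
  "crossed_module \<Psi> \<longleftrightarrow>
     group (deg1 \<Psi>) \<and> group (deg0 \<Psi>) \<and> bdry \<Psi> \<in> hom (deg1 \<Psi>) (deg0 \<Psi>) \<and>
     (\<forall>x\<in>carrier (deg0 \<Psi>). (\<lambda>\<alpha>. act \<Psi> \<alpha> x) \<in> hom (deg1 \<Psi>) (deg1 \<Psi>)) \<and>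
     (\<forall>\<alpha>\<in>carrier (deg1 \<Psi>). act \<Psi> \<alpha> \<one>\<^bsub>deg0 \<Psi>\<^esub> = \<alpha>) \<and>
     (\<forall>\<alpha>\<in>carrier (deg1 \<Psi>). \<forall>x\<in>carrier (deg0 \<Psi>). \<forall>y\<in>carrier (deg0 \<Psi>).
        act \<Psi> \<alpha> (x \<otimes>\<^bsub>deg0 \<Psi>\<^esub> y) = act \<Psi> (act \<Psi> \<alpha> x) y) \<and>
     (\<forall>\<alpha>\<in>carrier (deg1 \<Psi>). \<forall>x\<in>carrier (deg0 \<Psi>).
        bdry \<Psi> (act \<Psi> \<alpha> x) = inv\<^bsub>deg0 \<Psi>\<^esub> x \<otimes>\<^bsub>deg0 \<Psi>\<^esub> bdry \<Psi> \<alpha> \<otimes>\<^bsub>deg0 \<Psi>\<^esub> x) \<and>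
     (\<forall>\<alpha>\<in>carrier (deg1 \<Psi>). \<forall>\<beta>\<in>carrier (deg1 \<Psi>).
        act \<Psi> \<beta> (bdry \<Psi> \<alpha>) = inv\<^bsub>deg1 \<Psi>\<^esub> \<alpha> \<otimes>\<^bsub>deg1 \<Psi>\<^esub> \<beta> \<otimes>\<^bsub>deg1 \<Psi>\<^esub> \<alpha>)"

text \<open>\<open>comp C g f\<close> is the composite "g after f".\<close>

record ('o, 'm) smcat =
  objs :: "'o set"
  arrs :: "'m set"
  src :: "'m \<Rightarrow> 'o"
  tgt :: "'m \<Rightarrow> 'o"
  ident :: "'o \<Rightarrow> 'm"
  comp :: "'m \<Rightarrow> 'm \<Rightarrow> 'm"
  tens_obj :: "'o \<Rightarrow> 'o \<Rightarrow> 'o"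
  tens_arr :: "'m \<Rightarrow> 'm \<Rightarrow> 'm"
  unit_obj :: "'o"

definition hom_set :: "('o, 'm) smcat \<Rightarrow> 'o \<Rightarrow> 'o \<Rightarrow> 'm set" where
  "hom_set C X Y = {f \<in> arrs C. src C f = X \<and> tgt C f = Y}"

definition is_category :: "('o, 'm) smcat \<Rightarrow> bool" where
  "is_category C \<longleftrightarrow>
     (\<forall>f\<in>arrs C. src C f \<in> objs C \<and> tgt C f \<in> objs C) \<and>
     (\<forall>X\<in>objs C. ident C X \<in> hom_set C X X) \<and>
     (\<forall>f\<in>arrs C. \<forall>g\<in>arrs C. src C g = tgt C f \<longrightarrow>
        comp C g f \<in> hom_set C (src C f) (tgt C g)) \<and>
     (\<forall>f\<in>arrs C. comp C f (ident C (src C f)) = f \<and> comp C (ident C (tgt C f)) f = f) \<and>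
     (\<forall>f\<in>arrs C. \<forall>g\<in>arrs C. \<forall>h\<in>arrs C. src C g = tgt C f \<longrightarrow> src C h = tgt C g \<longrightarrow>
        comp C h (comp C g f) = comp C (comp C h g) f)"

definition strict_monoidal_category :: "('o, 'm) smcat \<Rightarrow> bool" where
  "strict_monoidal_category C \<longleftrightarrow>
     is_category C \<and>
     unit_obj C \<in> objs C \<and>
     (\<forall>X\<in>objs C. \<forall>Y\<in>objs C. tens_obj C X Y \<in> objs C) \<and>
     (\<forall>f\<in>arrs C. \<forall>g\<in>arrs C. tens_arr C f g \<in>
        hom_set C (tens_obj C (src C f) (src C g)) (tens_obj C (tgt C f) (tgt C g))) \<and>
     (\<forall>X\<in>objs C. \<forall>Y\<in>objs C.
        tens_arr C (ident C X) (ident C Y) = ident C (tens_obj C X Y)) \<and>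
     (\<forall>f\<in>arrs C. \<forall>f'\<in>arrs C. \<forall>g\<in>arrs C. \<forall>g'\<in>arrs C.
        src C f' = tgt C f \<longrightarrow> src C g' = tgt C g \<longrightarrow>
        tens_arr C (comp C f' f) (comp C g' g) = comp C (tens_arr C f' g') (tens_arr C f g)) \<and>
     (\<forall>X\<in>objs C. \<forall>Y\<in>objs C. \<forall>Z\<in>objs C.
        tens_obj C (tens_obj C X Y) Z = tens_obj C X (tens_obj C Y Z)) \<and>
     (\<forall>f\<in>arrs C. \<forall>g\<in>arrs C. \<forall>h\<in>arrs C.
        tens_arr C (tens_arr C f g) h = tens_arr C f (tens_arr C g h)) \<and>
     (\<forall>X\<in>objs C. tens_obj C (unit_obj C) X = X \<and> tens_obj C X (unit_obj C) = X) \<and>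
     (\<forall>f\<in>arrs C. tens_arr C (ident C (unit_obj C)) f = f \<and>
        tens_arr C f (ident C (unit_obj C)) = f)"

definition is_iso :: "('o, 'm) smcat \<Rightarrow> 'm \<Rightarrow> bool" where
  "is_iso C f \<longleftrightarrow> f \<in> arrs C \<and>
     (\<exists>g\<in>hom_set C (tgt C f) (src C f).
        comp C g f = ident C (src C f) \<and> comp C f g = ident C (tgt C f))"

definition cat_of_xmod :: "('a, 'b, 'z) xmod_scheme \<Rightarrow> ('b, 'b \<times> 'a) smcat" where
  "cat_of_xmod \<Psi> =
     \<lparr>objs = carrier (deg0 \<Psi>),
      arrs = carrier (deg0 \<Psi>) \<times> carrier (deg1 \<Psi>),
      src = (\<lambda>(x, \<alpha>). x),
      tgt = (\<lambda>(x, \<alpha>). x \<otimes>\<^bsub>deg0 \<Psi>\<^esub> bdry \<Psi> \<alpha>),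
      ident = (\<lambda>x. (x, \<one>\<^bsub>deg1 \<Psi>\<^esub>)),
      comp = (\<lambda>(y, \<beta>) (x, \<alpha>). (x, \<alpha> \<otimes>\<^bsub>deg1 \<Psi>\<^esub> \<beta>)),
      tens_obj = (\<lambda>x y. x \<otimes>\<^bsub>deg0 \<Psi>\<^esub> y),
      tens_arr = (\<lambda>(x, \<alpha>) (y, \<beta>). (x \<otimes>\<^bsub>deg0 \<Psi>\<^esub> y, act \<Psi> \<alpha> y \<otimes>\<^bsub>deg1 \<Psi>\<^esub> \<beta>)),
      unit_obj = \<one>\<^bsub>deg0 \<Psi>\<^esub>\<rparr>"

text \<open>Strong monoidal functors: \<open>mu F X Y : F X \<otimes> F Y \<rightarrow> F (X \<otimes> Y)\<close> and \<open>eps F : 1 \<rightarrow> F 1\<close>.\<close>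

record ('o1, 'm1, 'o2, 'm2) mfunctor =
  on_obj :: "'o1 \<Rightarrow> 'o2"
  on_arr :: "'m1 \<Rightarrow> 'm2"
  mu :: "'o1 \<Rightarrow> 'o1 \<Rightarrow> 'm2"
  eps :: "'m2"

definition monoidal_functor ::
  "('o1, 'm1) smcat \<Rightarrow> ('o2, 'm2) smcat \<Rightarrow> ('o1, 'm1, 'o2, 'm2) mfunctor \<Rightarrow> bool" where
  "monoidal_functor C D F \<longleftrightarrow>
     (\<forall>X\<in>objs C. on_obj F X \<in> objs D) \<and>
     (\<forall>f\<in>arrs C. on_arr F f \<in> hom_set D (on_obj F (src C f)) (on_obj F (tgt C f))) \<and>
     (\<forall>X\<in>objs C. on_arr F (ident C X) = ident D (on_obj F X)) \<and>
     (\<forall>f\<in>arrs C. \<forall>g\<in>arrs C. src C g = tgt C f \<longrightarrow>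
        on_arr F (comp C g f) = comp D (on_arr F g) (on_arr F f)) \<and>
     (\<forall>X\<in>objs C. \<forall>Y\<in>objs C. is_iso D (mu F X Y) \<and>
        mu F X Y \<in> hom_set D (tens_obj D (on_obj F X) (on_obj F Y)) (on_obj F (tens_obj C X Y))) \<and>
     is_iso D (eps F) \<and> eps F \<in> hom_set D (unit_obj D) (on_obj F (unit_obj C)) \<and>
     (\<forall>f\<in>arrs C. \<forall>g\<in>arrs C.
        comp D (mu F (tgt C f) (tgt C g)) (tens_arr D (on_arr F f) (on_arr F g)) =
        comp D (on_arr F (tens_arr C f g)) (mu F (src C f) (src C g))) \<and>
     (\<forall>X\<in>objs C. \<forall>Y\<in>objs C. \<forall>Z\<in>objs C.
        comp D (mu F (tens_obj C X Y) Z) (tens_arr D (mu F X Y) (ident D (on_obj F Z))) =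
        comp D (mu F X (tens_obj C Y Z)) (tens_arr D (ident D (on_obj F X)) (mu F Y Z))) \<and>
     (\<forall>X\<in>objs C.
        comp D (mu F (unit_obj C) X) (tens_arr D (eps F) (ident D (on_obj F X)))
          = ident D (on_obj F X) \<and>
        comp D (mu F X (unit_obj C)) (tens_arr D (ident D (on_obj F X)) (eps F))
          = ident D (on_obj F X))"

definition id_mfunctor :: "('o, 'm) smcat \<Rightarrow> ('o, 'm, 'o, 'm) mfunctor" where
  "id_mfunctor C =
     \<lparr>on_obj = (\<lambda>X. X), on_arr = (\<lambda>f. f),
      mu = (\<lambda>X Y. ident C (tens_obj C X Y)), eps = ident C (unit_obj C)\<rparr>"

definition comp_mfunctor ::
  "('o3, 'm3) smcat \<Rightarrow> ('o2, 'm2, 'o3, 'm3) mfunctor \<Rightarrow> ('o1, 'm1, 'o2, 'm2) mfunctor \<Rightarrow>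
   ('o1, 'm1, 'o3, 'm3) mfunctor" where
  "comp_mfunctor D G F =
     \<lparr>on_obj = (\<lambda>X. on_obj G (on_obj F X)), on_arr = (\<lambda>f. on_arr G (on_arr F f)),
      mu = (\<lambda>X Y. comp D (on_arr G (mu F X Y)) (mu G (on_obj F X) (on_obj F Y))),
      eps = comp D (on_arr G (eps F)) (eps G)\<rparr>"

definition monoidal_nat_iso ::
  "('o1, 'm1) smcat \<Rightarrow> ('o2, 'm2) smcat \<Rightarrow> ('o1, 'm1, 'o2, 'm2) mfunctor \<Rightarrow>
   ('o1, 'm1, 'o2, 'm2) mfunctor \<Rightarrow> ('o1 \<Rightarrow> 'm2) \<Rightarrow> bool" where
  "monoidal_nat_iso C D F G \<tau> \<longleftrightarrow>
     (\<forall>X\<in>objs C. \<tau> X \<in> hom_set D (on_obj F X) (on_obj G X) \<and> is_iso D (\<tau> X)) \<and>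
     (\<forall>f\<in>arrs C. comp D (\<tau> (tgt C f)) (on_arr F f) = comp D (on_arr G f) (\<tau> (src C f))) \<and>
     (\<forall>X\<in>objs C. \<forall>Y\<in>objs C.
        comp D (\<tau> (tens_obj C X Y)) (mu F X Y) = comp D (mu G X Y) (tens_arr D (\<tau> X) (\<tau> Y))) \<and>
     comp D (\<tau> (unit_obj C)) (eps F) = eps G"

definition monoidally_equivalent :: "('o1, 'm1) smcat \<Rightarrow> ('o2, 'm2) smcat \<Rightarrow> bool" where
  "monoidally_equivalent C D \<longleftrightarrow>
     strict_monoidal_category C \<and> strict_monoidal_category D \<and>
     (\<exists>F G \<sigma> \<tau>. monoidal_functor C D F \<and> monoidal_functor D C G \<and>
        monoidal_nat_iso C C (comp_mfunctor C G F) (id_mfunctor C) \<sigma> \<and>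
        monoidal_nat_iso D D (comp_mfunctor D F G) (id_mfunctor D) \<tau>)"

section \<open>Analytic maps\<close>

text \<open>
  \<open>real_analytic_at I f x\<close>: near \<open>x\<close>, the function \<open>f\<close> on \<open>\<real>\<^sup>I\<close> (\<open>I\<close> finite) is the sum of a
  power series in \<open>y - x\<close>, indexed by multi-indices. Points of \<open>\<real>\<^sup>I\<close> and multi-indices are
  extensional functions on \<open>I\<close>.
\<close>

definition real_analytic_at :: "'i set \<Rightarrow> (('i \<Rightarrow> real) \<Rightarrow> real) \<Rightarrow> ('i \<Rightarrow> real) \<Rightarrow> bool" where
  "real_analytic_at I f x \<longleftrightarrow>
     (\<exists>c. \<exists>r>0. \<forall>y \<in> I \<rightarrow>\<^sub>E UNIV. (\<forall>i\<in>I. \<bar>y i - x i\<bar> < r) \<longrightarrow>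
        ((\<lambda>k. c k * (\<Prod>i\<in>I. (y i - x i) ^ k i)) has_sum f y) (I \<rightarrow>\<^sub>E (UNIV :: nat set)))"

text \<open>
  An analytic manifold \<open>M\<close> is presented by a jointly surjective family of pairs \<open>(I, p)\<close> where
  \<open>p : \<real>\<^sup>I \<rightarrow> M\<close> is a local analytic isomorphism onto an open subset, not necessarily
  injective (so that \<open>\<real> \<rightarrow> \<real>/\<int>\<close> is allowed); the local inverses of these maps are the charts.
  A map is analytic if its local coordinate representations are.
\<close>

type_synonym ('i, 'm) atlas = "('i set \<times> (('i \<Rightarrow> real) \<Rightarrow> 'm)) set"

definition analytic_map :: "('i, 'm) atlas \<Rightarrow> ('j, 'n) atlas \<Rightarrow> ('m \<Rightarrow> 'n) \<Rightarrow> bool" where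
  "analytic_map \<A> \<B> f \<longleftrightarrow>
     (\<forall>(I, p)\<in>\<A>. \<forall>x \<in> I \<rightarrow>\<^sub>E UNIV. \<exists>(K, q)\<in>\<B>. \<exists>g.
        (\<forall>j\<in>K. real_analytic_at I (g j) x) \<and>
        (\<exists>r>0. \<forall>y \<in> I \<rightarrow>\<^sub>E UNIV. (\<forall>i\<in>I. \<bar>y i - x i\<bar> < r) \<longrightarrow> f (p y) = q (\<lambda>j\<in>K. g j y)))"

definition prod_atlas :: "('i, 'm) atlas \<Rightarrow> ('j, 'n) atlas \<Rightarrow> ('i + 'j, 'm \<times> 'n) atlas" where
  "prod_atlas \<A> \<B> =
     {(I <+> K, \<lambda>y. (p (\<lambda>i\<in>I. y (Inl i)), q (\<lambda>j\<in>K. y (Inr j)))) | I p K q.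
        (I, p) \<in> \<A> \<and> (K, q) \<in> \<B>}"

record ('a, 'b, 'i, 'j) lie_xmod = "('a, 'b) xmod" +
  atlas1 :: "('i, 'a) atlas"
  atlas0 :: "('j, 'b) atlas"

section \<open>The weak actor\<close>

text \<open>The element denoted \<open>\<kappa>\<^bsub>x,y,z\<^esub>\<close>, for \<open>p = p\<^sub>0\<close>.\<close>

definition kappa3 ::
  "('a, 'b, 'z) xmod_scheme \<Rightarrow> ('b \<Rightarrow> 'b) \<Rightarrow> ('b \<times> 'b \<Rightarrow> 'a) \<Rightarrow> 'b \<Rightarrow> 'b \<Rightarrow> 'b \<Rightarrow> 'a" where
  "kappa3 \<Psi> p \<kappa> x y z = act \<Psi> (\<kappa> (x, y)) (p z) \<otimes>\<^bsub>deg1 \<Psi>\<^esub> \<kappa> (x \<otimes>\<^bsub>deg0 \<Psi>\<^esub> y, z)"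

definition weak_end ::
  "('a, 'b, 'z) xmod_scheme \<Rightarrow> (('b \<Rightarrow> 'b) \<times> ('a \<Rightarrow> 'a) \<times> ('b \<times> 'b \<Rightarrow> 'a)) set" where
  "weak_end \<Psi> =
     {(p0, p1, \<kappa>).
        p0 \<in> carrier (deg0 \<Psi>) \<rightarrow>\<^sub>E carrier (deg0 \<Psi>) \<and> p0 \<one>\<^bsub>deg0 \<Psi>\<^esub> = \<one>\<^bsub>deg0 \<Psi>\<^esub> \<and>
        p1 \<in> carrier (deg1 \<Psi>) \<rightarrow>\<^sub>E carrier (deg1 \<Psi>) \<and> p1 \<one>\<^bsub>deg1 \<Psi>\<^esub> = \<one>\<^bsub>deg1 \<Psi>\<^esub> \<and>
        \<kappa> \<in> carrier (deg0 \<Psi>) \<times> carrier (deg0 \<Psi>) \<rightarrow>\<^sub>E carrier (deg1 \<Psi>) \<and>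
        (\<forall>\<alpha>\<in>carrier (deg1 \<Psi>). p0 (bdry \<Psi> \<alpha>) = bdry \<Psi> (p1 \<alpha>)) \<and>
        (\<forall>x\<in>carrier (deg0 \<Psi>). \<forall>y\<in>carrier (deg0 \<Psi>).
           p0 x \<otimes>\<^bsub>deg0 \<Psi>\<^esub> p0 y \<otimes>\<^bsub>deg0 \<Psi>\<^esub> bdry \<Psi> (\<kappa> (x, y)) = p0 (x \<otimes>\<^bsub>deg0 \<Psi>\<^esub> y)) \<and>
        (\<forall>\<alpha>\<in>carrier (deg1 \<Psi>). \<forall>\<beta>\<in>carrier (deg1 \<Psi>).
           p1 \<alpha> \<otimes>\<^bsub>deg1 \<Psi>\<^esub> p1 \<beta> \<otimes>\<^bsub>deg1 \<Psi>\<^esub> \<kappa> (bdry \<Psi> \<alpha>, bdry \<Psi> \<beta>) = p1 (\<alpha> \<otimes>\<^bsub>deg1 \<Psi>\<^esub> \<beta>)) \<and>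
        (\<forall>x\<in>carrier (deg0 \<Psi>). \<forall>y\<in>carrier (deg0 \<Psi>). \<forall>z\<in>carrier (deg0 \<Psi>).
           kappa3 \<Psi> p0 \<kappa> x y z = \<kappa> (y, z) \<otimes>\<^bsub>deg1 \<Psi>\<^esub> \<kappa> (x, y \<otimes>\<^bsub>deg0 \<Psi>\<^esub> z)) \<and>
        (\<forall>\<alpha>\<in>carrier (deg1 \<Psi>). \<forall>x\<in>carrier (deg0 \<Psi>).
           act \<Psi> (p1 \<alpha>) (p0 x) \<otimes>\<^bsub>deg1 \<Psi>\<^esub> \<kappa> (bdry \<Psi> \<alpha>, x) =
           p1 (act \<Psi> \<alpha> x) \<otimes>\<^bsub>deg1 \<Psi>\<^esub> \<kappa> (x, bdry \<Psi> (act \<Psi> \<alpha> x)))}"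

definition weak_comp ::
  "('a, 'b, 'z) xmod_scheme \<Rightarrow> ('b \<Rightarrow> 'b) \<times> ('a \<Rightarrow> 'a) \<times> ('b \<times> 'b \<Rightarrow> 'a) \<Rightarrow>
   ('b \<Rightarrow> 'b) \<times> ('a \<Rightarrow> 'a) \<times> ('b \<times> 'b \<Rightarrow> 'a) \<Rightarrow> ('b \<Rightarrow> 'b) \<times> ('a \<Rightarrow> 'a) \<times> ('b \<times> 'b \<Rightarrow> 'a)" where
  "weak_comp \<Psi> = (\<lambda>(f0, f1, \<kappa>) (g0, g1, \<gamma>).
     (compose (carrier (deg0 \<Psi>)) f0 g0,
      compose (carrier (deg1 \<Psi>)) f1 g1,
      \<lambda>(x, y)\<in>carrier (deg0 \<Psi>) \<times> carrier (deg0 \<Psi>).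
        f1 (\<gamma> (x, y)) \<otimes>\<^bsub>deg1 \<Psi>\<^esub> kappa3 \<Psi> f0 \<kappa> (g0 x) (g0 y) (bdry \<Psi> (\<gamma> (x, y)))))"

definition weak_aut_group ::
  "('a, 'b, 'i, 'j) lie_xmod \<Rightarrow> (('b \<Rightarrow> 'b) \<times> ('a \<Rightarrow> 'a) \<times> ('b \<times> 'b \<Rightarrow> 'a)) monoid" where
  "weak_aut_group \<Psi> =
     \<lparr>carrier = {(f0, f1, \<kappa>) \<in> weak_end \<Psi>.
        bij_betw f0 (carrier (deg0 \<Psi>)) (carrier (deg0 \<Psi>)) \<and>
        bij_betw f1 (carrier (deg1 \<Psi>)) (carrier (deg1 \<Psi>)) \<and>
        analytic_map (atlas0 \<Psi>) (atlas0 \<Psi>) f0 \<and>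
        analytic_map (atlas0 \<Psi>) (atlas0 \<Psi>) (inv_into (carrier (deg0 \<Psi>)) f0) \<and>
        analytic_map (atlas1 \<Psi>) (atlas1 \<Psi>) f1 \<and>
        analytic_map (atlas1 \<Psi>) (atlas1 \<Psi>) (inv_into (carrier (deg1 \<Psi>)) f1) \<and>
        analytic_map (prod_atlas (atlas0 \<Psi>) (atlas0 \<Psi>)) (atlas1 \<Psi>) \<kappa>},
      mult = weak_comp \<Psi>,
      one = (\<lambda>x\<in>carrier (deg0 \<Psi>). x, \<lambda>\<alpha>\<in>carrier (deg1 \<Psi>). \<alpha>,
             \<lambda>_\<in>carrier (deg0 \<Psi>) \<times> carrier (deg0 \<Psi>). \<one>\<^bsub>deg1 \<Psi>\<^esub>)\<rparr>"

definition pointed_maps :: "('a, 'b, 'i, 'j) lie_xmod \<Rightarrow> ('b \<Rightarrow> 'a) monoid" where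
  "pointed_maps \<Psi> =
     \<lparr>carrier = {\<eta> \<in> carrier (deg0 \<Psi>) \<rightarrow>\<^sub>E carrier (deg1 \<Psi>).
        \<eta> \<one>\<^bsub>deg0 \<Psi>\<^esub> = \<one>\<^bsub>deg1 \<Psi>\<^esub> \<and> analytic_map (atlas0 \<Psi>) (atlas1 \<Psi>) \<eta>},
      mult = (\<lambda>\<eta>1 \<eta>2. \<lambda>x\<in>carrier (deg0 \<Psi>).
        \<eta>2 x \<otimes>\<^bsub>deg1 \<Psi>\<^esub> \<eta>1 (x \<otimes>\<^bsub>deg0 \<Psi>\<^esub> bdry \<Psi> (\<eta>2 x))),
      one = (\<lambda>x\<in>carrier (deg0 \<Psi>). \<one>\<^bsub>deg1 \<Psi>\<^esub>)\<rparr>"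

definition wAct ::
  "('a, 'b, 'i, 'j) lie_xmod \<Rightarrow>
   ('b \<Rightarrow> 'a, ('b \<Rightarrow> 'b) \<times> ('a \<Rightarrow> 'a) \<times> ('b \<times> 'b \<Rightarrow> 'a)) xmod" where
  "wAct \<Psi> =
     \<lparr>deg1 = units_of (pointed_maps \<Psi>),
      deg0 = weak_aut_group \<Psi>,
      bdry = (\<lambda>\<eta>.
        (\<lambda>x\<in>carrier (deg0 \<Psi>). x \<otimes>\<^bsub>deg0 \<Psi>\<^esub> bdry \<Psi> (\<eta> x),
         \<lambda>\<alpha>\<in>carrier (deg1 \<Psi>). \<alpha> \<otimes>\<^bsub>deg1 \<Psi>\<^esub> \<eta> (bdry \<Psi> \<alpha>),
         \<lambda>(x, y)\<in>carrier (deg0 \<Psi>) \<times> carrier (deg0 \<Psi>).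
           inv\<^bsub>deg1 \<Psi>\<^esub> (\<eta> y) \<otimes>\<^bsub>deg1 \<Psi>\<^esub> inv\<^bsub>deg1 \<Psi>\<^esub> (act \<Psi> (\<eta> x) y) \<otimes>\<^bsub>deg1 \<Psi>\<^esub>
           \<eta> (x \<otimes>\<^bsub>deg0 \<Psi>\<^esub> y))),
      act = (\<lambda>\<eta> (f0, f1, \<kappa>). \<lambda>x\<in>carrier (deg0 \<Psi>).
        let u = inv\<^bsub>deg0 \<Psi>\<^esub> x \<otimes>\<^bsub>deg0 \<Psi>\<^esub>
              inv_into (carrier (deg0 \<Psi>)) f0 (f0 x \<otimes>\<^bsub>deg0 \<Psi>\<^esub> bdry \<Psi> (\<eta> (f0 x)))
        in inv_into (carrier (deg1 \<Psi>)) f1 (\<eta> (f0 x) \<otimes>\<^bsub>deg1 \<Psi>\<^esub> inv\<^bsub>deg1 \<Psi>\<^esub> (\<kappa> (x, u))))\<rparr>"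

definition wAct_plus ::
  "('a, 'b, 'i, 'j) lie_xmod \<Rightarrow>
   ('b \<Rightarrow> 'a, ('b \<Rightarrow> 'b) \<times> ('a \<Rightarrow> 'a) \<times> ('b \<times> 'b \<Rightarrow> 'a)) xmod" where
  "wAct_plus \<Psi> = (wAct \<Psi>)
     \<lparr>deg0 := (weak_aut_group \<Psi>)
        \<lparr>carrier := {(f0, f1, \<kappa>) \<in> carrier (weak_aut_group \<Psi>).
           \<forall>\<alpha>\<in>kernel (deg1 \<Psi>) (deg0 \<Psi>) (bdry \<Psi>). f1 \<alpha> = \<alpha>}\<rparr>\<rparr>"

section \<open>Lattices, tensor products and tori\<close>

definition zmul :: "int \<Rightarrow> 'a::ab_group_add \<Rightarrow> 'a" where
  "zmul k a = (if 0 \<le> k then ((+) a ^^ nat k) 0 else - ((+) a ^^ nat (- k)) 0)"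

definition zbasis :: "'l::ab_group_add set \<Rightarrow> bool" where
  "zbasis B \<longleftrightarrow> finite B \<and>
     (\<forall>m. \<exists>!c. (\<forall>b. b \<notin> B \<longrightarrow> c b = 0) \<and> m = (\<Sum>b\<in>B. zmul (c b) b))"

definition biadditive ::
  "('a::ab_group_add \<Rightarrow> 'b::ab_group_add \<Rightarrow> 'c::ab_group_add) \<Rightarrow> bool" where
  "biadditive h \<longleftrightarrow> (\<forall>x. Modules.additive (h x)) \<and> (\<forall>y. Modules.additive (\<lambda>x. h x y))"

text \<open>
  The tensor product over \<open>\<int>\<close>: the free abelian group on pairs modulo the subgroup generated
  by the bilinearity relations.
\<close>

inductive_set tensor_rels :: "(('l::ab_group_add \<times> 'a::ab_group_add) \<Rightarrow>\<^sub>0 int) set" where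
  zero: "0 \<in> tensor_rels"
| left: "frag_of (m + m', a) - frag_of (m, a) - frag_of (m', a) \<in> tensor_rels"
| right: "frag_of (m, a + a') - frag_of (m, a) - frag_of (m, a') \<in> tensor_rels"
| diff: "p \<in> tensor_rels \<Longrightarrow> q \<in> tensor_rels \<Longrightarrow> p - q \<in> tensor_rels"

lemma tensor_rels_uminus: "p \<in> tensor_rels \<Longrightarrow> - p \<in> tensor_rels"
  using tensor_rels.diff[OF tensor_rels.zero, of p] by simp

lemma tensor_rels_add: "p \<in> tensor_rels \<Longrightarrow> q \<in> tensor_rels \<Longrightarrow> p + q \<in> tensor_rels"
  using tensor_rels.diff[OF _ tensor_rels_uminus, of p q] by simp

quotient_type (overloaded) ('l, 'a) tensor =
    "('l::ab_group_add \<times> 'a::ab_group_add) \<Rightarrow>\<^sub>0 int" / "\<lambda>p q. p - q \<in> tensor_rels"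
proof (rule equivpI)
  show "reflp (\<lambda>p q. p - q \<in> tensor_rels)"
    by (auto simp: reflp_def tensor_rels.zero)
  show "symp (\<lambda>p q. p - q \<in> tensor_rels)"
    by (rule sympI) (drule tensor_rels_uminus, simp)
  show "transp (\<lambda>p q. p - q \<in> tensor_rels)"
    by (rule transpI) (drule (1) tensor_rels_add, simp)
qed

instantiation tensor :: (ab_group_add, ab_group_add) ab_group_add
begin

lift_definition zero_tensor :: "('a, 'b) tensor" is 0 .

lift_definition plus_tensor :: "('a, 'b) tensor \<Rightarrow> ('a, 'b) tensor \<Rightarrow> ('a, 'b) tensor" is "(+)"
  by (drule (1) tensor_rels_add) (simp add: algebra_simps)

lift_definition uminus_tensor :: "('a, 'b) tensor \<Rightarrow> ('a, 'b) tensor" is uminus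
  by (drule tensor_rels_uminus) (simp add: algebra_simps)

lift_definition minus_tensor :: "('a, 'b) tensor \<Rightarrow> ('a, 'b) tensor \<Rightarrow> ('a, 'b) tensor" is "(-)"
  by (drule (1) tensor_rels.diff) (simp add: algebra_simps)

instance
  by standard (transfer; simp add: algebra_simps tensor_rels.zero)+

end

lift_definition tens :: "'l::ab_group_add \<Rightarrow> 'a::ab_group_add \<Rightarrow> ('l, 'a) tensor"
  is "\<lambda>m a. frag_of (m, a)" .

text \<open>The homomorphism induced by a biadditive map (unique by the universal property).\<close>

definition tensor_lift ::
  "('l::ab_group_add \<Rightarrow> 'a::ab_group_add \<Rightarrow> 'c::ab_group_add) \<Rightarrow> ('l, 'a) tensor \<Rightarrow> 'c" where
  "tensor_lift h = (THE g. Modules.additive g \<and> (\<forall>m a. g (tens m a) = h m a))"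

text \<open>\<open>\<real>/\<int>\<close>, with \<open>abs_rmodz a = [a]\<close>.\<close>

quotient_type rmodz = real / "\<lambda>a b. a - b \<in> \<int>"
proof (rule equivpI)
  show "reflp (\<lambda>a b. a - b \<in> (\<int> :: real set))" by (simp add: reflp_def)
  show "symp (\<lambda>a b. a - b \<in> (\<int> :: real set))"
    by (rule sympI) (drule Ints_minus, simp)
  show "transp (\<lambda>a b. a - b \<in> (\<int> :: real set))"
    by (rule transpI) (drule (1) Ints_add, simp)
qed

instantiation rmodz :: ab_group_add
begin

lift_definition zero_rmodz :: rmodz is 0 .

lift_definition plus_rmodz :: "rmodz \<Rightarrow> rmodz \<Rightarrow> rmodz" is "(+)"
  by (drule (1) Ints_add) (simp add: algebra_simps)

lift_definition uminus_rmodz :: "rmodz \<Rightarrow> rmodz" is uminus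
  by (drule Ints_minus) (simp add: algebra_simps)

lift_definition minus_rmodz :: "rmodz \<Rightarrow> rmodz \<Rightarrow> rmodz" is "(-)"
  by (drule (1) Ints_diff) (simp add: algebra_simps)

instance
  by standard (transfer; simp)+

end

text \<open>\<open>U(1)\<close>. Its group operation, multiplication of complex numbers, is written additively.\<close>

typedef u1 = "{z :: complex. cmod z = 1}"
  by (rule exI[of _ 1]) simp

setup_lifting type_definition_u1

instantiation u1 :: ab_group_add
begin

lift_definition zero_u1 :: u1 is 1 by simp

lift_definition plus_u1 :: "u1 \<Rightarrow> u1 \<Rightarrow> u1" is "(*)" by (simp add: norm_mult)

lift_definition uminus_u1 :: "u1 \<Rightarrow> u1" is inverse by (simp add: norm_inverse)

lift_definition minus_u1 :: "u1 \<Rightarrow> u1 \<Rightarrow> u1" is "(/)" by (simp add: norm_divide)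

instance
proof
  fix a b c :: u1
  show "a + b + c = a + (b + c)" by transfer (simp add: mult.assoc)
  show "a + b = b + a" by transfer (simp add: mult.commute)
  show "0 + a = a" by transfer simp
  show "- a + a = 0" by transfer (metis left_inverse norm_zero zero_neq_one)
  show "a - b = a + - b" by transfer (simp add: divide_inverse)
qed

end

lift_definition exp_u1 :: "real \<Rightarrow> u1" is "\<lambda>a. cis (2 * pi * a)" by simp

text \<open>\<open>exp : \<Lambda>\<^sup>\<or> \<otimes> \<real> \<rightarrow> \<Lambda>\<^sup>\<or> \<otimes> U(1)\<close>.\<close>

definition torus_exp :: "('l::ab_group_add, real) tensor \<Rightarrow> ('l, u1) tensor" where
  "torus_exp = tensor_lift (\<lambda>m a. tens m (exp_u1 a))"

section \<open>The crossed module \<open>\<Theta>'\<close>\<close>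

definition add_group :: "'a::ab_group_add monoid" where
  "add_group = \<lparr>carrier = UNIV, mult = (+), one = 0\<rparr>"

definition sign_group :: "int monoid" where
  "sign_group = \<lparr>carrier = {1, -1}, mult = (*), one = 1\<rparr>"

definition semidirect ::
  "('n, 'x) monoid_scheme \<Rightarrow> ('h, 'y) monoid_scheme \<Rightarrow> ('h \<Rightarrow> 'n \<Rightarrow> 'n) \<Rightarrow> ('n \<times> 'h) monoid" where
  "semidirect N H a =
     \<lparr>carrier = carrier N \<times> carrier H,
      mult = (\<lambda>(x, g) (y, h). (x \<otimes>\<^bsub>N\<^esub> a g y, g \<otimes>\<^bsub>H\<^esub> h)),
      one = (\<one>\<^bsub>N\<^esub>, \<one>\<^bsub>H\<^esub>)\<rparr>"

text \<open>\<open>J(m, x)\<close> for \<open>m\<close> in the lattice and \<open>x \<in> \<Lambda>\<^sup>\<or> \<otimes> \<real>\<close>.\<close>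

definition form_ext ::
  "('l::ab_group_add \<Rightarrow> 'l \<Rightarrow> int) \<Rightarrow> 'l \<Rightarrow> ('l, real) tensor \<Rightarrow> real" where
  "form_ext J m = tensor_lift (\<lambda>m' a. of_int (J m m') * a)"

text \<open>The linear coordinates on \<open>\<Lambda>\<^sup>\<or> \<otimes> \<real>\<close> are those given by all bases of the lattice.\<close>

definition Theta' ::
  "('l::ab_group_add \<Rightarrow> 'l \<Rightarrow> int) \<Rightarrow>
   ('l \<times> rmodz, ('l, real) tensor \<times> int, unit, 'l) lie_xmod" where
  "Theta' J =
     \<lparr>deg1 = add_group \<times>\<times> add_group,
      deg0 = semidirect add_group sign_group zmul,
      bdry = (\<lambda>(m, a). (tens m 1, 1)),
      act = (\<lambda>(m, a) (x, \<epsilon>). (zmul \<epsilon> m, a + abs_rmodz (form_ext J m x))),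
      atlas1 = {({()}, \<lambda>y. (m, abs_rmodz (y ()))) | m. True},
      atlas0 = {(B, \<lambda>y. (\<Sum>b\<in>B. tens b (y b), \<epsilon>)) | B \<epsilon>. zbasis B \<and> \<epsilon> \<in> {1, -1}}\<rparr>"

section \<open>The crossed module \<open>\<Xi>'\<close>\<close>

definition symm :: "('l \<Rightarrow> 'l \<Rightarrow> int) \<Rightarrow> 'l \<Rightarrow> 'l \<Rightarrow> int" where
  "symm J m n = J m n + J n m"

definition isometries :: "('l::ab_group_add \<Rightarrow> 'l \<Rightarrow> int) \<Rightarrow> ('l \<Rightarrow> 'l) set" where
  "isometries I = {f. Modules.additive f \<and> bij f \<and> (\<forall>m n. I (f m) (f n) = I m n)}"

definition pullback :: "('l \<Rightarrow> 'l) \<Rightarrow> ('l \<Rightarrow> 'l \<Rightarrow> int) \<Rightarrow> 'l \<Rightarrow> 'l \<Rightarrow> int" where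
  "pullback f B = (\<lambda>m n. B (f m) (f n))"

definition O_tilde ::
  "('l::ab_group_add \<Rightarrow> 'l \<Rightarrow> int) \<Rightarrow> (('l \<Rightarrow> 'l) \<times> ('l \<Rightarrow> 'l \<Rightarrow> int)) monoid" where
  "O_tilde J =
     \<lparr>carrier = {(f, B). f \<in> isometries (symm J) \<and> biadditive B \<and>
        (\<forall>m n. B m n - B n m = J m n - pullback f J m n)},
      mult = (\<lambda>(f, B) (g, B'). (f \<circ> g, \<lambda>m n. pullback g B m n + B' m n)),
      one = (id, \<lambda>m n. 0)\<rparr>"

definition symmetric_forms :: "('l::ab_group_add \<Rightarrow> 'l \<Rightarrow> int) set" where
  "symmetric_forms = {B. biadditive B \<and> (\<forall>m n. B m n = B n m)}"

definition even_forms :: "(('l::ab_group_add \<Rightarrow> 'l) \<times> ('l \<Rightarrow> 'l \<Rightarrow> int)) set" where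
  "even_forms = {(id, B) | B. B \<in> symmetric_forms \<and> (\<forall>m. even (B m m))}"

definition E_group ::
  "('l::ab_group_add \<Rightarrow> 'l \<Rightarrow> int) \<Rightarrow> (('l \<Rightarrow> 'l) \<times> ('l \<Rightarrow> 'l \<Rightarrow> int)) set monoid" where
  "E_group J = O_tilde J Mod even_forms"

text \<open>All \<open>(f, B)\<close> in a class \<open>e\<close> have the same \<open>f\<close>, which acts on the torus as \<open>f \<otimes> U(1)\<close>.\<close>

definition E_act ::
  "(('l::ab_group_add \<Rightarrow> 'l) \<times> ('l \<Rightarrow> 'l \<Rightarrow> int)) set \<Rightarrow> ('l, u1) tensor \<Rightarrow> ('l, u1) tensor" where
  "E_act e = tensor_lift (\<lambda>m z. tens (the_elem (fst ` e) m) z)"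

definition lattice_ext :: "('l::ab_group_add \<Rightarrow> 'l \<Rightarrow> int) \<Rightarrow> ('l \<times> bit) monoid" where
  "lattice_ext J =
     \<lparr>carrier = UNIV,
      mult = (\<lambda>(n, \<iota>) (n', \<iota>'). (n + n', \<iota> + \<iota>' + of_int (J n' n))),
      one = (0, 0)\<rparr>"

definition two_lattice :: "('l::ab_group_add \<times> bit) set" where
  "two_lattice = {(zmul 2 m, 0) | m. True}"

text \<open>
  In \<open>\<Xi>'\<close> the values at classes are given on representatives. Each set under
  \<open>the_elem\<close> collects the values at all admissible representatives; that it is a singleton is the
  well-definedness of \<open>\<xi>'\<close> and of the action.
\<close>

definition Xi' ::
  "('l::ab_group_add \<Rightarrow> 'l \<Rightarrow> int) \<Rightarrow>
   (('l \<times> bit) set, ('l, u1) tensor \<times> (('l \<Rightarrow> 'l) \<times> ('l \<Rightarrow> 'l \<Rightarrow> int)) set) xmod" where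
  "Xi' J =
     \<lparr>deg1 = lattice_ext J Mod two_lattice,
      deg0 = semidirect add_group (E_group J) E_act,
      bdry = (\<lambda>c. the_elem
        {(torus_exp (tens n (1/2)), even_forms #>\<^bsub>O_tilde J\<^esub> (id, B)) | n \<iota> B.
           (n, \<iota>) \<in> c \<and> B \<in> symmetric_forms \<and> (\<forall>m. even (symm J n m - B m m))}),
      act = (\<lambda>c (t, e). the_elem
        {two_lattice #>\<^bsub>lattice_ext J\<^esub> (inv_into UNIV f n, \<iota> + of_int (B (inv_into UNIV f n) (inv_into UNIV f n))) | n \<iota> f B.
           (n, \<iota>) \<in> c \<and> (f, B) \<in> e})\<rparr>"

end

theory Submission
  imports Defs "HOL-Analysis.Elementary_Metric_Spaces"
begin

text \<open>
  The two crossed modules are compared through a span. Its apex is the semidirect product of the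
  vector space \<open>t\<close> and the group of all \<open>(f, B)\<close> with \<open>B - B\<^sup>t = J - f\<^sup>*J\<close>. It maps onto \<open>T \<rtimes> E\<close> through
  \<open>exp\<close>, and it maps to the weak automorphisms by an explicit formula: \<open>(v, f, B)\<close> acts on
  \<open>t \<rtimes> {\<plusminus>1}\<close> by \<open>f\<close> and conjugation with a translation by \<open>-v\<close>, the cochain \<open>\<kappa>\<close> is half of the
  difference of the cocycle \<open>J(x, \<epsilon>y)\<close> and its pullback, and \<open>B(m, m)/2\<close> corrects \<open>f\<^sub>1\<close>. For
  each element of the apex, the ways to write its first image as a boundary correspond to the ways
  to write its second image as a boundary, multiplicatively and equivariantly. So it suffices that
  both maps are essentially surjective.

  For the second map, let \<open>(f, \<kappa>)\<close> be a weak automorphism. As \<open>\<kappa>\<close> is analytic, its lattice component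
  vanishes and \<open>f\<^sub>0\<close> is linear on \<open>t\<close>. The commutator of \<open>\<kappa>\<close> on \<open>t\<close> is bimultiplicative and equal to
  \<open>J(m, x) - J(fm, fx)\<close> at lattice points \<open>m\<close>; at \<open>x = m/N\<close> this gives \<open>J(fm, fm) = J(m, m)\<close>, so \<open>f\<close> is an
  isometry of \<open>I\<close>. Dividing by an element of the apex makes \<open>f\<^sub>0\<close> the identity. Then \<open>\<kappa>\<close> is symmetric on \<open>t\<close>
  and the reflection \<open>(0, -1)\<close> provides a splitting, so a boundary removes \<open>\<kappa>\<close>. What is left is a
  homomorphism from the lattice to \<open>{0, 1/2}\<close>, and it comes from a form \<open>B(m, n) = \<Phi>(m) \<Phi>(n)\<close>.
\<close>

section \<open>Spans of crossed modules\<close>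

text \<open>A point of \<open>T\<close> determines the vector \<open>v\<close> only up to the
  lattice, and the weak automorphism built from \<open>(v, f, B)\<close> changes with
  \<open>v\<close>; this is why a third group carries both maps. The constants are forced.
  Conjugation with the translation by \<open>-v\<close> moves a reflection \<open>(x, -1)\<close> to
  \<open>(x - 2v, -1)\<close>. The boundary of a pointed map with lattice value \<open>n\<close> on
  the reflections moves them by \<open>-n\<close>, so \<open>v = n/2\<close>, which is the origin of
  \<open>exp(n/2)\<close>. An isometry of \<open>I\<close> need not preserve \<open>J\<close>, but
  \<open>J - pullback f J\<close> is alternating; therefore half of the difference of the two
  cocycles has exactly the commutator \<open>J(x, y) - J(fx, fy)\<close> that the axioms of a weak
  endomorphism prescribe. The parity condition in \<open>\<xi>'\<close> is the comparison of two
  values of the map on the lattice: \<open>B(m, m)/2 + I(n, m)/4\<close> from the apex and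
  \<open>- I(n, m)/4\<close> from the pointed map agree modulo 1 precisely if \<open>I(n, m)\<close>
  and \<open>B(m, m)\<close> have the same parity.\<close>

locale xmodule =
  fixes X :: "('a, 'b, 'z) xmod_scheme" (structure)
  assumes crossed_module: "crossed_module X"
begin

sublocale G1: group "deg1 X" using crossed_module by (simp add: crossed_module_def)
sublocale G0: group "deg0 X" using crossed_module by (simp add: crossed_module_def)

lemma bdry_closed [simp]: "\<alpha> \<in> carrier (deg1 X) \<Longrightarrow> bdry X \<alpha> \<in> carrier (deg0 X)"
  and bdry_mult [simp]: "\<alpha> \<in> carrier (deg1 X) \<Longrightarrow> \<beta> \<in> carrier (deg1 X) \<Longrightarrow>
    bdry X (\<alpha> \<otimes>\<^bsub>deg1 X\<^esub> \<beta>) = bdry X \<alpha> \<otimes>\<^bsub>deg0 X\<^esub> bdry X \<beta>"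
  using crossed_module by (auto simp: crossed_module_def hom_def Pi_def)

lemma group_hom_bdry: "group_hom (deg1 X) (deg0 X) (bdry X)"
  using crossed_module
  by (auto simp: crossed_module_def group_hom_def group_hom_axioms_def)

lemma bdry_one [simp]: "bdry X \<one>\<^bsub>deg1 X\<^esub> = \<one>\<^bsub>deg0 X\<^esub>"
  using group_hom.hom_one[OF group_hom_bdry] .

lemma bdry_inv [simp]: "\<alpha> \<in> carrier (deg1 X) \<Longrightarrow>
    bdry X (inv\<^bsub>deg1 X\<^esub> \<alpha>) = inv\<^bsub>deg0 X\<^esub> bdry X \<alpha>"
  using group_hom.hom_inv[OF group_hom_bdry] .

lemma group_hom_act: "x \<in> carrier (deg0 X) \<Longrightarrow> group_hom (deg1 X) (deg1 X) (\<lambda>\<alpha>. act X \<alpha> x)"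
  using crossed_module
  by (auto simp: crossed_module_def group_hom_def group_hom_axioms_def)

lemma act_closed [simp]: "\<alpha> \<in> carrier (deg1 X) \<Longrightarrow> x \<in> carrier (deg0 X) \<Longrightarrow>
    act X \<alpha> x \<in> carrier (deg1 X)"
  using group_hom.hom_closed[OF group_hom_act] .

lemma act_mult1 [simp]: "\<alpha> \<in> carrier (deg1 X) \<Longrightarrow> \<beta> \<in> carrier (deg1 X) \<Longrightarrow> x \<in> carrier (deg0 X) \<Longrightarrow>
    act X (\<alpha> \<otimes>\<^bsub>deg1 X\<^esub> \<beta>) x = act X \<alpha> x \<otimes>\<^bsub>deg1 X\<^esub> act X \<beta> x"
  using group_hom.hom_mult[OF group_hom_act] .

lemma act_one1 [simp]: "x \<in> carrier (deg0 X) \<Longrightarrow> act X \<one>\<^bsub>deg1 X\<^esub> x = \<one>\<^bsub>deg1 X\<^esub>"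
  using group_hom.hom_one[OF group_hom_act] .

lemma act_inv1 [simp]: "\<alpha> \<in> carrier (deg1 X) \<Longrightarrow> x \<in> carrier (deg0 X) \<Longrightarrow>
    act X (inv\<^bsub>deg1 X\<^esub> \<alpha>) x = inv\<^bsub>deg1 X\<^esub> act X \<alpha> x"
  using group_hom.hom_inv[OF group_hom_act] .

lemma act_one [simp]: "\<alpha> \<in> carrier (deg1 X) \<Longrightarrow> act X \<alpha> \<one>\<^bsub>deg0 X\<^esub> = \<alpha>"
  and act_mult [simp]: "\<alpha> \<in> carrier (deg1 X) \<Longrightarrow> x \<in> carrier (deg0 X) \<Longrightarrow> y \<in> carrier (deg0 X) \<Longrightarrow>
    act X \<alpha> (x \<otimes>\<^bsub>deg0 X\<^esub> y) = act X (act X \<alpha> x) y"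
  and bdry_act [simp]: "\<alpha> \<in> carrier (deg1 X) \<Longrightarrow> x \<in> carrier (deg0 X) \<Longrightarrow>
    bdry X (act X \<alpha> x) = inv\<^bsub>deg0 X\<^esub> x \<otimes>\<^bsub>deg0 X\<^esub> (bdry X \<alpha> \<otimes>\<^bsub>deg0 X\<^esub> x)"
  and peiffer [simp]: "\<alpha> \<in> carrier (deg1 X) \<Longrightarrow> \<beta> \<in> carrier (deg1 X) \<Longrightarrow>
    act X \<beta> (bdry X \<alpha>) = inv\<^bsub>deg1 X\<^esub> \<alpha> \<otimes>\<^bsub>deg1 X\<^esub> (\<beta> \<otimes>\<^bsub>deg1 X\<^esub> \<alpha>)"
  using crossed_module by (auto simp: crossed_module_def G0.m_assoc G1.m_assoc)

lemma act_inv_bdry [simp]: "\<alpha> \<in> carrier (deg1 X) \<Longrightarrow> \<beta> \<in> carrier (deg1 X) \<Longrightarrow>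
    act X \<beta> (inv\<^bsub>deg0 X\<^esub> bdry X \<alpha>) = \<alpha> \<otimes>\<^bsub>deg1 X\<^esub> (\<beta> \<otimes>\<^bsub>deg1 X\<^esub> inv\<^bsub>deg1 X\<^esub> \<alpha>)"
  using peiffer[of "inv\<^bsub>deg1 X\<^esub> \<alpha>" \<beta>] by simp

lemma act_act_inv [simp]: "\<alpha> \<in> carrier (deg1 X) \<Longrightarrow> x \<in> carrier (deg0 X) \<Longrightarrow>
    act X (act X \<alpha> x) (inv\<^bsub>deg0 X\<^esub> x) = \<alpha>"
  "\<alpha> \<in> carrier (deg1 X) \<Longrightarrow> x \<in> carrier (deg0 X) \<Longrightarrow>
    act X (act X \<alpha> (inv\<^bsub>deg0 X\<^esub> x)) x = \<alpha>"
  by (simp_all flip: act_mult)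

lemmas group_simps = G0.m_assoc G1.m_assoc G0.inv_mult_group G1.inv_mult_group

lemma cancel0 [simp]: "x \<in> carrier (deg0 X) \<Longrightarrow> y \<in> carrier (deg0 X) \<Longrightarrow> x \<otimes>\<^bsub>deg0 X\<^esub> (inv\<^bsub>deg0 X\<^esub> x \<otimes>\<^bsub>deg0 X\<^esub> y) = y"
  "x \<in> carrier (deg0 X) \<Longrightarrow> y \<in> carrier (deg0 X) \<Longrightarrow> inv\<^bsub>deg0 X\<^esub> x \<otimes>\<^bsub>deg0 X\<^esub> (x \<otimes>\<^bsub>deg0 X\<^esub> y) = y"
  by (simp_all flip: G0.m_assoc)

lemma cancel1 [simp]: "x \<in> carrier (deg1 X) \<Longrightarrow> y \<in> carrier (deg1 X) \<Longrightarrow> x \<otimes>\<^bsub>deg1 X\<^esub> (inv\<^bsub>deg1 X\<^esub> x \<otimes>\<^bsub>deg1 X\<^esub> y) = y"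
  "x \<in> carrier (deg1 X) \<Longrightarrow> y \<in> carrier (deg1 X) \<Longrightarrow> inv\<^bsub>deg1 X\<^esub> x \<otimes>\<^bsub>deg1 X\<^esub> (x \<otimes>\<^bsub>deg1 X\<^esub> y) = y"
  by (simp_all flip: G1.m_assoc)

lemma strict_monoidal_category: "strict_monoidal_category (cat_of_xmod X)"
  by (auto simp: strict_monoidal_category_def is_category_def cat_of_xmod_def hom_set_def group_simps)

lemma is_iso_cat: "is_iso (cat_of_xmod X) f \<longleftrightarrow> f \<in> arrs (cat_of_xmod X)"
proof
  assume f: "f \<in> arrs (cat_of_xmod X)"
  then obtain x \<alpha> where f_eq: "f = (x, \<alpha>)" and "x \<in> carrier (deg0 X)" "\<alpha> \<in> carrier (deg1 X)"
    by (auto simp: cat_of_xmod_def)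
  then show "is_iso (cat_of_xmod X) f" using f
    unfolding is_iso_def
    by (intro conjI bexI[of _ "(x \<otimes>\<^bsub>deg0 X\<^esub> bdry X \<alpha>, inv\<^bsub>deg1 X\<^esub> \<alpha>)"])
      (simp_all add: cat_of_xmod_def hom_set_def group_simps)
qed (simp add: is_iso_def)

end

text \<open>
  The degree-1 group of the apex of the span is the fibre product of \<open>Om\<close> and \<open>deg1 X\<close> over
  \<open>deg0 X\<close>, and \<open>T\<close> is the degree-1 part of the map from the apex to \<open>Y\<close>.
\<close>

locale xspan = X: xmodule X + Y: xmodule Y + O: group Om
  for X :: "('a, 'b, 'z) xmod_scheme" and Y :: "('c, 'd, 'w) xmod_scheme" and Om :: "('o, 'v) monoid_scheme" +
  fixes P :: "'o \<Rightarrow> 'b" and S :: "'o \<Rightarrow> 'd" and T :: "'o \<Rightarrow> 'a \<Rightarrow> 'c" and s :: "'b \<Rightarrow> 'o" and a :: "'b \<Rightarrow> 'a"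
  assumes P_hom: "P \<in> hom Om (deg0 X)" and S_hom: "S \<in> hom Om (deg0 Y)"
    and T_closed [simp]: "x \<in> carrier Om \<Longrightarrow> \<alpha> \<in> carrier (deg1 X) \<Longrightarrow> P x = bdry X \<alpha> \<Longrightarrow>
      T x \<alpha> \<in> carrier (deg1 Y)"
    and bdry_T [simp]: "x \<in> carrier Om \<Longrightarrow> \<alpha> \<in> carrier (deg1 X) \<Longrightarrow> P x = bdry X \<alpha> \<Longrightarrow>
      bdry Y (T x \<alpha>) = S x"
    and T_mult: "x \<in> carrier Om \<Longrightarrow> \<alpha> \<in> carrier (deg1 X) \<Longrightarrow> P x = bdry X \<alpha> \<Longrightarrow>
      x' \<in> carrier Om \<Longrightarrow> \<alpha>' \<in> carrier (deg1 X) \<Longrightarrow> P x' = bdry X \<alpha>' \<Longrightarrow>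
      T x \<alpha> \<otimes>\<^bsub>deg1 Y\<^esub> T x' \<alpha>' = T (x \<otimes>\<^bsub>Om\<^esub> x') (\<alpha> \<otimes>\<^bsub>deg1 X\<^esub> \<alpha>')"
    and T_act: "x \<in> carrier Om \<Longrightarrow> \<alpha> \<in> carrier (deg1 X) \<Longrightarrow> P x = bdry X \<alpha> \<Longrightarrow> z \<in> carrier Om \<Longrightarrow>
      act Y (T x \<alpha>) (S z) = T (inv\<^bsub>Om\<^esub> z \<otimes>\<^bsub>Om\<^esub> (x \<otimes>\<^bsub>Om\<^esub> z)) (act X \<alpha> (P z))"
    and s_closed [simp]: "u \<in> carrier (deg0 X) \<Longrightarrow> s u \<in> carrier Om"
    and a_closed [simp]: "u \<in> carrier (deg0 X) \<Longrightarrow> a u \<in> carrier (deg1 X)"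
    and s_a: "u \<in> carrier (deg0 X) \<Longrightarrow> P (s u) \<otimes>\<^bsub>deg0 X\<^esub> bdry X (a u) = u"
begin

lemma group_hom_P: "group_hom Om (deg0 X) P" and group_hom_S: "group_hom Om (deg0 Y) S"
  using P_hom S_hom by (auto simp: group_hom_def group_hom_axioms_def)

lemmas P_simps [simp] = group_hom.hom_mult[OF group_hom_P] group_hom.hom_one[OF group_hom_P]
  group_hom.hom_closed[OF group_hom_P] group_hom.hom_inv[OF group_hom_P]
lemmas S_simps [simp] = group_hom.hom_mult[OF group_hom_S] group_hom.hom_one[OF group_hom_S]
  group_hom.hom_closed[OF group_hom_S] group_hom.hom_inv[OF group_hom_S]

text \<open>With this rule the simplifier discharges the fibre product conditions
  \<open>P x = bdry X \<alpha>\<close> of the rules for \<open>T\<close> by a computation in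
  \<open>deg0 X\<close>.\<close>

lemma P_s [simp]: "x \<in> carrier (deg0 X) \<Longrightarrow> P (s x) = x \<otimes>\<^bsub>deg0 X\<^esub> inv\<^bsub>deg0 X\<^esub> bdry X (a x)"
  using s_a[of x] by (metis X.G0.inv_solve_right P_simps(3) X.bdry_closed s_closed a_closed)

lemma cancelO [simp]: "x \<in> carrier Om \<Longrightarrow> y \<in> carrier Om \<Longrightarrow> x \<otimes>\<^bsub>Om\<^esub> (inv\<^bsub>Om\<^esub> x \<otimes>\<^bsub>Om\<^esub> y) = y"
  "x \<in> carrier Om \<Longrightarrow> y \<in> carrier Om \<Longrightarrow> inv\<^bsub>Om\<^esub> x \<otimes>\<^bsub>Om\<^esub> (x \<otimes>\<^bsub>Om\<^esub> y) = y"
  by (simp_all flip: O.m_assoc)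

lemmas span_simps = X.group_simps Y.group_simps O.m_assoc O.inv_mult_group

lemma T_one [simp]: "T \<one>\<^bsub>Om\<^esub> \<one>\<^bsub>deg1 X\<^esub> = \<one>\<^bsub>deg1 Y\<^esub>"
proof -
  have "T \<one>\<^bsub>Om\<^esub> \<one>\<^bsub>deg1 X\<^esub> \<otimes>\<^bsub>deg1 Y\<^esub> T \<one>\<^bsub>Om\<^esub> \<one>\<^bsub>deg1 X\<^esub> = T \<one>\<^bsub>Om\<^esub> \<one>\<^bsub>deg1 X\<^esub>"
    by (simp add: T_mult)
  then show ?thesis by (metis T_closed Y.G1.l_cancel_one O.one_closed P_simps(2) X.bdry_one X.G1.one_closed)
qed

text \<open>Lift to the apex of the arrow from \<open>x\<close> to its target. As
  \<open>P (s x)\<close> is \<open>x\<close> times the inverse of \<open>bdry X (a x)\<close>, the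
  two arguments of \<open>T\<close> lie over the same element of \<open>deg0 X\<close>.\<close>

definition Tarr :: "'b \<Rightarrow> 'a \<Rightarrow> 'c" where
  "Tarr x \<alpha> = T (inv\<^bsub>Om\<^esub> s x \<otimes>\<^bsub>Om\<^esub> s (x \<otimes>\<^bsub>deg0 X\<^esub> bdry X \<alpha>))
     (a x \<otimes>\<^bsub>deg1 X\<^esub> (\<alpha> \<otimes>\<^bsub>deg1 X\<^esub> inv\<^bsub>deg1 X\<^esub> a (x \<otimes>\<^bsub>deg0 X\<^esub> bdry X \<alpha>)))"

text \<open>The comparison of the product of \<open>s x\<close> and \<open>s y\<close> with the
  value of \<open>s\<close> at the product. The action of \<open>y\<close> appears because the
  correction \<open>a x\<close> has to be moved past \<open>y\<close>.\<close>

definition Tmu :: "'b \<Rightarrow> 'b \<Rightarrow> 'c" where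
  "Tmu x y = T (inv\<^bsub>Om\<^esub> s y \<otimes>\<^bsub>Om\<^esub> (inv\<^bsub>Om\<^esub> s x \<otimes>\<^bsub>Om\<^esub> s (x \<otimes>\<^bsub>deg0 X\<^esub> y)))
     (a y \<otimes>\<^bsub>deg1 X\<^esub> (act X (a x) y \<otimes>\<^bsub>deg1 X\<^esub> inv\<^bsub>deg1 X\<^esub> a (x \<otimes>\<^bsub>deg0 X\<^esub> y)))"

definition Teps :: "'c" where
  "Teps = T (s \<one>\<^bsub>deg0 X\<^esub>) (inv\<^bsub>deg1 X\<^esub> a \<one>\<^bsub>deg0 X\<^esub>)"

definition span_functor :: "('b, 'b \<times> 'a, 'd, 'd \<times> 'c) mfunctor" where
  "span_functor = \<lparr>on_obj = (\<lambda>x. S (s x)), on_arr = (\<lambda>(x, \<alpha>). (S (s x), Tarr x \<alpha>)),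
     mu = (\<lambda>x y. (S (s x) \<otimes>\<^bsub>deg0 Y\<^esub> S (s y), Tmu x y)), eps = (\<one>\<^bsub>deg0 Y\<^esub>, Teps)\<rparr>"

lemma Tarr_closed [simp]: "x \<in> carrier (deg0 X) \<Longrightarrow> \<alpha> \<in> carrier (deg1 X) \<Longrightarrow> Tarr x \<alpha> \<in> carrier (deg1 Y)"
  and bdry_Tarr [simp]: "x \<in> carrier (deg0 X) \<Longrightarrow> \<alpha> \<in> carrier (deg1 X) \<Longrightarrow>
     bdry Y (Tarr x \<alpha>) = inv\<^bsub>deg0 Y\<^esub> S (s x) \<otimes>\<^bsub>deg0 Y\<^esub> S (s (x \<otimes>\<^bsub>deg0 X\<^esub> bdry X \<alpha>))"
  by (simp_all add: Tarr_def span_simps)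

lemma Tmu_closed [simp]: "x \<in> carrier (deg0 X) \<Longrightarrow> y \<in> carrier (deg0 X) \<Longrightarrow> Tmu x y \<in> carrier (deg1 Y)"
  and bdry_Tmu [simp]: "x \<in> carrier (deg0 X) \<Longrightarrow> y \<in> carrier (deg0 X) \<Longrightarrow>
     bdry Y (Tmu x y) = inv\<^bsub>deg0 Y\<^esub> S (s y) \<otimes>\<^bsub>deg0 Y\<^esub> (inv\<^bsub>deg0 Y\<^esub> S (s x) \<otimes>\<^bsub>deg0 Y\<^esub> S (s (x \<otimes>\<^bsub>deg0 X\<^esub> y)))"
  by (simp_all add: Tmu_def span_simps)

lemma Teps_closed [simp]: "Teps \<in> carrier (deg1 Y)"
  and bdry_Teps [simp]: "bdry Y Teps = S (s \<one>\<^bsub>deg0 X\<^esub>)"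
  by (simp_all add: Teps_def span_simps)

lemma Tarr_one: "x \<in> carrier (deg0 X) \<Longrightarrow> Tarr x \<one>\<^bsub>deg1 X\<^esub> = \<one>\<^bsub>deg1 Y\<^esub>"
  by (simp add: Tarr_def)

lemma Tarr_comp: "x \<in> carrier (deg0 X) \<Longrightarrow> \<alpha> \<in> carrier (deg1 X) \<Longrightarrow> \<beta> \<in> carrier (deg1 X) \<Longrightarrow>
  Tarr x (\<alpha> \<otimes>\<^bsub>deg1 X\<^esub> \<beta>) = Tarr x \<alpha> \<otimes>\<^bsub>deg1 Y\<^esub> Tarr (x \<otimes>\<^bsub>deg0 X\<^esub> bdry X \<alpha>) \<beta>"
  by (simp add: Tarr_def T_mult span_simps)

lemma Tmu_natural:
  "x \<in> carrier (deg0 X) \<Longrightarrow> \<alpha> \<in> carrier (deg1 X) \<Longrightarrow> y \<in> carrier (deg0 X) \<Longrightarrow> \<beta> \<in> carrier (deg1 X) \<Longrightarrow>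
  act Y (Tarr x \<alpha>) (S (s y)) \<otimes>\<^bsub>deg1 Y\<^esub> (Tarr y \<beta> \<otimes>\<^bsub>deg1 Y\<^esub> 
    Tmu (x \<otimes>\<^bsub>deg0 X\<^esub> bdry X \<alpha>) (y \<otimes>\<^bsub>deg0 X\<^esub> bdry X \<beta>)) =
  Tmu x y \<otimes>\<^bsub>deg1 Y\<^esub> Tarr (x \<otimes>\<^bsub>deg0 X\<^esub> y) (act X \<alpha> y \<otimes>\<^bsub>deg1 X\<^esub> \<beta>)"
  by (simp add: Tarr_def Tmu_def T_mult T_act span_simps)

lemma Tmu_assoc:
  "x \<in> carrier (deg0 X) \<Longrightarrow> y \<in> carrier (deg0 X) \<Longrightarrow> z \<in> carrier (deg0 X) \<Longrightarrow>
   act Y (Tmu x y) (S (s z)) \<otimes>\<^bsub>deg1 Y\<^esub> Tmu (x \<otimes>\<^bsub>deg0 X\<^esub> y) z =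
   Tmu y z \<otimes>\<^bsub>deg1 Y\<^esub> Tmu x (y \<otimes>\<^bsub>deg0 X\<^esub> z)"
  by (simp add: Tmu_def T_mult T_act span_simps)

lemma Tmu_unit:
  "x \<in> carrier (deg0 X) \<Longrightarrow> act Y Teps (S (s x)) \<otimes>\<^bsub>deg1 Y\<^esub> Tmu \<one>\<^bsub>deg0 X\<^esub> x = \<one>\<^bsub>deg1 Y\<^esub>"
  "x \<in> carrier (deg0 X) \<Longrightarrow> Teps \<otimes>\<^bsub>deg1 Y\<^esub> Tmu x \<one>\<^bsub>deg0 X\<^esub> = \<one>\<^bsub>deg1 Y\<^esub>"
  by (simp_all add: Tmu_def Teps_def T_mult T_act span_simps)

text \<open>All naturality and coherence conditions are equations between values of
  \<open>T\<close>. By \<open>T_mult\<close> and \<open>T_act\<close> each side is \<open>T\<close>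
  at one pair, and the pairs agree by the axioms of a group and of the crossed module
  \<open>X\<close>.\<close>

lemma monoidal_functor: "monoidal_functor (cat_of_xmod X) (cat_of_xmod Y) span_functor"
  unfolding monoidal_functor_def
  by (auto simp: Y.is_iso_cat[unfolded cat_of_xmod_def] span_functor_def cat_of_xmod_def hom_set_def Tarr_one Tarr_comp Tmu_natural
      Tmu_assoc Tmu_unit span_simps)

end

text \<open>One of the two inverse laws between \<open>T\<close> and \<open>U\<close> suffices here:
  it trivializes the composite functor on \<open>X\<close>. The composite on \<open>Y\<close> is
  obtained from a second instance with the roles exchanged.\<close>

locale xspan_equiv = F: xspan X Y Om P S T s a + G: xspan Y X Om S P U r b
  for X :: "('a, 'b, 'z) xmod_scheme" and Y :: "('c, 'd, 'w) xmod_scheme" and Om :: "('o, 'v) monoid_scheme"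
  and P :: "'o \<Rightarrow> 'b" and S :: "'o \<Rightarrow> 'd" and T :: "'o \<Rightarrow> 'a \<Rightarrow> 'c" and U :: "'o \<Rightarrow> 'c \<Rightarrow> 'a"
  and s :: "'b \<Rightarrow> 'o" and a :: "'b \<Rightarrow> 'a" and r :: "'d \<Rightarrow> 'o" and b :: "'d \<Rightarrow> 'c" +
  assumes U_T: "x \<in> carrier Om \<Longrightarrow> \<alpha> \<in> carrier (deg1 X) \<Longrightarrow> P x = bdry X \<alpha> \<Longrightarrow> U x (T x \<alpha>) = \<alpha>"
begin

text \<open>The elements \<open>r (S (s x))\<close> and \<open>s x\<close> have images under
  \<open>S\<close> that differ by the boundary of \<open>b (S (s x))\<close>; \<open>U\<close> turns
  this into an arrow between their images under \<open>P\<close>, and \<open>a x\<close> leads from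
  \<open>P (s x)\<close> to \<open>x\<close>.\<close>

definition unit_iso :: "'b \<Rightarrow> 'a" where
  "unit_iso x = U (inv\<^bsub>Om\<^esub> r (S (s x)) \<otimes>\<^bsub>Om\<^esub> s x) (b (S (s x))) \<otimes>\<^bsub>deg1 X\<^esub> a x"

lemma unit_iso_closed [simp]: "x \<in> carrier (deg0 X) \<Longrightarrow> unit_iso x \<in> carrier (deg1 X)"
  and bdry_unit_iso [simp]: "x \<in> carrier (deg0 X) \<Longrightarrow> bdry X (unit_iso x) = inv\<^bsub>deg0 X\<^esub> P (r (S (s x))) \<otimes>\<^bsub>deg0 X\<^esub> x"
  by (simp_all add: unit_iso_def F.span_simps)

lemma unit_iso_natural:
  assumes "x \<in> carrier (deg0 X)" "\<alpha> \<in> carrier (deg1 X)"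
  shows "G.Tarr (S (s x)) (F.Tarr x \<alpha>) \<otimes>\<^bsub>deg1 X\<^esub> unit_iso (x \<otimes>\<^bsub>deg0 X\<^esub> bdry X \<alpha>) = unit_iso x \<otimes>\<^bsub>deg1 X\<^esub> \<alpha>"
proof -
  let ?x' = "x \<otimes>\<^bsub>deg0 X\<^esub> bdry X \<alpha>"
  \<comment> \<open>The only use of the inverse law: it recovers \<open>\<alpha>\<close> from its
    image \<open>F.Tarr x \<alpha>\<close>. The rest is multiplicativity of
    \<open>U\<close>.\<close>
  have "\<alpha> = inv\<^bsub>deg1 X\<^esub> a x \<otimes>\<^bsub>deg1 X\<^esub> (U (inv\<^bsub>Om\<^esub> s x \<otimes>\<^bsub>Om\<^esub> s ?x') (F.Tarr x \<alpha>) \<otimes>\<^bsub>deg1 X\<^esub> a ?x')"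
    using assms by (simp add: F.Tarr_def U_T F.span_simps)
  then have "unit_iso x \<otimes>\<^bsub>deg1 X\<^esub> \<alpha> = unit_iso x \<otimes>\<^bsub>deg1 X\<^esub> (inv\<^bsub>deg1 X\<^esub> a x \<otimes>\<^bsub>deg1 X\<^esub>
      (U (inv\<^bsub>Om\<^esub> s x \<otimes>\<^bsub>Om\<^esub> s ?x') (F.Tarr x \<alpha>) \<otimes>\<^bsub>deg1 X\<^esub> a ?x'))" by simp
  also have "\<dots> = (U (inv\<^bsub>Om\<^esub> r (S (s x)) \<otimes>\<^bsub>Om\<^esub> s x) (b (S (s x))) \<otimes>\<^bsub>deg1 X\<^esub>
      U (inv\<^bsub>Om\<^esub> s x \<otimes>\<^bsub>Om\<^esub> s ?x') (F.Tarr x \<alpha>)) \<otimes>\<^bsub>deg1 X\<^esub> a ?x'"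
    using assms by (simp add: unit_iso_def F.span_simps)
  also have "\<dots> = U (inv\<^bsub>Om\<^esub> r (S (s x)) \<otimes>\<^bsub>Om\<^esub> s ?x') (b (S (s x)) \<otimes>\<^bsub>deg1 Y\<^esub> F.Tarr x \<alpha>) \<otimes>\<^bsub>deg1 X\<^esub> a ?x'"
    using assms by (subst G.T_mult) (simp_all add: F.span_simps)
  also have "\<dots> = (G.Tarr (S (s x)) (F.Tarr x \<alpha>) \<otimes>\<^bsub>deg1 X\<^esub> U (inv\<^bsub>Om\<^esub> r (S (s ?x')) \<otimes>\<^bsub>Om\<^esub> s ?x') (b (S (s ?x')))) \<otimes>\<^bsub>deg1 X\<^esub> a ?x'"
    using assms unfolding G.Tarr_def by (subst G.T_mult) (simp_all add: F.span_simps)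
  also have "\<dots> = G.Tarr (S (s x)) (F.Tarr x \<alpha>) \<otimes>\<^bsub>deg1 X\<^esub> unit_iso ?x'"
    using assms by (simp add: unit_iso_def F.span_simps)
  finally show ?thesis by simp
qed

lemma unit_iso_mu:
  assumes x: "x \<in> carrier (deg0 X)" and y: "y \<in> carrier (deg0 X)"
  shows "G.Tmu (S (s x)) (S (s y)) \<otimes>\<^bsub>deg1 X\<^esub> (G.Tarr (S (s x) \<otimes>\<^bsub>deg0 Y\<^esub> S (s y)) (F.Tmu x y) \<otimes>\<^bsub>deg1 X\<^esub>
      unit_iso (x \<otimes>\<^bsub>deg0 X\<^esub> y)) = act X (unit_iso x) (P (r (S (s y)))) \<otimes>\<^bsub>deg1 X\<^esub> unit_iso y"
    (is "?lhs = ?rhs")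
proof -
  let ?u = "S (s x)" let ?v = "S (s y)" let ?z = "s (x \<otimes>\<^bsub>deg0 X\<^esub> y)"
  let ?w = "inv\<^bsub>Om\<^esub> r ?v \<otimes>\<^bsub>Om\<^esub> (inv\<^bsub>Om\<^esub> r ?u \<otimes>\<^bsub>Om\<^esub> (s x \<otimes>\<^bsub>Om\<^esub> s y))"
  let ?c = "b ?v \<otimes>\<^bsub>deg1 Y\<^esub> act Y (b ?u) ?v"
  let ?t = "inv\<^bsub>Om\<^esub> s y \<otimes>\<^bsub>Om\<^esub> (inv\<^bsub>Om\<^esub> s x \<otimes>\<^bsub>Om\<^esub> ?z)"
  have "?lhs = (U (inv\<^bsub>Om\<^esub> r ?v \<otimes>\<^bsub>Om\<^esub> (inv\<^bsub>Om\<^esub> r ?u \<otimes>\<^bsub>Om\<^esub> ?z)) (?c \<otimes>\<^bsub>deg1 Y\<^esub> F.Tmu x y)) \<otimes>\<^bsub>deg1 X\<^esub> a (x \<otimes>\<^bsub>deg0 X\<^esub> y)"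
    using x y by (simp add: G.Tmu_def G.Tarr_def unit_iso_def F.span_simps flip: F.X.G1.m_assoc) (simp add: G.T_mult F.span_simps)
  also have "\<dots> = (U ?w ?c \<otimes>\<^bsub>deg1 X\<^esub> U ?t (F.Tmu x y)) \<otimes>\<^bsub>deg1 X\<^esub> a (x \<otimes>\<^bsub>deg0 X\<^esub> y)"
    using x y by (subst G.T_mult) (simp_all add: F.span_simps)
  also have "U ?t (F.Tmu x y) = a y \<otimes>\<^bsub>deg1 X\<^esub> (act X (a x) y \<otimes>\<^bsub>deg1 X\<^esub> inv\<^bsub>deg1 X\<^esub> a (x \<otimes>\<^bsub>deg0 X\<^esub> y))"
    using x y unfolding F.Tmu_def by (subst U_T) (simp_all add: F.span_simps)
  finally have lhs: "?lhs = U ?w ?c \<otimes>\<^bsub>deg1 X\<^esub> (a y \<otimes>\<^bsub>deg1 X\<^esub> act X (a x) y)"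
    using x y by (simp add: F.span_simps)
  let ?B = "U (inv\<^bsub>Om\<^esub> r ?v \<otimes>\<^bsub>Om\<^esub> s y) (b ?v)"
  let ?A = "U (inv\<^bsub>Om\<^esub> r ?u \<otimes>\<^bsub>Om\<^esub> s x) (b ?u)"
  have B: "?B \<in> carrier (deg1 X)" "bdry X ?B = inv\<^bsub>deg0 X\<^esub> P (r ?v) \<otimes>\<^bsub>deg0 X\<^esub> P (s y)"
    using x y by (simp_all add: F.span_simps)
  have A: "?A \<in> carrier (deg1 X)"
    using x y by (simp_all add: F.span_simps)
  \<comment> \<open>The Peiffer identity: passing \<open>?B\<close> changes the action of
    \<open>P (r ?v)\<close> on \<open>a x\<close> into that of \<open>P (s y)\<close>, since
    \<open>bdry X ?B\<close> is the quotient of the two.\<close>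
  have "act X (a x) (P (r ?v)) \<otimes>\<^bsub>deg1 X\<^esub> ?B = ?B \<otimes>\<^bsub>deg1 X\<^esub> act X (act X (a x) (P (r ?v))) (bdry X ?B)"
    using B(1) x y by (simp del: G.bdry_T add: F.span_simps)
  also have "act X (act X (a x) (P (r ?v))) (bdry X ?B) = act X (a x) (P (s y))"
    unfolding B(2) using x y by (simp del: F.P_s G.P_s flip: F.X.act_mult)
  finally have swap: "act X (a x) (P (r ?v)) \<otimes>\<^bsub>deg1 X\<^esub> ?B = ?B \<otimes>\<^bsub>deg1 X\<^esub> act X (a x) (P (s y))" .
  have "?rhs = act X ?A (P (r ?v)) \<otimes>\<^bsub>deg1 X\<^esub> ((act X (a x) (P (r ?v)) \<otimes>\<^bsub>deg1 X\<^esub> ?B) \<otimes>\<^bsub>deg1 X\<^esub> a y)"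
    using x y A B(1) by (simp add: unit_iso_def F.span_simps del: F.P_s G.P_s)
  also have "\<dots> = (act X ?A (P (r ?v)) \<otimes>\<^bsub>deg1 X\<^esub> ?B) \<otimes>\<^bsub>deg1 X\<^esub> (act X (a x) (P (s y)) \<otimes>\<^bsub>deg1 X\<^esub> a y)"
    unfolding swap using x y A B(1) by (simp add: F.span_simps del: F.P_s G.P_s)
  also have "act X (a x) (P (s y)) \<otimes>\<^bsub>deg1 X\<^esub> a y = a y \<otimes>\<^bsub>deg1 X\<^esub> act X (a x) y"
    using x y by (simp add: F.span_simps)
  also have "act X ?A (P (r ?v)) \<otimes>\<^bsub>deg1 X\<^esub> ?B = U ?w ?c"
    using x y by (subst G.T_act) (simp_all add: F.span_simps G.T_mult)
  finally show ?thesis using lhs by simp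
qed

lemma unit_iso_eps:
  "G.Teps \<otimes>\<^bsub>deg1 X\<^esub> (G.Tarr \<one>\<^bsub>deg0 Y\<^esub> F.Teps \<otimes>\<^bsub>deg1 X\<^esub> unit_iso \<one>\<^bsub>deg0 X\<^esub>) = \<one>\<^bsub>deg1 X\<^esub>"
proof -
  have "G.Teps \<otimes>\<^bsub>deg1 X\<^esub> (G.Tarr \<one>\<^bsub>deg0 Y\<^esub> F.Teps \<otimes>\<^bsub>deg1 X\<^esub> unit_iso \<one>\<^bsub>deg0 X\<^esub>) =
     U (s \<one>\<^bsub>deg0 X\<^esub>) F.Teps \<otimes>\<^bsub>deg1 X\<^esub> a \<one>\<^bsub>deg0 X\<^esub>"
    by (simp add: G.Teps_def G.Tarr_def unit_iso_def F.span_simps flip: F.X.G1.m_assoc) (simp add: G.T_mult F.span_simps)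
  also have "U (s \<one>\<^bsub>deg0 X\<^esub>) F.Teps = inv\<^bsub>deg1 X\<^esub> a \<one>\<^bsub>deg0 X\<^esub>"
    unfolding F.Teps_def by (subst U_T) simp_all
  finally show ?thesis by simp
qed

lemma monoidal_nat_iso_unit:
  "monoidal_nat_iso (cat_of_xmod X) (cat_of_xmod X) (comp_mfunctor (cat_of_xmod X) G.span_functor F.span_functor)
     (id_mfunctor (cat_of_xmod X)) (\<lambda>x. (P (r (S (s x))), unit_iso x))"
  unfolding monoidal_nat_iso_def
  by (auto simp: F.X.is_iso_cat[unfolded cat_of_xmod_def] F.span_functor_def G.span_functor_def comp_mfunctor_def id_mfunctor_def cat_of_xmod_def hom_set_def
      unit_iso_natural unit_iso_mu unit_iso_eps F.span_simps simp del: F.P_s G.P_s)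

end

theorem monoidally_equivalent_span:
  assumes "xspan_equiv X Y Om P S T U s a r b" "xspan_equiv Y X Om S P U T r b s a"
  shows "monoidally_equivalent (cat_of_xmod X) (cat_of_xmod Y)"
proof -
  interpret FG: xspan_equiv X Y Om P S T U s a r b by fact
  interpret GF: xspan_equiv Y X Om S P U T r b s a by fact
  show ?thesis
    unfolding monoidally_equivalent_def
    using FG.F.X.strict_monoidal_category FG.F.Y.strict_monoidal_category
      FG.F.monoidal_functor FG.G.monoidal_functor FG.monoidal_nat_iso_unit GF.monoidal_nat_iso_unit by blast
qed

section \<open>Convergent power series\<close>

definition monomial :: "'i set \<Rightarrow> ('i \<Rightarrow> real) \<Rightarrow> ('i \<Rightarrow> nat) \<Rightarrow> real" where
  "monomial I z l = (\<Prod>i\<in>I. z i ^ l i)"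

abbreviation multi_indices :: "'i set \<Rightarrow> ('i \<Rightarrow> nat) set" where
  "multi_indices I \<equiv> I \<rightarrow>\<^sub>E UNIV"

definition polydisc :: "'i set \<Rightarrow> real \<Rightarrow> ('i \<Rightarrow> real) set" where
  "polydisc I \<rho> = {z \<in> I \<rightarrow>\<^sub>E UNIV. \<forall>i\<in>I. \<bar>z i\<bar> \<le> \<rho>}"

text \<open>The weighted \<open>\<ell>\<^sup>1\<close> Banach algebra of power series: \<open>P\<close> is on the polydisc of radius \<open>\<rho>\<close> the sum of a series of
  norm at most \<open>w\<close>.\<close>

definition power_series_on :: "'i set \<Rightarrow> real \<Rightarrow> real \<Rightarrow> (('i \<Rightarrow> real) \<Rightarrow> real) \<Rightarrow> bool" where
  "power_series_on I \<rho> w P \<longleftrightarrow> (\<exists>d s. ((\<lambda>l. \<bar>d l\<bar> * monomial I (\<lambda>_. \<rho>) l) has_sum s) (multi_indices I) \<and> s \<le> w \<and>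
     (\<forall>z\<in>polydisc I \<rho>. ((\<lambda>l. d l * monomial I z l) has_sum P z) (multi_indices I)))"

lemma monomial_nonneg: "0 \<le> \<rho> \<Longrightarrow> 0 \<le> monomial I (\<lambda>_. \<rho>) l"
  by (simp add: monomial_def prod_nonneg)

lemma abs_monomial_le: "z \<in> polydisc I \<rho> \<Longrightarrow> \<bar>monomial I z l\<bar> \<le> monomial I (\<lambda>_. \<rho>) l"
  unfolding monomial_def abs_prod
  by (rule prod_mono) (auto simp: polydisc_def power_abs intro!: power_mono)

lemma monomial_zero: "monomial I z (\<lambda>i\<in>I. 0) = 1"
  by (simp add: monomial_def)

lemma multi_index_zero:
  assumes "l \<in> multi_indices I" "\<forall>i\<in>I. l i = 0"
  shows "l = (\<lambda>i\<in>I. 0)"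
  using assms by (intro extensionalityI[of l I]) (auto simp: PiE_def)

lemma monomial_at_zero:
  assumes "finite I" "l \<in> multi_indices I"
  shows "monomial I (\<lambda>i\<in>I. 0) l = (if l = (\<lambda>i\<in>I. 0) then 1 else 0)"
proof (cases "\<forall>i\<in>I. l i = 0")
  case True
  with assms(2) have "l = (\<lambda>i\<in>I. 0)" by (rule multi_index_zero)
  then show ?thesis by (simp add: monomial_zero)
next
  case False
  then obtain i where "i \<in> I" "l i \<noteq> 0" by auto
  then have "l \<noteq> (\<lambda>i\<in>I. 0)" by auto
  then show ?thesis using \<open>i \<in> I\<close> \<open>l i \<noteq> 0\<close> assms(1)
    by (auto simp: monomial_def intro!: bexI[of _ i])
qed

lemma has_sum_abs_le:
  fixes f g :: "'a \<Rightarrow> real"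
  assumes "(f has_sum a) A" "(g has_sum b) A" "\<And>x. x \<in> A \<Longrightarrow> \<bar>f x\<bar> \<le> g x"
  shows "\<bar>a\<bar> \<le> b"
proof (rule abs_leI)
  show "a \<le> b" using assms(1,2) by (rule has_sum_mono) (use assms(3) in fastforce)
  have "((\<lambda>x. - f x) has_sum - a) A" using assms(1) by (simp add: has_sum_uminus)
  then show "- a \<le> b" using assms(2) by (rule has_sum_mono) (use assms(3) in fastforce)
qed

lemma power_series_on_bound:
  assumes "power_series_on I \<rho> w P" "z \<in> polydisc I \<rho>"
  shows "\<bar>P z\<bar> \<le> w"
proof -
  obtain d s where d: "((\<lambda>l. \<bar>d l\<bar> * monomial I (\<lambda>_. \<rho>) l) has_sum s) (multi_indices I)" "s \<le> w"
      "((\<lambda>l. d l * monomial I z l) has_sum P z) (multi_indices I)"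
    using assms by (auto simp: power_series_on_def)
  have "\<bar>P z\<bar> \<le> s"
    using d(3,1) by (rule has_sum_abs_le) (auto simp: abs_mult intro!: mult_left_mono abs_monomial_le assms(2))
  with d(2) show ?thesis by simp
qed

lemma power_series_on_cong:
  assumes "power_series_on I \<rho> w P" "w \<le> w'" "\<And>z. z \<in> polydisc I \<rho> \<Longrightarrow> P z = Q z"
  shows "power_series_on I \<rho> w' Q"
proof -
  obtain d s where d: "((\<lambda>l. \<bar>d l\<bar> * monomial I (\<lambda>_. \<rho>) l) has_sum s) (multi_indices I)" "s \<le> w"
      "\<forall>z\<in>polydisc I \<rho>. ((\<lambda>l. d l * monomial I z l) has_sum P z) (multi_indices I)"
    using assms(1) by (auto simp: power_series_on_def)
  show ?thesis unfolding power_series_on_def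
    using d assms(2,3) by (intro exI[of _ d] exI[of _ s]) auto
qed

lemma power_series_on_const:
  assumes "finite I" "0 \<le> \<rho>"
  shows "power_series_on I \<rho> \<bar>a\<bar> (\<lambda>_. a)"
proof -
  let ?d = "\<lambda>l. if l = (\<lambda>i\<in>I. 0) then a else 0"
  have 1: "((\<lambda>l. ?d l * monomial I z l) has_sum a) (multi_indices I)" for z
    by (rule has_sum_finite_neutralI[of "{\<lambda>i\<in>I. 0}"]) (auto simp: monomial_zero)
  have 2: "((\<lambda>l. \<bar>?d l\<bar> * monomial I (\<lambda>_. \<rho>) l) has_sum \<bar>a\<bar>) (multi_indices I)"
    by (rule has_sum_finite_neutralI[of "{\<lambda>i\<in>I. 0}"]) (auto simp: monomial_zero)
  show ?thesis unfolding power_series_on_def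
    using 1 2 by (intro exI[of _ ?d] exI[of _ "\<bar>a\<bar>"]) auto
qed

lemma power_series_on_coord_mult:
  assumes "finite I" "i \<in> I" "0 \<le> \<rho>" "power_series_on I \<rho> w P"
  shows "power_series_on I \<rho> (\<rho> * w) (\<lambda>z. z i * P z)"
proof -
  obtain d s where d: "((\<lambda>l. \<bar>d l\<bar> * monomial I (\<lambda>_. \<rho>) l) has_sum s) (multi_indices I)" "s \<le> w"
      "\<forall>z\<in>polydisc I \<rho>. ((\<lambda>l. d l * monomial I z l) has_sum P z) (multi_indices I)"
    using assms(4) by (auto simp: power_series_on_def)
  define \<phi> where "\<phi> = (\<lambda>l :: 'a \<Rightarrow> nat. l(i := Suc (l i)))"
  define d' where "d' = (\<lambda>l. if l i = 0 then 0 else d (l(i := l i - 1)))"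
  have d'_\<phi>: "d' (\<phi> l) = d l" for l by (simp add: d'_def \<phi>_def)
  have inj: "inj_on \<phi> (multi_indices I)"
  proof (rule inj_on_inverseI[where g = "\<lambda>l. l(i := l i - 1)"])
    show "(\<phi> l)(i := \<phi> l i - 1) = l" for l by (simp add: \<phi>_def)
  qed
  have img: "l \<in> \<phi> ` multi_indices I" if "l \<in> multi_indices I" "l i \<noteq> 0" for l
    using that assms(2) by (intro image_eqI[of _ _ "l(i := l i - 1)"]) (auto simp: \<phi>_def PiE_def extensional_def)
  have sub: "\<phi> ` multi_indices I \<subseteq> multi_indices I"
    using assms(2) by (auto simp: \<phi>_def PiE_def extensional_def)
  have mon: "monomial I z (\<phi> l) = z i * monomial I z l" for z :: "'a \<Rightarrow> real" and l
  proof -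
    have "(\<Prod>j\<in>I - {i}. z j ^ \<phi> l j) = (\<Prod>j\<in>I - {i}. z j ^ l j)"
      by (rule prod.cong) (auto simp: \<phi>_def)
    moreover have "\<phi> l i = Suc (l i)" by (simp add: \<phi>_def)
    ultimately show ?thesis unfolding monomial_def
      by (simp only: prod.remove[OF assms(1,2), of "\<lambda>j. z j ^ \<phi> l j"] prod.remove[OF assms(1,2), of "\<lambda>j. z j ^ l j"]
        power_Suc mult.assoc)
  qed
  \<comment> \<open>Needed twice, with \<open>h = abs\<close> for the norm and with the identity for
    the value. The condition \<open>h 0 = 0\<close> removes the indices outside the image of
    \<open>\<phi>\<close>.\<close>
  have shift: "((\<lambda>l. h (d' l) * monomial I z l) has_sum (z i * S)) (multi_indices I)"
    if "h 0 = 0" and S: "((\<lambda>l. h (d l) * monomial I z l) has_sum S) (multi_indices I)" for h :: "real \<Rightarrow> real" and z S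
  proof -
    have "((\<lambda>l. z i * (h (d l) * monomial I z l)) has_sum (z i * S)) (multi_indices I)"
      using S by (rule has_sum_cmult_right)
    moreover have "(\<lambda>l. z i * (h (d l) * monomial I z l)) = (\<lambda>l. h (d' l) * monomial I z l) \<circ> \<phi>"
      by (auto simp: d'_\<phi> mon)
    ultimately have "((\<lambda>l. h (d' l) * monomial I z l) has_sum (z i * S)) (\<phi> ` multi_indices I)"
      by (simp add: has_sum_reindex[OF inj])
    moreover have "((\<lambda>l. h (d' l) * monomial I z l) has_sum (z i * S)) (\<phi> ` multi_indices I) \<longleftrightarrow>
       ((\<lambda>l. h (d' l) * monomial I z l) has_sum (z i * S)) (multi_indices I)"
    proof (rule has_sum_cong_neutral)
      fix l assume "l \<in> multi_indices I - \<phi> ` multi_indices I"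
      then have "l i = 0" using img by blast
      then show "h (d' l) * monomial I z l = 0" using that(1) by (simp add: d'_def)
    qed (use sub in auto)
    ultimately show ?thesis by simp
  qed
  have 1: "((\<lambda>l. \<bar>d' l\<bar> * monomial I (\<lambda>_. \<rho>) l) has_sum (\<rho> * s)) (multi_indices I)"
    using shift[of abs "\<lambda>_. \<rho>" s] d(1) by simp
  have 2: "((\<lambda>l. d' l * monomial I z l) has_sum (z i * P z)) (multi_indices I)" if "z \<in> polydisc I \<rho>" for z
    using shift[of "\<lambda>x. x" z "P z"] d(3) that by simp
  show ?thesis unfolding power_series_on_def
    using 1 2 d(2) assms(3) by (intro exI[of _ d'] exI[of _ "\<rho> * s"]) (auto intro: mult_left_mono)
qed

text \<open>Completeness of the weighted space. The double family of coefficients, weighted by the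
  radius, is absolutely summable on \<open>K \<times> multi_indices I\<close>, so summation over
  \<open>K\<close> may be carried out coefficient by coefficient.\<close>

lemma power_series_on_has_sum:
  assumes "0 < \<rho>" and P: "\<And>k. k \<in> K \<Longrightarrow> power_series_on I \<rho> (w k) (P k)"
    and w: "(w has_sum W) K" and Q: "\<And>z. z \<in> polydisc I \<rho> \<Longrightarrow> ((\<lambda>k. P k z) has_sum Q z) K"
  shows "power_series_on I \<rho> W Q"
proof -
  let ?N = "multi_indices I" let ?m = "monomial I (\<lambda>_. \<rho>)"
  define \<Phi> where "\<Phi> k d s \<longleftrightarrow> ((\<lambda>l. \<bar>d l\<bar> * ?m l) has_sum s) ?N \<and> s \<le> w k \<and>
     (\<forall>z\<in>polydisc I \<rho>. ((\<lambda>l. d l * monomial I z l) has_sum P k z) ?N)" for k d s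
  have "\<forall>k\<in>K. \<exists>d. \<exists>s. \<Phi> k d s" using P by (simp add: power_series_on_def \<Phi>_def)
  from bchoice[OF this] obtain d where "\<forall>k\<in>K. \<exists>s. \<Phi> k (d k) s" by (rule exE)
  from bchoice[OF this(1)] obtain s where ds: "\<forall>k\<in>K. \<Phi> k (d k) (s k)" by (rule exE)
  have d: "\<And>k. k \<in> K \<Longrightarrow> ((\<lambda>l. \<bar>d k l\<bar> * ?m l) has_sum s k) ?N" "\<And>k. k \<in> K \<Longrightarrow> s k \<le> w k"
     "\<And>k z. k \<in> K \<Longrightarrow> z\<in>polydisc I \<rho> \<Longrightarrow> ((\<lambda>l. d k l * monomial I z l) has_sum P k z) ?N"
    using ds by (simp_all add: \<Phi>_def)
  have m_pos: "?m l > 0" for l using assms(1) by (simp add: monomial_def prod_pos)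
  have s_nonneg: "0 \<le> s k" if "k \<in> K" for k
    using d(1)[OF that] by (rule has_sum_nonneg) (simp add: less_imp_le m_pos)
  have s_sum: "s summable_on K"
    using has_sum_imp_summable[OF w] by (rule summable_on_comparison_test) (use d(2) s_nonneg in auto)
  have abs_sum: "(\<lambda>(k, l). \<bar>d k l\<bar> * ?m l) summable_on K \<times> ?N"
  proof (rule summable_on_SigmaI)
    show "((\<lambda>l. case (k, l) of (k, l) \<Rightarrow> \<bar>d k l\<bar> * ?m l) has_sum s k) ?N" if "k \<in> K" for k
      using d(1)[OF that] by simp
  qed (use s_sum m_pos in \<open>auto simp: less_imp_le\<close>)
  have sum_z: "(\<lambda>(k, l). d k l * monomial I z l) summable_on K \<times> ?N" if z: "z \<in> polydisc I \<rho>" for z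
  proof (rule abs_summable_summable)
    show "(\<lambda>x. norm (case x of (k, l) \<Rightarrow> d k l * monomial I z l)) summable_on K \<times> ?N"
      by (rule summable_on_comparison_test[OF abs_sum])
        (auto simp: abs_mult intro!: mult_left_mono abs_monomial_le z)
  qed
  have sum_d: "(\<lambda>k. d k l) summable_on K" "(\<lambda>k. \<bar>d k l\<bar> * ?m l) summable_on K" if "l \<in> ?N" for l
  proof -
    have "(\<lambda>(l, k). \<bar>d k l\<bar> * ?m l) summable_on ?N \<times> K"
      using abs_sum by (subst summable_on_swap) (simp add: case_prod_unfold)
    then show 1: "(\<lambda>k. \<bar>d k l\<bar> * ?m l) summable_on K"
      using summable_on_SigmaD1[of "\<lambda>l k. \<bar>d k l\<bar> * ?m l" ?N "\<lambda>_. K" l] that by auto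
    then have "(\<lambda>k. (\<bar>d k l\<bar> * ?m l) * inverse (?m l)) summable_on K"
      by (rule summable_on_cmult_left)
    then have "(\<lambda>k. norm (d k l)) summable_on K"
      using m_pos[of l] by (simp add: mult.assoc)
    then show "(\<lambda>k. d k l) summable_on K" by (rule abs_summable_summable)
  qed
  define d' where "d' l = infsum (\<lambda>k. d k l) K" for l
  have 2: "((\<lambda>l. d' l * monomial I z l) has_sum Q z) ?N" if z: "z \<in> polydisc I \<rho>" for z
  proof -
    let ?f = "\<lambda>k l. d k l * monomial I z l"
    obtain S where S: "((\<lambda>(k, l). ?f k l) has_sum S) (K \<times> ?N)"
      using sum_z[OF z] by (auto simp: summable_on_def)
    from S have "((\<lambda>k. P k z) has_sum S) K" by (rule has_sum_SigmaD) (simp add: d(3) z)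
    then have "S = Q z" using Q[OF z] by (rule has_sum_unique)
    moreover have "((\<lambda>(l, k). ?f k l) has_sum S) (?N \<times> K)"
      using S by (subst has_sum_swap) (simp add: case_prod_unfold)
    then have "((\<lambda>l. d' l * monomial I z l) has_sum S) ?N"
    proof (rule has_sum_SigmaD)
      fix l assume "l \<in> ?N"
      have "((\<lambda>k. d k l) has_sum d' l) K" using sum_d(1)[OF \<open>l \<in> ?N\<close>] by (simp add: d'_def)
      then show "((\<lambda>y. case (l, y) of (l, k) \<Rightarrow> ?f k l) has_sum d' l * monomial I z l) K"
        by (simp add: has_sum_cmult_left)
    qed
    ultimately show ?thesis by simp
  qed
  obtain A where A: "((\<lambda>(k, l). \<bar>d k l\<bar> * ?m l) has_sum A) (K \<times> ?N)"
    using abs_sum by (auto simp: summable_on_def)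
  from A have "(s has_sum A) K" by (rule has_sum_SigmaD) (simp add: d(1))
  then have "A \<le> W" using w by (rule has_sum_mono) (rule d(2))
  define b where "b l = infsum (\<lambda>k. \<bar>d k l\<bar> * ?m l) K" for l
  have "((\<lambda>(l, k). \<bar>d k l\<bar> * ?m l) has_sum A) (?N \<times> K)"
    using A by (subst has_sum_swap) (simp add: case_prod_unfold)
  then have b: "(b has_sum A) ?N"
    by (rule has_sum_SigmaD) (use sum_d(2) in \<open>simp add: b_def\<close>)
  have d'_b: "\<bar>d' l\<bar> * ?m l \<le> b l" if "l \<in> ?N" for l
  proof -
    have "((\<lambda>k. d k l * ?m l) has_sum d' l * ?m l) K"
      using sum_d(1)[OF that] by (simp add: d'_def has_sum_cmult_left)
    moreover have "((\<lambda>k. \<bar>d k l\<bar> * ?m l) has_sum b l) K" using sum_d(2)[OF that] by (simp add: b_def)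
    ultimately have "\<bar>d' l * ?m l\<bar> \<le> b l"
      by (rule has_sum_abs_le) (simp add: abs_mult abs_of_pos[OF m_pos])
    then show ?thesis by (simp add: abs_mult abs_of_pos[OF m_pos])
  qed
  have "(\<lambda>l. \<bar>d' l\<bar> * ?m l) summable_on ?N"
    by (rule summable_on_comparison_test[OF has_sum_imp_summable[OF b]]) (simp_all add: d'_b less_imp_le[OF m_pos] mult_nonneg_nonneg)
  then obtain s' where s': "((\<lambda>l. \<bar>d' l\<bar> * ?m l) has_sum s') ?N" by (auto simp: summable_on_def)
  then have "s' \<le> A" using b by (rule has_sum_mono) (rule d'_b)
  then show ?thesis unfolding power_series_on_def
    using s' 2 \<open>A \<le> W\<close> by (intro exI[of _ d'] exI[of _ s']) auto
qed

lemma power_series_on_monomial_mult: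
  assumes "finite I" "0 < \<rho>" "power_series_on I \<rho> w P"
  shows "power_series_on I \<rho> (monomial I (\<lambda>_. \<rho>) l * w) (\<lambda>z. monomial I z l * P z)"
proof -
  have pow: "power_series_on I \<rho> (\<rho> ^ n * w) (\<lambda>z. z i ^ n * P z)" if "i \<in> I" "power_series_on I \<rho> w P" for i n w P
  proof (induction n)
    case 0 then show ?case using that by simp
  next
    case (Suc n)
    from power_series_on_coord_mult[OF assms(1) that(1) less_imp_le[OF assms(2)] this]
    show ?case by (simp add: mult.assoc)
  qed
  have "power_series_on I \<rho> ((\<Prod>i\<in>I'. \<rho> ^ l i) * w) (\<lambda>z. (\<Prod>i\<in>I'. z i ^ l i) * P z)" if "I' \<subseteq> I" for I'
    using finite_subset[OF that assms(1)] that
  proof (induction I' rule: finite_induct)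
    case empty then show ?case using assms(3) by simp
  next
    case (insert i I')
    then show ?case using pow[of i _ _ "l i"] by (simp add: mult.assoc)
  qed
  then show ?thesis by (simp add: monomial_def)
qed

lemma power_series_on_add:
  assumes "power_series_on I \<rho> w P" "power_series_on I \<rho> w' Q" and True: "0 \<le> \<rho>"
  shows "power_series_on I \<rho> (w + w') (\<lambda>z. P z + Q z)"
proof -
  obtain d s where d: "((\<lambda>l. \<bar>d l\<bar> * monomial I (\<lambda>_. \<rho>) l) has_sum s) (multi_indices I)" "s \<le> w"
      "\<forall>z\<in>polydisc I \<rho>. ((\<lambda>l. d l * monomial I z l) has_sum P z) (multi_indices I)"
    using assms(1) by (auto simp: power_series_on_def)
  obtain d' s' where d': "((\<lambda>l. \<bar>d' l\<bar> * monomial I (\<lambda>_. \<rho>) l) has_sum s') (multi_indices I)" "s' \<le> w'"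
      "\<forall>z\<in>polydisc I \<rho>. ((\<lambda>l. d' l * monomial I z l) has_sum Q z) (multi_indices I)"
    using assms(2) by (auto simp: power_series_on_def)
  let ?e = "\<lambda>l. d l + d' l"
  have sum: "((\<lambda>l. \<bar>d l\<bar> * monomial I (\<lambda>_. \<rho>) l + \<bar>d' l\<bar> * monomial I (\<lambda>_. \<rho>) l) has_sum (s + s')) (multi_indices I)"
    using d(1) d'(1) by (rule has_sum_add)
  have le: "\<bar>?e l\<bar> * monomial I (\<lambda>_. \<rho>) l \<le> \<bar>d l\<bar> * monomial I (\<lambda>_. \<rho>) l + \<bar>d' l\<bar> * monomial I (\<lambda>_. \<rho>) l" for l
    using mult_right_mono[OF abs_triangle_ineq monomial_nonneg[OF True]] by (simp add: distrib_right)
  have "(\<lambda>l. \<bar>?e l\<bar> * monomial I (\<lambda>_. \<rho>) l) summable_on multi_indices I"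
    by (rule summable_on_comparison_test[OF has_sum_imp_summable[OF sum]])
      (simp_all add: le monomial_nonneg[OF True] mult_nonneg_nonneg)
  then obtain t where t: "((\<lambda>l. \<bar>?e l\<bar> * monomial I (\<lambda>_. \<rho>) l) has_sum t) (multi_indices I)"
    by (auto simp: summable_on_def)
  then have "t \<le> s + s'" using sum by (rule has_sum_mono) (rule le)
  moreover have "((\<lambda>l. ?e l * monomial I z l) has_sum (P z + Q z)) (multi_indices I)" if "z \<in> polydisc I \<rho>" for z
    unfolding distrib_right using d(3) d'(3) that by (intro has_sum_add) auto
  ultimately show ?thesis unfolding power_series_on_def
    using t d(2) d'(2) by (intro exI[of _ ?e] exI[of _ t]) auto
qed

text \<open>Expanding only the first factor into monomials presents the product as a convergent sum
  of series whose norms are known, so no Cauchy product of multi-indices is required.\<close>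

lemma power_series_on_mult:
  assumes "finite I" "0 < \<rho>" "power_series_on I \<rho> w P" "power_series_on I \<rho> w' Q" "0 \<le> w'"
  shows "power_series_on I \<rho> (w * w') (\<lambda>z. P z * Q z)"
proof -
  obtain d s where d: "((\<lambda>l. \<bar>d l\<bar> * monomial I (\<lambda>_. \<rho>) l) has_sum s) (multi_indices I)" "s \<le> w"
      "\<forall>z\<in>polydisc I \<rho>. ((\<lambda>l. d l * monomial I z l) has_sum P z) (multi_indices I)"
    using assms(3) by (auto simp: power_series_on_def)
  have a: "power_series_on I \<rho> (\<bar>d l\<bar> * (monomial I (\<lambda>_. \<rho>) l * w')) (\<lambda>z. d l * (monomial I z l * Q z))" for l
  proof -
    have "power_series_on I \<rho> (infsum (\<lambda>_. \<bar>d l\<bar> * (monomial I (\<lambda>_. \<rho>) l * w')) {()}) (\<lambda>z. d l * (monomial I z l * Q z))"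
    proof -
      obtain e t where e: "((\<lambda>k. \<bar>e k\<bar> * monomial I (\<lambda>_. \<rho>) k) has_sum t) (multi_indices I)"
          "t \<le> monomial I (\<lambda>_. \<rho>) l * w'"
          "\<forall>z\<in>polydisc I \<rho>. ((\<lambda>k. e k * monomial I z k) has_sum (monomial I z l * Q z)) (multi_indices I)"
        using power_series_on_monomial_mult[OF assms(1,2,4), of l] by (auto simp: power_series_on_def)
      have "((\<lambda>k. \<bar>d l * e k\<bar> * monomial I (\<lambda>_. \<rho>) k) has_sum \<bar>d l\<bar> * t) (multi_indices I)"
        using has_sum_cmult_right[OF e(1), of "\<bar>d l\<bar>"] by (simp add: abs_mult mult.assoc)
      moreover have "((\<lambda>k. d l * e k * monomial I z k) has_sum (d l * (monomial I z l * Q z))) (multi_indices I)"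
        if "z \<in> polydisc I \<rho>" for z
        using has_sum_cmult_right[OF bspec[OF e(3) that], of "d l"] by (simp add: mult.assoc)
      ultimately show ?thesis unfolding power_series_on_def
        using e(2) by (intro exI[of _ "\<lambda>k. d l * e k"] exI[of _ "\<bar>d l\<bar> * t"]) (auto intro: mult_left_mono)
    qed
    then show ?thesis by simp
  qed
  have b: "((\<lambda>l. \<bar>d l\<bar> * (monomial I (\<lambda>_. \<rho>) l * w')) has_sum s * w') (multi_indices I)"
    using has_sum_cmult_left[OF d(1), of w'] by (simp add: mult.assoc)
  have c: "((\<lambda>l. d l * (monomial I z l * Q z)) has_sum P z * Q z) (multi_indices I)" if "z \<in> polydisc I \<rho>" for z
    using has_sum_cmult_left[OF bspec[OF d(3) that], of "Q z"] by (simp add: mult.assoc)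
  have "power_series_on I \<rho> (s * w') (\<lambda>z. P z * Q z)"
    by (rule power_series_on_has_sum[OF assms(2) _ b c]) (rule a)
  then show ?thesis by (rule power_series_on_cong) (use d(2) assms(5) in \<open>auto intro: mult_right_mono\<close>)
qed

lemma power_series_on_shrink:
  assumes "power_series_on I \<rho> w P" "0 \<le> \<rho>'" "\<rho>' \<le> \<rho>"
  shows "power_series_on I \<rho>' w P"
proof -
  obtain d s where d: "((\<lambda>l. \<bar>d l\<bar> * monomial I (\<lambda>_. \<rho>) l) has_sum s) (multi_indices I)" "s \<le> w"
      "\<forall>z\<in>polydisc I \<rho>. ((\<lambda>l. d l * monomial I z l) has_sum P z) (multi_indices I)"
    using assms(1) by (auto simp: power_series_on_def)
  have le: "\<bar>d l\<bar> * monomial I (\<lambda>_. \<rho>') l \<le> \<bar>d l\<bar> * monomial I (\<lambda>_. \<rho>) l" for l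
    unfolding monomial_def using assms(2,3) by (intro mult_left_mono prod_mono) (auto intro: power_mono)
  have "(\<lambda>l. \<bar>d l\<bar> * monomial I (\<lambda>_. \<rho>') l) summable_on multi_indices I"
    by (rule summable_on_comparison_test[OF has_sum_imp_summable[OF d(1)]]) (simp_all add: le monomial_nonneg[OF assms(2)] mult_nonneg_nonneg)
  then obtain t where t: "((\<lambda>l. \<bar>d l\<bar> * monomial I (\<lambda>_. \<rho>') l) has_sum t) (multi_indices I)"
    by (auto simp: summable_on_def)
  moreover have "t \<le> s" using t d(1) by (rule has_sum_mono) (rule le)
  moreover have "polydisc I \<rho>' \<subseteq> polydisc I \<rho>" using assms(3) by (force simp: polydisc_def)
  ultimately show ?thesis unfolding power_series_on_def
    using d(2,3) by (intro exI[of _ d] exI[of _ t]) auto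
qed

text \<open>Without the constant term every monomial has positive degree, so shrinking the radius by
  a factor \<open>t \<le> 1\<close> shrinks the norm at least by \<open>t\<close>.\<close>

lemma power_series_on_small:
  assumes "finite I" "power_series_on I \<rho> w P" "0 < \<rho>" "0 < e"
  shows "\<exists>\<rho>'>0. \<rho>' \<le> \<rho> \<and> power_series_on I \<rho>' e (\<lambda>z. P z - P (\<lambda>i\<in>I. 0))"
proof -
  let ?o = "\<lambda>i\<in>I. 0 :: nat"
  obtain d s where d: "((\<lambda>l. \<bar>d l\<bar> * monomial I (\<lambda>_. \<rho>) l) has_sum s) (multi_indices I)" "s \<le> w"
      "\<forall>z\<in>polydisc I \<rho>. ((\<lambda>l. d l * monomial I z l) has_sum P z) (multi_indices I)"
    using assms(2) by (auto simp: power_series_on_def)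
  have z0: "(\<lambda>i\<in>I. 0) \<in> polydisc I \<rho>" using assms(3) by (auto simp: polydisc_def)
  have "((\<lambda>l. d l * monomial I (\<lambda>i\<in>I. 0) l) has_sum d ?o) (multi_indices I)"
    by (rule has_sum_finite_neutralI[of "{?o}"]) (auto simp: monomial_at_zero[OF assms(1)])
  then have P0: "P (\<lambda>i\<in>I. 0) = d ?o" using d(3) z0 has_sum_unique by blast
  define d' where "d' l = (if l = ?o then 0 else d l)" for l
  have s_nonneg: "0 \<le> s" using d(1) by (rule has_sum_nonneg) (use assms(3) in \<open>auto simp: monomial_nonneg\<close>)
  \<comment> \<open>Chosen so that \<open>t * s \<le> e\<close>; the denominator
    \<open>s + 1\<close> allows \<open>s = 0\<close>, and the bound 1 keeps the new radius below
    \<open>\<rho>\<close>.\<close>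
  define t where "t = min 1 (e / (s + 1))"
  have t: "0 < t" "t \<le> 1" "t * s \<le> e"
  proof -
    show "0 < t" "t \<le> 1" using s_nonneg assms(4) by (auto simp: t_def)
    have "t * s \<le> e / (s + 1) * s" using s_nonneg by (intro mult_right_mono) (auto simp: t_def)
    also have "\<dots> = e * (s / (s + 1))" by simp
    also have "\<dots> \<le> e * 1" using s_nonneg assms(4) by (intro mult_left_mono) (auto simp: field_simps)
    finally show "t * s \<le> e" by simp
  qed
  have mon: "monomial I (\<lambda>_. t * \<rho>) l \<le> t * monomial I (\<lambda>_. \<rho>) l" if "l \<in> multi_indices I" "l \<noteq> ?o" for l
  proof -
    have "\<exists>i\<in>I. l i \<noteq> 0"
    proof (rule ccontr)
      assume "\<not> (\<exists>i\<in>I. l i \<noteq> 0)"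
      then have "l = ?o" by (intro multi_index_zero[OF that(1)]) simp
      with that(2) show False by contradiction
    qed
    then obtain i where i: "i \<in> I" "l i \<noteq> 0" by (elim bexE)
    have "(\<Prod>i\<in>I. t ^ l i) = t ^ l i * (\<Prod>i\<in>I - {i}. t ^ l i)" using i assms(1) by (simp add: prod.remove)
    also have "\<dots> \<le> t ^ 1 * 1"
      using t i by (intro mult_mono power_decreasing prod_le_1) (auto simp: power_le_one prod_nonneg)
    finally have "(\<Prod>i\<in>I. t ^ l i) \<le> t" by simp
    then have "(\<Prod>i\<in>I. t ^ l i) * monomial I (\<lambda>_. \<rho>) l \<le> t * monomial I (\<lambda>_. \<rho>) l"
      using assms(3) by (intro mult_right_mono) (auto simp: monomial_nonneg)
    then show ?thesis by (simp add: monomial_def power_mult_distrib prod.distrib)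
  qed
  have le: "\<bar>d' l\<bar> * monomial I (\<lambda>_. t * \<rho>) l \<le> t * (\<bar>d l\<bar> * monomial I (\<lambda>_. \<rho>) l)" if "l \<in> multi_indices I" for l
    using mult_left_mono[OF mon[OF that], of "\<bar>d l\<bar>"] t assms(3)
    by (auto simp: d'_def mult_ac monomial_nonneg)
  have ts: "((\<lambda>l. t * (\<bar>d l\<bar> * monomial I (\<lambda>_. \<rho>) l)) has_sum t * s) (multi_indices I)"
    using d(1) by (rule has_sum_cmult_right)
  have "(\<lambda>l. \<bar>d' l\<bar> * monomial I (\<lambda>_. t * \<rho>) l) summable_on multi_indices I"
    by (rule summable_on_comparison_test[OF has_sum_imp_summable[OF ts]])
      (use le t assms(3) in \<open>auto simp: monomial_nonneg\<close>)
  then obtain S where S: "((\<lambda>l. \<bar>d' l\<bar> * monomial I (\<lambda>_. t * \<rho>) l) has_sum S) (multi_indices I)"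
    by (auto simp: summable_on_def)
  then have "S \<le> t * s" using ts le by (rule has_sum_mono)
  have tr: "t * \<rho> \<le> \<rho>" using t assms(3) by (simp add: mult_left_le_one_le)
  have "((\<lambda>l. d' l * monomial I z l) has_sum (P z - P (\<lambda>i\<in>I. 0))) (multi_indices I)" if z: "z \<in> polydisc I (t * \<rho>)" for z
  proof -
    have "z \<in> polydisc I \<rho>" using z tr by (force simp: polydisc_def)
    with d(3) have "((\<lambda>l. d l * monomial I z l) has_sum P z) (multi_indices I)" by blast
    moreover have "((\<lambda>l. if l = ?o then - d l else 0) has_sum - d ?o) (multi_indices I)"
      by (rule has_sum_finite_neutralI[of "{?o}"]) auto
    ultimately have "((\<lambda>l. d l * monomial I z l + (if l = ?o then - d l else 0)) has_sum P z + - d ?o) (multi_indices I)"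
      by (rule has_sum_add)
    moreover have "(\<lambda>l. d l * monomial I z l + (if l = ?o then - d l else 0)) = (\<lambda>l. d' l * monomial I z l)"
      by (rule ext) (simp add: d'_def monomial_zero)
    ultimately show ?thesis by (simp add: P0)
  qed
  then have "power_series_on I (t * \<rho>) e (\<lambda>z. P z - P (\<lambda>i\<in>I. 0))"
    unfolding power_series_on_def using S \<open>S \<le> t * s\<close> t(3) by (intro exI[of _ d'] exI[of _ S]) auto
  then show ?thesis using t assms(3) tr by (intro exI[of _ "t * \<rho>"]) auto
qed

lemma power_series_on_power:
  assumes "finite I" "0 < \<rho>" "power_series_on I \<rho> w P" "0 \<le> w"
  shows "power_series_on I \<rho> (w ^ n) (\<lambda>z. P z ^ n)"
proof (induction n)
  case 0 then show ?case using power_series_on_const[OF assms(1), of \<rho> 1] assms(2) by simp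
next
  case (Suc n) then show ?case using power_series_on_mult[OF assms(1,2,3) Suc] assms(4) by simp
qed

lemma power_series_on_prod:
  assumes "finite I" "0 < \<rho>" "finite K" "\<And>j. j \<in> K \<Longrightarrow> power_series_on I \<rho> (w j) (P j)" "\<And>j. j \<in> K \<Longrightarrow> 0 \<le> w j"
  shows "power_series_on I \<rho> (\<Prod>j\<in>K. w j) (\<lambda>z. \<Prod>j\<in>K. P j z)"
  using assms(3-)
proof (induction K rule: finite_induct)
  case empty then show ?case using power_series_on_const[OF assms(1), of \<rho> 1] assms(2) by simp
next
  case (insert j K)
  then show ?case using power_series_on_mult[OF assms(1,2), of "w j" "P j"] by (simp add: prod_nonneg)
qed

text \<open>Unconditional summability of a real family is absolute. So convergence at the single
  corner \<open>(\<rho>, \<dots>, \<rho>)\<close> of the polydisc already bounds the norm.\<close>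

lemma real_analytic_at_iff:
  assumes "finite I" "x \<in> I \<rightarrow>\<^sub>E UNIV"
  shows "real_analytic_at I f x \<longleftrightarrow> (\<exists>\<rho>>0. \<exists>w. power_series_on I \<rho> w (\<lambda>z. f (\<lambda>i\<in>I. x i + z i)))"
proof
  assume "real_analytic_at I f x"
  then obtain c r where r: "r > 0" and c: "\<And>y. y \<in> I \<rightarrow>\<^sub>E UNIV \<Longrightarrow> (\<forall>i\<in>I. \<bar>y i - x i\<bar> < r) \<Longrightarrow>
        ((\<lambda>k. c k * (\<Prod>i\<in>I. (y i - x i) ^ k i)) has_sum f y) (multi_indices I)"
    unfolding real_analytic_at_def by blast
  \<comment> \<open>The closed polydisc, including its corner, has to lie inside the open box of
    radius \<open>r\<close>.\<close>
  define \<rho> where "\<rho> = r / 2"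
  have c': "((\<lambda>k. c k * monomial I z k) has_sum f (\<lambda>i\<in>I. x i + z i)) (multi_indices I)" if "z \<in> polydisc I \<rho>" for z
  proof -
    have "((\<lambda>k. c k * (\<Prod>i\<in>I. ((\<lambda>i\<in>I. x i + z i) i - x i) ^ k i)) has_sum f (\<lambda>i\<in>I. x i + z i)) (multi_indices I)"
      using that r by (intro c) (auto simp: polydisc_def \<rho>_def intro: le_less_trans)
    then show ?thesis by (simp add: monomial_def)
  qed
  have "(\<lambda>k. c k * monomial I (\<lambda>i\<in>I. \<rho>) k) summable_on multi_indices I"
    using c'[of "\<lambda>i\<in>I. \<rho>"] r by (auto simp: polydisc_def \<rho>_def summable_on_def)
  then have "(\<lambda>k. norm (c k * monomial I (\<lambda>i\<in>I. \<rho>) k)) summable_on multi_indices I"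
    by (simp only: summable_on_iff_abs_summable_on_real[symmetric])
  moreover have "norm (c k * monomial I (\<lambda>i\<in>I. \<rho>) k) = \<bar>c k\<bar> * monomial I (\<lambda>_. \<rho>) k" for k
    using r by (simp add: abs_mult monomial_def abs_of_nonneg prod_nonneg \<rho>_def)
  ultimately obtain s where "((\<lambda>k. \<bar>c k\<bar> * monomial I (\<lambda>_. \<rho>) k) has_sum s) (multi_indices I)"
    by (auto simp: summable_on_def)
  then have "power_series_on I \<rho> s (\<lambda>z. f (\<lambda>i\<in>I. x i + z i))"
    unfolding power_series_on_def using c' by blast
  then show "\<exists>\<rho>>0. \<exists>w. power_series_on I \<rho> w (\<lambda>z. f (\<lambda>i\<in>I. x i + z i))" using r unfolding \<rho>_def by (intro exI[of _ "r / 2"]) auto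
next
  assume "\<exists>\<rho>>0. \<exists>w. power_series_on I \<rho> w (\<lambda>z. f (\<lambda>i\<in>I. x i + z i))"
  then obtain \<rho> d where \<rho>: "\<rho> > 0" and d: "\<And>z. z\<in>polydisc I \<rho> \<Longrightarrow>
     ((\<lambda>l. d l * monomial I z l) has_sum f (\<lambda>i\<in>I. x i + z i)) (multi_indices I)"
    unfolding power_series_on_def by blast
  have "((\<lambda>k. d k * (\<Prod>i\<in>I. (y i - x i) ^ k i)) has_sum f y) (multi_indices I)"
    if "y \<in> I \<rightarrow>\<^sub>E UNIV" "\<forall>i\<in>I. \<bar>y i - x i\<bar> < \<rho>" for y
  proof -
    have "(\<lambda>i\<in>I. y i - x i) \<in> polydisc I \<rho>" using that by (auto simp: polydisc_def less_imp_le)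
    from d[OF this] have "((\<lambda>l. d l * monomial I (\<lambda>i\<in>I. y i - x i) l) has_sum f (\<lambda>i\<in>I. x i + (\<lambda>i\<in>I. y i - x i) i)) (multi_indices I)" .
    moreover have "(\<lambda>i\<in>I. x i + (\<lambda>i\<in>I. y i - x i) i) = y"
      using that(1) by (auto simp: fun_eq_iff PiE_def extensional_def)
    ultimately show ?thesis by (simp add: monomial_def)
  qed
  then show "real_analytic_at I f x" unfolding real_analytic_at_def using \<rho> by blast
qed

lemma real_analytic_at_small:
  assumes "finite I" "x \<in> I \<rightarrow>\<^sub>E UNIV" "real_analytic_at I f x" "0 < e"
  shows "\<exists>\<rho>>0. power_series_on I \<rho> e (\<lambda>z. f (\<lambda>i\<in>I. x i + z i) - f x)"
proof -
  obtain \<rho> w where \<rho>: "\<rho> > 0" "power_series_on I \<rho> w (\<lambda>z. f (\<lambda>i\<in>I. x i + z i))"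
    using assms(3) unfolding real_analytic_at_iff[OF assms(1,2)] by auto
  have "(\<lambda>i\<in>I. x i + (\<lambda>i\<in>I. 0) i) = x" using assms(2) by (auto simp: fun_eq_iff PiE_def extensional_def)
  then show ?thesis using power_series_on_small[OF assms(1) \<rho>(2,1) assms(4)] by auto
qed

definition near :: "'i set \<Rightarrow> real \<Rightarrow> ('i \<Rightarrow> real) \<Rightarrow> ('i \<Rightarrow> real) set" where
  "near I r x = {y \<in> I \<rightarrow>\<^sub>E UNIV. \<forall>i\<in>I. \<bar>y i - x i\<bar> < r}"

lemma near_mono: "r \<le> r' \<Longrightarrow> near I r x \<subseteq> near I r' x"
  by (force simp: near_def)

lemma near_self: "0 < r \<Longrightarrow> x \<in> I \<rightarrow>\<^sub>E UNIV \<Longrightarrow> x \<in> near I r x"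
  by (simp add: near_def)

lemma real_analytic_at_continuous:
  assumes "finite I" "x \<in> I \<rightarrow>\<^sub>E UNIV" "real_analytic_at I f x" "0 < e"
  shows "\<exists>r>0. \<forall>y\<in>near I r x. \<bar>f y - f x\<bar> < e"
proof -
  obtain \<rho> where \<rho>: "\<rho> > 0" "power_series_on I \<rho> (e / 2) (\<lambda>z. f (\<lambda>i\<in>I. x i + z i) - f x)"
    using real_analytic_at_small[OF assms(1-3)] assms(4) by (metis half_gt_zero)
  show ?thesis
  proof (intro exI[of _ \<rho>] conjI \<rho>(1) ballI impI)
    fix y assume "y \<in> near I \<rho> x"
    then have y: "y \<in> I \<rightarrow>\<^sub>E UNIV" "\<forall>i\<in>I. \<bar>y i - x i\<bar> < \<rho>" by (auto simp: near_def)
    have "(\<lambda>i\<in>I. y i - x i) \<in> polydisc I \<rho>" using y by (auto simp: polydisc_def less_imp_le)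
    from power_series_on_bound[OF \<rho>(2) this]
    have "\<bar>f (\<lambda>i\<in>I. x i + (\<lambda>i\<in>I. y i - x i) i) - f x\<bar> \<le> e / 2" .
    moreover have "(\<lambda>i\<in>I. x i + (\<lambda>i\<in>I. y i - x i) i) = y"
      using y(1) by (auto simp: fun_eq_iff PiE_def extensional_def)
    ultimately show "\<bar>f y - f x\<bar> < e" using assms(4) by simp
  qed
qed

text \<open>On a small polydisc the increments of all \<open>g j\<close> have norm at most
  \<open>r\<close>, the radius of the outer series. Substitution then replaces a monomial by a
  series whose norm is at most the value of that monomial at \<open>r\<close>, and these norms are
  summable against the coefficients.\<close>

lemma real_analytic_at_compose:
  assumes I: "finite I" and K: "finite K" and x: "x \<in> I \<rightarrow>\<^sub>E UNIV"
    and g: "\<And>j. j \<in> K \<Longrightarrow> real_analytic_at I (g j) x"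
    and h: "real_analytic_at K h (\<lambda>j\<in>K. g j x)"
  shows "real_analytic_at I (\<lambda>y. h (\<lambda>j\<in>K. g j y)) x"
proof -
  obtain r w where r: "r > 0" "power_series_on K r w (\<lambda>v. h (\<lambda>j\<in>K. (\<lambda>j\<in>K. g j x) j + v j))"
    using h by (subst (asm) real_analytic_at_iff[OF K]) auto
  have "\<forall>j\<in>K. \<exists>\<rho>>0. power_series_on I \<rho> r (\<lambda>z. g j (\<lambda>i\<in>I. x i + z i) - g j x)"
    by (intro ballI real_analytic_at_small[OF I x g r(1)])
  then obtain R where R: "\<And>j. j \<in> K \<Longrightarrow> R j > 0 \<and> power_series_on I (R j) r (\<lambda>z. g j (\<lambda>i\<in>I. x i + z i) - g j x)"
    by metis
  \<comment> \<open>The entry 1 keeps the minimum defined when \<open>K\<close> is empty.\<close>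
  define \<rho> where "\<rho> = Min (insert 1 (R ` K))"
  have \<rho>: "\<rho> > 0" "\<And>j. j \<in> K \<Longrightarrow> \<rho> \<le> R j" using K R by (auto simp: \<rho>_def)
  let ?P = "\<lambda>j z. g j (\<lambda>i\<in>I. x i + z i) - g j x"
  have P: "power_series_on I \<rho> r (?P j)" if "j \<in> K" for j
    using power_series_on_shrink[of I "R j" r "?P j" \<rho>] R[OF that] \<rho> that by auto
  obtain c s where c: "((\<lambda>l. \<bar>c l\<bar> * monomial K (\<lambda>_. r) l) has_sum s) (multi_indices K)" "s \<le> w"
      "\<And>z. z\<in>polydisc K r \<Longrightarrow> ((\<lambda>l. c l * monomial K z l) has_sum h (\<lambda>j\<in>K. (\<lambda>j\<in>K. g j x) j + z j)) (multi_indices K)"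
    using r(2) by (auto simp: power_series_on_def)
  have "power_series_on I \<rho> s (\<lambda>z. h (\<lambda>j\<in>K. g j (\<lambda>i\<in>I. x i + z i)))"
  proof (rule power_series_on_has_sum[OF \<rho>(1) _ c(1)])
    fix l assume "l \<in> multi_indices K"
    have "power_series_on I \<rho> (\<Prod>j\<in>K. r ^ l j) (\<lambda>z. \<Prod>j\<in>K. ?P j z ^ l j)"
      using r(1) by (intro power_series_on_prod power_series_on_power I \<rho>(1) K P) auto
    from power_series_on_mult[OF I \<rho>(1) power_series_on_const[OF I, of \<rho> "c l"] this] r(1) \<rho>(1)
    show "power_series_on I \<rho> (\<bar>c l\<bar> * monomial K (\<lambda>_. r) l) (\<lambda>z. c l * monomial K (\<lambda>j\<in>K. ?P j z) l)"
      by (simp add: monomial_def prod_nonneg)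
  next
    fix z assume z: "z \<in> polydisc I \<rho>"
    have "(\<lambda>j\<in>K. ?P j z) \<in> polydisc K r"
      using power_series_on_bound[OF P z] by (auto simp: polydisc_def)
    from c(3)[OF this]
    show "((\<lambda>l. c l * monomial K (\<lambda>j\<in>K. ?P j z) l) has_sum h (\<lambda>j\<in>K. g j (\<lambda>i\<in>I. x i + z i))) (multi_indices K)"
      by (simp cong: restrict_cong)
  qed
  then show ?thesis unfolding real_analytic_at_iff[OF I x] using \<rho>(1) by (intro exI conjI)
qed

lemma real_analytic_at_const:
  assumes "finite I" "x \<in> I \<rightarrow>\<^sub>E UNIV"
  shows "real_analytic_at I (\<lambda>_. a) x"
  unfolding real_analytic_at_iff[OF assms] using power_series_on_const[OF assms(1), of 1 a]
  by (intro exI[of _ 1] conjI exI[of _ "\<bar>a\<bar>"]) simp_all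

lemma real_analytic_at_coord:
  assumes "finite I" "x \<in> I \<rightarrow>\<^sub>E UNIV" "i \<in> I"
  shows "real_analytic_at I (\<lambda>y. y i) x"
proof -
  have "power_series_on I 1 (1 * \<bar>1\<bar>) (\<lambda>z. z i * 1)"
    by (rule power_series_on_coord_mult[OF assms(1,3) _ power_series_on_const[OF assms(1)]]) auto
  then have "power_series_on I 1 (\<bar>x i\<bar> + 1) (\<lambda>z. x i + z i)"
    using power_series_on_add[OF power_series_on_const[OF assms(1), of 1 "x i"], of 1 "\<lambda>z. z i"] by simp
  then have "power_series_on I 1 (\<bar>x i\<bar> + 1) (\<lambda>z. (\<lambda>i\<in>I. x i + z i) i)" using assms(3) by simp
  then show ?thesis unfolding real_analytic_at_iff[OF assms(1,2)] by (intro exI[of _ 1]) auto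
qed

lemma power_series_on_common_radius:
  assumes "finite I" "x \<in> I \<rightarrow>\<^sub>E UNIV" "real_analytic_at I f x" "real_analytic_at I g x"
  obtains \<rho> w w' where "\<rho> > 0" "power_series_on I \<rho> w (\<lambda>z. f (\<lambda>i\<in>I. x i + z i))" "power_series_on I \<rho> w' (\<lambda>z. g (\<lambda>i\<in>I. x i + z i))"
proof -
  obtain \<rho> w where \<rho>: "\<rho> > 0" "power_series_on I \<rho> w (\<lambda>z. f (\<lambda>i\<in>I. x i + z i))"
    using assms(3) unfolding real_analytic_at_iff[OF assms(1,2)] by auto
  obtain \<rho>' w' where \<rho>': "\<rho>' > 0" "power_series_on I \<rho>' w' (\<lambda>z. g (\<lambda>i\<in>I. x i + z i))"
    using assms(4) unfolding real_analytic_at_iff[OF assms(1,2)] by auto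
  show thesis
  proof (rule that)
    show "min \<rho> \<rho>' > 0" using \<rho> \<rho>' by simp
    show "power_series_on I (min \<rho> \<rho>') w (\<lambda>z. f (\<lambda>i\<in>I. x i + z i))"
      using \<rho> \<rho>' by (intro power_series_on_shrink[OF \<rho>(2)]) auto
    show "power_series_on I (min \<rho> \<rho>') w' (\<lambda>z. g (\<lambda>i\<in>I. x i + z i))"
      using \<rho> \<rho>' by (intro power_series_on_shrink[OF \<rho>'(2)]) auto
  qed
qed

lemma real_analytic_at_add:
  assumes "finite I" "x \<in> I \<rightarrow>\<^sub>E UNIV" "real_analytic_at I f x" "real_analytic_at I g x"
  shows "real_analytic_at I (\<lambda>y. f y + g y) x"
proof -
  obtain \<rho> w w' where "\<rho> > 0" "power_series_on I \<rho> w (\<lambda>z. f (\<lambda>i\<in>I. x i + z i))" "power_series_on I \<rho> w' (\<lambda>z. g (\<lambda>i\<in>I. x i + z i))"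
    by (rule power_series_on_common_radius[OF assms])
  then have "power_series_on I \<rho> (w + w') (\<lambda>z. f (\<lambda>i\<in>I. x i + z i) + g (\<lambda>i\<in>I. x i + z i))"
    by (intro power_series_on_add) auto
  then show ?thesis unfolding real_analytic_at_iff[OF assms(1,2)] using \<open>\<rho> > 0\<close> by (intro exI conjI)
qed

lemma real_analytic_at_mult:
  assumes "finite I" "x \<in> I \<rightarrow>\<^sub>E UNIV" "real_analytic_at I f x" "real_analytic_at I g x"
  shows "real_analytic_at I (\<lambda>y. f y * g y) x"
proof -
  obtain \<rho> w w' where *: "\<rho> > 0" "power_series_on I \<rho> w (\<lambda>z. f (\<lambda>i\<in>I. x i + z i))" "power_series_on I \<rho> w' (\<lambda>z. g (\<lambda>i\<in>I. x i + z i))"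
    by (rule power_series_on_common_radius[OF assms])
  \<comment> \<open>The product rule wants a nonnegative bound for its second factor.\<close>
  have "power_series_on I \<rho> \<bar>w'\<bar> (\<lambda>z. g (\<lambda>i\<in>I. x i + z i))"
    using *(3) by (rule power_series_on_cong) auto
  from power_series_on_mult[OF assms(1) *(1,2) this]
  show ?thesis unfolding real_analytic_at_iff[OF assms(1,2)] using *(1) by (intro exI conjI) simp_all
qed

lemma real_analytic_at_sum:
  assumes "finite I" "x \<in> I \<rightarrow>\<^sub>E UNIV" "finite S" "\<And>j. j \<in> S \<Longrightarrow> real_analytic_at I (f j) x"
  shows "real_analytic_at I (\<lambda>y. \<Sum>j\<in>S. f j y) x"
  using assms(3,4)
  by (induction S rule: finite_induct) (auto intro!: real_analytic_at_const real_analytic_at_add assms(1,2))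

section \<open>Analytic maps\<close>

definition finite_atlas :: "('i, 'm) atlas \<Rightarrow> bool" where
  "finite_atlas \<A> \<longleftrightarrow> (\<forall>(I, p)\<in>\<A>. finite I)"

lemma finite_prod_atlas: "finite_atlas \<A> \<Longrightarrow> finite_atlas \<B> \<Longrightarrow> finite_atlas (prod_atlas \<A> \<B>)"
  by (fastforce simp: finite_atlas_def prod_atlas_def)

text \<open>Maps between carriers are restricted functions on larger types, so analyticity must
  depend only on the values at points covered by charts.\<close>

definition atlas_points :: "('i, 'm) atlas \<Rightarrow> 'm set" where
  "atlas_points \<A> = (\<Union>(I, p)\<in>\<A>. p ` (I \<rightarrow>\<^sub>E UNIV))"

lemma analytic_mapI:
  assumes "\<And>I p x. (I, p) \<in> \<A> \<Longrightarrow> x \<in> I \<rightarrow>\<^sub>E UNIV \<Longrightarrow> \<exists>K q g r. (K, q) \<in> \<B> \<and>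
     (\<forall>j\<in>K. real_analytic_at I (g j) x) \<and> 0 < r \<and> (\<forall>y\<in>near I r x. f (p y) = q (\<lambda>j\<in>K. g j y))"
  shows "analytic_map \<A> \<B> f"
  unfolding analytic_map_def
proof (clarify, goal_cases)
  case (1 I p x)
  from assms[OF this] obtain K q g r where "(K, q) \<in> \<B>" "\<forall>j\<in>K. real_analytic_at I (g j) x" "0 < r"
    "\<forall>y\<in>near I r x. f (p y) = q (\<lambda>j\<in>K. g j y)" by auto
  then show ?case by (intro bexI[of _ "(K, q)"]) (auto simp: near_def intro!: exI[of _ g] exI[of _ r])
qed

lemma analytic_mapE:
  assumes "analytic_map \<A> \<B> f" "(I, p) \<in> \<A>" "x \<in> I \<rightarrow>\<^sub>E UNIV"
  obtains K q g r where "(K, q) \<in> \<B>" "\<And>j. j\<in>K \<Longrightarrow> real_analytic_at I (g j) x" "0 < r"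
    "\<And>y. y\<in>near I r x \<Longrightarrow> f (p y) = q (\<lambda>j\<in>K. g j y)"
proof -
  have "case (I, p) of (I, p) \<Rightarrow> \<forall>x \<in> I \<rightarrow>\<^sub>E UNIV. \<exists>(K, q)\<in>\<B>. \<exists>g.
        (\<forall>j\<in>K. real_analytic_at I (g j) x) \<and>
        (\<exists>r>0. \<forall>y \<in> I \<rightarrow>\<^sub>E UNIV. (\<forall>i\<in>I. \<bar>y i - x i\<bar> < r) \<longrightarrow> f (p y) = q (\<lambda>j\<in>K. g j y))"
    using assms(1,2) unfolding analytic_map_def by (rule bspec)
  then obtain K q g r where "(K, q) \<in> \<B>" "\<forall>j\<in>K. real_analytic_at I (g j) x" "0 < r"
    "\<forall>y\<in>I \<rightarrow>\<^sub>E UNIV. (\<forall>i\<in>I. \<bar>y i - x i\<bar> < r) \<longrightarrow> f (p y) = q (\<lambda>j\<in>K. g j y)"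
    using assms(3) by blast
  then show thesis by (intro that[of K q g r]) (auto simp: near_def)
qed

lemma analytic_map_cong:
  assumes "analytic_map \<A> \<B> f" "\<And>x. x \<in> atlas_points \<A> \<Longrightarrow> f x = g x"
  shows "analytic_map \<A> \<B> g"
proof (rule analytic_mapI)
  fix I p and x :: "_ \<Rightarrow> real" assume *: "(I, p) \<in> \<A>" "x \<in> I \<rightarrow>\<^sub>E UNIV"
  have eq: "f (p y) = g (p y)" if "y \<in> near I r x" for y r
    using * that by (auto simp: atlas_points_def near_def intro!: assms(2) bexI[of _ "(I, p)"])
  show "\<exists>K q g' r. (K, q) \<in> \<B> \<and> (\<forall>j\<in>K. real_analytic_at I (g' j) x) \<and> 0 < r \<and>
      (\<forall>y\<in>near I r x. g (p y) = q (\<lambda>j\<in>K. g' j y))"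
  proof (rule analytic_mapE[OF assms(1) *])
    fix K q g' r assume "(K, q) \<in> \<B>" "\<And>j. j \<in> K \<Longrightarrow> real_analytic_at I (g' j) x" "0 < r"
      "\<And>y. y \<in> near I r x \<Longrightarrow> f (p y) = q (\<lambda>j\<in>K. g' j y)"
    then show ?thesis using eq by (intro exI[of _ K] exI[of _ q] exI[of _ g'] exI[of _ r]) auto
  qed
qed

text \<open>The coordinate expression of \<open>g\<close> is valid only near the image point.
  Continuity of the finitely many coordinates of \<open>f\<close> keeps them in that
  neighbourhood.\<close>

lemma analytic_map_compose:
  assumes fin: "finite_atlas \<A>" "finite_atlas \<B>" and f: "analytic_map \<A> \<B> f" and g: "analytic_map \<B> \<C> g"
  shows "analytic_map \<A> \<C> (\<lambda>x. g (f x))"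
proof (rule analytic_mapI)
  fix I p and x :: "_ \<Rightarrow> real" assume *: "(I, p) \<in> \<A>" and x: "x \<in> I \<rightarrow>\<^sub>E UNIV"
  obtain K q u r where q: "(K, q) \<in> \<B>" and u: "\<And>j. j \<in> K \<Longrightarrow> real_analytic_at I (u j) x" and r: "0 < r"
    "\<And>y. y \<in> near I r x \<Longrightarrow> f (p y) = q (\<lambda>j\<in>K. u j y)"
    by (rule analytic_mapE[OF f * x]) (rule that)
  obtain M t v s where t: "(M, t) \<in> \<C>" and v: "\<And>j. j \<in> M \<Longrightarrow> real_analytic_at K (v j) (\<lambda>j\<in>K. u j x)" and s: "0 < s"
    "\<And>y. y \<in> near K s (\<lambda>j\<in>K. u j x) \<Longrightarrow> g (q y) = t (\<lambda>j\<in>M. v j y)"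
    by (rule analytic_mapE[OF g q, of "\<lambda>j\<in>K. u j x"]) (simp, rule that)
  have finI: "finite I" and finK: "finite K" using fin * q by (auto simp: finite_atlas_def)
  have "\<forall>j\<in>K. \<exists>d>0. \<forall>y\<in>near I d x. \<bar>u j y - u j x\<bar> < s"
    by (intro ballI real_analytic_at_continuous[OF finI x u s(1)])
  then obtain d where d: "\<And>j. j \<in> K \<Longrightarrow> d j > 0" "\<And>j y. j \<in> K \<Longrightarrow> y \<in> near I (d j) x \<Longrightarrow> \<bar>u j y - u j x\<bar> < s"
    by metis
  define \<rho> where "\<rho> = Min (insert r (d ` K))"
  have \<rho>: "0 < \<rho>" "\<rho> \<le> r" "\<And>j. j \<in> K \<Longrightarrow> \<rho> \<le> d j" using r d finK by (auto simp: \<rho>_def)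
  have "g (f (p y)) = t (\<lambda>j\<in>M. v j (\<lambda>j\<in>K. u j y))" if y: "y \<in> near I \<rho> x" for y
  proof -
    have "f (p y) = q (\<lambda>j\<in>K. u j y)" using near_mono[OF \<rho>(2)] y by (intro r) auto
    moreover have "\<bar>u j y - u j x\<bar> < s" if "j \<in> K" for j
      using near_mono[OF \<rho>(3)] y that by (intro d) auto
    then have "(\<lambda>j\<in>K. u j y) \<in> near K s (\<lambda>j\<in>K. u j x)" by (auto simp: near_def)
    ultimately show ?thesis using s by simp
  qed
  moreover have "real_analytic_at I (\<lambda>y. v j (\<lambda>j\<in>K. u j y)) x" if "j \<in> M" for j
    by (rule real_analytic_at_compose[OF finI finK x u v[OF that]])
  ultimately show "\<exists>K q h r. (K, q) \<in> \<C> \<and> (\<forall>j\<in>K. real_analytic_at I (h j) x) \<and> 0 < r \<and>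
      (\<forall>y\<in>near I r x. g (f (p y)) = q (\<lambda>j\<in>K. h j y))"
    using t \<rho>(1) by (intro exI[of _ M] exI[of _ t] exI[of _ "\<lambda>j y. v j (\<lambda>j\<in>K. u j y)"] exI[of _ \<rho>]) auto
qed

lemma analytic_map_id: "finite_atlas \<A> \<Longrightarrow> analytic_map \<A> \<A> (\<lambda>x. x)"
proof (rule analytic_mapI)
  fix I p and x :: "_ \<Rightarrow> real" assume *: "(I, p) \<in> \<A>" "x \<in> I \<rightarrow>\<^sub>E UNIV" and "finite_atlas \<A>"
  then have "finite I" by (auto simp: finite_atlas_def)
  have eq: "(\<lambda>j\<in>I. y j) = y" if "y \<in> near I 1 x" for y using that by (auto simp: near_def PiE_def extensional_def)
  then show "\<exists>K q g r. (K, q) \<in> \<A> \<and> (\<forall>j\<in>K. real_analytic_at I (g j) x) \<and> 0 < r \<and> (\<forall>y\<in>near I r x. p y = q (\<lambda>j\<in>K. g j y))"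
    using * \<open>finite I\<close> by (intro exI[of _ I] exI[of _ p] exI[of _ "\<lambda>j y. y j"] exI[of _ 1]) (simp add: real_analytic_at_coord eq)
qed

lemma analytic_map_pair:
  assumes f: "analytic_map \<A> \<B> f" and g: "analytic_map \<A> \<C> g"
  shows "analytic_map \<A> (prod_atlas \<B> \<C>) (\<lambda>x. (f x, g x))"
proof (rule analytic_mapI)
  fix I p and x :: "_ \<Rightarrow> real" assume *: "(I, p) \<in> \<A>" and x: "x \<in> I \<rightarrow>\<^sub>E UNIV"
  obtain K q u r where q: "(K, q) \<in> \<B>" and u: "\<And>j. j \<in> K \<Longrightarrow> real_analytic_at I (u j) x" and r: "0 < r"
    "\<And>y. y \<in> near I r x \<Longrightarrow> f (p y) = q (\<lambda>j\<in>K. u j y)"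
    by (rule analytic_mapE[OF f * x]) (rule that)
  obtain M t v s where t: "(M, t) \<in> \<C>" and v: "\<And>j. j \<in> M \<Longrightarrow> real_analytic_at I (v j) x" and s: "0 < s"
    "\<And>y. y \<in> near I s x \<Longrightarrow> g (p y) = t (\<lambda>j\<in>M. v j y)"
    by (rule analytic_mapE[OF g * x]) (rule that)
  let ?w = "case_sum u v"
  have "(K <+> M, \<lambda>y. (q (\<lambda>i\<in>K. y (Inl i)), t (\<lambda>j\<in>M. y (Inr j)))) \<in> prod_atlas \<B> \<C>"
    using q t by (auto simp: prod_atlas_def)
  moreover have "\<forall>j\<in>K <+> M. real_analytic_at I (?w j) x" using u v by auto
  moreover have "(f (p y), g (p y)) = (q (\<lambda>i\<in>K. (\<lambda>j\<in>K <+> M. ?w j y) (Inl i)), t (\<lambda>i\<in>M. (\<lambda>j\<in>K <+> M. ?w j y) (Inr i)))"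
    if "y \<in> near I (min r s) x" for y
  proof -
    have "y \<in> near I r x" "y \<in> near I s x" using that by (auto simp: near_def)
    moreover have "(\<lambda>i\<in>K. (\<lambda>j\<in>K <+> M. ?w j y) (Inl i)) = (\<lambda>j\<in>K. u j y)"
      "(\<lambda>i\<in>M. (\<lambda>j\<in>K <+> M. ?w j y) (Inr i)) = (\<lambda>j\<in>M. v j y)"
      by (auto simp: restrict_def)
    ultimately show ?thesis using r s by simp
  qed
  ultimately show "\<exists>K q g' r. (K, q) \<in> prod_atlas \<B> \<C> \<and> (\<forall>j\<in>K. real_analytic_at I (g' j) x) \<and> 0 < r \<and>
       (\<forall>y\<in>near I r x. (f (p y), g (p y)) = q (\<lambda>j\<in>K. g' j y))"
    using r(1) s(1) by (intro exI[of _ "K <+> M"] exI exI[of _ ?w] exI[of _ "min r s"] conjI) auto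
qed

lemma analytic_map_fst: "finite_atlas \<A> \<Longrightarrow> finite_atlas \<B> \<Longrightarrow> analytic_map (prod_atlas \<A> \<B>) \<A> fst"
proof (rule analytic_mapI)
  fix I p and x :: "_ \<Rightarrow> real" assume *: "(I, p) \<in> prod_atlas \<A> \<B>" "x \<in> I \<rightarrow>\<^sub>E UNIV" and "finite_atlas \<A>" "finite_atlas \<B>"
  then obtain I1 p1 I2 p2 where I: "I = I1 <+> I2" and p: "p = (\<lambda>y. (p1 (\<lambda>i\<in>I1. y (Inl i)), p2 (\<lambda>j\<in>I2. y (Inr j))))"
    and *: "(I1, p1) \<in> \<A>" "(I2, p2) \<in> \<B>"
    by (auto simp: prod_atlas_def)
  then have "finite I" using \<open>finite_atlas \<A>\<close> \<open>finite_atlas \<B>\<close> by (auto simp: finite_atlas_def)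
  with I \<open>x \<in> I \<rightarrow>\<^sub>E UNIV\<close> have "real_analytic_at I (\<lambda>y. y (Inl j)) x" if "j \<in> I1" for j
    using that by (intro real_analytic_at_coord) auto
  with * p show "\<exists>K q g r. (K, q) \<in> \<A> \<and> (\<forall>j\<in>K. real_analytic_at I (g j) x) \<and> 0 < r \<and> (\<forall>y\<in>near I r x. fst (p y) = q (\<lambda>j\<in>K. g j y))"
    by (intro exI[of _ I1] exI[of _ p1] exI[of _ "\<lambda>j y. y (Inl j)"] exI[of _ 1]) simp
qed

lemma analytic_map_snd: "finite_atlas \<A> \<Longrightarrow> finite_atlas \<B> \<Longrightarrow> analytic_map (prod_atlas \<A> \<B>) \<B> snd"
proof (rule analytic_mapI)
  fix I p and x :: "_ \<Rightarrow> real" assume *: "(I, p) \<in> prod_atlas \<A> \<B>" "x \<in> I \<rightarrow>\<^sub>E UNIV" and "finite_atlas \<A>" "finite_atlas \<B>"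
  then obtain I1 p1 I2 p2 where I: "I = I1 <+> I2" and p: "p = (\<lambda>y. (p1 (\<lambda>i\<in>I1. y (Inl i)), p2 (\<lambda>j\<in>I2. y (Inr j))))"
    and *: "(I1, p1) \<in> \<A>" "(I2, p2) \<in> \<B>"
    by (auto simp: prod_atlas_def)
  then have "finite I" using \<open>finite_atlas \<A>\<close> \<open>finite_atlas \<B>\<close> by (auto simp: finite_atlas_def)
  with I \<open>x \<in> I \<rightarrow>\<^sub>E UNIV\<close> have "real_analytic_at I (\<lambda>y. y (Inr j)) x" if "j \<in> I2" for j
    using that by (intro real_analytic_at_coord) auto
  with * p show "\<exists>K q g r. (K, q) \<in> \<B> \<and> (\<forall>j\<in>K. real_analytic_at I (g j) x) \<and> 0 < r \<and> (\<forall>y\<in>near I r x. snd (p y) = q (\<lambda>j\<in>K. g j y))"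
    by (intro exI[of _ I2] exI[of _ p2] exI[of _ "\<lambda>j y. y (Inr j)"] exI[of _ 1]) simp
qed

section \<open>Integer multiples and biadditive maps\<close>

lemma funpow_add_zero: "((+) a ^^ n) 0 + ((+) a ^^ k) 0 = ((+) a ^^ (n + k)) (0 :: 'a::ab_group_add)"
  by (induction n) (simp_all add: add.assoc)

lemma zmul_of_nat: "zmul (int n) a = ((+) a ^^ n) 0"
  by (simp add: zmul_def)

lemma zmul_uminus: "zmul (- k) a = - zmul k a"
  by (auto simp: zmul_def)

lemma zmul_0 [simp]: "zmul 0 a = 0" and zmul_1 [simp]: "zmul 1 a = a" and zmul_m1 [simp]: "zmul (- 1) a = - a"
  by (simp_all add: zmul_def)

lemma zmul_diff_nat: "zmul (int n - int k) a = zmul (int n) a - zmul (int k) a"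
proof (cases "k \<le> n")
  case True
  have "zmul (int (n - k)) a + zmul (int k) a = zmul (int n) a"
    unfolding zmul_of_nat funpow_add_zero using True by simp
  then show ?thesis using True by (simp add: of_nat_diff algebra_simps)
next
  case False
  have "zmul (int (k - n)) a + zmul (int n) a = zmul (int k) a"
    unfolding zmul_of_nat funpow_add_zero using False by simp
  moreover have "zmul (int n - int k) a = - zmul (int (k - n)) a"
    using False by (simp add: of_nat_diff flip: zmul_uminus)
  ultimately show ?thesis by (simp add: algebra_simps)
qed

lemma zmul_add_left: "zmul (j + k) a = zmul j a + zmul k a"
proof -
  obtain n n' where j: "j = int n - int n'" by (metis int_diff_cases)
  obtain l l' where k: "k = int l - int l'" by (metis int_diff_cases)
  have "j + k = int (n + l) - int (n' + l')" using j k by simp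
  moreover have "zmul (int (n + l)) a = zmul (int n) a + zmul (int l) a" for n l
    by (simp only: zmul_of_nat funpow_add_zero)
  ultimately show ?thesis by (simp only: j k zmul_diff_nat) (simp add: algebra_simps)
qed

lemma zmul_pred: "zmul (k - 1) a = zmul k a - a"
  using zmul_add_left[of k "- 1" a] by simp

lemma zmul_add_right: "zmul k (a + b) = zmul k a + zmul k b"
  by (induction k rule: int_induct[of _ 0]) (simp_all add: zmul_add_left zmul_pred algebra_simps)

lemma additive_zmul: "Modules.additive (zmul k)" "Modules.additive (\<lambda>k. zmul k a)"
  by (simp_all add: Modules.additive_def zmul_add_right zmul_add_left)

lemma additive_zmul_hom:
  assumes "Modules.additive f"
  shows "f (zmul k a) = zmul k (f a)"
  by (induction k rule: int_induct[of _ 0])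
    (simp_all add: zmul_add_left zmul_pred additive.zero[OF assms] additive.add[OF assms] additive.diff[OF assms])

lemma zmul_eq_mult: "zmul k a = of_int k * (a :: 'a::ring_1)"
  by (induction k rule: int_induct[of _ 0]) (simp_all add: zmul_add_left zmul_pred algebra_simps)

lemma zmul_zmul: "zmul j (zmul k a) = zmul (j * k) a"
  using additive_zmul_hom[OF additive_zmul(2)[of a], of j k] by (simp add: zmul_eq_mult)

lemma zmul_2: "zmul 2 a = a + a"
  using zmul_add_left[of 1 1 a] by simp

lemma biadditiveI:
  assumes "\<And>x y y'. h x (y + y') = h x y + h x y'" "\<And>x x' y. h (x + x') y = h x y + h x' y"
  shows "biadditive h"
  using assms by (simp add: biadditive_def Modules.additive_def)

context
  fixes h :: "'a::ab_group_add \<Rightarrow> 'b::ab_group_add \<Rightarrow> 'c::ab_group_add"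
  assumes h: "biadditive h"
begin

lemma biadditive_right: "Modules.additive (h x)" and biadditive_left: "Modules.additive (\<lambda>x. h x y)"
  using h by (auto simp: biadditive_def)

lemmas biadditive_simps = additive.add[OF biadditive_right] additive.add[OF biadditive_left]
  additive.zero[OF biadditive_right] additive.zero[OF biadditive_left]
  additive.minus[OF biadditive_right] additive.minus[OF biadditive_left]
  additive.diff[OF biadditive_right] additive.diff[OF biadditive_left]

end

section \<open>Tensor products\<close>

lemma tens_add_left: "tens (m + m') a = tens m a + tens m' a"
  by transfer (metis diff_diff_add tensor_rels.left)

lemma tens_add_right: "tens m (a + a') = tens m a + tens m a'"
  by transfer (metis diff_diff_add tensor_rels.right)

lemma biadditive_tens: "biadditive tens"
  by (rule biadditiveI) (simp_all add: tens_add_left tens_add_right)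

lemmas tens_simps = biadditive_simps[OF biadditive_tens]

lemma tensor_induct [case_names zero tens diff]:
  assumes "P 0" "\<And>m a. P (tens m a)" "\<And>x y. P x \<Longrightarrow> P y \<Longrightarrow> P (x - y)"
  shows "P (x :: ('l::ab_group_add, 'a::ab_group_add) tensor)"
proof -
  have "P (abs_tensor p)" for p
  proof (rule frag_induction[of p UNIV "\<lambda>p. P (abs_tensor p)"])
    show "P (abs_tensor 0)" using assms(1) by (simp add: zero_tensor_def)
    show "P (abs_tensor (frag_of k))" for k using assms(2)[of "fst k" "snd k"] by (simp add: tens_def)
    show "P (abs_tensor (a - b))" if "P (abs_tensor a)" "P (abs_tensor b)" for a b
      using assms(3)[OF that] by (simp add: minus_tensor.abs_eq)
  qed simp
  from this[of "rep_tensor x"] show ?thesis by (simp add: Quotient3_abs_rep[OF Quotient3_tensor])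
qed

lemma tensor_ext:
  assumes "Modules.additive f" "Modules.additive g" "\<And>m a. f (tens m a) = g (tens m a)"
  shows "f x = g x"
  by (induction x rule: tensor_induct)
    (simp_all add: assms(3) additive.zero[OF assms(1)] additive.zero[OF assms(2)] additive.diff[OF assms(1)] additive.diff[OF assms(2)])

text \<open>The linear extension \<open>\<phi>\<close> of \<open>h\<close> to the free abelian group
  vanishes on the bilinearity relations, so it does not depend on the representative chosen by
  \<open>rep_tensor\<close>.\<close>

lemma tensor_lift_exists:
  fixes h :: "'l::ab_group_add \<Rightarrow> 'a::ab_group_add \<Rightarrow> 'c::ab_group_add"
  assumes "biadditive h"
  shows "\<exists>g. Modules.additive g \<and> (\<forall>m a. g (tens m a) = h m a)"
proof -
  let ?h = "\<lambda>k. h (fst k) (snd k)"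
  define \<phi> where "\<phi> p = (\<Sum>k\<in>Poly_Mapping.keys p. zmul (Poly_Mapping.lookup p k) (?h k))" for p
  \<comment> \<open>Summation over a larger finite set makes it possible to add two elements with
    different supports.\<close>
  have \<phi>: "\<phi> p = (\<Sum>k\<in>S. zmul (Poly_Mapping.lookup p k) (?h k))" if "finite S" "Poly_Mapping.keys p \<subseteq> S" for p S
    unfolding \<phi>_def using that by (intro sum.mono_neutral_left) (auto simp: in_keys_iff)
  have add: "\<phi> (p + q) = \<phi> p + \<phi> q" for p q
  proof -
    let ?S = "Poly_Mapping.keys p \<union> Poly_Mapping.keys q"
    have "\<phi> (p + q) = (\<Sum>k\<in>?S. zmul (Poly_Mapping.lookup (p + q) k) (?h k))"
      by (intro \<phi> Poly_Mapping.keys_add) simp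
    also have "\<dots> = \<phi> p + \<phi> q"
      by (simp add: \<phi>[of ?S p] \<phi>[of ?S q] lookup_add zmul_add_left sum.distrib)
    finally show ?thesis .
  qed
  then have "Modules.additive \<phi>" by (simp add: Modules.additive_def)
  note \<phi>_add = additive.add[OF this] additive.diff[OF this] additive.zero[OF this]
  have frag: "\<phi> (frag_of k) = ?h k" for k by (simp add: \<phi>_def)
  have rels: "\<phi> p = 0" if "p \<in> tensor_rels" for p
    using that by induction (simp_all add: \<phi>_add frag biadditive_simps[OF assms])
  have rep: "\<phi> (rep_tensor (abs_tensor p)) = \<phi> p" for p
  proof -
    have "abs_tensor (rep_tensor (abs_tensor p)) = abs_tensor p" by (rule Quotient3_abs_rep[OF Quotient3_tensor])
    then have "rep_tensor (abs_tensor p) - p \<in> tensor_rels" by (simp add: tensor.abs_eq_iff)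
    then show ?thesis using rels \<phi>_add(2) by fastforce
  qed
  have "Modules.additive (\<lambda>x. \<phi> (rep_tensor x))"
  proof
    fix x y :: "('l, 'a) tensor"
    have "x + y = abs_tensor (rep_tensor x) + abs_tensor (rep_tensor y)"
      by (simp only: Quotient3_abs_rep[OF Quotient3_tensor])
    then show "\<phi> (rep_tensor (x + y)) = \<phi> (rep_tensor x) + \<phi> (rep_tensor y)"
      by (simp only: plus_tensor.abs_eq rep \<phi>_add)
  qed
  moreover have "\<phi> (rep_tensor (tens m a)) = h m a" for m a
    by (simp add: tens_def rep frag)
  ultimately show ?thesis by blast
qed

lemma tensor_lift:
  assumes "biadditive h"
  shows additive_tensor_lift: "Modules.additive (tensor_lift h)"
    and tensor_lift_tens: "tensor_lift h (tens m a) = h m a"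
proof -
  obtain g where g: "Modules.additive g" "\<forall>m a. g (tens m a) = h m a" using tensor_lift_exists[OF assms] by blast
  have "tensor_lift h = g" unfolding tensor_lift_def
  proof (rule the_equality)
    fix g' assume "Modules.additive g' \<and> (\<forall>m a. g' (tens m a) = h m a)"
    then show "g' = g" using tensor_ext[of g' g] g by (auto intro!: ext)
  qed (use g in blast)
  then show "Modules.additive (tensor_lift h)" "tensor_lift h (tens m a) = h m a" using g by auto
qed

definition tmap :: "('l::ab_group_add \<Rightarrow> 'l) \<Rightarrow> ('l, 'a::ab_group_add) tensor \<Rightarrow> ('l, 'a) tensor" where
  "tmap f = tensor_lift (\<lambda>m a. tens (f m) a)"

lemma biadditive_tmap: "Modules.additive f \<Longrightarrow> biadditive (\<lambda>m a. tens (f m) a)"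
  by (rule biadditiveI) (simp_all add: tens_simps additive.add)

lemma additive_tmap: "Modules.additive f \<Longrightarrow> Modules.additive (tmap f)"
  and tmap_tens [simp]: "Modules.additive f \<Longrightarrow> tmap f (tens m a) = tens (f m) a"
  unfolding tmap_def by (simp_all add: tensor_lift biadditive_tmap)

lemma additive_id: "Modules.additive (\<lambda>x. x)" "Modules.additive id"
  by (simp_all add: Modules.additive_def)

lemma additive_comp: "Modules.additive f \<Longrightarrow> Modules.additive g \<Longrightarrow> Modules.additive (\<lambda>x. f (g x))"
  by (simp add: Modules.additive_def)

lemma additive_plus: "Modules.additive f \<Longrightarrow> Modules.additive g \<Longrightarrow> Modules.additive (\<lambda>x. f x + g x)"
  for f g :: "_ \<Rightarrow> _::ab_group_add"
  by (simp add: Modules.additive_def algebra_simps)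

lemma additive_uminus: "Modules.additive f \<Longrightarrow> Modules.additive (\<lambda>x. - f x)"
  for f :: "_ \<Rightarrow> _::ab_group_add"
  by (simp add: Modules.additive_def algebra_simps)

lemma additive_inv:
  assumes "Modules.additive f" "bij f"
  shows "Modules.additive (inv_into UNIV f)"
proof
  fix x y
  have "f ((inv_into UNIV f) x + (inv_into UNIV f) y) = x + y" using assms by (simp add: additive.add bij_is_surj surj_f_inv_f)
  then show "(inv_into UNIV f) (x + y) = (inv_into UNIV f) x + (inv_into UNIV f) y" using assms(2) by (metis bij_inv_eq_iff)
qed

lemma tmap_id [simp]: "tmap id x = x" "tmap (\<lambda>m. m) x = x"
  using tensor_ext[OF additive_tmap additive_id(1), of id x] tensor_ext[OF additive_tmap additive_id(1), of "\<lambda>m. m" x]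
  by (simp_all add: additive_id)

lemma tmap_tmap: "Modules.additive f \<Longrightarrow> Modules.additive g \<Longrightarrow> tmap f (tmap g x) = tmap (\<lambda>m. f (g m)) x"
  by (rule tensor_ext) (simp_all add: additive_tmap additive_comp)

lemma tmap_inv:
  assumes "Modules.additive f" "bij f"
  shows "tmap f (tmap (inv_into UNIV f) x) = x" "tmap (inv_into UNIV f) (tmap f x) = x"
  using assms additive_inv[OF assms]
  by (simp_all add: tmap_tmap bij_is_surj surj_f_inv_f bij_is_inj)

text \<open>The tensor product is constructed as an abelian group only; this is its structure of a
  real vector space.\<close>

definition vscale :: "real \<Rightarrow> ('l::ab_group_add, real) tensor \<Rightarrow> ('l, real) tensor" where
  "vscale r = tensor_lift (\<lambda>m a. tens m (r * a))"

lemma additive_vscale: "Modules.additive (vscale r :: ('l::ab_group_add, real) tensor \<Rightarrow> _)"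
  and vscale_tens [simp]: "vscale r (tens m a) = tens (m :: 'l) (r * a)"
proof -
  have h: "biadditive (\<lambda>m :: 'l. \<lambda>a. tens m (r * a))"
    by (rule biadditiveI) (simp_all add: tens_simps distrib_left)
  show "Modules.additive (vscale r :: ('l, real) tensor \<Rightarrow> _)"
    unfolding vscale_def by (rule additive_tensor_lift[OF h])
  show "vscale r (tens m a) = tens m (r * a)"
    unfolding vscale_def by (rule tensor_lift_tens[OF h])
qed

lemmas vscale_simps = additive.add[OF additive_vscale] additive.zero[OF additive_vscale]
  additive.minus[OF additive_vscale] additive.diff[OF additive_vscale]

lemma vscale_vscale [simp]: "vscale r (vscale s x) = vscale (r * s) x"
  by (rule tensor_ext) (simp_all add: additive_vscale additive_comp mult.assoc)

lemma vscale_1 [simp]: "vscale 1 x = x"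
  by (rule tensor_ext) (simp_all add: additive_vscale additive_id)

lemma vscale_add_left: "vscale (r + s) x = vscale r x + vscale s x"
  by (rule tensor_ext) (simp_all add: additive_vscale additive_plus distrib_right tens_simps)

lemma vscale_0 [simp]: "vscale 0 x = 0"
  using vscale_add_left[of 0 0 x] by simp

lemma vscale_uminus_left: "vscale (- r) x = - vscale r x"
  using vscale_add_left[of r "- r" x] by (simp add: eq_neg_iff_add_eq_0 add.commute)

lemma vscale_half: "vscale (1/2) x + vscale (1/2) x = x"
  using vscale_add_left[of "1/2" "1/2" x] by simp

lemma tmap_vscale: "Modules.additive f \<Longrightarrow> tmap f (vscale r x) = vscale r (tmap f x)"
  by (rule tensor_ext[of "\<lambda>x. tmap f (vscale r x)" "\<lambda>x. vscale r (tmap f x)"]) (simp_all add: additive_vscale additive_tmap additive_comp)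

section \<open>Coordinates\<close>

definition crd :: "'l::ab_group_add set \<Rightarrow> 'l \<Rightarrow> 'l \<Rightarrow> int" where
  "crd B m = (THE c. (\<forall>b. b \<notin> B \<longrightarrow> c b = 0) \<and> m = (\<Sum>b\<in>B. zmul (c b) b))"

definition tcrd :: "'l::ab_group_add set \<Rightarrow> 'l \<Rightarrow> ('l, 'a::ab_group_add) tensor \<Rightarrow> 'a" where
  "tcrd B b = tensor_lift (\<lambda>m a. zmul (crd B m b) a)"

locale lattice_basis =
  fixes B :: "'l::ab_group_add set"
  assumes zbasis: "zbasis B"
begin

lemma finite_basis: "finite B" using zbasis by (simp add: zbasis_def)

lemma crd_ex1: "\<exists>!c. (\<forall>b. b \<notin> B \<longrightarrow> c b = 0) \<and> m = (\<Sum>b\<in>B. zmul (c b) b)"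
  using zbasis by (simp add: zbasis_def)

lemma crd_outside: "b \<notin> B \<Longrightarrow> crd B m b = 0" and crd_expand: "m = (\<Sum>b\<in>B. zmul (crd B m b) b)"
  using theI'[OF crd_ex1[of m]] unfolding crd_def by blast+

lemma crd_unique: "(\<And>b. b \<notin> B \<Longrightarrow> c b = 0) \<Longrightarrow> m = (\<Sum>b\<in>B. zmul (c b) b) \<Longrightarrow> crd B m = c"
  unfolding crd_def by (rule the1_equality[OF crd_ex1]) blast

lemma crd_add: "crd B (m + n) b = crd B m b + crd B n b"
proof -
  have "crd B (m + n) = (\<lambda>b. crd B m b + crd B n b)"
    using crd_expand[of m] crd_expand[of n]
    by (intro crd_unique) (simp_all add: crd_outside zmul_add_left sum.distrib)
  then show ?thesis by simp
qed

lemma additive_crd: "Modules.additive (\<lambda>m. crd B m b)"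
  by (simp add: Modules.additive_def crd_add)

lemma crd_basis: "b \<in> B \<Longrightarrow> crd B b = (\<lambda>b'. if b' = b then 1 else 0)"
  using finite_basis by (intro crd_unique) (auto simp: if_distrib[of "\<lambda>k. zmul k _"] cong: if_cong)

lemma crd_eqI: "(\<And>b. b \<in> B \<Longrightarrow> crd B m b = crd B n b) \<Longrightarrow> m = n"
  by (subst (1 2) crd_expand) (simp cong: sum.cong)

lemma additive_tcrd: "Modules.additive (tcrd B b :: ('l, 'a::ab_group_add) tensor \<Rightarrow> _)"
  and tcrd_tens [simp]: "tcrd B b (tens m a) = zmul (crd B m b) (a :: 'a)"
proof -
  have h: "biadditive (\<lambda>m (a :: 'a). zmul (crd B m b) a)"
    by (rule biadditiveI) (simp_all add: zmul_add_right zmul_add_left crd_add)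
  show "Modules.additive (tcrd B b :: ('l, 'a) tensor \<Rightarrow> _)" unfolding tcrd_def by (rule additive_tensor_lift[OF h])
  show "tcrd B b (tens m a) = zmul (crd B m b) a" unfolding tcrd_def by (rule tensor_lift_tens[OF h])
qed

lemmas tcrd_simps = additive.add[OF additive_tcrd] additive.zero[OF additive_tcrd]
  additive.minus[OF additive_tcrd] additive.diff[OF additive_tcrd] additive.sum[OF additive_tcrd]

lemma tens_expand: "tens m a = (\<Sum>b\<in>B. tens b (zmul (crd B m b) a))"
proof -
  have "tens (zmul k b) a = tens b (zmul k a)" for k and b :: 'l
    using additive_zmul_hom[OF biadditive_left[OF biadditive_tens], of k b a]
      additive_zmul_hom[OF biadditive_right[OF biadditive_tens], of b k a] by simp
  moreover have "tens m a = (\<Sum>b\<in>B. tens (zmul (crd B m b) b) a)"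
    by (subst crd_expand[of m]) (simp add: additive.sum[OF biadditive_left[OF biadditive_tens]])
  ultimately show ?thesis by simp
qed

lemma additive_sum_fun: "(\<And>b. b \<in> S \<Longrightarrow> Modules.additive (\<lambda>x. f b x)) \<Longrightarrow> Modules.additive (\<lambda>x. \<Sum>b\<in>S. f b x)"
  by (simp add: Modules.additive_def sum.distrib)

lemma tensor_expand: "x = (\<Sum>b\<in>B. tens b (tcrd B b x))"
  by (rule tensor_ext[OF additive_id(1)])
    (auto intro!: additive_sum_fun additive_comp[OF biadditive_right[OF biadditive_tens] additive_tcrd] tens_expand)

lemma tcrd_sum: "b \<in> B \<Longrightarrow> tcrd B b (\<Sum>b'\<in>B. tens b' (y b')) = y b"
  using finite_basis by (simp add: tcrd_simps crd_basis if_distrib[of "\<lambda>k. zmul k _"] cong: if_cong)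

lemma tensor_eqI: "(\<And>b. b \<in> B \<Longrightarrow> tcrd B b x = tcrd B b y) \<Longrightarrow> x = y"
  by (subst (1 2) tensor_expand) (simp cong: sum.cong)

lemma tens_inject: "r \<noteq> 0 \<Longrightarrow> tens (m :: 'l) (r :: real) = tens n r \<longleftrightarrow> m = n"
proof
  assume "r \<noteq> 0" "tens m r = tens n r"
  then have "zmul (crd B m b) r = zmul (crd B n b) r" for b by (metis tcrd_tens)
  then show "m = n" using \<open>r \<noteq> 0\<close> by (intro crd_eqI) (simp add: zmul_eq_mult)
qed simp

end

section \<open>Circles and tori\<close>

lemma abs_rmodz_add: "abs_rmodz (a + b) = abs_rmodz a + abs_rmodz b"
  by (simp add: plus_rmodz.abs_eq)

lemma abs_rmodz_eq_0: "abs_rmodz a = 0 \<longleftrightarrow> a \<in> \<int>"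
  by (simp add: zero_rmodz_def rmodz.abs_eq_iff)

lemma abs_rmodz_eq: "abs_rmodz a = abs_rmodz b \<longleftrightarrow> a - b \<in> \<int>"
  by (simp add: rmodz.abs_eq_iff)

lemma additive_abs_rmodz: "Modules.additive abs_rmodz"
  by (simp add: Modules.additive_def abs_rmodz_add)

lemmas abs_rmodz_simps = abs_rmodz_add additive.zero[OF additive_abs_rmodz] additive.minus[OF additive_abs_rmodz]
  additive.diff[OF additive_abs_rmodz]

lemma abs_rmodz_of_int [simp]: "abs_rmodz (of_int k) = 0"
  by (simp add: abs_rmodz_eq_0)

lemma rmodz_exhaust: obtains r where "a = abs_rmodz r"
  using Quotient3_abs_rep[OF Quotient3_rmodz] by metis

lemma exp_u1_add: "exp_u1 (a + b) = exp_u1 a + exp_u1 b"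
  by transfer (simp add: cis_mult distrib_left)

lemma additive_exp_u1: "Modules.additive exp_u1"
  by (simp add: Modules.additive_def exp_u1_add)

lemma exp_u1_eq_0: "exp_u1 a = 0 \<longleftrightarrow> a \<in> \<int>"
proof -
  have "exp_u1 a = 0 \<longleftrightarrow> cis (2 * pi * a) = 1" by transfer rule
  also have "\<dots> \<longleftrightarrow> cos (2 * pi * a) = 1"
    by (auto simp: complex_eq_iff) (metis abs_one cos_one_sin_zero)
  also have "\<dots> \<longleftrightarrow> (\<exists>n. 2 * pi * a = real_of_int n * 2 * pi)"
    by (simp add: cos_one_2pi_int)
  also have "\<dots> \<longleftrightarrow> a \<in> \<int>" by (auto simp: Ints_def)
  finally show ?thesis .
qed

lemma exp_u1_surj: obtains a where "z = exp_u1 a"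
proof -
  have "\<exists>a. z = exp_u1 a"
  proof transfer
    fix z :: complex assume "cmod z = 1"
    then have "cis (Arg z) = z" by (metis cis_Arg_unique rcis_cmod_Arg rcis_def mult_1 of_real_1)
    then have "z = cis (2 * pi * (Arg z / (2 * pi)))" by simp
    then show "\<exists>a. z = cis (2 * pi * a)" by blast
  qed
  then show thesis using that by blast
qed

lemma additive_torus_exp: "Modules.additive (torus_exp :: ('l::ab_group_add, real) tensor \<Rightarrow> _)"
  and torus_exp_tens [simp]: "torus_exp (tens m a) = tens (m :: 'l) (exp_u1 a)"
proof -
  have h: "biadditive (\<lambda>(m :: 'l) a. tens m (exp_u1 a))"
    by (rule biadditiveI) (simp_all add: tens_simps exp_u1_add)
  show "Modules.additive (torus_exp :: ('l, real) tensor \<Rightarrow> _)"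
    unfolding torus_exp_def by (rule additive_tensor_lift[OF h])
  show "torus_exp (tens m a) = tens m (exp_u1 a)"
    unfolding torus_exp_def by (rule tensor_lift_tens[OF h])
qed

lemmas torus_exp_simps = additive.add[OF additive_torus_exp] additive.zero[OF additive_torus_exp]
  additive.minus[OF additive_torus_exp] additive.diff[OF additive_torus_exp] additive.sum[OF additive_torus_exp]

lemma tmap_torus_exp: "Modules.additive f \<Longrightarrow> tmap f (torus_exp x) = torus_exp (tmap f x)"
  by (rule tensor_ext[of "\<lambda>x. tmap f (torus_exp x)" "\<lambda>x. torus_exp (tmap f x)"])
    (simp_all add: additive_torus_exp additive_tmap additive_comp)

context lattice_basis
begin

lemma tcrd_torus_exp: "tcrd B b (torus_exp x) = exp_u1 (tcrd B b x)"
  by (rule tensor_ext[of "\<lambda>x. tcrd B b (torus_exp x)" "\<lambda>x. exp_u1 (tcrd B b x)"])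
    (simp_all add: additive_torus_exp additive_tcrd additive_comp additive_exp_u1 additive_zmul_hom[OF additive_exp_u1])

text \<open>Exactness of \<open>\<Lambda>\<^sup>\<or> \<rightarrow> t \<rightarrow> T\<close> in the
  middle: in the coordinates of a basis it is the statement that the kernel of \<open>exp_u1\<close>
  is the group of integers.\<close>

lemma torus_exp_eq_0: "torus_exp x = 0 \<longleftrightarrow> (\<exists>m :: 'l. x = tens m 1)"
proof
  assume "torus_exp x = 0"
  then have "exp_u1 (tcrd B b x) = 0" for b using tcrd_torus_exp[of b x] by (simp add: tcrd_simps)
  then have "\<forall>b. \<exists>k. tcrd B b x = real_of_int k" by (auto simp: exp_u1_eq_0 Ints_def)
  then obtain k where k: "\<And>b. tcrd B b x = real_of_int (k b)" by metis
  have "x = tens (\<Sum>b\<in>B. zmul (k b) b) 1"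
  proof (rule tensor_eqI)
    fix b assume "b \<in> B"
    have "crd B (\<Sum>b\<in>B. zmul (k b) b) b = k b"
      using \<open>b \<in> B\<close> finite_basis
      by (simp add: additive.sum[OF additive_crd] additive_zmul_hom[OF additive_crd] crd_basis zmul_eq_mult if_distrib[of "(*) _"] cong: if_cong)
    then show "tcrd B b x = tcrd B b (tens (\<Sum>b\<in>B. zmul (k b) b) 1)" by (simp add: k zmul_eq_mult)
  qed
  then show "\<exists>m. x = tens m 1" by blast
next
  assume "\<exists>m. x = tens m 1"
  moreover have "exp_u1 1 = 0" by (simp add: exp_u1_eq_0)
  ultimately show "torus_exp x = 0" by (auto simp: tens_simps)
qed

lemma torus_exp_surj: obtains x where "t = torus_exp (x :: ('l, real) tensor)"
proof -
  have "\<forall>b. \<exists>a. tcrd B b t = exp_u1 a" by (metis exp_u1_surj)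
  then obtain a where a: "\<And>b. tcrd B b t = exp_u1 (a b)" by metis
  have "t = torus_exp (\<Sum>b\<in>B. tens b (a b))"
    by (rule tensor_eqI) (simp add: a tcrd_torus_exp tcrd_sum)
  then show thesis using that by blast
qed

end

section \<open>Real extensions of integral forms\<close>

definition bform :: "('l::ab_group_add \<Rightarrow> 'l \<Rightarrow> int) \<Rightarrow> ('l, real) tensor \<Rightarrow> ('l, real) tensor \<Rightarrow> real" where
  "bform J x y = tensor_lift (\<lambda>m a. a * form_ext J m y) x"

context
  fixes J :: "'l::ab_group_add \<Rightarrow> 'l \<Rightarrow> int"
  assumes J: "biadditive J"
begin

lemma additive_form_ext: "Modules.additive (form_ext J m)"
  and form_ext_tens [simp]: "form_ext J m (tens n a) = of_int (J m n) * a"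
proof -
  have h: "biadditive (\<lambda>n a. real_of_int (J m n) * a)"
    by (rule biadditiveI) (simp_all add: biadditive_simps[OF J] algebra_simps)
  show "Modules.additive (form_ext J m)" unfolding form_ext_def by (rule additive_tensor_lift[OF h])
  show "form_ext J m (tens n a) = of_int (J m n) * a" unfolding form_ext_def by (rule tensor_lift_tens[OF h])
qed

lemma form_ext_add: "form_ext J (m + m') y = form_ext J m y + form_ext J m' y"
  by (rule tensor_ext) (simp_all add: additive_form_ext additive_plus biadditive_simps[OF J] algebra_simps)

lemma bform_lift: "biadditive (\<lambda>m a. a * form_ext J m y)"
  by (rule biadditiveI) (simp_all add: form_ext_add algebra_simps)

lemma bform_tens_left: "bform J (tens m a) y = a * form_ext J m y"
  unfolding bform_def by (rule tensor_lift_tens[OF bform_lift])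

lemma bform_tens [simp]: "bform J (tens m a) (tens n b) = of_int (J m n) * a * b"
  by (simp add: bform_tens_left)

lemma biadditive_bform: "biadditive (bform J)"
proof -
  have left: "Modules.additive (\<lambda>x. bform J x y)" for y
    unfolding bform_def by (rule additive_tensor_lift[OF bform_lift])
  have "bform J x (y + y') = bform J x y + bform J x y'" for x y y'
    by (rule tensor_ext) (simp_all add: left additive_plus bform_tens_left additive.add[OF additive_form_ext] distrib_left)
  then show ?thesis using left by (simp add: biadditive_def Modules.additive_def)
qed

lemmas bform_simps = biadditive_simps[OF biadditive_bform]

lemma form_ext_eq_bform: "form_ext J m x = bform J (tens m 1) x"
  by (simp add: bform_tens_left)

end

lemma biadditive_ext:
  assumes F: "biadditive F" and G: "biadditive G" and eq: "\<And>m a n b. F (tens m a) (tens n b) = G (tens m a) (tens n b)"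
  shows "F x y = G x y"
proof -
  have "F (tens m a) y = G (tens m a) y" for m a
    by (rule tensor_ext[OF biadditive_right[OF F] biadditive_right[OF G]]) (rule eq)
  then show ?thesis
    by (rule tensor_ext[OF biadditive_left[OF F] biadditive_left[OF G]])
qed

lemma biadditive_comp: "biadditive F \<Longrightarrow> Modules.additive f \<Longrightarrow> Modules.additive g \<Longrightarrow> biadditive (\<lambda>x y. F (f x) (g y))"
  by (auto simp: biadditive_def Modules.additive_def)

lemma biadditive_flip: "biadditive F \<Longrightarrow> biadditive (\<lambda>x y. F y x)"
  by (auto simp: biadditive_def)

lemma biadditive_plus: "biadditive F \<Longrightarrow> biadditive G \<Longrightarrow> biadditive (\<lambda>x y. F x y + G x y)"
  by (auto simp: biadditive_def intro: additive_plus)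

lemma biadditive_uminus: "biadditive F \<Longrightarrow> biadditive (\<lambda>x y. - F x y)"
  by (auto simp: biadditive_def intro: additive_uminus)

lemma biadditive_symm:
  assumes "biadditive J" shows "biadditive (symm J)"
  unfolding symm_def by (rule biadditive_plus[OF assms biadditive_flip[OF assms]])

lemma biadditive_pullback: "biadditive B \<Longrightarrow> Modules.additive f \<Longrightarrow> biadditive (pullback f B)"
  unfolding pullback_def by (rule biadditive_comp)

lemma biadditive_scale: "biadditive F \<Longrightarrow> biadditive (\<lambda>x y. c * (F x y :: real))"
  by (auto simp: biadditive_def Modules.additive_def distrib_left)

lemma bform_vscale_left: "biadditive J \<Longrightarrow> bform J (vscale r x) y = r * bform J x y"
  by (rule biadditive_ext[OF biadditive_comp[OF biadditive_bform additive_vscale additive_id(1)] biadditive_scale[OF biadditive_bform]]) auto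

lemma bform_vscale_right: "biadditive J \<Longrightarrow> bform J x (vscale r y) = r * bform J x y"
  by (rule biadditive_ext[OF biadditive_comp[OF biadditive_bform additive_id(1) additive_vscale] biadditive_scale[OF biadditive_bform]]) auto

lemma bform_symm: "biadditive J \<Longrightarrow> bform (symm J) x y = bform J x y + bform J y x"
  by (rule biadditive_ext[OF biadditive_bform[OF biadditive_symm] biadditive_plus[OF biadditive_bform biadditive_flip[OF biadditive_bform]]])
    (auto simp: biadditive_symm, auto simp: symm_def algebra_simps)

lemma bform_tmap: "biadditive J \<Longrightarrow> Modules.additive f \<Longrightarrow> bform J (tmap f x) (tmap f y) = bform (pullback f J) x y"
  by (rule biadditive_ext[OF biadditive_comp[OF biadditive_bform additive_tmap additive_tmap] biadditive_bform[OF biadditive_pullback]])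
    (auto simp: biadditive_pullback, auto simp: pullback_def)

section \<open>Local properties on the domain of a chart\<close>

lemma real_analytic_at_cong_near:
  assumes "real_analytic_at I f x" "0 < r" "\<And>y. y \<in> near I r x \<Longrightarrow> f y = g y"
  shows "real_analytic_at I g x"
proof -
  obtain c s where s: "s > 0" and c: "\<forall>y \<in> I \<rightarrow>\<^sub>E UNIV. (\<forall>i\<in>I. \<bar>y i - x i\<bar> < s) \<longrightarrow>
        ((\<lambda>k. c k * (\<Prod>i\<in>I. (y i - x i) ^ k i)) has_sum f y) (I \<rightarrow>\<^sub>E (UNIV :: nat set))"
    using assms(1) unfolding real_analytic_at_def by blast
  show ?thesis unfolding real_analytic_at_def
  proof (intro exI[of _ c] exI[of _ "min r s"] conjI ballI impI)
    show "0 < min r s" using assms(2) s by simp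
    fix y assume y: "y \<in> I \<rightarrow>\<^sub>E UNIV" "\<forall>i\<in>I. \<bar>y i - x i\<bar> < min r s"
    then have "f y = g y" by (intro assms(3)) (auto simp: near_def)
    then show "((\<lambda>k. c k * (\<Prod>i\<in>I. (y i - x i) ^ k i)) has_sum g y) (I \<rightarrow>\<^sub>E (UNIV :: nat set))"
      using c y by auto
  qed
qed

text \<open>The domain of a chart is connected: the function is restricted to the segment
  \<open>g\<close> from \<open>y\<close> to \<open>y'\<close>, where connectedness of the real line
  applies.\<close>

lemma locally_constant_on_chart:
  fixes F :: "('i \<Rightarrow> real) \<Rightarrow> 'c"
  assumes "finite I" and loc: "\<And>x. x \<in> I \<rightarrow>\<^sub>E UNIV \<Longrightarrow> \<exists>r>0. \<forall>y\<in>near I r x. F y = F x"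
    and "y \<in> I \<rightarrow>\<^sub>E UNIV" "y' \<in> I \<rightarrow>\<^sub>E UNIV"
  shows "F y = F y'"
proof -
  define g where "g t = (\<lambda>i\<in>I. y i + t * (y' i - y i))" for t :: real
  have "F (g 0) = F (g 1)"
  proof (rule connected_local_const[of UNIV])
    show "\<forall>t\<in>UNIV. eventually (\<lambda>s. F (g t) = F (g s)) (at t within UNIV)"
    proof
      fix t
      obtain r where r: "r > 0" "\<forall>y\<in>near I r (g t). F y = F (g t)" using loc[of "g t"] by (auto simp: g_def)
      \<comment> \<open>\<open>M\<close> bounds the speed of every coordinate along the segment; the
        summand 1 makes it positive.\<close>
      define M where "M = 1 + (\<Sum>i\<in>I. \<bar>y' i - y i\<bar>)"
      have M: "\<bar>y' i - y i\<bar> \<le> M" if "i \<in> I" for i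
        using member_le_sum[of i I "\<lambda>i. \<bar>y' i - y i\<bar>"] that assms(1) by (simp add: M_def)
      have "M > 0" by (simp add: M_def add_pos_nonneg sum_nonneg)
      have "F (g t) = F (g s)" if s: "dist s t < r / M" for s
      proof -
        have "\<bar>g s i - g t i\<bar> < r" if "i \<in> I" for i
        proof -
          have "\<bar>g s i - g t i\<bar> = \<bar>s - t\<bar> * \<bar>y' i - y i\<bar>"
            using that by (simp add: g_def abs_mult flip: left_diff_distrib)
          also have "\<dots> \<le> \<bar>s - t\<bar> * M" using M[OF that] by (intro mult_left_mono) auto
          also have "\<dots> < r" using s \<open>M > 0\<close> by (simp add: dist_real_def field_simps)
          finally show ?thesis .
        qed
        then have "g s \<in> near I r (g t)" by (auto simp: near_def g_def)
        then show ?thesis using r by simp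
      qed
      then show "eventually (\<lambda>s. F (g t) = F (g s)) (at t within UNIV)"
        unfolding eventually_at using r \<open>M > 0\<close> by (intro exI[of _ "r / M"]) auto
    qed
  qed auto
  moreover have "g 0 = y" "g 1 = y'" using assms(3,4) by (auto simp: g_def fun_eq_iff PiE_def extensional_def)
  ultimately show ?thesis by simp
qed

section \<open>The Lie crossed module\<close>

definition gset :: "(('l::ab_group_add, real) tensor \<times> int) set" where
  "gset = UNIV \<times> {1, - 1}"

definition gm :: "('l::ab_group_add, real) tensor \<times> int \<Rightarrow> ('l, real) tensor \<times> int \<Rightarrow> ('l, real) tensor \<times> int" where
  "gm X Y = (fst X + zmul (snd X) (fst Y), snd X * snd Y)"

text \<open>Everything that is constant on the two components and trivial on the identity component
  has this form: the translation part of an automorphism as well as the lattice part of a pointed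
  map. By \<open>cs_crossed\<close> it is a crossed homomorphism in the sign.\<close>

definition cs :: "'a::zero \<Rightarrow> int \<Rightarrow> 'a" where
  "cs c \<epsilon> = (if \<epsilon> = 1 then 0 else c)"

definition emb :: "'l::ab_group_add \<Rightarrow> ('l, real) tensor \<times> int" where
  "emb m = (tens m 1, 1)"

text \<open>The automorphism of \<open>t \<rtimes> {\<plusminus>1}\<close> that extends
  \<open>f\<close> and sends the reflection \<open>(0, -1)\<close> to
  \<open>(c, -1)\<close>.\<close>

definition aut :: "('l::ab_group_add \<Rightarrow> 'l) \<Rightarrow> ('l, real) tensor \<Rightarrow> ('l, real) tensor \<times> int \<Rightarrow> ('l, real) tensor \<times> int" where
  "aut f c X = (tmap f (fst X) + cs c (snd X), snd X)"

lemma cs_simps [simp]: "cs c 1 = 0" "cs c (- 1) = c" "cs 0 \<epsilon> = 0"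
  by (simp_all add: cs_def)

lemma gset_iff: "X \<in> gset \<longleftrightarrow> snd X = 1 \<or> snd X = - 1"
  by (cases X) (auto simp: gset_def)

lemma gsetE: assumes "X \<in> gset" obtains x where "X = (x, 1)" | x where "X = (x, - 1)"
  using assms by (cases X) (auto simp: gset_iff)

lemma gset_simps [simp]: "(x, 1) \<in> gset" "(x, - 1) \<in> gset" "emb m \<in> gset"
  "X \<in> gset \<Longrightarrow> Y \<in> gset \<Longrightarrow> gm X Y \<in> gset" "X \<in> gset \<Longrightarrow> aut f c X \<in> gset"
  by (auto simp: gset_iff emb_def gm_def aut_def)

lemma gm_assoc: "gm (gm X Y) Z = gm X (gm Y Z)"
  by (simp add: gm_def zmul_add_right zmul_zmul add.assoc mult.assoc)

lemma gm_one [simp]: "gm (0, 1) X = X" "gm X (0, 1) = X"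
  by (simp_all add: gm_def additive.zero[OF additive_zmul(1)])

lemma aut_gm: "Modules.additive f \<Longrightarrow> X \<in> gset \<Longrightarrow> Y \<in> gset \<Longrightarrow> aut f c (gm X Y) = gm (aut f c X) (aut f c Y)"
  by (elim gsetE) (simp_all add: aut_def gm_def additive.add[OF additive_tmap] additive.diff[OF additive_tmap])

lemma aut_emb: "Modules.additive f \<Longrightarrow> aut f c (emb m) = emb (f m)"
  by (simp add: aut_def emb_def)

lemma aut_aut: "Modules.additive f \<Longrightarrow> Modules.additive f' \<Longrightarrow> aut f c (aut f' c' X) = aut (\<lambda>x. f (f' x)) (c + tmap f c') X"
  by (auto simp: aut_def cs_def tmap_tmap additive.add[OF additive_tmap] additive.zero[OF additive_tmap])

lemma gm_emb: "X \<in> gset \<Longrightarrow> gm (emb m) X = gm X (emb (zmul (snd X) m))"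
  by (elim gsetE) (simp_all add: gm_def emb_def tens_simps add.commute)

lemma gm_emb_emb: "gm (emb m) (emb n) = emb (m + n)"
  by (simp add: gm_def emb_def tens_simps)

definition ginv :: "('l::ab_group_add, real) tensor \<times> int \<Rightarrow> ('l, real) tensor \<times> int" where
  "ginv X = (zmul (- snd X) (fst X), snd X)"

lemma gm_ginv: "X \<in> gset \<Longrightarrow> gm (ginv X) X = (0, 1)" "X \<in> gset \<Longrightarrow> gm X (ginv X) = (0, 1)" "X \<in> gset \<Longrightarrow> ginv X \<in> gset"
  by (auto simp: gm_def ginv_def gset_iff)

lemma Theta_simps:
  "carrier (deg0 (Theta' J)) = gset" "carrier (deg1 (Theta' J)) = UNIV"
  "mult (deg0 (Theta' J)) = gm" "mult (deg1 (Theta' J)) \<alpha> \<beta> = (fst \<alpha> + fst \<beta>, snd \<alpha> + snd \<beta>)"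
  "one (deg0 (Theta' J)) = (0, 1)" "one (deg1 (Theta' J)) = (0, 0)"
  "bdry (Theta' J) \<alpha> = emb (fst \<alpha>)"
  "act (Theta' J) \<alpha> X = (zmul (snd X) (fst \<alpha>), snd \<alpha> + abs_rmodz (form_ext J (fst \<alpha>) (fst X)))"
  "atlas1 (Theta' J) = {({()}, \<lambda>y. (m, abs_rmodz (y ()))) | m. True}"
  "atlas0 (Theta' J) = {(B, \<lambda>y. (\<Sum>b\<in>B. tens b (y b), \<epsilon>)) | B \<epsilon>. zbasis B \<and> \<epsilon> \<in> {1, -1}}"
  by (simp_all add: Theta'_def semidirect_def add_group_def sign_group_def gset_def gm_def emb_def DirProd_def
      fun_eq_iff case_prod_unfold)

lemma group_deg0_Theta: "group (deg0 (Theta' J))"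
  by (rule groupI) (auto simp: Theta_simps gm_assoc intro: gm_ginv)

lemma group_deg1_Theta: "group (deg1 (Theta' J))"
  by (rule groupI) (auto simp: Theta_simps add.assoc intro: exI[of _ "- _"])

lemma inv_Theta:
  "X \<in> gset \<Longrightarrow> inv\<^bsub>deg0 (Theta' J)\<^esub> X = ginv X"
  "inv\<^bsub>deg1 (Theta' J)\<^esub> \<alpha> = (- fst \<alpha>, - snd \<alpha>)"
  by (rule group.inv_equality[OF group_deg0_Theta]; simp add: Theta_simps gm_ginv)
    (rule group.inv_equality[OF group_deg1_Theta]; simp add: Theta_simps)

section \<open>Analytic functions on \<open>t \<rtimes> {\<plusminus>1}\<close> and analytic maps
  into the degree-1 group\<close>

definition A0 :: "('l::ab_group_add, ('l, real) tensor \<times> int) atlas" where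
  "A0 = {(B, \<lambda>y. (\<Sum>b\<in>B. tens b (y b), \<epsilon>)) | B \<epsilon>. zbasis B \<and> \<epsilon> \<in> {1, -1}}"

definition A1 :: "(unit, 'l::ab_group_add \<times> rmodz) atlas" where
  "A1 = {({()}, \<lambda>y. (m, abs_rmodz (y ()))) | m. True}"

lemma atlas_Theta: "atlas0 (Theta' J) = A0" "atlas1 (Theta' J) = A1"
  by (simp_all add: Theta_simps A0_def A1_def)

lemma finite_A0: "finite_atlas A0" and finite_A1: "finite_atlas A1"
  by (auto simp: finite_atlas_def A0_def A1_def zbasis_def)

lemmas finite_A00 = finite_prod_atlas[OF finite_A0 finite_A0]

text \<open>Analyticity for functions with real values needs no atlas on the target and is closed
  under sums and products. Analytic maps into \<open>A1\<close> and \<open>A0\<close> are assembled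
  from such functions.\<close>

definition real_analytic_on_atlas :: "('i, 'm) atlas \<Rightarrow> ('m \<Rightarrow> real) \<Rightarrow> bool" where
  "real_analytic_on_atlas \<A> h \<longleftrightarrow> (\<forall>(I, p)\<in>\<A>. \<forall>x\<in>I \<rightarrow>\<^sub>E UNIV. real_analytic_at I (\<lambda>y. h (p y)) x)"

definition chart_constant :: "('i, 'm) atlas \<Rightarrow> ('m \<Rightarrow> 'c) \<Rightarrow> bool" where
  "chart_constant \<A> m \<longleftrightarrow> (\<forall>(I, p)\<in>\<A>. \<forall>y\<in>I \<rightarrow>\<^sub>E UNIV. \<forall>y'\<in>I \<rightarrow>\<^sub>E UNIV. m (p y) = m (p y'))"

lemma chart_constantD: "chart_constant \<A> m \<Longrightarrow> (I, p) \<in> \<A> \<Longrightarrow> y \<in> I \<rightarrow>\<^sub>E UNIV \<Longrightarrow> y' \<in> I \<rightarrow>\<^sub>E UNIV \<Longrightarrow> m (p y) = m (p y')"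
  by (fastforce simp: chart_constant_def)

lemma chart_constantI:
  "(\<And>I p y y'. (I, p) \<in> \<A> \<Longrightarrow> y \<in> I \<rightarrow>\<^sub>E UNIV \<Longrightarrow> y' \<in> I \<rightarrow>\<^sub>E UNIV \<Longrightarrow> m (p y) = m (p y')) \<Longrightarrow> chart_constant \<A> m"
  by (auto simp: chart_constant_def)

lemma chart_constant_comp: "chart_constant \<A> m \<Longrightarrow> chart_constant \<A> (\<lambda>X. F (m X))"
  by (fastforce simp: chart_constant_def)

lemma chart_constant_comp2:
  assumes "chart_constant \<A> m" "chart_constant \<A> m'"
  shows "chart_constant \<A> (\<lambda>X. F (m X) (m' X))"
proof (rule chart_constantI)
  fix I p and y y' :: "_ \<Rightarrow> real" assume "(I, p) \<in> \<A>" "y \<in> I \<rightarrow>\<^sub>E UNIV" "y' \<in> I \<rightarrow>\<^sub>E UNIV"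
  from chart_constantD[OF assms(1) this] chart_constantD[OF assms(2) this]
  show "F (m (p y)) (m' (p y)) = F (m (p y')) (m' (p y'))" by simp
qed

lemma chart_constant_snd: "chart_constant A0 snd"
  by (auto simp: chart_constant_def A0_def)

lemma prod_atlasE:
  assumes "(I, p) \<in> prod_atlas \<A> \<B>"
  obtains I1 p1 I2 p2 where "I = I1 <+> I2" "p = (\<lambda>y. (p1 (\<lambda>i\<in>I1. y (Inl i)), p2 (\<lambda>j\<in>I2. y (Inr j))))" "(I1, p1) \<in> \<A>" "(I2, p2) \<in> \<B>"
  using assms by (auto simp: prod_atlas_def)

lemma chart_constant_prod:
  assumes "chart_constant \<A> m"
  shows "chart_constant (prod_atlas \<A> \<B>) (\<lambda>X. m (fst X))" "chart_constant (prod_atlas \<B> \<A>) (\<lambda>X. m (snd X))"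
  unfolding chart_constant_def
  by (auto elim!: prod_atlasE intro!: chart_constantD[OF assms])

context
  fixes \<A> :: "('i, 'm) atlas"
  assumes fin: "finite_atlas \<A>"
begin

lemma real_analytic_on_atlasI:
  "(\<And>I p x. (I, p) \<in> \<A> \<Longrightarrow> finite I \<Longrightarrow> x \<in> I \<rightarrow>\<^sub>E UNIV \<Longrightarrow> real_analytic_at I (\<lambda>y. h (p y)) x) \<Longrightarrow> real_analytic_on_atlas \<A> h"
  using fin by (fastforce simp: real_analytic_on_atlas_def finite_atlas_def)

lemma real_analytic_on_atlasD:
  assumes "real_analytic_on_atlas \<A> h" "(I, p) \<in> \<A>" "x \<in> I \<rightarrow>\<^sub>E UNIV"
  shows "real_analytic_at I (\<lambda>y. h (p y)) x"
  using bspec[OF assms(1)[unfolded real_analytic_on_atlas_def] assms(2)] assms(3) by auto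

lemma real_analytic_on_atlas_chart_constant:
  assumes "chart_constant \<A> m"
  shows "real_analytic_on_atlas \<A> m"
proof (rule real_analytic_on_atlasI)
  fix I p x assume *: "(I, p) \<in> \<A>" "finite I" "x \<in> I \<rightarrow>\<^sub>E (UNIV :: real set)"
  have "real_analytic_at I (\<lambda>y. m (p x)) x" using * by (intro real_analytic_at_const)
  then show "real_analytic_at I (\<lambda>y. m (p y)) x"
    by (rule real_analytic_at_cong_near[OF _ zero_less_one])
      (rule chart_constantD[OF assms *(1,3)], simp add: near_def)
qed

lemma real_analytic_on_atlas_add:
  assumes h: "real_analytic_on_atlas \<A> h" and h': "real_analytic_on_atlas \<A> h'"
  shows "real_analytic_on_atlas \<A> (\<lambda>X. h X + h' X)"
proof (rule real_analytic_on_atlasI)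
  fix I p x assume *: "(I, p) \<in> \<A>" "finite I" "x \<in> I \<rightarrow>\<^sub>E (UNIV :: real set)"
  show "real_analytic_at I (\<lambda>y. h (p y) + h' (p y)) x"
    by (rule real_analytic_at_add[OF *(2,3) real_analytic_on_atlasD[OF h *(1,3)] real_analytic_on_atlasD[OF h' *(1,3)]])
qed

lemma real_analytic_on_atlas_mult:
  assumes h: "real_analytic_on_atlas \<A> h" and h': "real_analytic_on_atlas \<A> h'"
  shows "real_analytic_on_atlas \<A> (\<lambda>X. h X * h' X)"
proof (rule real_analytic_on_atlasI)
  fix I p x assume *: "(I, p) \<in> \<A>" "finite I" "x \<in> I \<rightarrow>\<^sub>E (UNIV :: real set)"
  show "real_analytic_at I (\<lambda>y. h (p y) * h' (p y)) x"
    by (rule real_analytic_at_mult[OF *(2,3) real_analytic_on_atlasD[OF h *(1,3)] real_analytic_on_atlasD[OF h' *(1,3)]])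
qed

lemma real_analytic_on_atlas_sum:
  assumes "finite S" and h: "\<And>j. j \<in> S \<Longrightarrow> real_analytic_on_atlas \<A> (h j)"
  shows "real_analytic_on_atlas \<A> (\<lambda>X. \<Sum>j\<in>S. h j X)"
proof (rule real_analytic_on_atlasI)
  fix I p x assume *: "(I, p) \<in> \<A>" "finite I" "x \<in> I \<rightarrow>\<^sub>E (UNIV :: real set)"
  show "real_analytic_at I (\<lambda>y. \<Sum>j\<in>S. h j (p y)) x"
    by (rule real_analytic_at_sum[OF *(2,3) assms(1) real_analytic_on_atlasD[OF h *(1,3)]])
qed

lemma real_analytic_on_atlas_const: "real_analytic_on_atlas \<A> (\<lambda>_. c)"
  by (rule real_analytic_on_atlas_chart_constant) (auto simp: chart_constant_def)

lemma analytic_map_A1I: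
  assumes "chart_constant \<A> m" "real_analytic_on_atlas \<A> h"
  shows "analytic_map \<A> A1 (\<lambda>X. (m X, abs_rmodz (h X)))"
proof (rule analytic_mapI)
  fix I p and x :: "_ \<Rightarrow> real" assume *: "(I, p) \<in> \<A>" "x \<in> I \<rightarrow>\<^sub>E UNIV"
  have "({()}, \<lambda>y. (m (p x), abs_rmodz (y ()))) \<in> A1" by (auto simp: A1_def)
  moreover have "m (p y) = m (p x)" if "y \<in> near I 1 x" for y
    using that *(2) by (intro chart_constantD[OF assms(1) *(1)]) (auto simp: near_def)
  ultimately show "\<exists>K q g r. (K, q) \<in> A1 \<and> (\<forall>j\<in>K. real_analytic_at I (g j) x) \<and> 0 < r \<and>
     (\<forall>y\<in>near I r x. (m (p y), abs_rmodz (h (p y))) = q (\<lambda>j\<in>K. g j y))"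
    using real_analytic_on_atlasD[OF assms(2) *]
    by (intro exI[of _ "{()}"] exI[of _ "\<lambda>y. (m (p x), abs_rmodz (y ()))"] exI[of _ "\<lambda>_ y. h (p y)"] exI[of _ 1]) auto
qed

lemma analytic_map_A1E:
  assumes "analytic_map \<A> A1 u" "(I, p) \<in> \<A>" "x \<in> I \<rightarrow>\<^sub>E UNIV"
  obtains m g r where "real_analytic_at I g x" "0 < r" "\<And>y. y \<in> near I r x \<Longrightarrow> u (p y) = (m, abs_rmodz (g y))"
proof (rule analytic_mapE[OF assms])
  fix K q g r assume *: "(K, q) \<in> A1" "\<And>j. j \<in> K \<Longrightarrow> real_analytic_at I (g j) x" "0 < r"
    "\<And>y. y \<in> near I r x \<Longrightarrow> u (p y) = q (\<lambda>j\<in>K. g j y)"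
  then obtain m where "K = {()}" "q = (\<lambda>y. (m, abs_rmodz (y ())))" by (auto simp: A1_def)
  with * show thesis by (intro that[of "g ()" r m]) auto
qed

text \<open>\<open>F\<close> and \<open>Q\<close> may be arbitrary functions because their arguments
  are lattice components, which are constant near each point. Most of the arithmetic of cochains is
  an instance of this lemma.\<close>

lemma analytic_map_A1_map2:
  assumes u: "analytic_map \<A> A1 u" and v: "analytic_map \<A> A1 v"
  shows "analytic_map \<A> A1 (\<lambda>X. (F (fst (u X)) (fst (v X)), snd (u X) + snd (v X) + Q (fst (u X)) (fst (v X))))"
proof (rule analytic_mapI)
  fix I p and x :: "_ \<Rightarrow> real" assume *: "(I, p) \<in> \<A>" "x \<in> I \<rightarrow>\<^sub>E UNIV"
  then have "finite I" using fin by (auto simp: finite_atlas_def)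
  obtain m g r where 1: "real_analytic_at I g x" "0 < r" "\<And>y. y \<in> near I r x \<Longrightarrow> u (p y) = (m, abs_rmodz (g y))"
    by (rule analytic_map_A1E[OF u *]) (rule that)
  obtain m' g' r' where 2: "real_analytic_at I g' x" "0 < r'" "\<And>y. y \<in> near I r' x \<Longrightarrow> v (p y) = (m', abs_rmodz (g' y))"
    by (rule analytic_map_A1E[OF v *]) (rule that)
  obtain c where c: "Q m m' = abs_rmodz c" by (rule rmodz_exhaust)
  have n: "y \<in> near I r x" "y \<in> near I r' x" if "y \<in> near I (min r r') x" for y using that by (auto simp: near_def)
  have "({()}, \<lambda>y. (F m m', abs_rmodz (y ()))) \<in> A1" by (auto simp: A1_def)
  moreover have "real_analytic_at I (\<lambda>y. g y + g' y + c) x"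
    using 1 2 \<open>finite I\<close> * by (intro real_analytic_at_add real_analytic_at_const)
  ultimately show "\<exists>K q h r. (K, q) \<in> A1 \<and> (\<forall>j\<in>K. real_analytic_at I (h j) x) \<and> 0 < r \<and>
     (\<forall>y\<in>near I r x. (F (fst (u (p y))) (fst (v (p y))), snd (u (p y)) + snd (v (p y)) + Q (fst (u (p y))) (fst (v (p y)))) = q (\<lambda>j\<in>K. h j y))"
    using 1 2 n
    by (intro exI[of _ "{()}"] exI[of _ "\<lambda>y. (F m m', abs_rmodz (y ()))"] exI[of _ "\<lambda>_ y. g y + g' y + c"] exI[of _ "min r r'"])
      (auto simp: c abs_rmodz_add)
qed

lemma analytic_map_A1_uminus:
  assumes u: "analytic_map \<A> A1 u"
  shows "analytic_map \<A> A1 (\<lambda>X. (F (fst (u X)), - snd (u X)))"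
proof (rule analytic_mapI)
  fix I p and x :: "_ \<Rightarrow> real" assume *: "(I, p) \<in> \<A>" "x \<in> I \<rightarrow>\<^sub>E UNIV"
  then have "finite I" using fin by (auto simp: finite_atlas_def)
  obtain m g r where 1: "real_analytic_at I g x" "0 < r" "\<And>y. y \<in> near I r x \<Longrightarrow> u (p y) = (m, abs_rmodz (g y))"
    by (rule analytic_map_A1E[OF u *]) (rule that)
  have "({()}, \<lambda>y. (F m, abs_rmodz (y ()))) \<in> A1" by (auto simp: A1_def)
  moreover have "real_analytic_at I (\<lambda>y. (- 1) * g y) x"
    using 1 \<open>finite I\<close> * by (intro real_analytic_at_mult real_analytic_at_const)
  ultimately show "\<exists>K q h r. (K, q) \<in> A1 \<and> (\<forall>j\<in>K. real_analytic_at I (h j) x) \<and> 0 < r \<and>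
     (\<forall>y\<in>near I r x. (F (fst (u (p y))), - snd (u (p y))) = q (\<lambda>j\<in>K. h j y))"
    using 1
    by (intro exI[of _ "{()}"] exI[of _ "\<lambda>y. (F m, abs_rmodz (y ()))"] exI[of _ "\<lambda>_ y. (- 1) * g y"] exI[of _ r])
      (auto simp: abs_rmodz_simps)
qed

text \<open>The lattice carries the discrete topology and the domain of a chart is
  connected.\<close>

lemma chart_constant_fst_A1:
  assumes "analytic_map \<A> A1 u"
  shows "chart_constant \<A> (\<lambda>X. fst (u X))"
  unfolding chart_constant_def
proof clarify
  fix I p y y' assume *: "(I, p) \<in> \<A>" "y \<in> I \<rightarrow>\<^sub>E (UNIV :: real set)" "y' \<in> I \<rightarrow>\<^sub>E (UNIV :: real set)"
  then have "finite I" using fin by (auto simp: finite_atlas_def)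
  show "fst (u (p y)) = fst (u (p y'))"
  proof (rule locally_constant_on_chart[OF \<open>finite I\<close> _ *(2,3)])
    fix x :: "'i \<Rightarrow> real" assume x: "x \<in> I \<rightarrow>\<^sub>E UNIV"
    obtain m g r where "real_analytic_at I g x" "0 < r" "\<And>y. y \<in> near I r x \<Longrightarrow> u (p y) = (m, abs_rmodz (g y))"
      by (rule analytic_map_A1E[OF assms *(1) x]) (rule that)
    then show "\<exists>r>0. \<forall>y\<in>near I r x. fst (u (p y)) = fst (u (p x))"
      using near_self[of r x I] x by (intro exI[of _ r]) auto
  qed
qed

lemma analytic_map_A1_const: "analytic_map \<A> A1 (\<lambda>_. c)"
proof -
  obtain r where r: "snd c = abs_rmodz r" by (rule rmodz_exhaust)
  have "analytic_map \<A> A1 (\<lambda>X. (fst c, abs_rmodz r))"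
    by (rule analytic_map_A1I[OF _ real_analytic_on_atlas_const]) (auto simp: chart_constant_def)
  then show ?thesis by (simp flip: r)
qed

end

lemma real_analytic_on_atlas_prod:
  assumes "finite_atlas \<A>" "finite_atlas \<B>" "real_analytic_on_atlas \<A> h"
  shows "real_analytic_on_atlas (prod_atlas \<A> \<B>) (\<lambda>X. h (fst X))" "real_analytic_on_atlas (prod_atlas \<B> \<A>) (\<lambda>X. h (snd X))"
proof -
  show "real_analytic_on_atlas (prod_atlas \<A> \<B>) (\<lambda>X. h (fst X))"
  proof (rule real_analytic_on_atlasI[OF finite_prod_atlas[OF assms(1,2)]])
    fix I p x assume *: "(I, p) \<in> prod_atlas \<A> \<B>" "finite I" "x \<in> I \<rightarrow>\<^sub>E (UNIV :: real set)"
    then obtain I1 p1 I2 p2 where I: "I = I1 <+> I2" and p: "p = (\<lambda>y. (p1 (\<lambda>i\<in>I1. y (Inl i)), p2 (\<lambda>j\<in>I2. y (Inr j))))" and 1: "(I1, p1) \<in> \<A>"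
      by (elim prod_atlasE)
    have "real_analytic_at I (\<lambda>y. (\<lambda>y. h (p1 y)) (\<lambda>j\<in>I1. (\<lambda>j y. y (Inl j)) j y)) x"
      using *(2,3) I by (intro real_analytic_at_compose real_analytic_at_coord real_analytic_on_atlasD[OF assms(1,3) 1]) auto
    then show "real_analytic_at I (\<lambda>y. h (fst (p y))) x" by (simp add: p)
  qed
  show "real_analytic_on_atlas (prod_atlas \<B> \<A>) (\<lambda>X. h (snd X))"
  proof (rule real_analytic_on_atlasI[OF finite_prod_atlas[OF assms(2,1)]])
    fix I p x assume *: "(I, p) \<in> prod_atlas \<B> \<A>" "finite I" "x \<in> I \<rightarrow>\<^sub>E (UNIV :: real set)"
    then obtain I1 p1 I2 p2 where I: "I = I1 <+> I2" and p: "p = (\<lambda>y. (p1 (\<lambda>i\<in>I1. y (Inl i)), p2 (\<lambda>j\<in>I2. y (Inr j))))" and 1: "(I2, p2) \<in> \<A>"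
      by (elim prod_atlasE)
    have "real_analytic_at I (\<lambda>y. (\<lambda>y. h (p2 y)) (\<lambda>j\<in>I2. (\<lambda>j y. y (Inr j)) j y)) x"
      using *(2,3) I by (intro real_analytic_at_compose real_analytic_at_coord real_analytic_on_atlasD[OF assms(1,3) 1]) auto
    then show "real_analytic_at I (\<lambda>y. h (snd (p y))) x" by (simp add: p)
  qed
qed

lemma atlas_points_I: "(I, p) \<in> \<A> \<Longrightarrow> x \<in> I \<rightarrow>\<^sub>E UNIV \<Longrightarrow> p x \<in> atlas_points \<A>"
  unfolding atlas_points_def by (intro UN_I[of "(I, p)"]) auto

context lattice_basis
begin

lemma atlas_points_A0: "atlas_points A0 = (gset :: (('l, real) tensor \<times> int) set)"
proof
  show "atlas_points A0 \<subseteq> (gset :: (('l, real) tensor \<times> int) set)" by (auto simp: atlas_points_def A0_def gset_def)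
  show "(gset :: (('l, real) tensor \<times> int) set) \<subseteq> atlas_points A0"
  proof
    fix X :: "('l, real) tensor \<times> int" assume X: "X \<in> gset"
    let ?p = "\<lambda>y. (\<Sum>b\<in>B. tens b (y b), snd X)"
    have "(B, ?p) \<in> A0" using X zbasis by (auto simp: A0_def gset_iff)
    then have "?p (\<lambda>b\<in>B. tcrd B b (fst X)) \<in> atlas_points A0" by (rule atlas_points_I) auto
    moreover have "?p (\<lambda>b\<in>B. tcrd B b (fst X)) = X"
      using tensor_expand[of "fst X"] by (cases X) (simp cong: sum.cong)
    ultimately show "X \<in> atlas_points A0" by simp
  qed
qed

lemma atlas_points_prod: "atlas_points (prod_atlas \<A> \<B>) \<subseteq> atlas_points \<A> \<times> atlas_points \<B>"
proof
  fix X assume "X \<in> atlas_points (prod_atlas \<A> \<B>)"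
  then obtain I p y where "(I, p) \<in> prod_atlas \<A> \<B>" "X = p y" by (auto simp: atlas_points_def)
  then show "X \<in> atlas_points \<A> \<times> atlas_points \<B>" by (auto elim!: prod_atlasE intro!: atlas_points_I)
qed

lemma tcrd_chart: "tcrd B b (\<Sum>b'\<in>B'. tens b' (y b')) = (\<Sum>b'\<in>B'. of_int (crd B b' b) * (y b' :: real))"
  by (simp add: tcrd_simps zmul_eq_mult)

lemma real_analytic_tcrd: "real_analytic_on_atlas A0 (\<lambda>X. tcrd B b (fst X))"
proof (rule real_analytic_on_atlasI[OF finite_A0])
  fix I :: "'l set" and p x assume *: "(I, p) \<in> A0" "finite I" "x \<in> I \<rightarrow>\<^sub>E (UNIV :: real set)"
  then obtain \<epsilon> where p: "p = (\<lambda>y. (\<Sum>b\<in>I. tens b (y b), \<epsilon>))" by (auto simp: A0_def)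
  show "real_analytic_at I (\<lambda>y. tcrd B b (fst (p y))) x" unfolding p fst_conv tcrd_chart
    using *(2,3) by (intro real_analytic_at_sum real_analytic_at_mult real_analytic_at_const real_analytic_at_coord)
qed

text \<open>The atlas contains the charts of all bases, but one basis is enough to present a map:
  its chart, together with the locally constant sign, covers a component.\<close>

lemma analytic_map_A0I:
  assumes "chart_constant \<A> (\<lambda>X. snd (u X))" "\<And>b. b \<in> B \<Longrightarrow> real_analytic_on_atlas \<A> (\<lambda>X. tcrd B b (fst (u X)))"
    "\<And>X. X \<in> atlas_points \<A> \<Longrightarrow> u X \<in> gset" "finite_atlas \<A>"
  shows "analytic_map \<A> A0 u"
proof (rule analytic_mapI)
  fix I p and x :: "_ \<Rightarrow> real" assume *: "(I, p) \<in> \<A>" "x \<in> I \<rightarrow>\<^sub>E UNIV"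
  have "p x \<in> atlas_points \<A>" using * by (rule atlas_points_I)
  then have "u (p x) \<in> gset" by (rule assms(3))
  then have "(B, \<lambda>y. (\<Sum>b\<in>B. tens b (y b), snd (u (p x)))) \<in> A0" using zbasis by (auto simp: A0_def gset_iff)
  moreover have "u (p y) = (\<Sum>b\<in>B. tens b ((\<lambda>b\<in>B. tcrd B b (fst (u (p y)))) b), snd (u (p x)))" if "y \<in> near I 1 x" for y
  proof -
    have "snd (u (p y)) = snd (u (p x))"
      using that *(2) by (intro chart_constantD[OF assms(1) *(1)]) (auto simp: near_def)
    then show ?thesis using tensor_expand[of "fst (u (p y))"] by (cases "u (p y)") (simp cong: sum.cong)
  qed
  ultimately show "\<exists>K q g r. (K, q) \<in> A0 \<and> (\<forall>j\<in>K. real_analytic_at I (g j) x) \<and> 0 < r \<and>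
     (\<forall>y\<in>near I r x. u (p y) = q (\<lambda>j\<in>K. g j y))"
    using real_analytic_on_atlasD[OF assms(4) assms(2) *]
    by (intro exI[of _ B] exI[of _ "\<lambda>y. (\<Sum>b\<in>B. tens b (y b), snd (u (p x)))"] exI[of _ "\<lambda>b y. tcrd B b (fst (u (p y)))"] exI[of _ 1]) auto
qed

text \<open>The converse of \<open>analytic_map_A0I\<close>. The given chart may belong to another
  basis, and the change of basis is linear with integral coefficients.\<close>

lemma analytic_map_A0D:
  fixes u :: "'m \<Rightarrow> ('l, real) tensor \<times> int"
  assumes "analytic_map \<A> A0 u" "finite_atlas \<A>"
  shows "chart_constant \<A> (\<lambda>X. snd (u X))" "real_analytic_on_atlas \<A> (\<lambda>X. tcrd B b (fst (u X)))"
proof -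
  have *: "\<exists>r>0. (\<forall>y\<in>near I r x. snd (u (p y)) = snd (u (p x))) \<and> real_analytic_at I (\<lambda>y. tcrd B b (fst (u (p y)))) x"
    if "(I, p) \<in> \<A>" "x \<in> I \<rightarrow>\<^sub>E UNIV" "finite I" for I p and x :: "_ \<Rightarrow> real"
  proof (rule analytic_mapE[OF assms(1) that(1,2)])
    fix K :: "'l set" and q g r assume q: "(K, q) \<in> A0" "\<And>j. j \<in> K \<Longrightarrow> real_analytic_at I (g j) x" "0 < r"
      "\<And>y. y \<in> near I r x \<Longrightarrow> u (p y) = q (\<lambda>j\<in>K. g j y)"
    from q(1) obtain \<epsilon> where \<epsilon>: "q = (\<lambda>y. (\<Sum>b\<in>K. tens b (y b), \<epsilon>))" and "finite K" by (auto simp: A0_def zbasis_def)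
    have "real_analytic_at I (\<lambda>y. \<Sum>b'\<in>K. of_int (crd B b' b) * g b' y) x"
      using that(2,3) \<open>finite K\<close> q(2) by (intro real_analytic_at_sum real_analytic_at_mult real_analytic_at_const)
    then have "real_analytic_at I (\<lambda>y. tcrd B b (fst (u (p y)))) x"
      by (rule real_analytic_at_cong_near[OF _ q(3)]) (simp add: q(4) \<epsilon> tcrd_chart cong: sum.cong)
    moreover have "snd (u (p y)) = snd (u (p x))" if "y \<in> near I r x" for y
      using q(4)[OF that] q(4)[OF near_self[OF q(3)]] \<open>x \<in> I \<rightarrow>\<^sub>E UNIV\<close> by (simp add: \<epsilon>)
    ultimately show ?thesis using q(3) by blast
  qed
  show "chart_constant \<A> (\<lambda>X. snd (u X))" unfolding chart_constant_def
  proof clarify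
    fix I p y y' assume I: "(I, p) \<in> \<A>" "y \<in> I \<rightarrow>\<^sub>E (UNIV :: real set)" "y' \<in> I \<rightarrow>\<^sub>E (UNIV :: real set)"
    then have "finite I" using assms(2) by (auto simp: finite_atlas_def)
    then show "snd (u (p y)) = snd (u (p y'))"
      using *[OF I(1)] I(2,3) by (intro locally_constant_on_chart[of I "\<lambda>y. snd (u (p y))"]) blast+
  qed
  show "real_analytic_on_atlas \<A> (\<lambda>X. tcrd B b (fst (u X)))"
    by (rule real_analytic_on_atlasI[OF assms(2)]) (use * in blast)
qed

lemma tcrd_tmap: "Modules.additive f \<Longrightarrow> tcrd B b (tmap f x) = (\<Sum>b'\<in>B. tcrd B b' x * of_int (crd B (f b') b) :: real)"
  by (subst tensor_expand[of x])
    (simp add: additive.sum[OF additive_tmap] tcrd_simps zmul_eq_mult mult.commute)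

lemma bform_tcrd: "biadditive J \<Longrightarrow> bform J x y = (\<Sum>b\<in>B. \<Sum>b'\<in>B. of_int (J b b') * tcrd B b x * tcrd B b' y)"
  by (subst tensor_expand[of x], subst tensor_expand[of y])
    (simp add: additive.sum[OF biadditive_left[OF biadditive_bform]] additive.sum[OF biadditive_right[OF biadditive_bform]], rule sum.swap)

lemma real_analytic_bform:
  assumes "biadditive J" "finite_atlas \<A>" "\<And>b. b \<in> B \<Longrightarrow> real_analytic_on_atlas \<A> (\<lambda>X. tcrd B b (u X))"
    "\<And>b. b \<in> B \<Longrightarrow> real_analytic_on_atlas \<A> (\<lambda>X. tcrd B b (v X))"
  shows "real_analytic_on_atlas \<A> (\<lambda>X. bform J (u X) (v X))"
  unfolding bform_tcrd[OF assms(1)]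
  using assms finite_basis
  by (intro real_analytic_on_atlas_sum real_analytic_on_atlas_mult real_analytic_on_atlas_const)

lemma analytic_aut:
  assumes "Modules.additive f"
  shows "analytic_map A0 A0 (aut f (c :: ('l, real) tensor))"
proof (rule analytic_map_A0I)
  show "chart_constant A0 (\<lambda>X :: ('l, real) tensor \<times> int. snd (aut f c X))" using chart_constant_snd by (simp add: aut_def)
  show "real_analytic_on_atlas A0 (\<lambda>X. tcrd B b (fst (aut f c X)))" for b
    unfolding aut_def fst_conv tcrd_simps tcrd_tmap[OF assms]
    using finite_basis
    by (intro real_analytic_on_atlas_add real_analytic_on_atlas_sum real_analytic_on_atlas_mult real_analytic_tcrd finite_A0
       real_analytic_on_atlas_const real_analytic_on_atlas_chart_constant chart_constant_comp[OF chart_constant_snd, of "\<lambda>\<epsilon>. tcrd B b (cs c \<epsilon>)"])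
qed (auto simp: finite_A0 atlas_points_A0)

lemma analytic_gm: "analytic_map (prod_atlas A0 A0) A0 (\<lambda>p. gm (fst p) (snd p) :: ('l, real) tensor \<times> int)"
proof (rule analytic_map_A0I)
  show "chart_constant (prod_atlas A0 A0) (\<lambda>X :: (('l, real) tensor \<times> int) \<times> _. snd (gm (fst X) (snd X)))"
    unfolding gm_def snd_conv
    by (intro chart_constant_comp2[of _ _ _ "(*)"] chart_constant_prod[of _ snd] chart_constant_snd)
  show "real_analytic_on_atlas (prod_atlas A0 A0) (\<lambda>X. tcrd B b (fst (gm (fst X) (snd X))))" for b
    unfolding gm_def fst_conv tcrd_simps additive_zmul_hom[OF additive_tcrd] zmul_eq_mult
    by (intro real_analytic_on_atlas_add real_analytic_on_atlas_mult finite_A00 real_analytic_on_atlas_prod[OF finite_A0 finite_A0]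
       real_analytic_tcrd real_analytic_on_atlas_chart_constant chart_constant_comp[of _ _ real_of_int]
       chart_constant_prod[of _ snd] chart_constant_snd)
qed (use atlas_points_prod[of A0 A0] atlas_points_A0 in \<open>auto simp: finite_A00\<close>)

end

section \<open>Weak automorphisms\<close>

definition jr :: "('l::ab_group_add \<Rightarrow> 'l \<Rightarrow> int) \<Rightarrow> 'l \<Rightarrow> ('l, real) tensor \<Rightarrow> rmodz" where
  "jr J m x = abs_rmodz (form_ext J m x)"

text \<open>A cochain with values in \<open>\<real>/\<int>\<close> is regarded as a map into the
  degree-1 group with lattice component 0, so that the atlas \<open>A1\<close> decides on its
  analyticity.\<close>

definition analytic_cochain1 :: "(('l::ab_group_add, real) tensor \<times> int \<Rightarrow> rmodz) \<Rightarrow> bool" where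
  "analytic_cochain1 e \<longleftrightarrow> analytic_map A0 A1 (\<lambda>X. (0 :: 'l, e X))"

definition analytic_cochain2 :: "(('l::ab_group_add, real) tensor \<times> int \<Rightarrow> ('l, real) tensor \<times> int \<Rightarrow> rmodz) \<Rightarrow> bool" where
  "analytic_cochain2 k \<longleftrightarrow> analytic_map (prod_atlas A0 A0) A1 (\<lambda>p. (0 :: 'l, k (fst p) (snd p)))"

text \<open>
  By continuity a centre-preserving weak automorphism has \<open>\<kappa> = (0, k)\<close>, its \<open>f\<^sub>0\<close> is \<open>f\<close> followed by
  the translation of the reflections \<open>(x, -1)\<close> by \<open>c\<close>, and \<open>f\<^sub>1(m, a) = (f m, a + q m)\<close>. The
  conditions below are what remains of the axioms.
\<close>

definition weak_aut_data ::
  "('l::ab_group_add \<Rightarrow> 'l \<Rightarrow> int) \<Rightarrow> ('l \<Rightarrow> 'l) \<Rightarrow> ('l, real) tensor \<Rightarrow>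
   (('l, real) tensor \<times> int \<Rightarrow> ('l, real) tensor \<times> int \<Rightarrow> rmodz) \<Rightarrow> ('l \<Rightarrow> rmodz) \<Rightarrow> bool" where
  "weak_aut_data J f c k q \<longleftrightarrow> Modules.additive f \<and> bij f \<and> q 0 = 0 \<and>
     (\<forall>m n. q m + q n + k (emb m) (emb n) = q (m + n)) \<and>
     (\<forall>X\<in>gset. \<forall>Y\<in>gset. \<forall>Z\<in>gset. k X Y + k (gm X Y) Z = k Y Z + k X (gm Y Z)) \<and>
     (\<forall>m. \<forall>X\<in>gset. q m + jr J (f m) (fst (aut f c X)) + k (emb m) X =
        jr J m (fst X) + q (zmul (snd X) m) + k X (emb (zmul (snd X) m))) \<and>
     analytic_cochain2 k"

definition weak_aut ::
  "('l::ab_group_add \<Rightarrow> 'l) \<Rightarrow> ('l, real) tensor \<Rightarrow>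
   (('l, real) tensor \<times> int \<Rightarrow> ('l, real) tensor \<times> int \<Rightarrow> rmodz) \<Rightarrow> ('l \<Rightarrow> rmodz) \<Rightarrow>
   (('l, real) tensor \<times> int \<Rightarrow> ('l, real) tensor \<times> int) \<times> ('l \<times> rmodz \<Rightarrow> 'l \<times> rmodz) \<times>
   ((('l, real) tensor \<times> int) \<times> ('l, real) tensor \<times> int \<Rightarrow> 'l \<times> rmodz)" where
  "weak_aut f c k q = (\<lambda>X\<in>gset. aut f c X, \<lambda>\<alpha>. (f (fst \<alpha>), snd \<alpha> + q (fst \<alpha>)),
     \<lambda>p\<in>gset \<times> gset. (0, k (fst p) (snd p)))"

text \<open>The lattice component of an analytic pointed map is constant on both components and
  vanishes at the unit, so a single lattice element \<open>n\<close>, its value on the reflections,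
  describes it.\<close>

definition pointed_map :: "'l::ab_group_add \<Rightarrow> (('l, real) tensor \<times> int \<Rightarrow> rmodz) \<Rightarrow> ('l, real) tensor \<times> int \<Rightarrow> 'l \<times> rmodz" where
  "pointed_map n e = (\<lambda>X\<in>gset. (cs n (snd X), e X))"

lemma weak_aut_eqI:
  assumes "\<And>m. f m = f' m" "c = c'" "\<And>m. q m = q' m" "\<And>X Y. X \<in> gset \<Longrightarrow> Y \<in> gset \<Longrightarrow> k X Y = k' X Y"
  shows "weak_aut f c k q = weak_aut f' c' k' q'"
proof -
  have "f = f'" "q = q'" using assms by auto
  then show ?thesis using assms(2,4) by (simp add: weak_aut_def) (auto intro!: restrict_ext)
qed

lemma pointed_map_eqI:
  "n = n' \<Longrightarrow> (\<And>X. X \<in> gset \<Longrightarrow> e X = e' X) \<Longrightarrow> pointed_map n e = pointed_map n' e'"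
  by (auto simp: pointed_map_def restrict_def fun_eq_iff)

lemma wAct_plus_simps:
  "deg1 (wAct_plus \<Psi>) = units_of (pointed_maps \<Psi>)"
  "mult (deg0 (wAct_plus \<Psi>)) = weak_comp \<Psi>"
  "one (deg0 (wAct_plus \<Psi>)) = one (weak_aut_group \<Psi>)"
  "carrier (deg0 (wAct_plus \<Psi>)) = {(f0, f1, \<kappa>) \<in> carrier (weak_aut_group \<Psi>).
           \<forall>\<alpha>\<in>kernel (deg1 \<Psi>) (deg0 \<Psi>) (bdry \<Psi>). f1 \<alpha> = \<alpha>}"
  "bdry (wAct_plus \<Psi>) = bdry (wAct \<Psi>)" "act (wAct_plus \<Psi>) = act (wAct \<Psi>)"
  by (simp_all add: wAct_plus_def wAct_def weak_aut_group_def)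

context
  fixes J :: "'l::ab_group_add \<Rightarrow> 'l \<Rightarrow> int"
  assumes J: "biadditive J"
begin

lemma jr_add: "jr J (m + n) x = jr J m x + jr J n x" "jr J m (x + y) = jr J m x + jr J m y"
  by (simp_all add: jr_def form_ext_add[OF J] additive.add[OF additive_form_ext[OF J]] abs_rmodz_add)

lemma biadditive_jr: "biadditive (jr J)"
  by (rule biadditiveI) (simp_all add: jr_add)

lemmas jr_simps = biadditive_simps[OF biadditive_jr]

lemma jr_tens [simp]: "jr J m (tens n 1) = 0"
  by (simp add: jr_def form_ext_tens[OF J])

end

section \<open>Operations on analytic cochains\<close>

lemma analytic_cochain2_add: "analytic_cochain2 k \<Longrightarrow> analytic_cochain2 k' \<Longrightarrow> analytic_cochain2 (\<lambda>X Y. k X Y + k' X Y)"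
  unfolding analytic_cochain2_def
  by (drule (1) analytic_map_A1_map2[OF finite_A00, where F = "\<lambda>_ _. 0" and Q = "\<lambda>_ _. 0"]) simp

lemma analytic_cochain1_add: "analytic_cochain1 k \<Longrightarrow> analytic_cochain1 k' \<Longrightarrow> analytic_cochain1 (\<lambda>X. k X + k' X)"
  unfolding analytic_cochain1_def
  by (drule (1) analytic_map_A1_map2[OF finite_A0, where F = "\<lambda>_ _. 0" and Q = "\<lambda>_ _. 0"]) simp

lemma analytic_cochain2_uminus: "analytic_cochain2 k \<Longrightarrow> analytic_cochain2 (\<lambda>X Y. - k X Y)"
  unfolding analytic_cochain2_def
  by (drule analytic_map_A1_uminus[OF finite_A00, where F = "\<lambda>_. 0"]) simp

lemma analytic_cochain1_uminus: "analytic_cochain1 k \<Longrightarrow> analytic_cochain1 (\<lambda>X. - k X)"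
  unfolding analytic_cochain1_def
  by (drule analytic_map_A1_uminus[OF finite_A0, where F = "\<lambda>_. 0"]) simp

lemma analytic_cochain2_diff: "analytic_cochain2 k \<Longrightarrow> analytic_cochain2 k' \<Longrightarrow> analytic_cochain2 (\<lambda>X Y. k X Y - k' X Y)"
  using analytic_cochain2_add[OF _ analytic_cochain2_uminus] by fastforce

lemma analytic_cochain1_diff: "analytic_cochain1 k \<Longrightarrow> analytic_cochain1 k' \<Longrightarrow> analytic_cochain1 (\<lambda>X. k X - k' X)"
  using analytic_cochain1_add[OF _ analytic_cochain1_uminus] by fastforce

lemma analytic_cochain2_comp:
  fixes u v :: "('l::ab_group_add, real) tensor \<times> int \<Rightarrow> ('l, real) tensor \<times> int"
  assumes "analytic_cochain2 k" "analytic_map A0 A0 u" "analytic_map A0 A0 v"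
  shows "analytic_cochain2 (\<lambda>X Y. k (u X) (v Y))"
proof -
  have "analytic_map (prod_atlas A0 A0) (prod_atlas A0 A0) (\<lambda>p. (u (fst p), v (snd p)))"
    by (intro analytic_map_pair analytic_map_compose[OF finite_A00 finite_A0 analytic_map_fst assms(2)]
       analytic_map_compose[OF finite_A00 finite_A0 analytic_map_snd assms(3)] finite_A0)
  from analytic_map_compose[OF finite_A00 finite_A00 this assms(1)[unfolded analytic_cochain2_def]]
  show ?thesis by (simp add: analytic_cochain2_def)
qed

lemma analytic_cochain1_comp2:
  fixes u v :: "('l::ab_group_add, real) tensor \<times> int \<Rightarrow> ('l, real) tensor \<times> int"
  assumes "analytic_cochain2 k" "analytic_map A0 A0 u" "analytic_map A0 A0 v"
  shows "analytic_cochain1 (\<lambda>X. k (u X) (v X))"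
  using analytic_map_compose[OF finite_A0 finite_A00 analytic_map_pair[OF assms(2,3)] assms(1)[unfolded analytic_cochain2_def]]
  by (simp add: analytic_cochain1_def)

lemma analytic_cochain1_comp:
  fixes u :: "('l::ab_group_add, real) tensor \<times> int \<Rightarrow> ('l, real) tensor \<times> int"
  shows "analytic_cochain1 e \<Longrightarrow> analytic_map A0 A0 u \<Longrightarrow> analytic_cochain1 (\<lambda>X. e (u X))"
  unfolding analytic_cochain1_def by (rule analytic_map_compose[OF finite_A0 finite_A0])

lemma analytic_cochain2_fst: "analytic_cochain1 e \<Longrightarrow> analytic_cochain2 (\<lambda>X Y. e X)"
  unfolding analytic_cochain1_def analytic_cochain2_def
  by (rule analytic_map_compose[OF finite_A00 finite_A0 analytic_map_fst[OF finite_A0 finite_A0]])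

lemma analytic_cochain2_snd: "analytic_cochain1 e \<Longrightarrow> analytic_cochain2 (\<lambda>X Y. e Y)"
  unfolding analytic_cochain1_def analytic_cochain2_def
  by (rule analytic_map_compose[OF finite_A00 finite_A0 analytic_map_snd[OF finite_A0 finite_A0]])

lemma analytic_cochain2_real:
  "real_analytic_on_atlas (prod_atlas A0 A0) (\<lambda>p. h (fst p) (snd p)) \<Longrightarrow> analytic_cochain2 (\<lambda>X Y. abs_rmodz (h X Y))"
  unfolding analytic_cochain2_def
  by (rule analytic_map_A1I[OF finite_A00]) (simp_all add: chart_constant_def)

lemma analytic_cochain1_real:
  "real_analytic_on_atlas A0 h \<Longrightarrow> analytic_cochain1 (\<lambda>X. abs_rmodz (h X))"
  unfolding analytic_cochain1_def
  by (rule analytic_map_A1I[OF finite_A0]) (simp_all add: chart_constant_def)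

lemma analytic_cochain1_snd: "analytic_cochain1 (\<lambda>X. u (snd X))"
proof -
  have "\<exists>r. u \<epsilon> = abs_rmodz r" for \<epsilon> by (metis rmodz_exhaust)
  then obtain r where "u = (\<lambda>\<epsilon>. abs_rmodz (r \<epsilon>))" by metis
  then show ?thesis
    using analytic_cochain1_real[OF real_analytic_on_atlas_chart_constant[OF finite_A0 chart_constant_comp[OF chart_constant_snd, of r]]]
    by simp
qed

context lattice_basis
begin

lemma analytic_snd: "(\<And>\<epsilon>. u \<epsilon> \<in> gset) \<Longrightarrow> analytic_map A0 A0 (\<lambda>X. u (snd X) :: ('l, real) tensor \<times> int)"
  by (rule analytic_map_A0I)
    (auto intro!: chart_constant_comp[OF chart_constant_snd] real_analytic_on_atlas_chart_constant[OF finite_A0]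
      chart_constant_comp[OF chart_constant_snd, of "\<lambda>\<epsilon>. tcrd B _ (fst (u \<epsilon>))"] chart_constant_comp[OF chart_constant_snd, of "\<lambda>\<epsilon>. snd (u \<epsilon>)"]
      simp: finite_A0)

lemma analytic_cochain2_gm:
  fixes e :: "('l, real) tensor \<times> int \<Rightarrow> rmodz"
  shows "analytic_cochain1 e \<Longrightarrow> analytic_cochain2 (\<lambda>X Y. e (gm X Y))"
  unfolding analytic_cochain1_def analytic_cochain2_def
  by (rule analytic_map_compose[OF finite_A00 finite_A0 analytic_gm])

lemma real_analytic_bform_snd:
  fixes u :: "int \<Rightarrow> ('l, real) tensor"
  assumes "biadditive J"
  shows "real_analytic_on_atlas (prod_atlas A0 A0) (\<lambda>p. bform J (u (snd (fst p))) (fst (snd p)))"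
  by (rule real_analytic_bform[OF assms finite_A00])
    (auto intro!: real_analytic_on_atlas_chart_constant[OF finite_A00]
      chart_constant_prod(1)[OF chart_constant_comp[OF chart_constant_snd, of "\<lambda>\<epsilon>. tcrd B _ (u \<epsilon>)"]]
      real_analytic_on_atlas_prod(2)[OF finite_A0 finite_A0 real_analytic_tcrd])

lemma analytic_cochain2_jr:
  assumes "biadditive J"
  shows "analytic_cochain2 (\<lambda>X Y. jr J (cs (n :: 'l) (snd X)) (fst Y))"
  unfolding jr_def form_ext_eq_bform[OF assms]
  by (intro analytic_cochain2_real real_analytic_bform_snd[OF assms])

lemma emb_eq_one: "emb m = (0, 1) \<longleftrightarrow> m = (0 :: 'l)"
  using tens_inject[of 1 m 0] by (simp add: emb_def tens_simps)

lemma emb_inject: "emb m = emb n \<longleftrightarrow> m = (n :: 'l)"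
  using tens_inject[of 1 m n] by (simp add: emb_def)

lemma kernel_Theta: "kernel (deg1 (Theta' J)) (deg0 (Theta' J)) (bdry (Theta' J)) = {\<alpha>. fst \<alpha> = (0 :: 'l)}"
  by (auto simp: kernel_def Theta_simps emb_eq_one)

end

lemma aut_inverse:
  assumes "Modules.additive f" "bij f"
  shows "aut f c (aut (inv_into UNIV f) (- tmap (inv_into UNIV f) c) X) = X"
    "aut (inv_into UNIV f) (- tmap (inv_into UNIV f) c) (aut f c X) = X"
  by (auto simp: aut_def cs_def prod_eq_iff additive.diff[OF additive_tmap[OF assms(1)]]
      additive.add[OF additive_tmap[OF additive_inv[OF assms]]] additive.zero[OF additive_tmap[OF additive_inv[OF assms]]]
      tmap_inv[OF assms])

lemma bij_betw_aut: "Modules.additive f \<Longrightarrow> bij f \<Longrightarrow> bij_betw (aut f c) gset gset"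
  by (rule bij_betw_byWitness[where f' = "aut (inv_into UNIV f) (- tmap (inv_into UNIV f) c)"])
    (auto simp: aut_inverse)

lemma inv_into_aut: "Modules.additive f \<Longrightarrow> bij f \<Longrightarrow> X \<in> gset \<Longrightarrow>
    inv_into gset (\<lambda>X\<in>gset. aut f c X) X = aut (inv_into UNIV f) (- tmap (inv_into UNIV f) c) X"
  by (rule inv_into_f_eq) (auto simp: aut_inverse bij_betw_aut[THEN bij_betw_imp_inj_on] inj_on_def dest: bij_betw_aut[THEN bij_betw_imp_inj_on, THEN inj_onD])

lemma p1_inverse:
  assumes "bij f"
  shows "bij (\<lambda>\<alpha>. (f (fst \<alpha>), snd \<alpha> + q (fst \<alpha>) :: rmodz))"
    "inv_into UNIV (\<lambda>\<alpha>. (f (fst \<alpha>), snd \<alpha> + q (fst \<alpha>) :: rmodz)) =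
      (\<lambda>\<alpha>. (inv_into UNIV f (fst \<alpha>), snd \<alpha> - q (inv_into UNIV f (fst \<alpha>))))"
proof -
  let ?g = "\<lambda>\<alpha>. (inv_into UNIV f (fst \<alpha>), snd \<alpha> - q (inv_into UNIV f (fst \<alpha>)))"
  let ?f = "\<lambda>\<alpha>. (f (fst \<alpha>), snd \<alpha> + q (fst \<alpha>))"
  have 1: "?g (?f \<alpha>) = \<alpha>" for \<alpha> using assms by (simp add: bij_is_inj)
  have 2: "?f (?g \<alpha>) = \<alpha>" for \<alpha> using assms by (simp add: bij_is_surj surj_f_inv_f)
  show "bij ?f" by (rule bij_betw_byWitness[of _ ?g]) (use 1 2 in auto)
  show "inv_into UNIV ?f = ?g" by (rule inv_equality) (use 1 2 in auto)
qed

lemma analytic_p1: "analytic_map A1 A1 (\<lambda>\<alpha>. (f (fst \<alpha>), snd \<alpha> + q (fst \<alpha>)))"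
  using analytic_map_A1_map2[OF finite_A1 analytic_map_id[OF finite_A1] analytic_map_A1_const[OF finite_A1, of "(0, 0)"],
    of "\<lambda>m _. f m" "\<lambda>m _. q m"] by simp

locale theta = lattice_basis B for B :: "'l::ab_group_add set" +
  fixes J :: "'l \<Rightarrow> 'l \<Rightarrow> int"
  assumes J: "biadditive J"
begin

lemmas jr_J_simps [simp] = jr_simps[OF J] jr_tens[OF J]

context
  fixes f c k q
  assumes data: "weak_aut_data J f c k q"
begin

lemma wd_additive: "Modules.additive f" and wd_bij: "bij f" and wd_q0: "q 0 = 0"
  and wd_q: "q (m + n) = q m + q n + k (emb m) (emb n)"
  and wd_cocycle: "X \<in> gset \<Longrightarrow> Y \<in> gset \<Longrightarrow> Z \<in> gset \<Longrightarrow> k X Y + k (gm X Y) Z = k Y Z + k X (gm Y Z)"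
  and wd_compat: "X \<in> gset \<Longrightarrow> q m + jr J (f m) (fst (aut f c X)) + k (emb m) X =
        jr J m (fst X) + q (zmul (snd X) m) + k X (emb (zmul (snd X) m))"
  and wd_analytic: "analytic_cochain2 k"
  using data by (auto simp: weak_aut_data_def)

lemma emb_0: "emb 0 = (0, 1)"
  by (simp add: emb_def tens_simps)

text \<open>The cochain is normalized: the equation for \<open>q\<close> at 0 gives the value at the
  pair of units, and the cocycle identity spreads it to all pairs with one unit.\<close>

lemma wd_k_one: "X \<in> gset \<Longrightarrow> k X (0, 1) = 0" "X \<in> gset \<Longrightarrow> k (0, 1) X = 0"
proof -
  have k11: "k (0, 1) (0, 1) = 0" using wd_q[of 0 0] wd_q0 by (simp add: emb_0)
  show "X \<in> gset \<Longrightarrow> k X (0, 1) = 0" using wd_cocycle[of X "(0, 1)" "(0, 1)"] k11 by simp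
  show "X \<in> gset \<Longrightarrow> k (0, 1) X = 0" using wd_cocycle[of "(0, 1)" "(0, 1)" X] k11 by simp
qed

lemma weak_aut_closed: "weak_aut f c k q \<in> carrier (deg0 (wAct_plus (Theta' J)))"
proof -
  have "weak_aut f c k q \<in> weak_end (Theta' J)"
  proof -
    have "aut f c (0, 1) = (0, 1)" by (simp add: aut_def additive.zero[OF additive_tmap[OF wd_additive]])
    moreover have "f 0 = 0" "\<And>m n. f (m + n) = f m + f n" "\<And>k m. f (zmul k m) = zmul k (f m)"
      by (simp_all add: additive.zero[OF wd_additive] additive.add[OF wd_additive] additive_zmul_hom[OF wd_additive])
    moreover have "gm (aut f c X) (aut f c Y) = aut f c (gm X Y)" if "X \<in> gset" "Y \<in> gset" for X Y
      using that by (simp add: aut_gm[OF wd_additive])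
    moreover have "k X Y + k (gm X Y) Z = k Y Z + k X (gm Y Z)" if "X \<in> gset" "Y \<in> gset" "Z \<in> gset" for X Y Z
      by (rule wd_cocycle[OF that])
    moreover have "snd (aut f c X) = snd X" for X by (simp add: aut_def)
    moreover have "a + q m + jr J (f m) (fst (aut f c X)) + k (emb m) X =
         a + jr J m (fst X) + q (zmul (snd X) m) + k X (emb (zmul (snd X) m))" if "X \<in> gset" for a m X
      using wd_compat[OF that, of m] by (simp add: add.assoc)
    moreover have "a + q m + (b + q n) + k (emb m) (emb n) = a + b + q (m + n)" for a b m n
      by (simp add: wd_q algebra_simps)
    moreover have "(\<lambda>X\<in>gset. aut f c X) \<in> gset \<rightarrow>\<^sub>E gset" by auto
    moreover have "abs_rmodz (form_ext J m x) = jr J m x" for m x by (simp add: jr_def)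
    ultimately show ?thesis
      unfolding weak_end_def weak_aut_def
      by (simp add: Theta_simps kappa3_def emb_0 wd_q0 aut_emb[OF wd_additive] additive.zero[OF additive_zmul(1)])
  qed
  moreover have "bij_betw (\<lambda>X\<in>gset. aut f c X) gset gset"
    using bij_betw_aut[OF wd_additive wd_bij] by (simp cong: bij_betw_cong)
  moreover have "analytic_map A0 A0 (\<lambda>X\<in>gset. aut f c X)"
    by (rule analytic_map_cong[OF analytic_aut[OF wd_additive]]) (auto simp: atlas_points_A0)
  moreover have "analytic_map A0 A0 (inv_into gset (\<lambda>X\<in>gset. aut f c X))"
    by (rule analytic_map_cong[OF analytic_aut[OF additive_inv[OF wd_additive wd_bij]]])
      (auto simp: atlas_points_A0 inv_into_aut[OF wd_additive wd_bij])
  moreover have "bij (\<lambda>\<alpha>. (f (fst \<alpha>), snd \<alpha> + q (fst \<alpha>)))" "analytic_map A1 A1 (inv_into UNIV (\<lambda>\<alpha>. (f (fst \<alpha>), snd \<alpha> + q (fst \<alpha>))))"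
    using p1_inverse[OF wd_bij, of q] analytic_p1[of "inv_into UNIV f" "\<lambda>m. - q (inv_into UNIV f m)"] by simp_all
  moreover have "analytic_map (prod_atlas A0 A0) A1 (\<lambda>p\<in>gset \<times> gset. (0 :: 'l, k (fst p) (snd p)))"
    by (rule analytic_map_cong[OF wd_analytic[unfolded analytic_cochain2_def]])
      (use atlas_points_prod[of A0 A0] atlas_points_A0 in auto)
  ultimately show ?thesis
    unfolding wAct_plus_simps weak_aut_group_def kernel_Theta
    by (simp add: weak_aut_def atlas_Theta Theta_simps(1,2) analytic_p1 additive.zero[OF wd_additive] wd_q0)
qed

end

text \<open>The additive function \<open>h\<close> vanishes on the rationals, so
  \<open>h t = h (t - r)\<close> for every rational \<open>r\<close>; for \<open>r\<close> close to
  \<open>t\<close> this is small by continuity at 0.\<close>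

lemma additive_real_linear:
  fixes g :: "real \<Rightarrow> real"
  assumes "Modules.additive g" and cont: "\<And>e. e > 0 \<Longrightarrow> \<exists>d>0. \<forall>t. \<bar>t\<bar> < d \<longrightarrow> \<bar>g t\<bar> < e"
  shows "g t = t * g 1"
proof -
  define h where "h t = g t - t * g 1" for t
  have h: "Modules.additive h" using assms(1) by (simp add: Modules.additive_def h_def algebra_simps)
  have hz: "h (of_int k * t) = of_int k * h t" for k t
    using additive_zmul_hom[OF h, of k t] by (simp add: zmul_eq_mult)
  have "h 1 = 0" by (simp add: h_def)
  have hq: "h r = 0" if rat: "r \<in> \<rat>" for r
  proof -
    obtain a b where r: "r = of_int a / of_int b" "b \<noteq> 0" using Rats_cases'[OF rat] by (metis less_irrefl) 
    have "of_int b * h r = h (of_int a * 1)" using hz[of b r] r by simp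
    also have "\<dots> = 0" unfolding hz by (simp add: \<open>h 1 = 0\<close>)
    finally show ?thesis using r by simp
  qed
  have "\<bar>h t\<bar> \<le> e" if e: "e > 0" for e
  proof -
    obtain d where d: "d > 0" "\<forall>t. \<bar>t\<bar> < d \<longrightarrow> \<bar>g t\<bar> < e / 2" using cont[of "e / 2"] e by auto
    \<comment> \<open>The second bound makes \<open>\<bar>t - r\<bar> * \<bar>g 1\<bar>\<close> at
      most \<open>e / 2\<close>; adding 1 avoids a zero denominator.\<close>
    define d' where "d' = min d (e / (2 * (\<bar>g 1\<bar> + 1)))"
    have "d' > 0" using d e by (simp add: d'_def)
    then obtain r where r: "r \<in> \<rat>" "t - d' < r" "r < t" using Rats_dense_in_real[of "t - d'" t] by auto
    have s: "\<bar>t - r\<bar> < d'" using r by simp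
    have "h t = h (t - r)" using additive.diff[OF h] hq[OF r(1)] by simp
    also have "\<bar>\<dots>\<bar> \<le> \<bar>g (t - r)\<bar> + \<bar>t - r\<bar> * \<bar>g 1\<bar>" unfolding h_def by (metis abs_mult abs_triangle_ineq4)
    also have "\<bar>g (t - r)\<bar> \<le> e / 2" using d s by (auto simp: d'_def intro: less_imp_le)
    also have "\<bar>t - r\<bar> * \<bar>g 1\<bar> \<le> e / (2 * (\<bar>g 1\<bar> + 1)) * (\<bar>g 1\<bar> + 1)"
      using s e by (intro mult_mono) (auto simp: d'_def)
    also have "e / (2 * (\<bar>g 1\<bar> + 1)) * (\<bar>g 1\<bar> + 1) = e / 2" by (simp add: field_simps)
    finally show ?thesis by simp
  qed
  then have "h t = 0" by (metis abs_le_zero_iff dense_ge)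
  then show ?thesis by (simp add: h_def)
qed

text \<open>Each component is the image of a single chart, so a function that is constant on charts
  depends only on the sign.\<close>

lemma chart_constant_A0D:
  fixes x y :: "('l, real) tensor"
  assumes "chart_constant A0 m" "\<epsilon> = 1 \<or> \<epsilon> = - 1"
  shows "m (x, \<epsilon>) = m (y, \<epsilon>)"
proof -
  have "(B, \<lambda>y. (\<Sum>b\<in>B. tens b (y b), \<epsilon>)) \<in> A0" using zbasis assms(2) by (auto simp: A0_def)
  from chart_constantD[OF assms(1) this, of "\<lambda>b\<in>B. tcrd B b x" "\<lambda>b\<in>B. tcrd B b y"]
  show ?thesis using tensor_expand[of x] tensor_expand[of y] by (simp cong: sum.cong)
qed

lemma prod_atlasI: "(I, p) \<in> \<A> \<Longrightarrow> (K, q) \<in> \<B> \<Longrightarrow>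
    (I <+> K, \<lambda>y. (p (\<lambda>i\<in>I. y (Inl i)), q (\<lambda>j\<in>K. y (Inr j)))) \<in> prod_atlas \<A> \<B>"
  by (auto simp: prod_atlas_def)

lemma chart_constant_A00D:
  fixes x y x' y' :: "('l, real) tensor"
  assumes "chart_constant (prod_atlas A0 A0) m" "\<epsilon> = 1 \<or> \<epsilon> = - 1" "\<delta> = 1 \<or> \<delta> = - 1"
  shows "m ((x, \<epsilon>), (y, \<delta>)) = m ((x', \<epsilon>), (y', \<delta>))"
proof -
  have *: "(B, \<lambda>y. (\<Sum>b\<in>B. tens b (y b), \<epsilon>)) \<in> A0" if "\<epsilon> = 1 \<or> \<epsilon> = - 1" for \<epsilon> using zbasis that by (auto simp: A0_def)
  let ?p = "\<lambda>\<epsilon> y. (\<Sum>b\<in>B. tens b (y b), \<epsilon> :: int)"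
  let ?z = "\<lambda>x y. \<lambda>j\<in>B <+> B. case_sum (\<lambda>b. tcrd B b x) (\<lambda>b. tcrd B b y) j"
  have z: "?p \<epsilon> (\<lambda>i\<in>B. ?z x y (Inl i)) = (x, \<epsilon>)" "?p \<delta> (\<lambda>i\<in>B. ?z x y (Inr i)) = (y, \<delta>)" for x y \<epsilon> \<delta>
    using tensor_expand[of x] tensor_expand[of y] by (simp_all add: InlI InrI cong: sum.cong)
  from chart_constantD[OF assms(1) prod_atlasI[OF *[OF assms(2)] *[OF assms(3)]], of "?z x y" "?z x' y'"]
  show ?thesis unfolding z by auto
qed

text \<open>On each line through a lattice vector both sides are additive and agree at the lattice
  vector itself. Analyticity of \<open>p\<close> makes the coordinates of \<open>F\<close>
  continuous at 0, and then additivity implies linearity.\<close>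

lemma analytic_additive_linear:
  assumes p: "analytic_map A0 A0 p" and add: "Modules.additive F" and F: "\<And>x. F x = fst (p (x, 1))"
    and f: "\<And>m. F (tens m 1) = tens (f m) 1" "Modules.additive f"
  shows "F x = tmap f (x :: ('l, real) tensor)"
proof (rule tensor_ext[OF add additive_tmap[OF f(2)]])
  fix m and a :: real
  show "F (tens m a) = tmap f (tens m a)"
  proof (rule tensor_eqI)
    fix b
    define g where "g t = tcrd B b (F (tens m t))" for t :: real
    have g: "Modules.additive g"
      by (simp add: Modules.additive_def g_def tens_simps additive.add[OF add] tcrd_simps)
    have "\<exists>d>0. \<forall>t. \<bar>t\<bar> < d \<longrightarrow> \<bar>g t\<bar> < e" if "e > 0" for e
    proof -
      let ?q = "\<lambda>y. (\<Sum>b\<in>B. tens b (y b), 1 :: int)"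
      have "(B, ?q) \<in> A0" using zbasis by (auto simp: A0_def)
      from real_analytic_on_atlasD[OF finite_A0 analytic_map_A0D(2)[OF p finite_A0] this, of "\<lambda>b\<in>B. 0"]
      have "real_analytic_at B (\<lambda>y. tcrd B b (fst (p (?q y)))) (\<lambda>b\<in>B. 0)" by auto
      from real_analytic_at_continuous[OF finite_basis _ this that]
      obtain r where r: "r > 0" "\<forall>y\<in>near B r (\<lambda>b\<in>B. 0). \<bar>tcrd B b (F (fst (?q y))) - tcrd B b (F (fst (?q (\<lambda>b\<in>B. 0))))\<bar> < e"
        by (auto simp: F)
      define M where "M = 1 + (\<Sum>b\<in>B. \<bar>real_of_int (crd B m b)\<bar>)"
      have "M > 0" by (simp add: M_def add_pos_nonneg sum_nonneg)
      moreover have "\<bar>real_of_int (crd B m b)\<bar> \<le> M" if "b \<in> B" for b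
        using member_le_sum[OF that _ finite_basis, of "\<lambda>b. \<bar>real_of_int (crd B m b)\<bar>"] by (simp add: M_def)
      ultimately have M: "M > 0" "\<And>b. b \<in> B \<Longrightarrow> \<bar>real_of_int (crd B m b)\<bar> \<le> M" by auto
      have "\<bar>g t\<bar> < e" if "\<bar>t\<bar> < r / M" for t
      proof -
        let ?y = "\<lambda>b\<in>B. t * of_int (crd B m b)"
        have "\<bar>t\<bar> * \<bar>real_of_int (crd B m b)\<bar> < r" if "b \<in> B" for b
        proof -
          have "\<bar>t\<bar> * \<bar>real_of_int (crd B m b)\<bar> \<le> \<bar>t\<bar> * M" using M(2)[OF that] by (intro mult_left_mono) auto
          also have "\<dots> < r" using \<open>\<bar>t\<bar> < r / M\<close> M(1) by (simp add: field_simps)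
          finally show ?thesis .
        qed
        then have "?y \<in> near B r (\<lambda>b\<in>B. 0)" by (auto simp: near_def abs_mult)
        from bspec[OF r(2) this]
        have "\<bar>tcrd B b (F (fst (?q ?y))) - tcrd B b (F (fst (?q (\<lambda>b\<in>B. 0))))\<bar> < e" .
        moreover have "fst (?q ?y) = tens m t"
          by (subst tens_expand[of m t]) (simp add: zmul_eq_mult mult.commute)
        moreover have "fst (?q (\<lambda>b\<in>B. 0)) = 0" by (simp add: tens_simps)
        ultimately show ?thesis by (simp add: g_def additive.zero[OF add] tcrd_simps tens_simps)
      qed
      then show ?thesis using r(1) M(1) by (intro exI[of _ "r / M"]) auto
    qed
    from additive_real_linear[OF g this, of a]
    show "tcrd B b (F (tens m a)) = tcrd B b (tmap f (tens m a))"
      by (simp add: g_def f zmul_eq_mult mult.commute)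
  qed
qed

lemma weak_autE:
  assumes "w \<in> carrier (deg0 (wAct_plus (Theta' J)))"
  obtains f c k q where "weak_aut_data J f c k q" "w = weak_aut f c k q"
proof -
  obtain p0 p1 \<kappa> where w: "w = (p0, p1, \<kappa>)" by (cases w) auto
  have E: "(p0, p1, \<kappa>) \<in> weak_end (Theta' J)" and plus: "\<And>\<alpha>. fst \<alpha> = 0 \<Longrightarrow> p1 \<alpha> = \<alpha>"
    and bij0: "bij_betw p0 gset gset" and bij1: "bij p1" and an0: "analytic_map A0 A0 p0"
    and an\<kappa>: "analytic_map (prod_atlas A0 A0) A1 \<kappa>"
    using assms unfolding w wAct_plus_simps weak_aut_group_def kernel_Theta
    by (auto simp: Theta_simps(1,2) atlas_Theta)
  let ?T = "Theta' J"
  note E1 = E[unfolded weak_end_def mem_Collect_eq prod.case Theta_simps(1,2)]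
  have p0_ext: "p0 \<in> gset \<rightarrow>\<^sub>E gset" and p0_1: "p0 (0, 1) = (0, 1)" and p1_0: "p1 (0, 0) = (0, 0)"
    and \<kappa>_ext: "\<kappa> \<in> gset \<times> gset \<rightarrow>\<^sub>E UNIV"
    using E1 by (simp_all add: Theta_simps(5,6))
  have "p0 (bdry ?T \<alpha>) = bdry ?T (p1 \<alpha>)" for \<alpha> using E1 by blast
  then have bd: "\<And>\<alpha>. p0 (emb (fst \<alpha>)) = emb (fst (p1 \<alpha>))" by (simp add: Theta_simps)
  have "p0 X \<otimes>\<^bsub>deg0 ?T\<^esub> p0 Y \<otimes>\<^bsub>deg0 ?T\<^esub> bdry ?T (\<kappa> (X, Y)) = p0 (X \<otimes>\<^bsub>deg0 ?T\<^esub> Y)"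
    if "X \<in> gset" "Y \<in> gset" for X Y using E1 that by blast
  then have mu: "\<And>X Y. X \<in> gset \<Longrightarrow> Y \<in> gset \<Longrightarrow> gm (gm (p0 X) (p0 Y)) (emb (fst (\<kappa> (X, Y)))) = p0 (gm X Y)"
    by (simp add: Theta_simps)
  have m1_raw: "p1 \<alpha> \<otimes>\<^bsub>deg1 ?T\<^esub> p1 \<beta> \<otimes>\<^bsub>deg1 ?T\<^esub> \<kappa> (bdry ?T \<alpha>, bdry ?T \<beta>) = p1 (\<alpha> \<otimes>\<^bsub>deg1 ?T\<^esub> \<beta>)" for \<alpha> \<beta>
    using E1 by blast
  have m1: "snd (p1 \<alpha>) + snd (p1 \<beta>) + snd (\<kappa> (emb (fst \<alpha>), emb (fst \<beta>))) = snd (p1 (fst \<alpha> + fst \<beta>, snd \<alpha> + snd \<beta>))" for \<alpha> \<beta>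
    using arg_cong[OF m1_raw[of \<alpha> \<beta>], of snd] by (simp add: Theta_simps)
  have coc_raw: "kappa3 ?T p0 \<kappa> X Y Z = \<kappa> (Y, Z) \<otimes>\<^bsub>deg1 ?T\<^esub> \<kappa> (X, Y \<otimes>\<^bsub>deg0 ?T\<^esub> Z)"
    if "X \<in> gset" "Y \<in> gset" "Z \<in> gset" for X Y Z using E1 that by blast
  have coc: "snd (\<kappa> (X, Y)) + jr J (fst (\<kappa> (X, Y))) (fst (p0 Z)) + snd (\<kappa> (gm X Y, Z)) = snd (\<kappa> (Y, Z)) + snd (\<kappa> (X, gm Y Z))"
    if "X \<in> gset" "Y \<in> gset" "Z \<in> gset" for X Y Z
    using arg_cong[OF coc_raw[OF that], of snd] by (simp add: Theta_simps kappa3_def jr_def)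
  have cmp_raw: "act ?T (p1 \<alpha>) (p0 X) \<otimes>\<^bsub>deg1 ?T\<^esub> \<kappa> (bdry ?T \<alpha>, X) = p1 (act ?T \<alpha> X) \<otimes>\<^bsub>deg1 ?T\<^esub> \<kappa> (X, bdry ?T (act ?T \<alpha> X))"
    if "X \<in> gset" for \<alpha> X using E1 that by blast
  have cmp: "snd (p1 \<alpha>) + jr J (fst (p1 \<alpha>)) (fst (p0 X)) + snd (\<kappa> (emb (fst \<alpha>), X)) =
       snd (p1 (zmul (snd X) (fst \<alpha>), snd \<alpha> + jr J (fst \<alpha>) (fst X))) + snd (\<kappa> (X, emb (zmul (snd X) (fst \<alpha>))))"
    if "X \<in> gset" for \<alpha> X
    using arg_cong[OF cmp_raw[OF that, of \<alpha>], of snd] by (simp add: Theta_simps jr_def)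
  have p0_gset: "p0 X \<in> gset" if "X \<in> gset" for X using p0_ext that by auto
  have snd0: "snd (p0 (x, \<epsilon>)) = snd (p0 (y, \<epsilon>))" if "\<epsilon> = 1 \<or> \<epsilon> = - 1" for x y \<epsilon>
    using chart_constant_A0D[OF analytic_map_A0D(1)[OF an0 finite_A0] that] .
  have snd1: "snd (p0 (x, 1)) = 1" for x using snd0[of 1 x 0] p0_1 by simp
  have sndm: "snd (p0 (x, - 1)) = - 1" for x
  proof -
    \<comment> \<open>A preimage of a reflection exists by surjectivity of \<open>p0\<close>. It
      cannot lie in the identity component, which is mapped to itself, so the other component goes
      to the reflections.\<close>
    obtain X where X: "X \<in> gset" "p0 X = (0, - 1)" using bij0 by (metis bij_betw_imp_surj_on gset_simps(2) imageE)
    from X(1) show ?thesis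
    proof (cases rule: gsetE)
      case (1 y) then show ?thesis using snd1[of y] X(2) by simp
    next
      case (2 y) then show ?thesis using snd0[of "- 1" x y] X(2) by simp
    qed
  qed
  define F where "F x = fst (p0 (x, 1))" for x
  define c where "c = fst (p0 (0, - 1))"
  have p0F: "p0 (x, 1) = (F x, 1)" for x using snd1[of x] by (simp add: F_def prod_eq_iff)
  have p0c: "p0 (0, - 1) = (c, - 1)" using sndm[of 0] by (simp add: c_def prod_eq_iff)
  have \<kappa>_const: "fst (\<kappa> ((x, \<epsilon>), (y, \<delta>))) = fst (\<kappa> ((0, \<epsilon>), (0, \<delta>)))" if "\<epsilon> = 1 \<or> \<epsilon> = - 1" "\<delta> = 1 \<or> \<delta> = - 1" for x y \<epsilon> \<delta>
    by (rule chart_constant_A00D[OF chart_constant_fst_A1[OF finite_A00 an\<kappa>] that])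
  have F0: "F 0 = 0" using p0_1 by (simp add: F_def)
  \<comment> \<open>At the base points of the components the images are the unit and the involution
    \<open>(c, -1)\<close>. They already multiply correctly, so the lattice factor of
    \<open>\<kappa>\<close> must be 0.\<close>
  have \<kappa>_00: "fst (\<kappa> ((0, \<epsilon>), (0, \<delta>))) = 0" if "\<epsilon> = 1 \<or> \<epsilon> = - 1" "\<delta> = 1 \<or> \<delta> = - 1" for \<epsilon> \<delta>
  proof -
    have "tens (fst (\<kappa> ((0, \<epsilon>), (0, \<delta>)))) 1 = (0 :: ('l, real) tensor)"
      using mu[of "(0, \<epsilon>)" "(0, \<delta>)"] that by (auto simp: gm_def emb_def p0F p0c F0)
    then show ?thesis using tens_inject[of 1 _ 0] by (simp add: tens_simps)
  qed
  have \<kappa>_fst: "fst (\<kappa> (X, Y)) = 0" if "X \<in> gset" "Y \<in> gset" for X Y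
    using \<kappa>_const[of "snd X" "snd Y" "fst X" "fst Y"] \<kappa>_00[of "snd X" "snd Y"] that by (simp add: gset_iff)
  have p0_gm: "gm (p0 X) (p0 Y) = p0 (gm X Y)" if "X \<in> gset" "Y \<in> gset" for X Y
    using mu[OF that] \<kappa>_fst[OF that] p0_gset that by (simp add: emb_def tens_simps)
  have F_add: "Modules.additive F"
  proof
    fix x y show "F (x + y) = F x + F y" using p0_gm[of "(x, 1)" "(y, 1)"] by (simp add: gm_def p0F)
  qed
  have p0m: "p0 (x, - 1) = (F x + c, - 1)" for x
    using p0_gm[of "(x, 1)" "(0, - 1)"] by (simp add: gm_def p0F p0c)
  define f where "f m = fst (p1 (m, 0))" for m
  have p1_f: "fst (p1 (m, a)) = f m" for m a
    using bd[of "(m, a)"] bd[of "(m, 0)"] by (simp add: f_def emb_inject)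
  have F_tens: "F (tens m 1) = tens (f m) 1" for m
    using bd[of "(m, 0)"] by (simp add: f_def emb_def p0F)
  have f_add: "Modules.additive f"
  proof
    fix m n
    have "tens (f (m + n)) 1 = tens (f m + f n) (1 :: real)"
      by (simp add: tens_simps additive.add[OF F_add] flip: F_tens)
    then show "f (m + n) = f m + f n" by (simp add: tens_inject)
  qed
  have F_f: "F x = tmap f x" for x
    by (rule analytic_additive_linear[OF an0 F_add F_def F_tens f_add])
  have "bij f"
  proof (rule bijI)
    show "inj f"
    proof (rule injI)
      fix m n assume "f m = f n"
      then have "p0 (emb m) = p0 (emb n)" using bd[of "(m, 0)"] bd[of "(n, 0)"] by (simp add: f_def)
      then show "m = n" using bij_betw_imp_inj_on[OF bij0] by (simp add: inj_on_eq_iff emb_inject)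
    qed
    show "surj f"
    proof -
      have "\<exists>m. f m = n" for n
      proof -
        obtain \<alpha> where "p1 \<alpha> = (n, 0)" using bij1 by (metis bij_is_surj surjD)
        then have "f (fst \<alpha>) = n" using p1_f[of "fst \<alpha>" "snd \<alpha>"] by simp
        then show ?thesis by auto
      qed
      then show ?thesis by (metis surjI)
    qed
  qed
  define k where "k X Y = snd (\<kappa> (X, Y))" for X Y
  define q where "q m = snd (p1 (m, 0))" for m
  have cocycle: "k X Y + k (gm X Y) Z = k Y Z + k X (gm Y Z)" if "X \<in> gset" "Y \<in> gset" "Z \<in> gset" for X Y Z
    using coc[OF that] \<kappa>_fst[OF that(1,2)] by (simp add: k_def)
  have k11: "k (0, 1) (0, 1) = 0" using m1[of "(0, 0)" "(0, 0)"] p1_0 by (simp add: k_def emb_def tens_simps)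
  have kX1: "k X (0, 1) = 0" if "X \<in> gset" for X using cocycle[of X "(0, 1)" "(0, 1)"] k11 that by simp
  \<comment> \<open>The pair is the product of its lattice part and its circle part. On the latter
    \<open>p1\<close> is the identity because the automorphism preserves the centre, and
    \<open>\<kappa>\<close> vanishes at a unit.\<close>
  have p1: "p1 \<alpha> = (f (fst \<alpha>), snd \<alpha> + q (fst \<alpha>))" for \<alpha>
    using m1[of "(fst \<alpha>, 0)" "(0, snd \<alpha>)"] plus[of "(0, snd \<alpha>)"] kX1[of "emb (fst \<alpha>)"] p1_f[of "fst \<alpha>" "snd \<alpha>"]
    by (simp add: q_def k_def prod_eq_iff emb_def tens_simps add.commute)
  have p0: "p0 X = aut f c X" if "X \<in> gset" for X
    using that by (cases rule: gsetE) (simp_all add: p0F p0m aut_def F_f)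
  show thesis
  proof (rule that[of f c k q])
    show "weak_aut_data J f c k q" unfolding weak_aut_data_def
    proof (intro conjI allI ballI)
      show "q 0 = 0" using p1_0 by (simp add: q_def)
      show "q m + q n + k (emb m) (emb n) = q (m + n)" for m n using m1[of "(m, 0)" "(n, 0)"] by (simp add: q_def k_def)
      show "q m + jr J (f m) (fst (aut f c X)) + k (emb m) X = jr J m (fst X) + q (zmul (snd X) m) + k X (emb (zmul (snd X) m))"
        if "X \<in> gset" for m X
        using cmp[OF that, of "(m, 0)"] p0[OF that] by (simp add: p1 k_def)
      show "analytic_cochain2 k" unfolding analytic_cochain2_def
        by (rule analytic_map_cong[OF an\<kappa>])
          (use atlas_points_prod[of A0 A0] atlas_points_A0 \<kappa>_fst in \<open>auto simp: k_def prod_eq_iff\<close>)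
    qed (use f_add \<open>bij f\<close> cocycle in auto)
    have "p0 = (\<lambda>X\<in>gset. aut f c X)" using p0_ext p0 by (auto simp: fun_eq_iff PiE_def extensional_def)
    moreover have "\<kappa> = (\<lambda>p\<in>gset \<times> gset. (0, k (fst p) (snd p)))"
      using \<kappa>_ext \<kappa>_fst by (auto simp: fun_eq_iff PiE_def extensional_def k_def prod_eq_iff)
    ultimately show "w = weak_aut f c k q" using p1 by (auto simp: w weak_aut_def)
  qed
qed

end

definition pointed_data :: "(('l::ab_group_add, real) tensor \<times> int \<Rightarrow> rmodz) \<Rightarrow> bool" where
  "pointed_data e \<longleftrightarrow> e (0, 1) = 0 \<and> analytic_cochain1 e"

lemma aut_id_zero [simp]: "aut (\<lambda>m. m) 0 X = X"
  by (simp add: aut_def)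

lemma cs_add: "cs (a + b) \<epsilon> = cs a \<epsilon> + (cs b \<epsilon> :: 'a::monoid_add)"
  by (simp add: cs_def)

lemma cs_hom: "f 0 = 0 \<Longrightarrow> f (cs a \<epsilon>) = cs (f a) \<epsilon>"
  by (simp add: cs_def)

lemma cs_crossed: "X \<in> gset \<Longrightarrow> Y \<in> gset \<Longrightarrow> cs (a :: 'l::ab_group_add) (snd X * snd Y) = zmul (snd Y) (cs a (snd X)) + cs a (snd Y)"
  by (elim gsetE) (simp_all add: additive.zero[OF additive_zmul(1)])

text \<open>The sign: multiplying a reflection on the right by a lattice element \<open>n\<close>
  subtracts \<open>n\<close> from its vector.\<close>

lemma gm_emb_cs: "X \<in> gset \<Longrightarrow> gm X (emb (cs n (snd X))) = aut (\<lambda>m. m) (- tens n 1) X"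
  by (elim gsetE) (simp_all add: gm_def emb_def aut_def tens_simps)

section \<open>The group of weak automorphisms in terms of the data
  \<open>(f, c, k, q)\<close>\<close>

context theta
begin

lemma analytic_cochain2_aut: "analytic_cochain2 k \<Longrightarrow> Modules.additive f \<Longrightarrow>
    analytic_cochain2 (\<lambda>X Y. k (aut f (c :: ('l, real) tensor) X) (aut f c Y))"
  by (rule analytic_cochain2_comp[OF _ analytic_aut analytic_aut])

lemma analytic_cochain1_aut: "analytic_cochain1 e \<Longrightarrow> Modules.additive f \<Longrightarrow>
    analytic_cochain1 (\<lambda>X. e (aut f (c :: ('l, real) tensor) X))"
  by (rule analytic_cochain1_comp[OF _ analytic_aut])

abbreviation "T \<equiv> Theta' J"
abbreviation "WP \<equiv> wAct_plus (Theta' J)"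

lemma weak_comp_eq:
  assumes d: "weak_aut_data J f c k q" and d': "weak_aut_data J f' c' k' q'"
  shows "weak_comp T (weak_aut f c k q) (weak_aut f' c' k' q') =
    weak_aut (\<lambda>m. f (f' m)) (c + tmap f c') (\<lambda>X Y. k' X Y + k (aut f' c' X) (aut f' c' Y)) (\<lambda>m. q' m + q (f' m))"
proof -
  have f0: "f 0 = 0" using additive.zero[OF wd_additive[OF d]] .
  have 1: "compose gset (\<lambda>X\<in>gset. aut f c X) (\<lambda>X\<in>gset. aut f' c' X) = (\<lambda>X\<in>gset. aut (\<lambda>m. f (f' m)) (c + tmap f c') X)"
    unfolding compose_def by (rule restrict_ext) (simp add: aut_aut[OF wd_additive[OF d] wd_additive[OF d']])
  let ?\<kappa> = "\<lambda>p\<in>gset \<times> gset. (0 :: 'l, k (fst p) (snd p))" and ?\<kappa>' = "\<lambda>p\<in>gset \<times> gset. (0 :: 'l, k' (fst p) (snd p))"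
  let ?p0 = "\<lambda>X\<in>gset. aut f c X" and ?p0' = "\<lambda>X\<in>gset. aut f' c' X"
  let ?p1 = "\<lambda>\<alpha>. (f (fst \<alpha>), snd \<alpha> + q (fst \<alpha>))"
  have 2: "(\<lambda>(X, Y)\<in>gset \<times> gset. ?p1 (?\<kappa>' (X, Y)) \<otimes>\<^bsub>deg1 T\<^esub> kappa3 T ?p0 ?\<kappa> (?p0' X) (?p0' Y) (bdry T (?\<kappa>' (X, Y)))) =
    (\<lambda>p\<in>gset \<times> gset. (0, k' (fst p) (snd p) + k (aut f' c' (fst p)) (aut f' c' (snd p))))"
  proof (rule restrict_ext)
    fix p :: "(('l, real) tensor \<times> int) \<times> ('l, real) tensor \<times> int" assume "p \<in> gset \<times> gset"
    then obtain X Y where p: "p = (X, Y)" and X: "X \<in> gset" and Y: "Y \<in> gset" by blast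
    have aut_1: "aut f c (0, 1) = (0, 1)" by (simp add: aut_def additive.zero[OF additive_tmap[OF wd_additive[OF d]]])
    show "(case p of (X, Y) \<Rightarrow> ?p1 (?\<kappa>' (X, Y)) \<otimes>\<^bsub>deg1 T\<^esub> kappa3 T ?p0 ?\<kappa> (?p0' X) (?p0' Y) (bdry T (?\<kappa>' (X, Y)))) =
      (0, k' (fst p) (snd p) + k (aut f' c' (fst p)) (aut f' c' (snd p)))"
      using X Y by (simp add: p Theta_simps kappa3_def f0 wd_q0[OF d] emb_0[OF d] aut_1 wd_k_one(1)[OF d] flip: jr_def)
  qed
  show ?thesis
    unfolding weak_comp_def weak_aut_def prod.case Theta_simps(1,2) 1 2
    by (simp add: compose_def algebra_simps restrict_UNIV)
qed

lemma weak_aut_data_comp: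
  assumes d: "weak_aut_data J f c k q" and d': "weak_aut_data J f' c' k' q'"
  shows "weak_aut_data J (\<lambda>m. f (f' m)) (c + tmap f c') (\<lambda>X Y. k' X Y + k (aut f' c' X) (aut f' c' Y)) (\<lambda>m. q' m + q (f' m))"
  unfolding weak_aut_data_def
proof (intro conjI allI ballI)
  note a = wd_additive[OF d] and a' = wd_additive[OF d']
  show "Modules.additive (\<lambda>m. f (f' m))" by (rule additive_comp[OF a a'])
  show "bij (\<lambda>m. f (f' m))" using bij_comp[OF wd_bij[OF d'] wd_bij[OF d]] by (simp add: o_def)
  show "q' 0 + q (f' 0) = 0" by (simp add: wd_q0[OF d] wd_q0[OF d'] additive.zero[OF a'])
  show "q' m + q (f' m) + (q' n + q (f' n)) + (k' (emb m) (emb n) + k (aut f' c' (emb m)) (aut f' c' (emb n))) = q' (m + n) + q (f' (m + n))" for m n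
    by (simp add: wd_q[OF d] wd_q[OF d'] additive.add[OF a'] aut_emb[OF a'] algebra_simps)
  show "analytic_cochain2 (\<lambda>X Y. k' X Y + k (aut f' c' X) (aut f' c' Y))"
    by (rule analytic_cochain2_add[OF wd_analytic[OF d'] analytic_cochain2_aut[OF wd_analytic[OF d] a']])
next
  fix X Y Z :: "('l, real) tensor \<times> int" assume "X \<in> gset" "Y \<in> gset" "Z \<in> gset"
  then have "k' X Y + k' (gm X Y) Z + (k (aut f' c' X) (aut f' c' Y) + k (aut f' c' (gm X Y)) (aut f' c' Z)) =
      k' Y Z + k' X (gm Y Z) + (k (aut f' c' Y) (aut f' c' Z) + k (aut f' c' X) (aut f' c' (gm Y Z)))"
    using wd_cocycle[OF d, of "aut f' c' X" "aut f' c' Y" "aut f' c' Z"] wd_cocycle[OF d', of X Y Z]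
    by (simp add: aut_gm[OF wd_additive[OF d']])
  then show "k' X Y + k (aut f' c' X) (aut f' c' Y) + (k' (gm X Y) Z + k (aut f' c' (gm X Y)) (aut f' c' Z)) =
    k' Y Z + k (aut f' c' Y) (aut f' c' Z) + (k' X (gm Y Z) + k (aut f' c' X) (aut f' c' (gm Y Z)))"
    by (simp add: add_ac)
next
  fix m and X :: "('l, real) tensor \<times> int" assume X: "X \<in> gset"
  note a = wd_additive[OF d] and a' = wd_additive[OF d']
  let ?g = "aut f' c'"
  have "snd (?g X) = snd X" by (simp add: aut_def)
  with wd_compat[OF d, of "?g X" "f' m"] X
  have 1: "q (f' m) + jr J (f (f' m)) (fst (aut f c (?g X))) + k (?g (emb m)) (?g X) =
    jr J (f' m) (fst (?g X)) + q (f' (zmul (snd X) m)) + k (?g X) (?g (emb (zmul (snd X) m)))"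
    by (simp add: aut_emb[OF a'] additive_zmul_hom[OF a'])
  \<comment> \<open>This equation and the previous one share the term
    \<open>jr J (f' m) (fst (?g X))\<close> on opposite sides, so it cancels in their sum.\<close>
  from wd_compat[OF d' X, of m]
  have "q' m + k' (emb m) X + jr J (f' m) (fst (?g X)) = jr J m (fst X) + q' (zmul (snd X) m) + k' X (emb (zmul (snd X) m))"
    by (simp add: algebra_simps)
  with 1 have "(q (f' m) + jr J (f (f' m)) (fst (aut f c (?g X))) + k (?g (emb m)) (?g X)) + (q' m + k' (emb m) X + jr J (f' m) (fst (?g X))) =
    (jr J (f' m) (fst (?g X)) + q (f' (zmul (snd X) m)) + k (?g X) (?g (emb (zmul (snd X) m)))) +
    (jr J m (fst X) + q' (zmul (snd X) m) + k' X (emb (zmul (snd X) m)))" by simp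
  then have "q (f' m) + jr J (f (f' m)) (fst (aut f c (?g X))) + k (?g (emb m)) (?g X) + (q' m + k' (emb m) X) =
    q (f' (zmul (snd X) m)) + k (?g X) (?g (emb (zmul (snd X) m))) +
    (jr J m (fst X) + q' (zmul (snd X) m) + k' X (emb (zmul (snd X) m)))" by (simp add: algebra_simps)
  then show "q' m + q (f' m) + jr J (f (f' m)) (fst (aut (\<lambda>m. f (f' m)) (c + tmap f c') X)) + (k' (emb m) X + k (?g (emb m)) (?g X)) =
    jr J m (fst X) + (q' (zmul (snd X) m) + q (f' (zmul (snd X) m))) +
    (k' X (emb (zmul (snd X) m)) + k (?g X) (?g (emb (zmul (snd X) m))))"
    by (simp add: aut_aut[OF a a'] algebra_simps)
qed

lemma weak_aut_data_one: "weak_aut_data J (\<lambda>m. m) 0 (\<lambda>_ _. 0) (\<lambda>_. 0)"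
  unfolding weak_aut_data_def
  by (auto simp: additive_id analytic_cochain2_def bij_id[unfolded id_def] intro: analytic_map_A1_const[OF finite_A00])

lemma one_WP: "\<one>\<^bsub>deg0 WP\<^esub> = weak_aut (\<lambda>m. m) 0 (\<lambda>_ _. 0) (\<lambda>_. 0)"
  by (simp add: wAct_plus_simps weak_aut_group_def weak_aut_def Theta_simps restrict_UNIV)

lemma weak_aut_data_inv:
  assumes d: "weak_aut_data J f c k q"
  defines "fi \<equiv> inv_into UNIV f"
  defines "g \<equiv> aut fi (- tmap fi c)"
  shows "weak_aut_data J fi (- tmap fi c) (\<lambda>X Y. - k (g X) (g Y)) (\<lambda>m. - q (fi m))"
  unfolding weak_aut_data_def
proof (intro conjI allI ballI)
  note a = wd_additive[OF d]
  show a': "Modules.additive fi" unfolding fi_def by (rule additive_inv[OF a wd_bij[OF d]])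
  show "bij fi" unfolding fi_def using wd_bij[OF d] by (rule bij_imp_bij_inv)
  show "- q (fi 0) = 0" by (simp add: additive.zero[OF a'] wd_q0[OF d])
  show "- q (fi m) + - q (fi n) + - k (g (emb m)) (g (emb n)) = - q (fi (m + n))" for m n
    by (simp add: g_def aut_emb[OF a'] wd_q[OF d] additive.add[OF a'])
  show "analytic_cochain2 (\<lambda>X Y. - k (g X) (g Y))" unfolding g_def
    by (rule analytic_cochain2_uminus[OF analytic_cochain2_aut[OF wd_analytic[OF d] a']])
  fix X Y :: "('l, real) tensor \<times> int" assume X: "X \<in> gset"
  have g: "g X \<in> gset" if "X \<in> gset" for X using that by (simp add: g_def)
  show "- k (g X) (g Y) + - k (g (gm X Y)) (g Z) = - k (g Y) (g Z) + - k (g X) (g (gm Y Z))"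
    if "Y \<in> gset" "Z \<in> gset" for Z
    using arg_cong[OF wd_cocycle[OF d g[OF X] g[OF that(1)] g[OF that(2)]], of uminus] X that
    by (simp add: g_def aut_gm[OF a'])
  fix m
  have "f (fi m) = m" unfolding fi_def using wd_bij[OF d] by (simp add: bij_is_surj surj_f_inv_f)
  moreover have "aut f c (g X) = X" unfolding g_def fi_def by (rule aut_inverse[OF a wd_bij[OF d]])
  moreover have "snd (g X) = snd X" by (simp add: g_def aut_def)
  ultimately have "q (fi m) + jr J m (fst X) + k (g (emb m)) (g X) = jr J (fi m) (fst (g X)) + q (fi (zmul (snd X) m)) + k (g X) (g (emb (zmul (snd X) m)))"
    using wd_compat[OF d g[OF X], of "fi m"] by (simp add: g_def aut_emb[OF a'] additive_zmul_hom[OF a'])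
  then have "jr J m (fst X) = jr J (fi m) (fst (g X)) + q (fi (zmul (snd X) m)) + k (g X) (g (emb (zmul (snd X) m))) - q (fi m) - k (g (emb m)) (g X)"
    by (simp add: algebra_simps)
  then show "- q (fi m) + jr J (fi m) (fst (aut fi (- tmap fi c) X)) + - k (g (emb m)) (g X) =
    jr J m (fst X) + - q (fi (zmul (snd X) m)) + - k (g X) (g (emb (zmul (snd X) m)))"
    by (simp add: algebra_simps flip: g_def)
qed

lemma group_WP: "group (deg0 WP)"
proof (rule groupI)
  show "\<one>\<^bsub>deg0 WP\<^esub> \<in> carrier (deg0 WP)" unfolding one_WP by (rule weak_aut_closed[OF weak_aut_data_one])
  fix w assume "w \<in> carrier (deg0 WP)"
  then obtain f c k q where d: "weak_aut_data J f c k q" and w: "w = weak_aut f c k q" by (rule weak_autE)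
  note a = wd_additive[OF d]
  show "\<one>\<^bsub>deg0 WP\<^esub> \<otimes>\<^bsub>deg0 WP\<^esub> w = w"
    unfolding one_WP w wAct_plus_simps(2) weak_comp_eq[OF weak_aut_data_one d] by (rule weak_aut_eqI) auto
  show "\<exists>w'\<in>carrier (deg0 WP). w' \<otimes>\<^bsub>deg0 WP\<^esub> w = \<one>\<^bsub>deg0 WP\<^esub>"
  proof (rule bexI)
    let ?fi = "inv_into UNIV f"
    let ?g = "aut ?fi (- tmap ?fi c)"
    show "weak_aut ?fi (- tmap ?fi c) (\<lambda>X Y. - k (?g X) (?g Y)) (\<lambda>m. - q (?fi m)) \<in> carrier (deg0 WP)"
      by (rule weak_aut_closed[OF weak_aut_data_inv[OF d]])
    show "weak_aut ?fi (- tmap ?fi c) (\<lambda>X Y. - k (?g X) (?g Y)) (\<lambda>m. - q (?fi m)) \<otimes>\<^bsub>deg0 WP\<^esub> w = \<one>\<^bsub>deg0 WP\<^esub>"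
      unfolding one_WP w wAct_plus_simps(2) weak_comp_eq[OF weak_aut_data_inv[OF d] d]
      by (rule weak_aut_eqI) (simp_all add: bij_is_inj[OF wd_bij[OF d]] aut_inverse[OF a wd_bij[OF d]])
  qed
  fix w' assume "w' \<in> carrier (deg0 WP)"
  then obtain f' c' k' q' where d': "weak_aut_data J f' c' k' q'" and w': "w' = weak_aut f' c' k' q'" by (rule weak_autE)
  note a' = wd_additive[OF d']
  show "w \<otimes>\<^bsub>deg0 WP\<^esub> w' \<in> carrier (deg0 WP)"
    unfolding w w' wAct_plus_simps(2) weak_comp_eq[OF d d'] by (rule weak_aut_closed[OF weak_aut_data_comp[OF d d']])
  fix w'' assume "w'' \<in> carrier (deg0 WP)"
  then obtain f'' c'' k'' q'' where d'': "weak_aut_data J f'' c'' k'' q''" and w'': "w'' = weak_aut f'' c'' k'' q''" by (rule weak_autE)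
  note a'' = wd_additive[OF d'']
  show "w \<otimes>\<^bsub>deg0 WP\<^esub> w' \<otimes>\<^bsub>deg0 WP\<^esub> w'' = w \<otimes>\<^bsub>deg0 WP\<^esub> (w' \<otimes>\<^bsub>deg0 WP\<^esub> w'')"
    unfolding w w' w'' wAct_plus_simps(2) weak_comp_eq[OF d d'] weak_comp_eq[OF d' d'']
      weak_comp_eq[OF weak_aut_data_comp[OF d d'] d''] weak_comp_eq[OF d weak_aut_data_comp[OF d' d'']]
    by (rule weak_aut_eqI) (simp_all add: aut_aut[OF a' a''] tmap_tmap[OF a a'] additive.add[OF additive_tmap[OF a]] add.assoc)
qed

section \<open>Pointed maps\<close>

lemma pointed_map_closed:
  assumes "pointed_data e"
  shows "pointed_map n e \<in> carrier (pointed_maps T)"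
proof -
  have "analytic_map A0 A1 (\<lambda>X. (cs n (snd X), abs_rmodz 0))"
    by (rule analytic_map_A1I[OF finite_A0 chart_constant_comp[OF chart_constant_snd] real_analytic_on_atlas_const[OF finite_A0]])
  from analytic_map_A1_map2[OF finite_A0 assms[unfolded pointed_data_def analytic_cochain1_def, THEN conjunct2] this,
      of "\<lambda>_ m. m" "\<lambda>_ _. 0"]
  have "analytic_map A0 A1 (\<lambda>X. (cs n (snd X), e X))" by (simp add: abs_rmodz_simps)
  then have "analytic_map A0 A1 (pointed_map n e)"
    by (rule analytic_map_cong) (simp add: atlas_points_A0 pointed_map_def)
  then show ?thesis using assms
    by (simp add: pointed_maps_def Theta_simps(1,2,5,6) atlas_Theta pointed_data_def) (simp add: pointed_map_def)
qed

lemma pointed_mapE: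
  assumes "\<eta> \<in> carrier (pointed_maps T)"
  obtains n e where "pointed_data e" "\<eta> = pointed_map n e"
proof -
  have \<eta>: "\<eta> \<in> gset \<rightarrow>\<^sub>E UNIV" "\<eta> (0, 1) = (0, 0)" and an: "analytic_map A0 A1 \<eta>"
    using assms by (auto simp: pointed_maps_def Theta_simps(1,2,5,6) atlas_Theta)
  have const: "fst (\<eta> (x, \<epsilon>)) = fst (\<eta> (0, \<epsilon>))" if "\<epsilon> = 1 \<or> \<epsilon> = - 1" for x \<epsilon>
    by (rule chart_constant_A0D[OF chart_constant_fst_A1[OF finite_A0 an] that])
  obtain n where n: "n = fst (\<eta> (0, - 1))" by simp
  have "fst (\<eta> X) = cs n (snd X)" if "X \<in> gset" for X
    using that const[of "snd X" "fst X"] \<eta>(2) by (auto simp: gset_iff cs_def n)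
  then have "\<eta> X = pointed_map n (\<lambda>X. snd (\<eta> X)) X" for X
    using PiE_arb[OF \<eta>(1), of X] by (cases "X \<in> gset") (simp_all add: pointed_map_def prod_eq_iff)
  then have "\<eta> = pointed_map n (\<lambda>X. snd (\<eta> X))" by (rule ext)
  moreover have "pointed_data (\<lambda>X. snd (\<eta> X))"
    unfolding pointed_data_def analytic_cochain1_def
    using \<eta>(2) analytic_map_A1_map2[OF finite_A0 an analytic_map_A1_const[OF finite_A0, of "(0, 0)"], of "\<lambda>_ _. 0" "\<lambda>_ _. 0"] by simp
  ultimately show thesis by (rule that[rotated])
qed

lemma pointed_map_mult:
  "pointed_map n e \<otimes>\<^bsub>pointed_maps T\<^esub> pointed_map n' e' = pointed_map (n + n') (\<lambda>X. e' X + e (aut (\<lambda>m. m) (- tens n' 1) X))"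
  unfolding pointed_maps_def pointed_map_def Theta_simps(1) monoid.simps
proof (rule restrict_ext)
  fix X :: "('l, real) tensor \<times> int" assume X: "X \<in> gset"
  have "snd (aut f c X) = snd X" for f c by (simp add: aut_def)
  then show "(\<lambda>X\<in>gset. (cs n' (snd X), e' X)) X \<otimes>\<^bsub>deg1 T\<^esub>
    (\<lambda>X\<in>gset. (cs n (snd X), e X)) (X \<otimes>\<^bsub>deg0 T\<^esub> bdry T ((\<lambda>X\<in>gset. (cs n' (snd X), e' X)) X)) =
    (cs (n + n') (snd X), e' X + e (aut (\<lambda>m. m) (- tens n' 1) X))"
    using X by (simp add: Theta_simps gm_emb_cs[OF X] cs_add add.commute)
qed

lemma pointed_data_mult:
  assumes "pointed_data e" "pointed_data e'"
  shows "pointed_data (\<lambda>X. e' X + e (aut (\<lambda>m. m) (c :: ('l, real) tensor) X))"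
proof -
  have "aut (\<lambda>m. m) c (0, 1) = (0, 1)" by (simp add: aut_def)
  then show ?thesis using assms
    by (simp add: pointed_data_def analytic_cochain1_add analytic_cochain1_aut additive_id)
qed

lemma pointed_one: "\<one>\<^bsub>pointed_maps T\<^esub> = pointed_map 0 (\<lambda>_. 0)" and pointed_data_zero: "pointed_data (\<lambda>_. 0 :: rmodz)"
proof -
  show "\<one>\<^bsub>pointed_maps T\<^esub> = pointed_map 0 (\<lambda>_. 0)"
    by (simp add: pointed_maps_def pointed_map_def Theta_simps)
  show "pointed_data (\<lambda>_. 0 :: rmodz)"
    by (simp add: pointed_data_def analytic_cochain1_def analytic_map_A1_const[OF finite_A0])
qed

lemma monoid_pointed_maps: "Group.monoid (pointed_maps T)"
proof (rule monoidI)
  show "\<one>\<^bsub>pointed_maps T\<^esub> \<in> carrier (pointed_maps T)" unfolding pointed_one by (rule pointed_map_closed[OF pointed_data_zero])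
  fix \<eta> assume "\<eta> \<in> carrier (pointed_maps T)"
  then obtain n e where d: "pointed_data e" and \<eta>: "\<eta> = pointed_map n e" by (rule pointed_mapE)
  show "\<one>\<^bsub>pointed_maps T\<^esub> \<otimes>\<^bsub>pointed_maps T\<^esub> \<eta> = \<eta>" "\<eta> \<otimes>\<^bsub>pointed_maps T\<^esub> \<one>\<^bsub>pointed_maps T\<^esub> = \<eta>"
    unfolding pointed_one \<eta> pointed_map_mult by (rule pointed_map_eqI; simp add: tens_simps)+
  fix \<eta>' assume "\<eta>' \<in> carrier (pointed_maps T)"
  then obtain n' e' where d': "pointed_data e'" and \<eta>': "\<eta>' = pointed_map n' e'" by (rule pointed_mapE)
  show "\<eta> \<otimes>\<^bsub>pointed_maps T\<^esub> \<eta>' \<in> carrier (pointed_maps T)"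
    unfolding \<eta> \<eta>' pointed_map_mult by (rule pointed_map_closed[OF pointed_data_mult[OF d d']])
  fix \<eta>'' assume "\<eta>'' \<in> carrier (pointed_maps T)"
  then obtain n'' e'' where d'': "pointed_data e''" and \<eta>'': "\<eta>'' = pointed_map n'' e''" by (rule pointed_mapE)
  show "\<eta> \<otimes>\<^bsub>pointed_maps T\<^esub> \<eta>' \<otimes>\<^bsub>pointed_maps T\<^esub> \<eta>'' = \<eta> \<otimes>\<^bsub>pointed_maps T\<^esub> (\<eta>' \<otimes>\<^bsub>pointed_maps T\<^esub> \<eta>'')"
    unfolding \<eta> \<eta>' \<eta>'' pointed_map_mult
    by (rule pointed_map_eqI) (simp_all add: add.assoc aut_aut[OF additive_id(1) additive_id(1)] tens_simps)
qed

text \<open>Right multiplication by the lattice values is a translation on each component, so it can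
  be undone: the inverse has the value \<open>- n\<close> and evaluates \<open>e\<close> at the
  shifted argument.\<close>

lemma Units_pointed_maps: "Units (pointed_maps T) = carrier (pointed_maps T)"
proof
  show "carrier (pointed_maps T) \<subseteq> Units (pointed_maps T)"
  proof
    fix \<eta> assume \<eta>_in: "\<eta> \<in> carrier (pointed_maps T)"
    then obtain n e where d: "pointed_data e" and \<eta>: "\<eta> = pointed_map n e" by (rule pointed_mapE)
    let ?e = "\<lambda>X. - e (aut (\<lambda>m. m) (tens n 1) X)"
    let ?\<theta> = "pointed_map (- n) ?e"
    have "pointed_data ?e" using pointed_data_mult[OF d pointed_data_zero, of "tens n 1"]
      by (auto simp: pointed_data_def intro: analytic_cochain1_uminus)
    then have "?\<theta> \<in> carrier (pointed_maps T)" by (rule pointed_map_closed)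
    moreover have "?\<theta> \<otimes>\<^bsub>pointed_maps T\<^esub> \<eta> = \<one>\<^bsub>pointed_maps T\<^esub>" "\<eta> \<otimes>\<^bsub>pointed_maps T\<^esub> ?\<theta> = \<one>\<^bsub>pointed_maps T\<^esub>"
      unfolding \<eta> pointed_map_mult pointed_one
      by (rule pointed_map_eqI; simp add: aut_aut[OF additive_id(1) additive_id(1)] tens_simps)+
    ultimately show "\<eta> \<in> Units (pointed_maps T)" unfolding Units_def using \<eta>_in by blast
  qed
qed (auto simp: Units_def)

lemma deg1_WP: "carrier (deg1 WP) = carrier (pointed_maps T)" "mult (deg1 WP) = mult (pointed_maps T)"
  by (simp_all add: wAct_plus_simps(1) units_of_def Units_pointed_maps)

lemma group_WP1: "group (deg1 WP)"
  unfolding wAct_plus_simps(1) by (rule monoid.units_group[OF monoid_pointed_maps])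

text \<open>The coboundary of \<open>e\<close>, corrected by the change that the action of
  \<open>Y\<close> causes in the circle part of the value at \<open>X\<close>. The action pairs the
  lattice part of that value with the vector of \<open>Y\<close>.\<close>

definition bdry_cochain :: "'l \<Rightarrow> (('l, real) tensor \<times> int \<Rightarrow> rmodz) \<Rightarrow> ('l, real) tensor \<times> int \<Rightarrow> ('l, real) tensor \<times> int \<Rightarrow> rmodz" where
  "bdry_cochain n e X Y = e (gm X Y) - e Y - e X - jr J (cs n (snd X)) (fst Y)"

lemma bdry_WP: "bdry WP (pointed_map n e) = weak_aut (\<lambda>m. m) (- tens n 1) (bdry_cochain n e) (\<lambda>m. e (emb m))"
proof -
  let ?\<eta> = "pointed_map n e"
  have "(\<lambda>X\<in>gset. X \<otimes>\<^bsub>deg0 T\<^esub> bdry T (?\<eta> X)) = (\<lambda>X\<in>gset. aut (\<lambda>m. m) (- tens n 1) X)"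
    by (rule restrict_ext) (simp add: Theta_simps pointed_map_def gm_emb_cs)
  moreover have "(\<lambda>\<alpha>\<in>UNIV. \<alpha> \<otimes>\<^bsub>deg1 T\<^esub> ?\<eta> (bdry T \<alpha>)) = (\<lambda>\<alpha>. (fst \<alpha>, snd \<alpha> + e (emb (fst \<alpha>))))"
    by (simp add: Theta_simps pointed_map_def restrict_UNIV) (simp add: emb_def)
  moreover have "(\<lambda>(X, Y)\<in>gset \<times> gset. inv\<^bsub>deg1 T\<^esub> (?\<eta> Y) \<otimes>\<^bsub>deg1 T\<^esub> inv\<^bsub>deg1 T\<^esub> (act T (?\<eta> X) Y) \<otimes>\<^bsub>deg1 T\<^esub> ?\<eta> (X \<otimes>\<^bsub>deg0 T\<^esub> Y)) =
    (\<lambda>p\<in>gset \<times> gset. (0, bdry_cochain n e (fst p) (snd p)))"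
  proof (rule restrict_ext)
    fix p :: "(('l, real) tensor \<times> int) \<times> ('l, real) tensor \<times> int" assume "p \<in> gset \<times> gset"
    then obtain X Y where p: "p = (X, Y)" and X: "X \<in> gset" and Y: "Y \<in> gset" by blast
    have "snd (gm X Y) = snd X * snd Y" by (simp add: gm_def)
    then show "(case p of (X, Y) \<Rightarrow> inv\<^bsub>deg1 T\<^esub> (?\<eta> Y) \<otimes>\<^bsub>deg1 T\<^esub> inv\<^bsub>deg1 T\<^esub> (act T (?\<eta> X) Y) \<otimes>\<^bsub>deg1 T\<^esub> ?\<eta> (X \<otimes>\<^bsub>deg0 T\<^esub> Y)) =
      (0, bdry_cochain n e (fst p) (snd p))"
      using X Y by (simp add: p Theta_simps inv_Theta pointed_map_def cs_crossed[OF X Y] bdry_cochain_def jr_def)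
  qed
  ultimately show ?thesis
    unfolding wAct_plus_simps(5) by (simp add: wAct_def weak_aut_def Theta_simps(1,2))
qed

text \<open>Because \<open>f\<^sub>0\<close> is a homomorphism that extends \<open>f\<close>, the
  element \<open>u\<close> in the definition of the action is the lattice element
  \<open>cs (fi n) (snd X)\<close>.\<close>

lemma act_WP:
  assumes d: "weak_aut_data J f c k q"
  defines "fi \<equiv> inv_into UNIV f"
  shows "act WP (pointed_map n e) (weak_aut f c k q) =
    pointed_map (fi n) (\<lambda>X. e (aut f c X) - k X (emb (cs (fi n) (snd X))) - q (cs (fi n) (snd X)))"
proof -
  note a = wd_additive[OF d]
  have ffi: "f (fi m) = m" for m unfolding fi_def using wd_bij[OF d] by (simp add: bij_is_surj surj_f_inv_f)
  have fi_cs: "fi (cs n \<epsilon>) = cs (fi n) \<epsilon>" for \<epsilon>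
    by (rule cs_hom) (simp add: fi_def additive.zero[OF additive_inv[OF a wd_bij[OF d]]])
  have "act WP (pointed_map n e) (weak_aut f c k q) X = pointed_map (fi n) (\<lambda>X. e (aut f c X) - k X (emb (cs (fi n) (snd X))) - q (cs (fi n) (snd X))) X"
    if X: "X \<in> gset" for X
  proof -
    have "gm (aut f c X) (emb (cs n (snd X))) = aut f c (gm X (emb (fi (cs n (snd X)))))"
      using X by (simp add: aut_gm[OF a] aut_emb[OF a] ffi)
    moreover have "inv_into gset (\<lambda>X\<in>gset. aut f c X) (aut f c Z) = Z" if "Z \<in> gset" for Z
      using that by (simp add: inv_into_aut[OF a wd_bij[OF d]] aut_inverse[OF a wd_bij[OF d]])
    moreover have "gm (ginv X) (gm X Z) = Z" for Z using X by (simp add: gm_ginv flip: gm_assoc)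
    moreover have "snd (aut f c X) = snd X" by (simp add: aut_def)
    ultimately show ?thesis
      unfolding wAct_plus_simps(6) wAct_def weak_aut_def
      using X p1_inverse(2)[OF wd_bij[OF d], of q]
      by (simp add: Theta_simps inv_Theta pointed_map_def Let_def fi_cs flip: fi_def)
  qed
  moreover have "act WP (pointed_map n e) (weak_aut f c k q) X = pointed_map (fi n) e' X" if "X \<notin> gset" for X e'
    unfolding wAct_plus_simps(6) wAct_def weak_aut_def using that by (simp add: Theta_simps pointed_map_def)
  ultimately show ?thesis by blast
qed

lemma pointed_data_act:
  assumes d: "weak_aut_data J f c k q" and e: "pointed_data e"
  shows "pointed_data (\<lambda>X. e (aut f c X) - k X (emb (cs n (snd X))) - q (cs n (snd X)))"
proof -
  have "aut f c (0, 1) = (0, 1)" by (simp add: aut_def additive.zero[OF additive_tmap[OF wd_additive[OF d]]])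
  moreover have "analytic_cochain1 (\<lambda>X. k X (emb (cs n (snd X))))"
    by (rule analytic_cochain1_comp2[OF wd_analytic[OF d] analytic_map_id[OF finite_A0]])
      (rule analytic_snd[of "\<lambda>\<epsilon>. emb (cs n \<epsilon>)"], simp)
  moreover have "analytic_cochain1 (\<lambda>X :: ('l, real) tensor \<times> int. q (cs n (snd X)))"
    by (rule analytic_cochain1_snd[of "\<lambda>\<epsilon>. q (cs n \<epsilon>)"])
  ultimately show ?thesis using e
    by (simp add: pointed_data_def emb_0[OF d] wd_q0[OF d] wd_k_one[OF d] analytic_cochain1_diff analytic_cochain1_aut wd_additive[OF d])
qed

lemma weak_aut_data_bdry:
  assumes e: "pointed_data e"
  shows "weak_aut_data J (\<lambda>m. m) (- tens n 1) (bdry_cochain n e) (\<lambda>m. e (emb m))"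
  unfolding weak_aut_data_def
proof (intro conjI allI ballI)
  show "Modules.additive (\<lambda>m :: 'l. m)" by (rule additive_id)
  show "bij (\<lambda>m. m)" using bij_id by (simp add: id_def)
  show "e (emb 0) = 0" using e by (simp add: emb_def pointed_data_def tens_simps)
  show "e (emb m) + e (emb m') + bdry_cochain n e (emb m) (emb m') = e (emb (m + m'))" for m m'
    by (simp add: bdry_cochain_def gm_emb_emb) (simp add: emb_def)
  show "bdry_cochain n e X Y + bdry_cochain n e (gm X Y) Z = bdry_cochain n e Y Z + bdry_cochain n e X (gm Y Z)"
    if "X \<in> gset" "Y \<in> gset" "Z \<in> gset" for X Y Z
  proof -
    have "jr J (cs n (snd X)) (fst Y) + jr J (cs n (snd X * snd Y)) (fst Z) = jr J (cs n (snd Y)) (fst Z) + jr J (cs n (snd X)) (fst (gm Y Z))"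
      unfolding cs_crossed[OF that(1,2)] using that(2)
      by (elim gsetE) (simp_all add: gm_def)
    then have "jr J (cs n (snd X * snd Y)) (fst Z) = jr J (cs n (snd Y)) (fst Z) + jr J (cs n (snd X)) (fst (gm Y Z)) - jr J (cs n (snd X)) (fst Y)"
      by (simp add: algebra_simps)
    moreover have "snd (gm X Y) = snd X * snd Y" by (simp add: gm_def)
    ultimately show ?thesis by (simp add: bdry_cochain_def gm_assoc algebra_simps)
  qed
  show "analytic_cochain2 (bdry_cochain n e)"
    unfolding bdry_cochain_def[abs_def] using e
    by (intro analytic_cochain2_diff analytic_cochain2_gm analytic_cochain2_fst analytic_cochain2_snd analytic_cochain2_jr[OF J])
      (auto simp: pointed_data_def)
  show "e (emb m) + jr J m (fst (aut (\<lambda>m. m) (- tens n 1) X)) + bdry_cochain n e (emb m) X =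
      jr J m (fst X) + e (emb (zmul (snd X) m)) + bdry_cochain n e X (emb (zmul (snd X) m))" if "X \<in> gset" for m X
  proof -
    have "jr J m (fst (aut (\<lambda>m. m) (- tens n 1) X)) = jr J m (fst X)" by (simp add: aut_def cs_def)
    moreover have "snd (emb m) = 1" "fst (emb m) = tens m 1" for m :: 'l by (simp_all add: emb_def)
    ultimately show ?thesis by (simp add: bdry_cochain_def gm_emb[OF that])
  qed
qed

text \<open>The computation behind the equivariance of the boundary map. Both arguments of
  \<open>k\<close> are shifted by lattice elements; the shifts are removed by four instances of the
  cocycle identity, \<open>wd_q\<close> splits the value of \<open>q\<close> at the combined shift,
  and \<open>wd_compat\<close> moves one shift past \<open>Y\<close>.\<close>

lemma equivariance_identity:
  assumes d: "weak_aut_data J f c k q" and X: "X \<in> gset" and Y: "Y \<in> gset"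
  shows "k (gm X (emb (cs a (snd X)))) (gm Y (emb (cs a (snd Y)))) + k X (emb (cs a (snd X))) + q (cs a (snd X))
      + k Y (emb (cs a (snd Y))) + q (cs a (snd Y)) - k (gm X Y) (emb (cs a (snd X * snd Y))) - q (cs a (snd X * snd Y))
      - jr J (cs a (snd X)) (fst Y) = k X Y - jr J (f (cs a (snd X))) (fst (aut f c Y))"
proof -
  define p p' r s where "p = emb (cs a (snd X))" and "p' = emb (zmul (snd Y) (cs a (snd X)))" and "r = emb (cs a (snd Y))" and "s = gm p' r"
  have in_gset: "p \<in> gset" "p' \<in> gset" "r \<in> gset" "s \<in> gset" using X Y by (simp_all add: p_def p'_def r_def s_def)
  have pY: "gm p Y = gm Y p'" unfolding p_def p'_def by (rule gm_emb[OF Y])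
  have s: "emb (cs a (snd X * snd Y)) = s"
    by (simp add: s_def p'_def r_def gm_emb_emb cs_crossed[OF X Y])
  have q: "q (cs a (snd X * snd Y)) = q (zmul (snd Y) (cs a (snd X))) + q (cs a (snd Y)) + k p' r"
    unfolding cs_crossed[OF X Y] p'_def r_def by (rule wd_q[OF d])
  have A: "q (cs a (snd X)) = jr J (cs a (snd X)) (fst Y) + q (zmul (snd Y) (cs a (snd X))) + k Y p' - jr J (f (cs a (snd X))) (fst (aut f c Y)) - k p Y"
    using wd_compat[OF d Y, of "cs a (snd X)"] by (simp add: p_def p'_def algebra_simps)
  have "gm p (gm Y r) = gm Y s" by (simp add: s_def pY flip: gm_assoc)
  then have C1: "k (gm X p) (gm Y r) = k p (gm Y r) + k X (gm Y s) - k X p"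
    using wd_cocycle[OF d X in_gset(1), of "gm Y r"] Y in_gset by (simp add: algebra_simps)
  have C2: "k p (gm Y r) = k p Y + k (gm Y p') r - k Y r"
    using wd_cocycle[OF d in_gset(1) Y in_gset(3)] by (simp add: pY algebra_simps)
  have C3: "k X (gm Y s) = k X Y + k (gm X Y) s - k Y s"
    using wd_cocycle[OF d X Y in_gset(4)] by (simp add: algebra_simps)
  have C4: "k (gm Y p') r = k p' r + k Y s - k Y p'"
    using wd_cocycle[OF d Y in_gset(2,3)] by (simp add: algebra_simps s_def)
  show ?thesis unfolding s q A C1[unfolded p_def r_def] C2[unfolded p_def r_def] C3 C4[unfolded r_def]
    by (simp add: algebra_simps p_def r_def)
qed

lemma crossed_module_WP: "crossed_module WP"
  unfolding crossed_module_def
proof (intro conjI ballI)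
  interpret W0: group "deg0 WP" by (rule group_WP)
  interpret W1: group "deg1 WP" by (rule group_WP1)
  show "group (deg1 WP)" "group (deg0 WP)" by (rule group_WP1 group_WP)+
  have bdry_closed: "bdry WP \<eta> \<in> carrier (deg0 WP)" if \<eta>: "\<eta> \<in> carrier (deg1 WP)" for \<eta>
  proof -
    obtain n e where "pointed_data e" "\<eta> = pointed_map n e" using \<eta> unfolding deg1_WP by (rule pointed_mapE)
    then show ?thesis using weak_aut_closed[OF weak_aut_data_bdry] by (simp add: bdry_WP)
  qed
  have act_closed: "act WP \<eta> w \<in> carrier (deg1 WP)" if \<eta>: "\<eta> \<in> carrier (deg1 WP)" and w: "w \<in> carrier (deg0 WP)" for \<eta> w
  proof -
    obtain n e where e: "pointed_data e" "\<eta> = pointed_map n e" using \<eta> unfolding deg1_WP by (rule pointed_mapE)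
    obtain f c k q where d: "weak_aut_data J f c k q" "w = weak_aut f c k q" using w by (rule weak_autE)
    show ?thesis unfolding d(2) e(2) act_WP[OF d(1)] deg1_WP by (rule pointed_map_closed[OF pointed_data_act[OF d(1) e(1)]])
  qed
  show "bdry WP \<in> hom (deg1 WP) (deg0 WP)"
  proof (rule homI)
    fix \<eta> \<eta>' assume "\<eta> \<in> carrier (deg1 WP)" "\<eta>' \<in> carrier (deg1 WP)"
    then obtain n e n' e' where e: "pointed_data e" "\<eta> = pointed_map n e" and e': "pointed_data e'" "\<eta>' = pointed_map n' e'"
      unfolding deg1_WP by (metis pointed_mapE)
    show "bdry WP (\<eta> \<otimes>\<^bsub>deg1 WP\<^esub> \<eta>') = bdry WP \<eta> \<otimes>\<^bsub>deg0 WP\<^esub> bdry WP \<eta>'"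
      unfolding e e' deg1_WP pointed_map_mult bdry_WP wAct_plus_simps(2)
        weak_comp_eq[OF weak_aut_data_bdry[OF e(1)] weak_aut_data_bdry[OF e'(1)]]
    proof (rule weak_aut_eqI)
      fix X Y :: "('l, real) tensor \<times> int" assume X: "X \<in> gset" and Y: "Y \<in> gset"
      let ?g = "aut (\<lambda>m. m) (- tens n' 1)"
      have "jr J (cs n (snd (?g X))) (fst (?g Y)) = jr J (cs n (snd X)) (fst Y)" by (simp add: aut_def cs_def)
      then show "bdry_cochain (n + n') (\<lambda>X. e' X + e (?g X)) X Y = bdry_cochain n' e' X Y + bdry_cochain n e (?g X) (?g Y)"
        by (simp add: bdry_cochain_def cs_add aut_gm[OF additive_id(1) X Y] algebra_simps)
    qed (simp_all add: tens_simps aut_emb[OF additive_id(1)])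
  qed (rule bdry_closed)
  show "act WP \<eta> \<one>\<^bsub>deg0 WP\<^esub> = \<eta>" if \<eta>: "\<eta> \<in> carrier (deg1 WP)" for \<eta>
  proof -
    obtain n e where e: "pointed_data e" "\<eta> = pointed_map n e" using \<eta> unfolding deg1_WP by (rule pointed_mapE)
    show ?thesis unfolding e one_WP act_WP[OF weak_aut_data_one] by (rule pointed_map_eqI) (simp_all add: inv_f_eq)
  qed
  show "act WP \<eta>' (bdry WP \<eta>) = inv\<^bsub>deg1 WP\<^esub> \<eta> \<otimes>\<^bsub>deg1 WP\<^esub> \<eta>' \<otimes>\<^bsub>deg1 WP\<^esub> \<eta>"
    if \<eta>_in: "\<eta> \<in> carrier (deg1 WP)" and \<eta>'_in: "\<eta>' \<in> carrier (deg1 WP)" for \<eta> \<eta>'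
  proof -
  obtain n e where e: "pointed_data e" "\<eta> = pointed_map n e" using \<eta>_in unfolding deg1_WP by (rule pointed_mapE)
  obtain n' e' where e': "pointed_data e'" "\<eta>' = pointed_map n' e'" using \<eta>'_in unfolding deg1_WP by (rule pointed_mapE)
  have id: "inv_into UNIV (\<lambda>m. m) = (\<lambda>m :: 'l. m)" by (rule ext) (simp add: inv_f_eq)
  \<comment> \<open>The Peiffer identity is multiplied by \<open>\<eta>\<close> so that no inverse
    of a pointed map has to be computed. The equivariance of the boundary is treated in the same way
    below.\<close>
  have "\<eta> \<otimes>\<^bsub>deg1 WP\<^esub> act WP \<eta>' (bdry WP \<eta>) = \<eta>' \<otimes>\<^bsub>deg1 WP\<^esub> \<eta>"
    unfolding e e' bdry_WP act_WP[OF weak_aut_data_bdry[OF e(1)]] deg1_WP pointed_map_mult id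
  proof (rule pointed_map_eqI)
    show "n + n' = n' + n" by (rule add.commute)
    fix X :: "('l, real) tensor \<times> int" assume X: "X \<in> gset"
    have "fst (emb m) = tens m 1" for m :: 'l by (simp add: emb_def)
    then show "e' (aut (\<lambda>m. m) (- tens n 1) X) - bdry_cochain n e X (emb (cs n' (snd X))) - e (emb (cs n' (snd X))) +
        e (aut (\<lambda>m. m) (- tens n' 1) X) = e X + e' (aut (\<lambda>m. m) (- tens n 1) X)"
      by (simp add: bdry_cochain_def gm_emb_cs[OF X] algebra_simps)
  qed
  then show ?thesis
    using \<eta>_in \<eta>'_in act_closed[OF \<eta>'_in bdry_closed[OF \<eta>_in]]
    by (metis W1.inv_solve_left W1.m_assoc W1.inv_closed W1.m_closed)
  qed
  fix w assume w_in: "w \<in> carrier (deg0 WP)"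
  then obtain f c k q where d: "weak_aut_data J f c k q" and w: "w = weak_aut f c k q" by (rule weak_autE)
  note a = wd_additive[OF d] and ai = additive_inv[OF wd_additive[OF d] wd_bij[OF d]]
  let ?fi = "inv_into UNIV f"
  have ffi: "f (?fi m) = m" for m using wd_bij[OF d] by (simp add: bij_is_surj surj_f_inv_f)
  show "(\<lambda>\<eta>. act WP \<eta> w) \<in> hom (deg1 WP) (deg1 WP)"
  proof (rule homI)
    fix \<eta> \<eta>' assume "\<eta> \<in> carrier (deg1 WP)" "\<eta>' \<in> carrier (deg1 WP)"
    then obtain n e n' e' where e: "pointed_data e" "\<eta> = pointed_map n e" and e': "pointed_data e'" "\<eta>' = pointed_map n' e'"
      unfolding deg1_WP by (metis pointed_mapE)
    show "act WP (\<eta> \<otimes>\<^bsub>deg1 WP\<^esub> \<eta>') w = act WP \<eta> w \<otimes>\<^bsub>deg1 WP\<^esub> act WP \<eta>' w"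
      unfolding e e' w deg1_WP pointed_map_mult act_WP[OF d]
    proof (rule pointed_map_eqI)
      show "?fi (n + n') = ?fi n + ?fi n'" by (rule additive.add[OF ai])
      fix X :: "('l, real) tensor \<times> int" assume X: "X \<in> gset"
      let ?h = "aut (\<lambda>m. m) (- tens (?fi n') 1)"
      let ?r = "cs (?fi n) (snd X)" and ?s = "cs (?fi n') (snd X)"
      have h: "?h X = gm X (emb ?s)" using gm_emb_cs[OF X] by simp
      have 1: "aut f c (?h X) = aut (\<lambda>m. m) (- tens n' 1) (aut f c X)"
        by (simp add: aut_aut[OF a additive_id(1)] aut_aut[OF additive_id(1) a] additive.minus[OF additive_tmap[OF a]] tmap_tens[OF a] ffi add.commute)
      have 2: "snd (?h X) = snd X" by (simp add: aut_def)
      have "cs (?fi (n + n')) (snd X) = ?s + ?r" by (simp add: additive.add[OF ai] cs_add add.commute)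
      then have 3: "q (cs (?fi (n + n')) (snd X)) = q ?s + q ?r + k (emb ?s) (emb ?r)" "emb (cs (?fi (n + n')) (snd X)) = gm (emb ?s) (emb ?r)"
        by (simp_all add: wd_q[OF d] gm_emb_emb)
      have 4: "k (gm X (emb ?s)) (emb ?r) = k (emb ?s) (emb ?r) + k X (gm (emb ?s) (emb ?r)) - k X (emb ?s)"
        using wd_cocycle[OF d X, of "emb ?s" "emb ?r"] by (simp add: algebra_simps)
      show "e' (aut f c X) + e (aut (\<lambda>m. m) (- tens n' 1) (aut f c X)) - k X (emb (cs (?fi (n + n')) (snd X))) - q (cs (?fi (n + n')) (snd X)) =
        e' (aut f c X) - k X (emb ?s) - q ?s + (e (aut f c (?h X)) - k (?h X) (emb (cs (?fi n) (snd (?h X)))) - q (cs (?fi n) (snd (?h X))))"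
        unfolding 1 2 3 unfolding h 4 by (simp add: algebra_simps)
    qed
  qed (rule act_closed[OF _ w_in])
  fix \<eta> assume \<eta>_in: "\<eta> \<in> carrier (deg1 WP)"
  then obtain n e where e: "pointed_data e" "\<eta> = pointed_map n e" unfolding deg1_WP by (rule pointed_mapE)
  show "bdry WP (act WP \<eta> w) = inv\<^bsub>deg0 WP\<^esub> w \<otimes>\<^bsub>deg0 WP\<^esub> bdry WP \<eta> \<otimes>\<^bsub>deg0 WP\<^esub> w"
  proof -
    have "w \<otimes>\<^bsub>deg0 WP\<^esub> bdry WP (act WP \<eta> w) = bdry WP \<eta> \<otimes>\<^bsub>deg0 WP\<^esub> w"
      unfolding w e act_WP[OF d] bdry_WP wAct_plus_simps(2) weak_comp_eq[OF d weak_aut_data_bdry[OF pointed_data_act[OF d e(1)]]]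
        weak_comp_eq[OF weak_aut_data_bdry[OF e(1)] d]
    proof (rule weak_aut_eqI)
      show "c + tmap f (- tens (?fi n) 1) = - tens n 1 + tmap (\<lambda>m. m) c"
        by (simp add: additive.minus[OF additive_tmap[OF a]] tmap_tens[OF a] ffi)
      show "e (aut f c (emb m)) - k (emb m) (emb (cs (?fi n) (snd (emb m)))) - q (cs (?fi n) (snd (emb m))) + q m = q m + e (emb (f m))" for m
        using wd_k_one(1)[OF d, of "emb m"] by (simp add: aut_emb[OF a]) (simp add: emb_def tens_simps wd_q0[OF d])
      fix X Y :: "('l, real) tensor \<times> int" assume X: "X \<in> gset" and Y: "Y \<in> gset"
      let ?e = "\<lambda>X. e (aut f c X) - k X (emb (cs (?fi n) (snd X))) - q (cs (?fi n) (snd X))"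
      let ?h = "aut (\<lambda>m. m) (- tens (?fi n) 1)"
      have s: "snd (aut f c X) = snd X" "snd (gm X Y) = snd X * snd Y" by (simp_all add: aut_def gm_def)
      have fcs: "f (cs (?fi n) (snd X)) = cs n (snd X)" using cs_hom[of f, OF additive.zero[OF a]] by (simp add: ffi)
      have "k (?h X) (?h Y) = k X Y - jr J (cs n (snd X)) (fst (aut f c Y)) + jr J (cs (?fi n) (snd X)) (fst Y)
        - k X (emb (cs (?fi n) (snd X))) - q (cs (?fi n) (snd X)) - k Y (emb (cs (?fi n) (snd Y))) - q (cs (?fi n) (snd Y))
        + k (gm X Y) (emb (cs (?fi n) (snd X * snd Y))) + q (cs (?fi n) (snd X * snd Y))"
        using equivariance_identity[OF d X Y, of "?fi n"] unfolding gm_emb_cs[OF X] gm_emb_cs[OF Y] fcs by (simp add: algebra_simps)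
      then show "bdry_cochain (?fi n) ?e X Y + k (?h X) (?h Y) = k X Y + bdry_cochain n e (aut f c X) (aut f c Y)"
        unfolding bdry_cochain_def aut_gm[OF a X Y] s by (simp add: algebra_simps)
    qed simp
    then show ?thesis using w_in \<eta>_in act_closed[OF \<eta>_in w_in] bdry_closed
      by (metis W0.inv_solve_left W0.m_assoc W0.inv_closed W0.m_closed)
  qed
  show "act WP \<eta> (w \<otimes>\<^bsub>deg0 WP\<^esub> w') = act WP (act WP \<eta> w) w'" if "w' \<in> carrier (deg0 WP)" for w'
  proof -
    from that obtain f' c' k' q' where d': "weak_aut_data J f' c' k' q'" and w': "w' = weak_aut f' c' k' q'" by (rule weak_autE)
    let ?fi' = "inv_into UNIV f'"
    have f'fi': "f' (?fi' m) = m" for m using wd_bij[OF d'] by (simp add: bij_is_surj surj_f_inv_f)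
    have fi: "inv_into UNIV (\<lambda>m. f (f' m)) n = ?fi' (?fi n)"
      using wd_bij[OF weak_aut_data_comp[OF d d']] by (intro inv_f_eq) (simp_all add: bij_is_inj ffi f'fi')
    show ?thesis
      unfolding w w' e wAct_plus_simps(2) weak_comp_eq[OF d d'] act_WP[OF weak_aut_data_comp[OF d d']] act_WP[OF d] act_WP[OF d']
    proof (rule pointed_map_eqI)
      fix X :: "('l, real) tensor \<times> int" assume X: "X \<in> gset"
      have "snd (aut f' c' X) = snd X" by (simp add: aut_def)
      moreover have "f' (cs (?fi' (?fi n)) (snd X)) = cs (?fi n) (snd X)"
        using cs_hom[of f', OF additive.zero[OF wd_additive[OF d']]] by (simp add: f'fi')
      ultimately show "e (aut (\<lambda>m. f (f' m)) (c + tmap f c') X) - (k' X (emb (cs (inv_into UNIV (\<lambda>m. f (f' m)) n) (snd X))) +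
           k (aut f' c' X) (aut f' c' (emb (cs (inv_into UNIV (\<lambda>m. f (f' m)) n) (snd X))))) -
          (q' (cs (inv_into UNIV (\<lambda>m. f (f' m)) n) (snd X)) + q (f' (cs (inv_into UNIV (\<lambda>m. f (f' m)) n) (snd X)))) =
         e (aut f c (aut f' c' X)) - k (aut f' c' X) (emb (cs (?fi n) (snd (aut f' c' X)))) - q (cs (?fi n) (snd (aut f' c' X))) -
         k' X (emb (cs (?fi' (?fi n)) (snd X))) - q' (cs (?fi' (?fi n)) (snd X))"
        unfolding fi by (simp add: aut_emb[OF wd_additive[OF d']] aut_aut[OF a wd_additive[OF d']] algebra_simps)
    qed (rule fi)
  qed
qed

end

section \<open>The crossed module \<open>\<Xi>'\<close>\<close>

lemma of_int_bit: "(of_int k :: bit) = of_bool (odd k)"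
proof (cases "even k")
  case True
  then obtain j where "k = j + j" by (metis evenE mult_2)
  then show ?thesis by (cases "of_int j :: bit") auto
next
  case False
  then obtain j where "k = (j + j) + 1" by (metis oddE mult_2)
  then show ?thesis by (cases "of_int j :: bit") auto
qed

lemma of_int_bit_eq: "(of_int j :: bit) = of_int k \<longleftrightarrow> even (j - k)"
  by (simp add: of_int_bit)

text \<open>A canonical symmetric form with the parity required by \<open>\<xi>'\<close>: its
  diagonal is the square of \<open>I n m\<close>, which is congruent to \<open>I n m\<close> modulo
  2.\<close>

definition square_form :: "('l \<Rightarrow> 'l \<Rightarrow> int) \<Rightarrow> 'l \<Rightarrow> 'l \<Rightarrow> 'l \<Rightarrow> int" where
  "square_form I n m m' = I n m * I n m'"

context theta
begin

abbreviation "I \<equiv> symm J"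
abbreviation "OJ \<equiv> O_tilde J"
abbreviation "LE \<equiv> lattice_ext J"
abbreviation "XI \<equiv> Xi' J"

lemmas J_simps = biadditive_simps[OF J]
lemmas I_simps = biadditive_simps[OF biadditive_symm[OF J]]

lemma O_carrier: "(f, A) \<in> carrier OJ \<longleftrightarrow> f \<in> isometries I \<and> biadditive A \<and> (\<forall>m n. A m n - A n m = J m n - J (f m) (f n))"
  by (simp add: O_tilde_def pullback_def)

lemma O_mult: "(f, A) \<otimes>\<^bsub>OJ\<^esub> (g, A') = (f \<circ> g, \<lambda>m n. A (g m) (g n) + A' m n)"
  by (simp add: O_tilde_def pullback_def)

lemma O_one: "\<one>\<^bsub>OJ\<^esub> = (id, \<lambda>m n. 0)"
  by (simp add: O_tilde_def)

lemma isometriesD: "f \<in> isometries I \<Longrightarrow> Modules.additive f" "f \<in> isometries I \<Longrightarrow> bij f" "f \<in> isometries I \<Longrightarrow> I (f m) (f n) = I m n"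
  by (simp_all add: isometries_def)

lemma isometries_inv:
  assumes "f \<in> isometries I"
  shows "f (inv_into UNIV f m) = m" "inv_into UNIV f (f m) = m" "inv_into UNIV f \<in> isometries I"
proof -
  have 1: "f (inv_into UNIV f m) = m" for m using isometriesD(2)[OF assms] by (simp add: bij_is_surj surj_f_inv_f)
  then show "f (inv_into UNIV f m) = m" .
  show "inv_into UNIV f (f m) = m" using isometriesD(2)[OF assms] by (simp add: bij_is_inj)
  have "I (inv_into UNIV f m) (inv_into UNIV f n) = I m n" for m n
    using isometriesD(3)[OF assms, of "inv_into UNIV f m" "inv_into UNIV f n"] by (simp add: 1)
  then show "inv_into UNIV f \<in> isometries I"
    using isometriesD[OF assms] additive_inv bij_imp_bij_inv by (auto simp: isometries_def)
qed

lemma isometries_comp: "f \<in> isometries I \<Longrightarrow> g \<in> isometries I \<Longrightarrow> f \<circ> g \<in> isometries I"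
  by (simp add: isometries_def bij_comp) (simp add: Modules.additive_def)

lemma O_mult_closed: "(f, A) \<in> carrier OJ \<Longrightarrow> (g, A') \<in> carrier OJ \<Longrightarrow> (f \<circ> g, \<lambda>m n. A (g m) (g n) + A' m n) \<in> carrier OJ"
  unfolding O_carrier
proof (intro conjI allI)
  assume a: "f \<in> isometries I \<and> biadditive A \<and> (\<forall>m n. A m n - A n m = J m n - J (f m) (f n))"
    "g \<in> isometries I \<and> biadditive A' \<and> (\<forall>m n. A' m n - A' n m = J m n - J (g m) (g n))"
  show "f \<circ> g \<in> isometries I" using a isometries_comp by blast
  show "biadditive (\<lambda>m n. A (g m) (g n) + A' m n)"
    by (rule biadditive_plus[OF biadditive_comp]) (simp_all add: a isometriesD)
  fix m n
  have "A (g m) (g n) - A (g n) (g m) = J (g m) (g n) - J (f (g m)) (f (g n))" "A' m n - A' n m = J m n - J (g m) (g n)"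
    using a by auto
  then show "A (g m) (g n) + A' m n - (A (g n) (g m) + A' n m) = J m n - J ((f \<circ> g) m) ((f \<circ> g) n)" by simp
qed

lemma O_inv_closed:
  assumes "(f, A) \<in> carrier OJ"
  shows "(inv_into UNIV f, \<lambda>m n. - A (inv_into UNIV f m) (inv_into UNIV f n)) \<in> carrier OJ"
proof -
  let ?fi = "inv_into UNIV f"
  have f: "f \<in> isometries I" and A: "biadditive A" and eq: "\<And>m n. A m n - A n m = J m n - J (f m) (f n)"
    using assms by (auto simp: O_carrier)
  have "biadditive (\<lambda>m n. - A (?fi m) (?fi n))"
    by (rule biadditive_uminus[OF biadditive_comp[OF A]]) (rule isometriesD(1)[OF isometries_inv(3)[OF f]])+
  moreover have "- A (?fi m) (?fi n) - - A (?fi n) (?fi m) = J m n - J (?fi m) (?fi n)" for m n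
    using eq[of "?fi m" "?fi n"] by (simp add: isometries_inv[OF f])
  ultimately show ?thesis using isometries_inv(3)[OF f] by (simp add: O_carrier)
qed

lemma id_isometry: "id \<in> isometries I"
  by (simp add: isometries_def additive_id)

lemma group_O: "group OJ"
proof (rule groupI)
  show "\<one>\<^bsub>OJ\<^esub> \<in> carrier OJ" by (simp add: O_one O_carrier id_isometry biadditive_def Modules.additive_def)
  fix x assume "x \<in> carrier OJ"
  moreover obtain f A where x: "x = (f, A)" by (cases x)
  ultimately have xc: "(f, A) \<in> carrier OJ" by simp
  then have f: "f \<in> isometries I" by (simp add: O_carrier)
  show "\<one>\<^bsub>OJ\<^esub> \<otimes>\<^bsub>OJ\<^esub> x = x" by (simp add: x O_one O_mult)
  show "\<exists>y\<in>carrier OJ. y \<otimes>\<^bsub>OJ\<^esub> x = \<one>\<^bsub>OJ\<^esub>"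
    by (rule bexI[OF _ O_inv_closed[OF xc]]) (auto simp: x O_mult O_one isometries_inv[OF f])
  fix y assume "y \<in> carrier OJ"
  moreover obtain g A' where y: "y = (g, A')" by (cases y)
  ultimately show "x \<otimes>\<^bsub>OJ\<^esub> y \<in> carrier OJ" using O_mult_closed xc by (simp add: x O_mult)
  fix z assume "z \<in> carrier OJ"
  obtain h A'' where z: "z = (h, A'')" by (cases z)
  show "x \<otimes>\<^bsub>OJ\<^esub> y \<otimes>\<^bsub>OJ\<^esub> z = x \<otimes>\<^bsub>OJ\<^esub> (y \<otimes>\<^bsub>OJ\<^esub> z)"
    by (simp add: x y z O_mult comp_assoc add.assoc)
qed

sublocale O: group OJ by (rule group_O)

lemma O_inv: "(f, A) \<in> carrier OJ \<Longrightarrow> inv\<^bsub>OJ\<^esub> (f, A) = (inv_into UNIV f, \<lambda>m n. - A (inv_into UNIV f m) (inv_into UNIV f n))"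
proof (rule O.inv_equality)
  assume fA: "(f, A) \<in> carrier OJ"
  then have f: "f \<in> isometries I" by (simp add: O_carrier)
  show "(inv_into UNIV f, \<lambda>m n. - A (inv_into UNIV f m) (inv_into UNIV f n)) \<otimes>\<^bsub>OJ\<^esub> (f, A) = \<one>\<^bsub>OJ\<^esub>"
    by (auto simp: O_mult O_one isometries_inv[OF f])
qed (auto intro: O_inv_closed)

lemma even_forms_iff: "(f, A) \<in> even_forms \<longleftrightarrow> f = id \<and> biadditive A \<and> (\<forall>m n. A m n = A n m) \<and> (\<forall>m. even (A m m))"
  by (auto simp: even_forms_def symmetric_forms_def)

lemma even_forms_carrier: "even_forms \<subseteq> carrier OJ"
  by (auto simp: even_forms_def symmetric_forms_def O_carrier id_isometry)

lemma normal_even_forms: "even_forms \<lhd> OJ"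
  unfolding O.normal_inv_iff
proof
  show "subgroup even_forms OJ"
  proof (rule O.subgroupI[OF even_forms_carrier])
    have "(id, \<lambda>m n. 0) \<in> even_forms" by (simp add: even_forms_iff biadditive_def Modules.additive_def)
    then show "even_forms \<noteq> {}" by blast
    fix x :: "('l \<Rightarrow> 'l) \<times> ('l \<Rightarrow> 'l \<Rightarrow> int)" assume "x \<in> even_forms"
    moreover obtain f A where x: "x = (f, A)" by (cases x)
    ultimately have x': "f = id" "biadditive A" "\<And>m n. A m n = A n m" "\<And>m. even (A m m)" by (auto simp: even_forms_iff)
    then have "(id, A) \<in> carrier OJ" using even_forms_carrier \<open>x \<in> even_forms\<close> x by auto
    moreover have "inv_into UNIV id = (id :: 'l \<Rightarrow> 'l)" by (simp add: inv_id)
    ultimately show "inv\<^bsub>OJ\<^esub> x \<in> even_forms" using x' by (simp add: x O_inv even_forms_iff biadditive_uminus)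
    fix y :: "('l \<Rightarrow> 'l) \<times> ('l \<Rightarrow> 'l \<Rightarrow> int)" assume "y \<in> even_forms"
    moreover obtain g A' where y: "y = (g, A')" by (cases y)
    ultimately show "x \<otimes>\<^bsub>OJ\<^esub> y \<in> even_forms" using x' by (auto simp: x O_mult even_forms_iff biadditive_plus)
  qed
  show "\<forall>x\<in>carrier OJ. \<forall>h\<in>even_forms. x \<otimes>\<^bsub>OJ\<^esub> h \<otimes>\<^bsub>OJ\<^esub> inv\<^bsub>OJ\<^esub> x \<in> even_forms"
  proof (intro ballI)
    fix x h assume "x \<in> carrier OJ" "h \<in> (even_forms :: (('l \<Rightarrow> 'l) \<times> ('l \<Rightarrow> 'l \<Rightarrow> int)) set)"
    moreover obtain f A A0 g where x: "x = (f, A)" "h = (g, A0)" by (metis surj_pair)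
    ultimately have xc: "(f, A) \<in> carrier OJ" and h: "g = id" "biadditive A0" "\<And>m n. A0 m n = A0 n m" "\<And>m. even (A0 m m)"
      by (auto simp: even_forms_iff)
    have f: "f \<in> isometries I" using xc by (simp add: O_carrier)
    have "f \<circ> inv_into UNIV f = id" by (auto simp: isometries_inv[OF f])
    then show "x \<otimes>\<^bsub>OJ\<^esub> h \<otimes>\<^bsub>OJ\<^esub> inv\<^bsub>OJ\<^esub> x \<in> even_forms"
      using h biadditive_comp[OF h(2) isometriesD(1)[OF isometries_inv(3)[OF f]] isometriesD(1)[OF isometries_inv(3)[OF f]]]
      by (simp add: x O_inv[OF xc] O_mult even_forms_iff)
  qed
qed

sublocale EF: normal even_forms OJ by (rule normal_even_forms)

definition E_class :: "('l \<Rightarrow> 'l) \<Rightarrow> ('l \<Rightarrow> 'l \<Rightarrow> int) \<Rightarrow> (('l \<Rightarrow> 'l) \<times> ('l \<Rightarrow> 'l \<Rightarrow> int)) set" where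
  "E_class f A = even_forms #>\<^bsub>OJ\<^esub> (f, A)"

lemma E_class_mem: "(f', A') \<in> E_class f A \<Longrightarrow> f' = f \<and> even (A' m m - A m m)"
  by (auto simp: E_class_def r_coset_def even_forms_def O_mult)

lemma E_class_self: "(f, A) \<in> carrier OJ \<Longrightarrow> (f, A) \<in> E_class f A"
  unfolding E_class_def by (rule O.rcos_self[OF _ EF.subgroup_axioms])

text \<open>Two forms over the same \<open>f\<close> have the same antisymmetrization
  \<open>J - pullback f J\<close>, so their difference is symmetric. The parity of the diagonal then
  decides whether it is even.\<close>

lemma E_class_eq:
  assumes "(f, A) \<in> carrier OJ" "(f', A') \<in> carrier OJ"
  shows "E_class f A = E_class f' A' \<longleftrightarrow> f = f' \<and> (\<forall>m. even (A m m - A' m m))"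
proof
  assume "E_class f A = E_class f' A'"
  then have "(f, A) \<in> E_class f' A'" using E_class_self[OF assms(1)] by simp
  then show "f = f' \<and> (\<forall>m. even (A m m - A' m m))" using E_class_mem by blast
next
  assume *: "f = f' \<and> (\<forall>m. even (A m m - A' m m))"
  have f: "f \<in> isometries I" and A: "biadditive A" "biadditive A'" and eq: "\<And>m n. A m n - A n m = A' m n - A' n m"
    using assms * by (auto simp: O_carrier)
  let ?fi = "inv_into UNIV f"
  \<comment> \<open>Left multiplication by \<open>(id, A0)\<close> adds the pullback of
    \<open>A0\<close> along \<open>f\<close>, hence the difference is first transported by the
    inverse of \<open>f\<close>.\<close>
  let ?A0 = "\<lambda>m n. A (?fi m) (?fi n) - A' (?fi m) (?fi n)"
  have "biadditive (\<lambda>m n. A m n - A' m n)" using biadditive_plus[OF A(1) biadditive_uminus[OF A(2)]] by simp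
  then have "biadditive ?A0" by (rule biadditive_comp) (rule isometriesD(1)[OF isometries_inv(3)[OF f]])+
  moreover have "?A0 m n = ?A0 n m" for m n using eq[of "?fi m" "?fi n"] by simp
  ultimately have "(id, ?A0) \<in> even_forms" using * by (simp add: even_forms_iff)
  moreover have "(f, A) = (id, ?A0) \<otimes>\<^bsub>OJ\<^esub> (f', A')"
    using * by (simp add: O_mult isometries_inv(2)[OF f, simplified conjunct1[OF *]])
  ultimately have "(f, A) \<in> E_class f' A'" unfolding E_class_def r_coset_def by blast
  then show "E_class f A = E_class f' A'" unfolding E_class_def
    using O.repr_independence[OF _ assms(2) EF.subgroup_axioms] by simp
qed

lemma E_carrier: "carrier (E_group J) = {E_class f A | f A. (f, A) \<in> carrier OJ}"
  by (auto simp: E_group_def carrier_FactGroup E_class_def)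

lemma E_mult: "(f, A) \<in> carrier OJ \<Longrightarrow> (g, A') \<in> carrier OJ \<Longrightarrow>
    E_class f A \<otimes>\<^bsub>E_group J\<^esub> E_class g A' = E_class (f \<circ> g) (\<lambda>m n. A (g m) (g n) + A' m n)"
  by (simp add: E_group_def E_class_def EF.rcos_sum O_mult)

lemma O_one_closed: "(id, \<lambda>m n. 0) \<in> carrier OJ"
  using O.one_closed by (simp add: O_one)

lemma E_one: "\<one>\<^bsub>E_group J\<^esub> = E_class id (\<lambda>m n. 0)"
  using O.coset_mult_one[OF even_forms_carrier] by (simp add: E_group_def E_class_def O_one)

lemma E_act_E_class: "(f, A) \<in> carrier OJ \<Longrightarrow> E_act (E_class f A) = tmap f"
proof -
  assume "(f, A) \<in> carrier OJ"
  from E_class_self[OF this] have "f \<in> fst ` E_class f A" by (rule image_eqI[rotated]) simp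
  moreover have "fst ` E_class f A \<subseteq> {f}" using E_class_mem[of _ _ f A] by auto
  ultimately have "fst ` E_class f A = {f}" by blast
  then show ?thesis by (simp add: E_act_def tmap_def)
qed

lemma LE_mult: "(n, \<iota>) \<otimes>\<^bsub>LE\<^esub> (n', \<iota>') = (n + n', \<iota> + \<iota>' + of_int (J n' n))" and LE_carrier: "carrier LE = UNIV" and LE_one: "\<one>\<^bsub>LE\<^esub> = (0, 0)"
  by (simp_all add: lattice_ext_def)

lemma group_LE: "group LE"
proof (rule groupI)
  fix x y z :: "'l \<times> bit"
  obtain n \<iota> where x: "x = (n, \<iota>)" by (cases x)
  obtain n' \<iota>' where y: "y = (n', \<iota>')" by (cases y)
  obtain n'' \<iota>'' where z: "z = (n'', \<iota>'')" by (cases z)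
  show "x \<otimes>\<^bsub>LE\<^esub> y \<otimes>\<^bsub>LE\<^esub> z = x \<otimes>\<^bsub>LE\<^esub> (y \<otimes>\<^bsub>LE\<^esub> z)"
    unfolding x y z LE_mult J_simps of_int_add prod.inject by (simp only: add_ac simp_thms)
  show "\<one>\<^bsub>LE\<^esub> \<otimes>\<^bsub>LE\<^esub> x = x" by (simp add: x LE_mult LE_one J_simps)
  show "\<exists>y\<in>carrier LE. y \<otimes>\<^bsub>LE\<^esub> x = \<one>\<^bsub>LE\<^esub>"
    by (rule bexI[of _ "(- n, \<iota> + of_int (J n n))"]) (simp_all add: x LE_mult LE_one LE_carrier J_simps add_ac del: bit_not_zero_iff, (cases \<iota>; simp)?)
qed (simp_all add: LE_carrier)

sublocale L: group LE by (rule group_LE)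

lemma of_int_zmul_2 [simp]: "(of_int (J (zmul 2 m) n) :: bit) = 0" "(of_int (J n (zmul 2 m)) :: bit) = 0"
  by (simp_all add: zmul_2 J_simps)

text \<open>The cocycle vanishes modulo 2 as soon as one argument is twice a lattice element, so
  these elements are central and multiply like the lattice.\<close>

lemma normal_two_lattice: "two_lattice \<lhd> LE"
  unfolding L.normal_inv_iff
proof
  show "subgroup two_lattice LE"
  proof (rule L.subgroupI)
    have "(zmul 2 0, 0) \<in> (two_lattice :: ('l \<times> bit) set)" unfolding two_lattice_def by blast
    then show "two_lattice \<noteq> ({} :: ('l \<times> bit) set)" by blast
    fix x assume "x \<in> (two_lattice :: ('l \<times> bit) set)"
    then obtain m where x: "x = (zmul 2 m, 0)" by (auto simp: two_lattice_def)
    have "inv\<^bsub>LE\<^esub> x = (zmul 2 (- m), 0)"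
      by (rule L.inv_equality) (simp_all add: x LE_mult LE_one LE_carrier additive.minus[OF additive_zmul(1)])
    then show "inv\<^bsub>LE\<^esub> x \<in> two_lattice" unfolding two_lattice_def by blast
    fix y assume "y \<in> (two_lattice :: ('l \<times> bit) set)"
    then obtain m' where y: "y = (zmul 2 m', 0)" by (auto simp: two_lattice_def)
    have "x \<otimes>\<^bsub>LE\<^esub> y = (zmul 2 (m + m'), 0)" by (simp add: x y LE_mult zmul_add_right)
    then show "x \<otimes>\<^bsub>LE\<^esub> y \<in> two_lattice" unfolding two_lattice_def by blast
  qed (simp add: LE_carrier)
  show "\<forall>x\<in>carrier LE. \<forall>h\<in>two_lattice. x \<otimes>\<^bsub>LE\<^esub> h \<otimes>\<^bsub>LE\<^esub> inv\<^bsub>LE\<^esub> x \<in> two_lattice"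
  proof (intro ballI)
    fix x h assume x: "x \<in> carrier LE" and h: "h \<in> (two_lattice :: ('l \<times> bit) set)"
    then obtain m where hm: "h = (zmul 2 m, 0)" by (auto simp: two_lattice_def)
    have "x \<otimes>\<^bsub>LE\<^esub> h = h \<otimes>\<^bsub>LE\<^esub> x" by (cases x) (simp add: hm LE_mult add.commute)
    then have "x \<otimes>\<^bsub>LE\<^esub> h \<otimes>\<^bsub>LE\<^esub> inv\<^bsub>LE\<^esub> x = h" using x by (simp add: L.m_assoc LE_carrier)
    then show "x \<otimes>\<^bsub>LE\<^esub> h \<otimes>\<^bsub>LE\<^esub> inv\<^bsub>LE\<^esub> x \<in> two_lattice" using h by simp
  qed
qed

sublocale TL: normal two_lattice LE by (rule normal_two_lattice)

definition lattice_class :: "'l \<Rightarrow> bit \<Rightarrow> ('l \<times> bit) set" where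
  "lattice_class n \<iota> = two_lattice #>\<^bsub>LE\<^esub> (n, \<iota>)"

lemma lattice_class_eq_set: "lattice_class n \<iota> = {(n + zmul 2 m, \<iota>) | m. True}"
proof -
  have "lattice_class n \<iota> = (\<Union>h\<in>two_lattice. {h \<otimes>\<^bsub>LE\<^esub> (n, \<iota>)})" by (simp add: lattice_class_def r_coset_def)
  also have "\<dots> = {(n + zmul 2 m, \<iota>) | m. True}"
    by (auto simp: two_lattice_def LE_mult add.commute)
  finally show ?thesis .
qed

lemma lattice_class_self: "(n, \<iota>) \<in> lattice_class n \<iota>"
  unfolding lattice_class_eq_set by (auto intro: exI[of _ 0] simp: additive.zero[OF additive_zmul(1)])

lemma lattice_class_shift: "lattice_class (n + zmul 2 m) \<iota> = lattice_class n \<iota>"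
proof (rule equalityI; rule subsetI)
  fix u
  assume "u \<in> lattice_class (n + zmul 2 m) \<iota>"
  then obtain m' where "u = (n + zmul 2 m + zmul 2 m', \<iota>)" unfolding lattice_class_eq_set by blast
  then have "u = (n + zmul 2 (m + m'), \<iota>)" by (simp add: zmul_add_right add.assoc)
  then show "u \<in> lattice_class n \<iota>" unfolding lattice_class_eq_set by blast
next
  fix u
  assume "u \<in> lattice_class n \<iota>"
  then obtain m' where "u = (n + zmul 2 m', \<iota>)" unfolding lattice_class_eq_set by blast
  then have "u = (n + zmul 2 m + zmul 2 (m' - m), \<iota>)" by (simp add: additive.diff[OF additive_zmul(1)])
  then show "u \<in> lattice_class (n + zmul 2 m) \<iota>" unfolding lattice_class_eq_set by blast
qed

lemma Xi1_carrier: "carrier (deg1 XI) = {lattice_class n \<iota> | n \<iota>. True}"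
  by (auto simp: Xi'_def carrier_FactGroup lattice_class_def LE_carrier)

lemma Xi1_mult: "lattice_class n \<iota> \<otimes>\<^bsub>deg1 XI\<^esub> lattice_class n' \<iota>' = lattice_class (n + n') (\<iota> + \<iota>' + of_int (J n' n))"
  by (simp add: Xi'_def lattice_class_def TL.rcos_sum LE_carrier LE_mult)

lemma group_Xi1: "group (deg1 XI)"
  using TL.factorgroup_is_group by (simp add: Xi'_def)

lemma Xi0_carrier: "carrier (deg0 XI) = {(t, E_class f A) | t f A. (f, A) \<in> carrier OJ}"
  by (auto simp: Xi'_def semidirect_def add_group_def E_carrier)

lemma Xi0_mult: "(f, A) \<in> carrier OJ \<Longrightarrow> (g, A') \<in> carrier OJ \<Longrightarrow>
    (t, E_class f A) \<otimes>\<^bsub>deg0 XI\<^esub> (t', E_class g A') = (t + tmap f t', E_class (f \<circ> g) (\<lambda>m n. A (g m) (g n) + A' m n))"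
  by (simp add: Xi'_def semidirect_def add_group_def E_mult E_act_E_class)

lemma Xi0_one: "\<one>\<^bsub>deg0 XI\<^esub> = (0, E_class id (\<lambda>m n. 0))"
  by (simp add: Xi'_def semidirect_def add_group_def E_one)

lemma group_Xi0: "group (deg0 XI)"
proof (rule groupI)
  show "\<one>\<^bsub>deg0 XI\<^esub> \<in> carrier (deg0 XI)" using O_one_closed by (auto simp: Xi0_one Xi0_carrier)
  fix x assume "x \<in> carrier (deg0 XI)"
  then obtain t f A where x: "x = (t, E_class f A)" "(f, A) \<in> carrier OJ" by (auto simp: Xi0_carrier)
  have f: "f \<in> isometries I" using x by (simp add: O_carrier)
  show "\<one>\<^bsub>deg0 XI\<^esub> \<otimes>\<^bsub>deg0 XI\<^esub> x = x" by (simp add: x Xi0_one Xi0_mult O_one_closed)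
  let ?fi = "inv_into UNIV f"
  let ?A = "\<lambda>m n. - A (?fi m) (?fi n)"
  have "?fi \<circ> f = id" by (auto simp: isometries_inv[OF f])
  then have "(tmap ?fi (- t), E_class ?fi ?A) \<otimes>\<^bsub>deg0 XI\<^esub> x = \<one>\<^bsub>deg0 XI\<^esub>"
    by (simp add: x Xi0_mult O_inv_closed Xi0_one additive.minus[OF additive_tmap[OF isometriesD(1)[OF isometries_inv(3)[OF f]]]] isometries_inv[OF f])
  moreover have "(tmap ?fi (- t), E_class ?fi ?A) \<in> carrier (deg0 XI)" using O_inv_closed[OF x(2)] by (auto simp: Xi0_carrier)
  ultimately show "\<exists>y\<in>carrier (deg0 XI). y \<otimes>\<^bsub>deg0 XI\<^esub> x = \<one>\<^bsub>deg0 XI\<^esub>" by blast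
  fix y assume "y \<in> carrier (deg0 XI)"
  then obtain t' f' A' where y: "y = (t', E_class f' A')" "(f', A') \<in> carrier OJ" by (auto simp: Xi0_carrier)
  show "x \<otimes>\<^bsub>deg0 XI\<^esub> y \<in> carrier (deg0 XI)" using O_mult_closed[OF x(2) y(2)] by (auto simp: x y Xi0_mult Xi0_carrier)
  fix z assume "z \<in> carrier (deg0 XI)"
  then obtain t'' f'' A'' where z: "z = (t'', E_class f'' A'')" "(f'', A'') \<in> carrier OJ" by (auto simp: Xi0_carrier)
  have f': "f' \<in> isometries I" using y by (simp add: O_carrier)
  show "x \<otimes>\<^bsub>deg0 XI\<^esub> y \<otimes>\<^bsub>deg0 XI\<^esub> z = x \<otimes>\<^bsub>deg0 XI\<^esub> (y \<otimes>\<^bsub>deg0 XI\<^esub> z)"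
    by (simp add: x y z Xi0_mult O_mult_closed comp_assoc add.assoc additive.add[OF additive_tmap[OF isometriesD(1)[OF f]]]
        tmap_tmap[OF isometriesD(1)[OF f] isometriesD(1)[OF f']]) (simp add: o_def)
qed

lemma biadditive_square_form: "biadditive (square_form I n)"
  by (rule biadditiveI) (simp_all add: square_form_def I_simps algebra_simps)

lemma square_form_parity: "even (I n m - square_form I n m m)"
  by (simp add: square_form_def)

lemma symmetric_form_closed: "A \<in> symmetric_forms \<Longrightarrow> (id, A) \<in> carrier OJ"
  by (auto simp: symmetric_forms_def O_carrier id_isometry)

lemma square_form_symmetric: "square_form I n \<in> symmetric_forms"
  using biadditive_square_form by (simp add: symmetric_forms_def square_form_def)

lemma square_form_closed: "(id, square_form I n) \<in> carrier OJ"
  by (rule symmetric_form_closed[OF square_form_symmetric])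

text \<open>Replacing \<open>n\<close> by \<open>n + 2m\<close> changes \<open>n/2\<close> by the
  lattice vector \<open>m\<close>, which \<open>exp\<close> kills, and \<open>I(n, -)\<close> by an
  even function. All admissible forms have diagonals of the same parity, so
  \<open>square_form I n\<close> may represent their class.\<close>

lemma bdry_Xi: "bdry XI (lattice_class n \<iota>) = (torus_exp (tens n (1/2)), E_class id (square_form I n))"
proof -
  let ?v = "(torus_exp (tens n (1/2)), E_class id (square_form I n))"
  have "{(torus_exp (tens n (1/2)), even_forms #>\<^bsub>OJ\<^esub> (id, A)) | n \<iota>' A.
           (n, \<iota>') \<in> lattice_class n' \<iota> \<and> A \<in> symmetric_forms \<and> (\<forall>m. even (I n m - A m m))} = {?v}" if nn: "n' = n" for n'
  proof (intro equalityI subsetI)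
    fix v assume "v \<in> {?v}"
    then show "v \<in> {(torus_exp (tens n (1/2)), even_forms #>\<^bsub>OJ\<^esub> (id, A)) | n \<iota>' A.
           (n, \<iota>') \<in> lattice_class n' \<iota> \<and> A \<in> symmetric_forms \<and> (\<forall>m. even (I n m - A m m))}"
      unfolding nn E_class_def using lattice_class_self[of n \<iota>] square_form_symmetric[of n] square_form_parity[of n] by blast
  next
    fix v assume "v \<in> {(torus_exp (tens n (1/2)), even_forms #>\<^bsub>OJ\<^esub> (id, A)) | n \<iota>' A.
           (n, \<iota>') \<in> lattice_class n' \<iota> \<and> A \<in> symmetric_forms \<and> (\<forall>m. even (I n m - A m m))}"
    then obtain m A where v: "v = (torus_exp (tens (n + zmul 2 m) (1/2)), E_class id A)" and A: "A \<in> symmetric_forms"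
      and par: "\<forall>m'. even (I (n + zmul 2 m) m' - A m' m')" unfolding nn lattice_class_eq_set E_class_def by blast
    have "tens (zmul 2 m) (1/2) = tens m (1 :: real)" by (simp add: zmul_2 tens_add_left flip: tens_add_right)
    moreover have "torus_exp (tens m 1) = 0" using torus_exp_eq_0 by blast
    ultimately have "torus_exp (tens (n + zmul 2 m) (1/2)) = torus_exp (tens n (1/2))"
      by (simp only: tens_add_left torus_exp_simps) simp
    moreover have "E_class id A = E_class id (square_form I n)"
    proof -
      have "even (A m' m' - square_form I n m' m')" for m'
        using spec[OF par, of m'] square_form_parity[of n m'] by (simp add: zmul_2 I_simps)
      then show ?thesis by (simp add: E_class_eq[OF symmetric_form_closed[OF A] square_form_closed])
    qed
    ultimately show "v \<in> {?v}" by (simp add: v)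
  qed
  from this[OF refl] show ?thesis unfolding Xi'_def by simp
qed

text \<open>The parity of \<open>A(n, n)\<close> is unchanged when twice a lattice element is added
  to \<open>n\<close>, because the mixed terms are doubled, and when an even form is added to
  \<open>A\<close>.\<close>

lemma act_Xi:
  assumes fA: "(f, A) \<in> carrier OJ"
  defines "fi \<equiv> inv_into UNIV f"
  shows "act XI (lattice_class n \<iota>) (t, E_class f A) = lattice_class (fi n) (\<iota> + of_int (A (fi n) (fi n)))"
proof -
  let ?v = "lattice_class (fi n) (\<iota> + of_int (A (fi n) (fi n)))"
  let ?S = "\<lambda>c e. {two_lattice #>\<^bsub>LE\<^esub> (inv_into UNIV f n, \<iota> + of_int (A (inv_into UNIV f n) (inv_into UNIV f n))) | n \<iota> f A.
           (n, \<iota>) \<in> c \<and> (f, A) \<in> e}"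
  have f: "f \<in> isometries I" and A: "biadditive A" using fA by (auto simp: O_carrier)
  have fi: "Modules.additive fi" unfolding fi_def by (rule isometriesD(1)[OF isometries_inv(3)[OF f]])
  have "?S (lattice_class n \<iota>) (E_class f A) = {?v}"
  proof (intro equalityI subsetI)
    fix v assume "v \<in> {?v}"
    then show "v \<in> ?S (lattice_class n \<iota>) (E_class f A)"
      using lattice_class_self[of n \<iota>] E_class_self[OF fA] unfolding fi_def lattice_class_def[of "inv_into UNIV f n"] by fast
  next
    fix v assume "v \<in> ?S (lattice_class n \<iota>) (E_class f A)"
    then obtain n' \<iota>' f' A' where v: "v = lattice_class (inv_into UNIV f' n') (\<iota>' + of_int (A' (inv_into UNIV f' n') (inv_into UNIV f' n')))"
      and n': "(n', \<iota>') \<in> lattice_class n \<iota>" and f': "(f', A') \<in> E_class f A" unfolding lattice_class_def[symmetric] by blast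
    obtain m where m: "n' = n + zmul 2 m" "\<iota>' = \<iota>" using n' unfolding lattice_class_eq_set by blast
    have f'f: "f' = f" and par: "even (A' m' m' - A m' m')" for m' using E_class_mem[OF f'] by auto
    have eq: "fi n' = fi n + zmul 2 (fi m)" by (simp add: m additive.add[OF fi] additive_zmul_hom[OF fi])
    have "even (A (fi n') (fi n') - A (fi n) (fi n))" unfolding eq by (simp add: zmul_2 biadditive_simps[OF A])
    with par[of "fi n'"] have "even (A' (fi n') (fi n') - A (fi n) (fi n))" by simp
    then have "(of_int (A' (fi n') (fi n')) :: bit) = of_int (A (fi n) (fi n))" by (simp only: of_int_bit_eq)
    then show "v \<in> {?v}" unfolding v f'f fi_def[symmetric] m(2) by (simp add: eq lattice_class_shift)
  qed
  then show ?thesis unfolding Xi'_def by simp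
qed

lemma crossed_module_Xi: "crossed_module XI"
  unfolding crossed_module_def
proof (intro conjI ballI)
  interpret X0: group "deg0 XI" by (rule group_Xi0)
  interpret X1: group "deg1 XI" by (rule group_Xi1)
  show "group (deg1 XI)" "group (deg0 XI)" by (rule group_Xi1 group_Xi0)+
  have bdry_closed: "bdry XI c \<in> carrier (deg0 XI)" if c_in: "c \<in> carrier (deg1 XI)" for c
  proof -
    obtain n \<iota> where "c = lattice_class n \<iota>" using c_in by (auto simp: Xi1_carrier)
    then show ?thesis using square_form_closed[of n] by (simp only: Xi0_carrier bdry_Xi) blast
  qed
  have act_closed: "act XI c x \<in> carrier (deg1 XI)" if cx: "c \<in> carrier (deg1 XI)" "x \<in> carrier (deg0 XI)" for c x
  proof -
    obtain n \<iota> t f A where "c = lattice_class n \<iota>" "x = (t, E_class f A)" "(f, A) \<in> carrier OJ"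
      using cx by (auto simp: Xi1_carrier Xi0_carrier)
    then show ?thesis by (simp only: act_Xi Xi1_carrier) blast
  qed
  show "bdry XI \<in> hom (deg1 XI) (deg0 XI)"
  proof (rule homI)
    fix c c' assume "c \<in> carrier (deg1 XI)" "c' \<in> carrier (deg1 XI)"
    then obtain n \<iota> n' \<iota>' where c: "c = lattice_class n \<iota>" "c' = lattice_class n' \<iota>'" by (auto simp: Xi1_carrier)
    have closed: "(id, \<lambda>m m'. square_form I n m m' + square_form I n' m m') \<in> carrier OJ"
      using O_mult_closed[OF square_form_closed[of n] square_form_closed[of n']] by (simp add: o_def id_def)
    \<comment> \<open>The diagonals differ by \<open>2 * I n m * I n' m\<close>.\<close>
    have "even (square_form I (n + n') m m - (square_form I n m m + square_form I n' m m))" for m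
      by (simp add: square_form_def I_simps)
    then have "E_class id (square_form I (n + n')) = E_class id (\<lambda>m m'. square_form I n m m' + square_form I n' m m')"
      by (simp only: E_class_eq[OF square_form_closed closed]) simp
    then show "bdry XI (c \<otimes>\<^bsub>deg1 XI\<^esub> c') = bdry XI c \<otimes>\<^bsub>deg0 XI\<^esub> bdry XI c'"
      by (simp add: c Xi1_mult bdry_Xi Xi0_mult square_form_closed tens_add_left torus_exp_simps)
  qed (rule bdry_closed)
  show "act XI c \<one>\<^bsub>deg0 XI\<^esub> = c" if c_in: "c \<in> carrier (deg1 XI)" for c
  proof -
    obtain n \<iota> where "c = lattice_class n \<iota>" using c_in by (auto simp: Xi1_carrier)
    then show ?thesis by (simp only: Xi0_one act_Xi[OF O_one_closed] inv_id id_apply of_int_0 add_0_right)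
  qed
  show "act XI c' (bdry XI c) = inv\<^bsub>deg1 XI\<^esub> c \<otimes>\<^bsub>deg1 XI\<^esub> c' \<otimes>\<^bsub>deg1 XI\<^esub> c"
    if c_in: "c \<in> carrier (deg1 XI)" and c'_in: "c' \<in> carrier (deg1 XI)" for c c'
  proof -
    obtain n \<iota> n' \<iota>' where c: "c = lattice_class n \<iota>" "c' = lattice_class n' \<iota>'" using c_in c'_in by (auto simp: Xi1_carrier)
    have cancel: "a + (b + (u + v)) + v = b + a + u" for a b u v :: bit
      by (cases a; cases b; cases u; cases v) simp_all
    \<comment> \<open>The action of the boundary adds the parity of \<open>I(n, n')\<close>, which
      is that of \<open>J(n, n') + J(n', n)\<close>, the commutator of the central
      extension.\<close>
    have "(of_int (square_form I n n' n') :: bit) = of_int (J n n' + J n' n)"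
      unfolding of_int_bit_eq by (simp add: square_form_def symm_def)
    then have "c \<otimes>\<^bsub>deg1 XI\<^esub> act XI c' (bdry XI c) = c' \<otimes>\<^bsub>deg1 XI\<^esub> c"
      by (simp only: c bdry_Xi act_Xi[OF square_form_closed] inv_id id_apply Xi1_mult of_int_add cancel add.commute[of n])
    then show ?thesis using c_in c'_in act_closed[OF c'_in bdry_closed[OF c_in]]
      by (metis X1.inv_solve_left X1.m_assoc X1.inv_closed X1.m_closed)
  qed
  fix x assume x_in: "x \<in> carrier (deg0 XI)"
  then obtain t f A where x: "x = (t, E_class f A)" and fA: "(f, A) \<in> carrier OJ" by (auto simp: Xi0_carrier)
  have f: "f \<in> isometries I" and A: "biadditive A" and A_eq: "\<And>m n. A m n - A n m = J m n - J (f m) (f n)"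
    using fA by (auto simp: O_carrier)
  let ?fi = "inv_into UNIV f"
  have fi: "Modules.additive ?fi" by (rule isometriesD(1)[OF isometries_inv(3)[OF f]])
  show "(\<lambda>c. act XI c x) \<in> hom (deg1 XI) (deg1 XI)"
  proof (rule homI)
    fix c c' assume "c \<in> carrier (deg1 XI)" "c' \<in> carrier (deg1 XI)"
    then obtain n \<iota> n' \<iota>' where c: "c = lattice_class n \<iota>" "c' = lattice_class n' \<iota>'" by (auto simp: Xi1_carrier)
    let ?a = "?fi n" and ?a' = "?fi n'"
    \<comment> \<open>The cross terms of \<open>A\<close> at the sum have the parity of their
      difference, which is \<open>J(?a', ?a) - J(n', n)\<close> by the relation defining
      \<open>O_tilde\<close>. This is the change of the extension cocycle under
      \<open>f\<close>.\<close>
    have "even (J n' n + A (?a + ?a') (?a + ?a') - (A ?a ?a + A ?a' ?a' + J ?a' ?a))"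
      using A_eq[of ?a' ?a] by (simp add: biadditive_simps[OF A] isometries_inv[OF f]) presburger
    then have "(of_int (J n' n) + of_int (A (?a + ?a') (?a + ?a')) :: bit) = of_int (A ?a ?a) + of_int (A ?a' ?a') + of_int (J ?a' ?a)"
      by (simp only: of_int_add[symmetric] of_int_bit_eq)
    then show "act XI (c \<otimes>\<^bsub>deg1 XI\<^esub> c') x = act XI c x \<otimes>\<^bsub>deg1 XI\<^esub> act XI c' x"
      by (simp only: c x Xi1_mult act_Xi[OF fA] additive.add[OF fi] add.assoc) (simp only: add_ac)
  qed (rule act_closed[OF _ x_in])
  fix c assume c_in: "c \<in> carrier (deg1 XI)"
  then obtain n \<iota> where c: "c = lattice_class n \<iota>" by (auto simp: Xi1_carrier)
  show "bdry XI (act XI c x) = inv\<^bsub>deg0 XI\<^esub> x \<otimes>\<^bsub>deg0 XI\<^esub> bdry XI c \<otimes>\<^bsub>deg0 XI\<^esub> x"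
  proof -
    have "tmap f (torus_exp (tens (?fi n) (1/2))) = torus_exp (tens n (1/2))"
      using isometriesD(1)[OF f] by (simp add: tmap_torus_exp isometries_inv[OF f])
    moreover have "I (?fi n) m = I n (f m)" for m
      using isometriesD(3)[OF f, of "?fi n" m] by (simp add: isometries_inv[OF f])
    then have "(\<lambda>m m'. A m m' + square_form I (?fi n) m m') = (\<lambda>m m'. square_form I n (f m) (f m') + A m m')"
      by (simp add: square_form_def add.commute)
    ultimately have "x \<otimes>\<^bsub>deg0 XI\<^esub> bdry XI (act XI c x) = bdry XI c \<otimes>\<^bsub>deg0 XI\<^esub> x"
      by (simp add: x c act_Xi[OF fA] bdry_Xi Xi0_mult fA square_form_closed add.commute)
    then show ?thesis using x_in c_in act_closed[OF c_in x_in] bdry_closed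
      by (metis X0.inv_solve_left X0.m_assoc X0.inv_closed X0.m_closed)
  qed
  show "act XI c (x \<otimes>\<^bsub>deg0 XI\<^esub> y) = act XI (act XI c x) y" if y_in: "y \<in> carrier (deg0 XI)" for y
  proof -
    obtain t' f' A' where y: "y = (t', E_class f' A')" and fA': "(f', A') \<in> carrier OJ" using y_in by (auto simp: Xi0_carrier)
    have f': "f' \<in> isometries I" using fA' by (simp add: O_carrier)
    let ?fi' = "inv_into UNIV f'"
    have "inv_into UNIV (f \<circ> f') n = ?fi' (?fi n)"
      using isometriesD(2)[OF isometries_comp[OF f f']] isometries_inv[OF f] isometries_inv[OF f']
      by (intro inv_f_eq) (simp_all add: bij_is_inj)
    then show ?thesis
      by (simp only: x y c Xi0_mult[OF fA fA'] act_Xi[OF fA] act_Xi[OF fA'] act_Xi[OF O_mult_closed[OF fA fA']] isometries_inv[OF f'] of_int_add add.assoc)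
  qed
qed

end

section \<open>Uniqueness of the data of weak automorphisms and pointed maps, and elements of order
  two in \<open>\<real>/\<int>\<close>\<close>

lemma abs_rmodz_eqI: "a = b + of_int z \<Longrightarrow> abs_rmodz a = abs_rmodz b"
  by (simp add: abs_rmodz_add)

lemma weak_aut_eqD:
  assumes "weak_aut f c k q = weak_aut f' c' k' q'"
  shows "f = f'" "c = (c' :: ('l::ab_group_add, real) tensor)" "q = q'" "\<And>X Y. X \<in> gset \<Longrightarrow> Y \<in> gset \<Longrightarrow> k X Y = k' X Y"
proof -
  have 1: "(\<lambda>X\<in>gset. aut f c X) = (\<lambda>X\<in>gset. aut f' c' X)"
    and 2: "(\<lambda>\<alpha>. (f (fst \<alpha>), snd \<alpha> + q (fst \<alpha>))) = (\<lambda>\<alpha>. (f' (fst \<alpha>), snd \<alpha> + q' (fst \<alpha>)))"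
    and 3: "(\<lambda>p\<in>gset \<times> gset. (0 :: 'l, k (fst p) (snd p))) = (\<lambda>p\<in>gset \<times> gset. (0, k' (fst p) (snd p)))"
    using assms unfolding weak_aut_def by (simp_all only: prod.inject)
  have "f m = f' m" "q m = q' m" for m using fun_cong[OF 2, of "(m, 0)"] by simp_all
  then show ff: "f = f'" "q = q'" by auto
  have "aut f c (0, - 1) = aut f' c' (0, - 1)" using fun_cong[OF 1, of "(0, - 1)"] by simp
  then show "c = c'" by (simp add: aut_def ff)
  show "k X Y = k' X Y" if "X \<in> gset" "Y \<in> gset" for X Y
    using fun_cong[OF 3, of "(X, Y)"] that by simp
qed

lemma pointed_map_eqD:
  assumes "pointed_map n e = pointed_map n' e'"
  shows "n = n'" "\<And>X. X \<in> gset \<Longrightarrow> e X = e' X"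
proof -
  show "n = n'" using fun_cong[OF assms, of "(0, - 1)"] by (simp add: pointed_map_def)
  show "e X = e' X" if "X \<in> gset" for X using fun_cong[OF assms, of X] that by (simp add: pointed_map_def)
qed

definition half :: "bit \<Rightarrow> rmodz" where
  "half \<iota> = abs_rmodz (if \<iota> = 0 then 0 else 1 / 2)"

lemma half_of_int: "half (of_int j) = abs_rmodz (of_int j / 2)"
proof (cases "even j")
  case True
  then obtain i where "j = 2 * i" by blast
  then show ?thesis using True by (simp add: half_def of_int_bit abs_rmodz_simps)
next
  case False
  then obtain i where "j = 2 * i + 1" by (metis oddE)
  then show ?thesis using False by (simp add: half_def of_int_bit) (simp add: abs_rmodz_eq add_divide_distrib)
qed

lemma bit_exhaust: obtains j where "(\<iota> :: bit) = of_int j"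
proof -
  have "\<exists>j. \<iota> = of_int j" by (cases \<iota>) (auto intro: exI[of _ 0] exI[of _ 1])
  then show thesis using that by blast
qed

lemma half_add: "half (\<iota> + \<iota>') = half \<iota> + half \<iota>'"
proof -
  obtain j j' where "\<iota> = of_int j" "\<iota>' = of_int j'" by (metis bit_exhaust)
  then show ?thesis
    by (simp only: of_int_add[symmetric] half_of_int) (simp add: add_divide_distrib abs_rmodz_add)
qed

lemma half_inject: "half \<iota> = half \<iota>' \<longleftrightarrow> \<iota> = \<iota>'"
proof
  assume *: "half \<iota> = half \<iota>'"
  obtain j j' where j: "\<iota> = of_int j" "\<iota>' = of_int j'" by (metis bit_exhaust)
  from * have "(of_int j - of_int j') / (2 :: real) \<in> \<int>" by (simp add: j half_of_int abs_rmodz_eq diff_divide_distrib)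
  then obtain i where "(of_int j - of_int j') / (2 :: real) = of_int i" by (elim Ints_cases)
  then have "real_of_int (j - j') = of_int (2 * i)" by simp
  then have "j - j' = 2 * i" by (simp only: of_int_eq_iff)
  then show "\<iota> = \<iota>'" by (simp add: j of_int_bit_eq)
qed simp

lemma half_torsion: assumes "s + s = 0" obtains \<iota> where "s = half \<iota>"
proof -
  obtain r where r: "s = abs_rmodz r" by (rule rmodz_exhaust)
  with assms have "r + r \<in> \<int>" by (simp add: abs_rmodz_add[symmetric] abs_rmodz_eq_0)
  then obtain j where "r + r = of_int j" by (elim Ints_cases)
  then have "r = of_int j / 2" by simp
  then have "s = half (of_int j)" by (simp only: r half_of_int)
  then show thesis by (rule that)
qed

section \<open>The span between the two crossed modules\<close>

context theta
begin

lemmas BJ = bform_simps[OF J] bform_vscale_left[OF J] bform_vscale_right[OF J]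

text \<open>
  The element \<open>(v, f, A)\<close> of the apex acts by \<open>f\<close> and conjugation with the translation by \<open>-v\<close>. Its
  cochain is the difference of the cocycle \<open>J(x, \<epsilon>y)/2\<close> and of its pullback; on the lattice this is
  \<open>(J - f\<^sup>*J)/2 = (A - A\<^sup>t)/2\<close>, which modulo \<open>1\<close> is the coboundary of \<open>m \<mapsto> A(m, m)/2\<close>.
\<close>

definition half_J :: "('l, real) tensor \<times> int \<Rightarrow> ('l, real) tensor \<times> int \<Rightarrow> rmodz" where
  "half_J X Y = abs_rmodz (bform J (fst X) (zmul (snd X) (fst Y)) / 2)"

definition lift_cochain :: "('l \<Rightarrow> 'l) \<Rightarrow> ('l, real) tensor \<Rightarrow> ('l, real) tensor \<times> int \<Rightarrow> ('l, real) tensor \<times> int \<Rightarrow> rmodz" where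
  "lift_cochain f v X Y = half_J X Y - half_J (aut f (vscale (-2) v) X) (aut f (vscale (-2) v) Y)"

text \<open>The even part \<open>A(m, m)/2\<close> comes from additivity on the lattice. The odd
  part \<open>I(f m, v)/2\<close> is dictated by the compatibility condition at the reflection
  \<open>(0, -1)\<close>, which determines the difference of the values at \<open>m\<close> and
  \<open>- m\<close>.\<close>

definition lift_twist :: "('l \<Rightarrow> 'l) \<Rightarrow> ('l \<Rightarrow> 'l \<Rightarrow> int) \<Rightarrow> ('l, real) tensor \<Rightarrow> 'l \<Rightarrow> rmodz" where
  "lift_twist f A v m = abs_rmodz ((of_int (A m m) + bform J (tens (f m) 1) v + bform J v (tens (f m) 1)) / 2)"

definition apex_wAct :: "('l, real) tensor \<times> ('l \<Rightarrow> 'l) \<times> ('l \<Rightarrow> 'l \<Rightarrow> int) \<Rightarrow> _" where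
  "apex_wAct = (\<lambda>(v, f, A). weak_aut f (vscale (-2) v) (lift_cochain f v) (lift_twist f A v))"

text \<open>A cup product: \<open>J\<close> is bilinear and unchanged when the sign acts on both
  arguments, so \<open>J(x, \<epsilon>y)\<close> is a cocycle, and so is its half.\<close>

lemma half_J_cocycle:
  assumes "X \<in> gset" "Y \<in> gset" "Z \<in> gset"
  shows "half_J X Y + half_J (gm X Y) Z = half_J Y Z + half_J X (gm Y Z)"
  unfolding half_J_def abs_rmodz_add[symmetric]
  by (rule arg_cong[of _ _ abs_rmodz], insert assms, elim gsetE) (simp_all add: gm_def BJ field_simps)

lemma analytic_half_J: "analytic_cochain2 half_J"
proof -
  have eq: "tcrd B b (zmul (snd (fst p)) (fst (snd p))) = of_int (snd (fst p)) * tcrd B b (fst (snd p))" for b p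
    by (simp add: additive_zmul_hom[OF additive_tcrd] zmul_eq_mult)
  have "real_analytic_on_atlas (prod_atlas A0 A0) (\<lambda>p. bform J (fst (fst p)) (zmul (snd (fst p)) (fst (snd p))) * (1/2))"
  proof (intro real_analytic_on_atlas_mult[OF finite_A00] real_analytic_bform[OF J finite_A00] real_analytic_on_atlas_const[OF finite_A00])
    fix b
    show "real_analytic_on_atlas (prod_atlas A0 A0) (\<lambda>p. tcrd B b (fst (fst p)))"
      by (rule real_analytic_on_atlas_prod(1)[OF finite_A0 finite_A0 real_analytic_tcrd])
    show "real_analytic_on_atlas (prod_atlas A0 A0) (\<lambda>p. tcrd B b (zmul (snd (fst p)) (fst (snd p))))"
      unfolding eq
      by (intro real_analytic_on_atlas_mult[OF finite_A00] real_analytic_on_atlas_prod(2)[OF finite_A0 finite_A0 real_analytic_tcrd]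
        real_analytic_on_atlas_chart_constant[OF finite_A00] chart_constant_prod(1)[OF chart_constant_comp[OF chart_constant_snd, of real_of_int]])
  qed
  then show ?thesis unfolding half_J_def[abs_def] by (intro analytic_cochain2_real) simp
qed

lemma isometry_bform:
  assumes "f \<in> isometries I"
  shows "bform J (tmap f x) (tmap f y) + bform J (tmap f y) (tmap f x) = bform J x y + bform J y x"
proof -
  have "pullback f I = I" using isometriesD(3)[OF assms] by (simp add: pullback_def fun_eq_iff)
  then show ?thesis
    using bform_tmap[OF biadditive_symm[OF J] isometriesD(1)[OF assms], of x y] by (simp add: bform_symm[OF J])
qed

lemma isometry_bform_left:
  assumes "f \<in> isometries I"
  shows "bform J (tens (f m) 1) (tmap f y) = bform J (tens m 1) y + bform J y (tens m 1) - bform J (tmap f y) (tens (f m) 1)"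
  using isometry_bform[OF assms, of "tens m 1" y] isometriesD(1)[OF assms] by (simp add: tmap_tens)

lemma weak_aut_data_apex_wAct:
  assumes fA: "(f, A) \<in> carrier OJ"
  shows "weak_aut_data J f (vscale (-2) v) (lift_cochain f v) (lift_twist f A v)"
  unfolding weak_aut_data_def
proof (intro conjI allI ballI)
  have f: "f \<in> isometries I" and A: "biadditive A" and Aeq: "\<And>m n. A m n - A n m = J m n - J (f m) (f n)"
    using fA by (auto simp: O_carrier)
  note fadd = isometriesD(1)[OF f]
  show "Modules.additive f" "bij f" using isometriesD[OF f] by simp_all
  show "lift_twist f A v 0 = 0" by (simp add: lift_twist_def biadditive_simps[OF A] additive.zero[OF fadd] tens_simps BJ abs_rmodz_simps)
  show "analytic_cochain2 (lift_cochain f v)" unfolding lift_cochain_def[abs_def]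
    by (intro analytic_cochain2_diff analytic_half_J analytic_cochain2_aut fadd)
  show "lift_cochain f v X Y + lift_cochain f v (gm X Y) Z = lift_cochain f v Y Z + lift_cochain f v X (gm Y Z)" if "X \<in> gset" "Y \<in> gset" "Z \<in> gset" for X Y Z
  proof -
    let ?g = "aut f (vscale (-2) v)"
    have "half_J (?g X) (?g Y) + half_J (gm (?g X) (?g Y)) (?g Z) = half_J (?g Y) (?g Z) + half_J (?g X) (gm (?g Y) (?g Z))"
      using that by (intro half_J_cocycle) simp_all
    moreover have "half_J X Y + half_J (gm X Y) Z = half_J Y Z + half_J X (gm Y Z)" by (rule half_J_cocycle[OF that])
    ultimately show ?thesis using that unfolding lift_cochain_def by (simp add: aut_gm[OF fadd] algebra_simps)
  qed
  show "lift_twist f A v m + lift_twist f A v n + lift_cochain f v (emb m) (emb n) = lift_twist f A v (m + n)" for m n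
  proof -
    have "real_of_int (A m n) - A n m = J m n - J (f m) (f n)" using arg_cong[OF Aeq[of m n], of real_of_int] by simp
    then show ?thesis
      unfolding lift_cochain_def lift_twist_def half_J_def abs_rmodz_add[symmetric] abs_rmodz_simps(4)[symmetric]
      \<comment> \<open>By the defining relation of \<open>A\<close>, the two sides differ by half
        of \<open>A m n - A n m - (A m n + A n m)\<close>, which is the integer
        \<open>- A n m\<close>.\<close>
      by (intro abs_rmodz_eqI[of _ _ "- A n m"])
        (simp add: emb_def aut_def tmap_tens[OF fadd] additive.add[OF fadd] tens_simps BJ biadditive_simps[OF A] bform_tens[OF J] field_simps)
  qed
  show "lift_twist f A v m + jr J (f m) (fst (aut f (vscale (-2) v) X)) + lift_cochain f v (emb m) X =
      jr J m (fst X) + lift_twist f A v (zmul (snd X) m) + lift_cochain f v X (emb (zmul (snd X) m))" if "X \<in> gset" for m X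
    unfolding lift_cochain_def lift_twist_def half_J_def jr_def form_ext_eq_bform[OF J] abs_rmodz_add[symmetric] abs_rmodz_simps(4)[symmetric]
    using that isometry_bform_left[OF f, of m "fst X"]
    by (intro arg_cong[of _ _ abs_rmodz], elim gsetE)
      (simp_all add: emb_def aut_def tmap_tens[OF fadd] tens_simps BJ biadditive_simps[OF A] additive.minus[OF fadd]
        additive.minus[OF additive_tmap[OF fadd]] field_simps)
qed

lemma apex_wAct_closed: "(f, A) \<in> carrier OJ \<Longrightarrow> apex_wAct (v, f, A) \<in> carrier (deg0 WP)"
  unfolding apex_wAct_def prod.case by (rule weak_aut_closed[OF weak_aut_data_apex_wAct])

definition apex :: "(('l, real) tensor \<times> ('l \<Rightarrow> 'l) \<times> ('l \<Rightarrow> 'l \<Rightarrow> int)) monoid" where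
  "apex = semidirect add_group OJ (\<lambda>x. tmap (fst x))"

lemma apex_carrier: "(v, f, A) \<in> carrier apex \<longleftrightarrow> (f, A) \<in> carrier OJ"
  by (simp add: apex_def semidirect_def add_group_def)

lemma apex_mult: "(v, f, A) \<otimes>\<^bsub>apex\<^esub> (v', f', A') = (v + tmap f v', f \<circ> f', \<lambda>m n. A (f' m) (f' n) + A' m n)"
  by (simp add: apex_def semidirect_def add_group_def O_mult)

lemma apex_one: "\<one>\<^bsub>apex\<^esub> = (0, id, \<lambda>m n. 0)"
  by (simp add: apex_def semidirect_def add_group_def O_one)

lemma group_apex: "group apex"
proof (rule groupI)
  show "\<one>\<^bsub>apex\<^esub> \<in> carrier apex" using O_one_closed by (simp add: apex_one apex_carrier)
  fix x assume "x \<in> carrier apex"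
  moreover obtain v f A where x: "x = (v, f, A)" by (cases x)
  ultimately have fA: "(f, A) \<in> carrier OJ" by (simp add: apex_carrier)
  then have f: "f \<in> isometries I" by (simp add: O_carrier)
  show "\<one>\<^bsub>apex\<^esub> \<otimes>\<^bsub>apex\<^esub> x = x" by (simp add: x apex_one apex_mult)
  let ?fi = "inv_into UNIV f"
  let ?A = "\<lambda>m n. - A (?fi m) (?fi n)"
  have "?fi \<circ> f = id" by (auto simp: isometries_inv[OF f])
  then have "(tmap ?fi (- v), ?fi, ?A) \<otimes>\<^bsub>apex\<^esub> x = \<one>\<^bsub>apex\<^esub>"
    by (simp add: x apex_mult apex_one additive.minus[OF additive_tmap[OF isometriesD(1)[OF isometries_inv(3)[OF f]]]] isometries_inv[OF f])
  moreover have "(tmap ?fi (- v), ?fi, ?A) \<in> carrier apex" using O_inv_closed[OF fA] by (simp add: apex_carrier)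
  ultimately show "\<exists>y\<in>carrier apex. y \<otimes>\<^bsub>apex\<^esub> x = \<one>\<^bsub>apex\<^esub>" by blast
  fix y assume "y \<in> carrier apex"
  moreover obtain v' f' A' where y: "y = (v', f', A')" by (cases y)
  ultimately have fA': "(f', A') \<in> carrier OJ" by (simp add: apex_carrier)
  then have f': "f' \<in> isometries I" by (simp add: O_carrier)
  show "x \<otimes>\<^bsub>apex\<^esub> y \<in> carrier apex" using O_mult_closed[OF fA fA'] by (simp add: x y apex_mult apex_carrier)
  fix z assume "z \<in> carrier apex"
  obtain v'' f'' A'' where z: "z = (v'', f'', A'')" by (cases z)
  show "x \<otimes>\<^bsub>apex\<^esub> y \<otimes>\<^bsub>apex\<^esub> z = x \<otimes>\<^bsub>apex\<^esub> (y \<otimes>\<^bsub>apex\<^esub> z)"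
    by (simp add: x y z apex_mult comp_assoc add.assoc additive.add[OF additive_tmap[OF isometriesD(1)[OF f]]]
        tmap_tmap[OF isometriesD(1)[OF f] isometriesD(1)[OF f']]) (simp add: o_def)
qed

sublocale apex: group apex by (rule group_apex)

text \<open>Each cochain is \<open>half_J\<close> minus its pullback, so the cochain of a composite
  telescopes. For the twists the isometry property moves \<open>f\<close> from one argument of
  \<open>I\<close> to the other.\<close>

lemma apex_wAct_hom: "apex_wAct \<in> hom apex (deg0 WP)"
proof (rule homI)
  fix x assume "x \<in> carrier apex"
  moreover obtain v f A where x: "x = (v, f, A)" by (cases x)
  ultimately have fA: "(f, A) \<in> carrier OJ" by (simp add: apex_carrier)
  then have f: "f \<in> isometries I" by (simp add: O_carrier)
  show "apex_wAct x \<in> carrier (deg0 WP)" unfolding x by (rule apex_wAct_closed[OF fA])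
  fix y assume "y \<in> carrier apex"
  moreover obtain v' f' A' where y: "y = (v', f', A')" by (cases y)
  ultimately have fA': "(f', A') \<in> carrier OJ" by (simp add: apex_carrier)
  then have f': "f' \<in> isometries I" by (simp add: O_carrier)
  note fadd = isometriesD(1)[OF f] isometriesD(1)[OF f']
  have "apex_wAct x \<otimes>\<^bsub>deg0 WP\<^esub> apex_wAct y = weak_comp (Theta' J) (apex_wAct x) (apex_wAct y)" by (simp add: wAct_plus_simps)
  also have "\<dots> = apex_wAct (x \<otimes>\<^bsub>apex\<^esub> y)"
    unfolding x y apex_wAct_def prod.case apex_mult weak_comp_eq[OF weak_aut_data_apex_wAct[OF fA] weak_aut_data_apex_wAct[OF fA']]
  proof (rule weak_aut_eqI)
    show c: "vscale (- 2) v + tmap f (vscale (- 2) v') = vscale (- 2) (v + tmap f v')"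
      by (simp add: tmap_vscale[OF fadd(1)] vscale_simps)
    show "lift_cochain f' v' X Y + lift_cochain f v (aut f' (vscale (- 2) v') X) (aut f' (vscale (- 2) v') Y) = lift_cochain (f \<circ> f') (v + tmap f v') X Y" for X Y
      unfolding lift_cochain_def by (simp add: aut_aut[OF fadd] c o_def)
    show "lift_twist f' A' v' m + lift_twist f A v (f' m) = lift_twist (f \<circ> f') (\<lambda>m n. A (f' m) (f' n) + A' m n) (v + tmap f v') m" for m
      using isometry_bform_left[OF f, of "f' m" v']
      unfolding lift_twist_def abs_rmodz_add[symmetric]
      by (intro arg_cong[of _ _ abs_rmodz]) (simp add: BJ field_simps)
  qed simp
  finally show "apex_wAct (x \<otimes>\<^bsub>apex\<^esub> y) = apex_wAct x \<otimes>\<^bsub>deg0 WP\<^esub> apex_wAct y" ..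
qed

definition apex_Xi :: "('l, real) tensor \<times> ('l \<Rightarrow> 'l) \<times> ('l \<Rightarrow> 'l \<Rightarrow> int) \<Rightarrow> _" where
  "apex_Xi = (\<lambda>(v, f, A). (torus_exp v, E_class f A))"

lemma apex_Xi_hom: "apex_Xi \<in> hom apex (deg0 XI)"
proof (rule homI)
  fix x assume "x \<in> carrier apex"
  moreover obtain v f A where x: "x = (v, f, A)" by (cases x)
  ultimately have fA: "(f, A) \<in> carrier OJ" by (simp add: apex_carrier)
  then have f: "f \<in> isometries I" by (simp add: O_carrier)
  show "apex_Xi x \<in> carrier (deg0 XI)" using fA unfolding x apex_Xi_def Xi0_carrier by auto
  fix y assume "y \<in> carrier apex"
  moreover obtain v' f' A' where y: "y = (v', f', A')" by (cases y)
  ultimately have fA': "(f', A') \<in> carrier OJ" by (simp add: apex_carrier)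
  show "apex_Xi (x \<otimes>\<^bsub>apex\<^esub> y) = apex_Xi x \<otimes>\<^bsub>deg0 XI\<^esub> apex_Xi y"
    by (simp add: x y apex_Xi_def apex_mult Xi0_mult[OF fA fA'] torus_exp_simps tmap_torus_exp[OF isometriesD(1)[OF f]])
qed

text \<open>
  The solutions \<open>e\<close> of the equation that the boundary of \<open>pointed_map n e\<close> be the image of
  \<open>(n/2, id, A)\<close>: on translations \<open>e\<close> is determined, and on reflections up to an element \<open>\<iota>/2\<close> of order two.
\<close>

definition rel_cochain :: "'l \<Rightarrow> bit \<Rightarrow> ('l, real) tensor \<times> int \<Rightarrow> rmodz" where
  "rel_cochain n \<iota> X = (if snd X = 1 then abs_rmodz (- (bform J (fst X) (tens n 1) + bform J (tens n 1) (fst X)) / 4)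
     else half \<iota> + abs_rmodz ((of_int (J n n) + bform J (fst X) (tens n 1) - bform J (tens n 1) (fst X)) / 4))"

lemma pointed_data_rel_cochain: "pointed_data (rel_cochain n \<iota>)"
proof -
  let ?n = "tens n 1 :: ('l, real) tensor"
  obtain r where r: "half \<iota> = abs_rmodz r" by (rule rmodz_exhaust)
  let ?a = "\<lambda>X :: ('l, real) tensor \<times> int. if snd X = 1 then 0 else r + of_int (J n n) / 4"
  let ?b = "\<lambda>X :: ('l, real) tensor \<times> int. if snd X = 1 then - (1/4) else 1/4 :: real"
  have eq: "rel_cochain n \<iota> = (\<lambda>X. abs_rmodz (?a X + (?b X * bform J (fst X) ?n + (- (1/4)) * bform J ?n (fst X))))"
    by (auto simp: rel_cochain_def r fun_eq_iff abs_rmodz_add[symmetric] field_simps intro!: arg_cong[of _ _ abs_rmodz])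
  have cc: "chart_constant A0 (\<lambda>X :: ('l, real) tensor \<times> int. if snd X = 1 then (a :: real) else b)" for a b
    by (rule chart_constant_comp[OF chart_constant_snd, of "\<lambda>\<epsilon>. if \<epsilon> = 1 then a else b"])
  have tn: "real_analytic_on_atlas A0 (\<lambda>X :: ('l, real) tensor \<times> int. tcrd B b ?n)" for b
    by (rule real_analytic_on_atlas_const[OF finite_A0])
  have "analytic_cochain1 (rel_cochain n \<iota>)"
    unfolding eq
    by (intro analytic_cochain1_real real_analytic_on_atlas_add[OF finite_A0] real_analytic_on_atlas_mult[OF finite_A0]
        real_analytic_on_atlas_chart_constant[OF finite_A0 cc] real_analytic_bform[OF J finite_A0] real_analytic_tcrd tn
        real_analytic_on_atlas_const[OF finite_A0])
  then show ?thesis by (simp add: pointed_data_def rel_cochain_def BJ abs_rmodz_simps)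
qed

text \<open>
  \<open>apex_rel x \<alpha> \<beta>\<close>: the trivializations \<open>\<alpha>\<close> and \<open>\<beta>\<close> of the two images of \<open>x\<close> correspond to each
  other.
\<close>

inductive apex_rel :: "('l, real) tensor \<times> ('l \<Rightarrow> 'l) \<times> ('l \<Rightarrow> 'l \<Rightarrow> int) \<Rightarrow> ('l \<times> bit) set \<Rightarrow>
    (('l, real) tensor \<times> int \<Rightarrow> 'l \<times> rmodz) \<Rightarrow> bool" where
  "(id, A) \<in> carrier OJ \<Longrightarrow> (\<And>m. even (I n m - A m m)) \<Longrightarrow>
    apex_rel (tens n (1/2), id, A) (lattice_class n \<iota>) (pointed_map n (rel_cochain n \<iota>))"

lemma apex_rel_closed:
  assumes "apex_rel x \<alpha> \<beta>"
  shows "x \<in> carrier apex" "\<alpha> \<in> carrier (deg1 XI)" "\<beta> \<in> carrier (deg1 WP)"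
  using assms by (auto elim!: apex_rel.cases simp: apex_carrier Xi1_carrier deg1_WP pointed_map_closed[OF pointed_data_rel_cochain])

lemma apex_rel_P:
  assumes "apex_rel x \<alpha> \<beta>"
  shows "apex_Xi x = bdry XI \<alpha>"
  using assms
proof cases
  case (1 A n \<iota>)
  have "even (A m m - square_form I n m m)" for m
    using 1(5)[of m] square_form_parity[of n m] by presburger
  then have "E_class id A = E_class id (square_form I n)"
    by (simp only: E_class_eq[OF 1(4) square_form_closed]) simp
  then show ?thesis by (simp add: 1 apex_Xi_def bdry_Xi)
qed

text \<open>Translating the reflections by \<open>- n\<close> changes \<open>half_J\<close> by terms
  linear in \<open>x\<close> and \<open>y\<close>, and by a constant. The quarters in
  \<open>rel_cochain\<close> are the coefficients that make these terms a coboundary, after the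
  correction by the action.\<close>

lemma lift_cochain_rel_cochain:
  assumes "X \<in> gset" "Y \<in> gset"
  shows "lift_cochain id (tens n (1/2)) X Y = bdry_cochain n (rel_cochain n \<iota>) X Y"
proof -
  obtain j where j: "\<iota> = of_int j" by (rule bit_exhaust)
  have c: "vscale (-2) (tens n (1/2)) = - (tens n 1 :: ('l, real) tensor)"
    by (simp add: vscale_tens flip: tens_simps)
  note defs = lift_cochain_def c bdry_cochain_def half_J_def jr_def form_ext_eq_bform[OF J] j rel_cochain_def half_of_int gm_def aut_def cs_def
  note collect = abs_rmodz_add[symmetric] abs_rmodz_simps(3,4)[symmetric]
  show ?thesis
  proof (cases rule: gsetE[OF assms(1)]; cases rule: gsetE[OF assms(2)])
    fix x y :: "('l, real) tensor"
    assume XY: "X = (x, 1)" "Y = (y, 1)"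
    show ?thesis unfolding XY defs
      by (simp add: tens_simps BJ collect) (simp add: abs_rmodz_eq_0 field_simps)
  next
    fix x y :: "('l, real) tensor"
    assume XY: "X = (x, 1)" "Y = (y, - 1)"
    show ?thesis unfolding XY defs
      by (simp add: collect) (intro abs_rmodz_eqI[of _ _ 0], simp add: BJ tens_simps field_simps)
  next
    fix x y :: "('l, real) tensor"
    assume XY: "X = (x, - 1)" "Y = (y, 1)"
    show ?thesis unfolding XY defs
      by (simp add: collect) (intro abs_rmodz_eqI[of _ _ 0], simp add: BJ tens_simps field_simps)
  next
    fix x y :: "('l, real) tensor"
    assume XY: "X = (x, - 1)" "Y = (y, - 1)"
    show ?thesis unfolding XY defs
      \<comment> \<open>Only for two reflections is there an integral discrepancy:
        \<open>\<iota>/2\<close> and \<open>J(n, n)/4\<close> each enter twice, so the constant of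
        the coboundary is \<open>- j - J(n, n)/2\<close>, against \<open>J(n, n)/2\<close> on the
        other side.\<close>
      by (simp add: collect) (intro abs_rmodz_eqI[of _ _ "J n n + j"], simp add: BJ bform_tens[OF J] tens_simps field_simps)
  qed
qed

lemma lift_twist_id: "lift_twist id A (tens n (1/2)) m = abs_rmodz (of_int (A m m) / 2 + of_int (I n m) / 4)"
  unfolding lift_twist_def symm_def by (simp add: bform_tens[OF J] field_simps)

lemma rel_cochain_emb: "rel_cochain n \<iota> (emb m) = abs_rmodz (- of_int (I n m) / 4)"
  unfolding rel_cochain_def symm_def emb_def by (simp add: bform_tens[OF J] field_simps)

lemma apex_rel_S:
  assumes "apex_rel x \<alpha> \<beta>"
  shows "apex_wAct x = bdry WP \<beta>"
  using assms
proof cases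
  case (1 A n \<iota>)
  show ?thesis unfolding 1 apex_wAct_def prod.case bdry_WP
  proof (rule weak_aut_eqI)
    show "vscale (-2) (tens n (1/2)) = - (tens n 1 :: ('l, real) tensor)"
      by (simp add: vscale_tens flip: tens_simps)
    fix m
    obtain j where "I n m - A m m = 2 * j" using 1(5)[of m] by blast
    \<comment> \<open>The two maps on the lattice differ by half of
      \<open>A(m, m) + I(n, m)\<close>, an integer exactly because of the parity condition.\<close>
    then have "real_of_int (I n m) = of_int (A m m) + 2 * of_int j" by (metis add.commute diff_add_cancel of_int_add of_int_mult of_int_numeral)
    then show "lift_twist id A (tens n (1/2)) m = rel_cochain n \<iota> (emb m)"
      unfolding lift_twist_id rel_cochain_emb by (intro abs_rmodz_eqI[of _ _ "A m m + j"]) (simp add: field_simps)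
  qed (simp_all add: lift_cochain_rel_cochain)
qed

text \<open>Here the cocycle \<open>J(n', n)\<close> modulo 2 of the lattice extension arises: on
  reflections, the product of the two pointed maps exceeds the quadratic expression for
  \<open>n + n'\<close> by half of that integer, up to an integer.\<close>

lemma apex_rel_mult:
  assumes "apex_rel x \<alpha> \<beta>" "apex_rel x' \<alpha>' \<beta>'"
  shows "apex_rel (x \<otimes>\<^bsub>apex\<^esub> x') (\<alpha> \<otimes>\<^bsub>deg1 XI\<^esub> \<alpha>') (\<beta> \<otimes>\<^bsub>deg1 WP\<^esub> \<beta>')"
  using assms(1)
proof cases
  case (1 A n \<iota>)
  show ?thesis using assms(2)
  proof cases
    case 2: (1 A' n' \<iota>')
    let ?A = "\<lambda>m m'. A m m' + A' m m'" and ?\<iota> = "\<iota> + \<iota>' + of_int (J n' n)"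
    have "(id, ?A) \<in> carrier OJ" using O_mult_closed[OF 1(4) 2(4)] by (simp add: o_def id_def)
    moreover have "even (I (n + n') m - ?A m m)" for m using 1(5)[of m] 2(5)[of m] by (simp add: I_simps)
    ultimately have "apex_rel (tens (n + n') (1/2), id, ?A) (lattice_class (n + n') ?\<iota>) (pointed_map (n + n') (rel_cochain (n + n') ?\<iota>))"
      by (rule apex_rel.intros)
    moreover have "x \<otimes>\<^bsub>apex\<^esub> x' = (tens (n + n') (1/2), id, ?A)" by (simp add: 1 2 apex_mult tens_simps)
    moreover have "\<alpha> \<otimes>\<^bsub>deg1 XI\<^esub> \<alpha>' = lattice_class (n + n') ?\<iota>" by (simp only: 1 2 Xi1_mult)
    moreover have "\<beta> \<otimes>\<^bsub>deg1 WP\<^esub> \<beta>' = pointed_map (n + n') (rel_cochain (n + n') ?\<iota>)"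
      unfolding 1 2 deg1_WP pointed_map_mult
    proof (rule pointed_map_eqI[OF refl])
      fix X :: "('l, real) tensor \<times> int" assume "X \<in> gset"
      then show "rel_cochain n' \<iota>' X + rel_cochain n \<iota> (aut (\<lambda>m. m) (- tens n' 1) X) = rel_cochain (n + n') ?\<iota> X"
      proof (cases rule: gsetE)
        case (1 x)
        then show ?thesis unfolding rel_cochain_def
          by (simp add: aut_def abs_rmodz_add[symmetric]) (rule arg_cong[of _ _ abs_rmodz], simp add: BJ tens_simps field_simps)
      next
        case (2 x)
        obtain r where r: "half \<iota> = abs_rmodz r" by (rule rmodz_exhaust)
        obtain r' where r': "half \<iota>' = abs_rmodz r'" by (rule rmodz_exhaust)
        show ?thesis unfolding 2 rel_cochain_def half_add half_of_int r r' fst_conv snd_conv aut_def abs_rmodz_add[symmetric]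
          by (simp add: abs_rmodz_add[symmetric])
            (intro abs_rmodz_eqI[of _ _ "- J n' n"], simp add: BJ tens_simps J_simps bform_tens[OF J] field_simps)
      qed
    qed
    ultimately show ?thesis by simp
  qed
qed

lemma apex_rel_act:
  assumes "apex_rel x \<alpha> \<beta>" "z \<in> carrier apex"
  shows "apex_rel (inv\<^bsub>apex\<^esub> z \<otimes>\<^bsub>apex\<^esub> (x \<otimes>\<^bsub>apex\<^esub> z)) (act XI \<alpha> (apex_Xi z)) (act WP \<beta> (apex_wAct z))"
  using assms(1)
proof cases
  case (1 A n \<iota>)
  obtain w f C where z: "z = (w, f, C)" by (cases z)
  have fC: "(f, C) \<in> carrier OJ" using assms(2) by (simp add: z apex_carrier)
  have f: "f \<in> isometries I" and C: "biadditive C" using fC by (auto simp: O_carrier)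
  have A: "biadditive A" "\<And>m m'. A m m' = A m' m" using 1(4) by (auto simp: O_carrier)
  note fadd = isometriesD(1)[OF f]
  define N where "N = inv_into UNIV f n"
  have N: "f N = n" by (simp add: N_def isometries_inv[OF f])
  let ?A = "\<lambda>m m'. A (f m) (f m')" and ?\<iota> = "\<iota> + of_int (C N N)"
  have A': "(id, ?A) \<in> carrier OJ"
    using biadditive_comp[OF A(1) fadd fadd] A(2) by (simp add: O_carrier id_isometry)
  moreover have "even (I N m - ?A m m)" for m
    using 1(5)[of "f m"] isometriesD(3)[OF f, of N m] by (simp add: N)
  ultimately have "apex_rel (tens N (1/2), id, ?A) (lattice_class N ?\<iota>) (pointed_map N (rel_cochain N ?\<iota>))"
    by (rule apex_rel.intros)
  moreover have "inv\<^bsub>apex\<^esub> z \<otimes>\<^bsub>apex\<^esub> (x \<otimes>\<^bsub>apex\<^esub> z) = (tens N (1/2), id, ?A)"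
  proof -
    have "z \<otimes>\<^bsub>apex\<^esub> (tens N (1/2), id, ?A) = x \<otimes>\<^bsub>apex\<^esub> z"
      by (simp add: 1 z apex_mult tmap_tens[OF fadd] N add.commute)
    moreover have "(tens N (1/2), id, ?A) \<in> carrier apex" using A' by (simp add: apex_carrier)
    ultimately show ?thesis
      using assms(2) by (metis apex.l_inv apex.inv_closed apex.l_one apex.m_assoc)
  qed
  moreover have "act XI \<alpha> (apex_Xi z) = lattice_class N ?\<iota>"
    unfolding 1 z apex_Xi_def prod.case act_Xi[OF fC] N_def ..
  moreover have "act WP \<beta> (apex_wAct z) = pointed_map N (rel_cochain N ?\<iota>)"
    unfolding 1 z apex_wAct_def prod.case act_WP[OF weak_aut_data_apex_wAct[OF fC]] N_def[symmetric]
  proof (rule pointed_map_eqI[OF refl])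
    fix X :: "('l, real) tensor \<times> int" assume "X \<in> gset"
    note tN = arg_cong[OF tmap_tens[OF fadd, of N 1], unfolded N, of "bform J _", symmetric]
    note collect = abs_rmodz_add[symmetric] abs_rmodz_simps(3,4)[symmetric]
    obtain j where j: "\<iota> = of_int j" by (rule bit_exhaust)
    note defs = rel_cochain_def half_add half_of_int j lift_cochain_def half_J_def lift_twist_def N emb_def aut_def
    from \<open>X \<in> gset\<close>
    show "rel_cochain n \<iota> (aut f (vscale (- 2) w) X) - lift_cochain f w X (emb (cs N (snd X))) - lift_twist f C w (cs N (snd X)) = rel_cochain N ?\<iota> X"
    proof (cases rule: gsetE)
      case (1 x)
      show ?thesis unfolding 1 defs
        using isometry_bform_left[OF f, of N x]
        by (simp add: tens_simps BJ biadditive_simps[OF C] additive.zero[OF fadd] additive.zero[OF additive_tmap[OF fadd]] collect N)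
          (intro abs_rmodz_eqI[of _ _ 0], simp add: field_simps)
    next
      case (2 x)
      \<comment> \<open>The isometry preserves \<open>I\<close>, and the diagonal of
        \<open>I\<close> is twice that of \<open>J\<close>.\<close>
      have "J n n = J N N" using isometriesD(3)[OF f, of N N] by (simp add: symm_def N)
      then show ?thesis unfolding 2 defs
        using isometry_bform_left[OF f, of N x]
        by (simp add: tmap_tens[OF fadd] collect N)
          \<comment> \<open>The twist contributes \<open>- C(N, N)/2\<close>, which agrees modulo 1
            with the summand \<open>C(N, N)/2\<close> in the action on the lattice
            extension.\<close>
          (intro abs_rmodz_eqI[of _ _ "- C N N"], simp add: BJ tens_simps bform_tens[OF J] field_simps)
    qed
  qed
  ultimately show ?thesis by simp
qed

lemma lattice_class_inject: "lattice_class n \<iota> = lattice_class n \<iota>' \<Longrightarrow> \<iota> = \<iota>'"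
  using lattice_class_self[of n \<iota>] unfolding lattice_class_eq_set[of n \<iota>'] by blast

lemma rel_cochain_inject: "pointed_map n (rel_cochain n \<iota>) = pointed_map n (rel_cochain n \<iota>') \<Longrightarrow> \<iota> = \<iota>'"
  using pointed_map_eqD(2)[of n "rel_cochain n \<iota>" n "rel_cochain n \<iota>'" "(0, - 1)"] by (simp add: rel_cochain_def half_inject)

lemma apex_rel_unique_right: "apex_rel x \<alpha> \<beta> \<Longrightarrow> apex_rel x \<alpha> \<beta>' \<Longrightarrow> \<beta> = \<beta>'"
  by (elim apex_rel.cases) (auto simp: tens_inject dest: lattice_class_inject)

lemma apex_rel_unique_left: "apex_rel x \<alpha> \<beta> \<Longrightarrow> apex_rel x \<alpha>' \<beta> \<Longrightarrow> \<alpha> = \<alpha>'"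
  by (elim apex_rel.cases) (auto simp: tens_inject dest: rel_cochain_inject)

text \<open>The equation of boundaries only says that \<open>v\<close> is \<open>n0/2\<close> up to
  a lattice vector \<open>m\<close>. Then \<open>v = (n0 + 2m)/2\<close>, and \<open>n0 + 2m\<close>
  represents the same class.\<close>

lemma apex_rel_exists_right:
  assumes "x \<in> carrier apex" "\<alpha> \<in> carrier (deg1 XI)" "apex_Xi x = bdry XI \<alpha>"
  shows "\<exists>\<beta>. apex_rel x \<alpha> \<beta>"
proof -
  obtain v f A where x: "x = (v, f, A)" by (cases x)
  obtain n0 \<iota> where \<alpha>: "\<alpha> = lattice_class n0 \<iota>" using assms(2) by (auto simp: Xi1_carrier)
  have fA: "(f, A) \<in> carrier OJ" using assms(1) by (simp add: x apex_carrier)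
  have tv: "torus_exp v = torus_exp (tens n0 (1/2))" and "E_class f A = E_class id (square_form I n0)"
    using assms(3) by (simp_all add: x \<alpha> apex_Xi_def bdry_Xi)
  then have f: "f = id" and par: "\<And>m. even (A m m - square_form I n0 m m)"
    by (simp_all add: E_class_eq[OF fA square_form_closed])
  have "torus_exp (v - tens n0 (1/2)) = 0" by (simp add: torus_exp_simps tv)
  then obtain m where "v - tens n0 (1/2) = tens m 1" by (auto simp: torus_exp_eq_0)
  moreover have "tens (zmul 2 m) (1/2) = tens m (1 :: real)" by (simp add: zmul_2 tens_add_left flip: tens_add_right)
  ultimately have v: "v = tens (n0 + zmul 2 m) (1/2)" by (simp add: tens_simps algebra_simps)
  have "even (I (n0 + zmul 2 m) m' - A m' m')" for m'
    using par[of m'] square_form_parity[of n0 m'] unfolding zmul_2 I_simps by presburger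
  from apex_rel.intros[OF fA[unfolded f] this, of \<iota>] show ?thesis unfolding x \<alpha> v f lattice_class_shift by blast
qed

end

text \<open>The commutator pairing of the central extension with cocycle \<open>K\<close>; only the
  cocycle identity enters.\<close>

lemma cocycle_commutator_additive:
  fixes K :: "'a::ab_group_add \<Rightarrow> 'a \<Rightarrow> 'b::ab_group_add"
  assumes K: "\<And>x y z. K x y + K (x + y) z = K y z + K x (y + z)"
  shows "biadditive (\<lambda>x y. K x y - K y x)"
proof -
  have left: "K (x + y) z - K z (x + y) = (K x z - K z x) + (K y z - K z y)" for x y z
  proof -
    have eqs: "K (x + y) z = K y z + K x (y + z) - K x y" "K z (x + y) = K z x + K (x + z) y - K x y"
      "K x (y + z) = K x z + K (x + z) y - K z y"
      using K[of x y z] K[of z x y] K[of x z y] by (simp_all add: eq_diff_eq add_ac)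
    show ?thesis unfolding eqs by (simp add: algebra_simps)
  qed
  show ?thesis
  proof (rule biadditiveI)
    show "K (x + y) z - K z (x + y) = (K x z - K z x) + (K y z - K z y)" for x y z by (rule left)
    show "K z (x + y) - K (x + y) z = (K z x - K x z) + (K z y - K y z)" for x y z
      using left[of x y z] by (simp add: algebra_simps)
  qed
qed

text \<open>In the extension defined by \<open>K\<close>, which is abelian by symmetry, the middle
  factors of a product of four lifts may be exchanged.\<close>

lemma symmetric_cocycle_interchange:
  fixes K :: "'a::ab_group_add \<Rightarrow> 'a \<Rightarrow> 'b::ab_group_add"
  assumes K: "\<And>x y z. K x y + K (x + y) z = K y z + K x (y + z)" and symm: "\<And>x y. K x y = K y x"
  shows "K a b + K c d + K (a + b) (c + d) = K a c + K b d + K (a + c) (b + d)"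
proof -
  have eq: "K b (c + d) = K c (b + d) + K b d - K c d"
    using K[of b c d] K[of c b d] symm[of b c] by (simp add: eq_diff_eq add_ac)
  have eqs: "K (a + b) (c + d) = K b (c + d) + K a (b + c + d) - K a b"
    "K (a + c) (b + d) = K c (b + d) + K a (b + c + d) - K a c"
    using K[of a b "c + d"] K[of a c "b + d"] by (simp_all add: eq_diff_eq add_ac)
  show ?thesis unfolding eqs eq by (simp add: algebra_simps)
qed

lemma zmul_tens: "zmul k (tens m a) = tens m (of_int k * (a :: real))"
  using additive_zmul_hom[OF biadditive_right[OF biadditive_tens], of m k a] by (simp add: zmul_eq_mult)

context theta
begin

text \<open>Two solutions \<open>e\<close> differ by a homomorphism \<open>d\<close> from
  \<open>t \<rtimes> {\<plusminus>1}\<close> to \<open>\<real>/\<int>\<close>. On \<open>t\<close>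
  it is invariant under the reflection, so \<open>2d = 0\<close> there, and divisibility of
  \<open>t\<close> gives \<open>d = 0\<close>. At the reflection its value has order at most two and
  is the bit \<open>\<iota>\<close>.\<close>

lemma apex_rel_exists_left:
  assumes "x \<in> carrier apex" "\<beta> \<in> carrier (deg1 WP)" "apex_wAct x = bdry WP \<beta>"
  shows "\<exists>\<alpha>. apex_rel x \<alpha> \<beta>"
proof -
  obtain v f A where x: "x = (v, f, A)" by (cases x)
  obtain n e where e: "pointed_data e" and \<beta>: "\<beta> = pointed_map n e"
    using assms(2) unfolding deg1_WP by (rule pointed_mapE)
  have fA: "(f, A) \<in> carrier OJ" using assms(1) by (simp add: x apex_carrier)
  note eq = assms(3)[unfolded x \<beta> apex_wAct_def prod.case bdry_WP]
  have f: "f = id" using weak_aut_eqD(1)[OF eq] by (simp add: id_def)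
  \<comment> \<open>Comparing the translations of the reflections gives
    \<open>- 2v = - n\<close>.\<close>
  have "vscale (- 1 / 2) (vscale (- 2) v) = vscale (- 1 / 2) (- tens n 1)" using weak_aut_eqD(2)[OF eq] by simp
  then have v: "v = tens n (1/2)" by (simp add: vscale_simps tens_simps)
  have q: "lift_twist id A (tens n (1/2)) m = e (emb m)" for m using fun_cong[OF weak_aut_eqD(3)[OF eq]] by (simp add: f v)
  have k: "bdry_cochain n (rel_cochain n 0) X Y = bdry_cochain n e X Y" if "X \<in> gset" "Y \<in> gset" for X Y
    using weak_aut_eqD(4)[OF eq that] lift_cochain_rel_cochain[OF that] by (simp add: f v)
  define d where "d X = e X - rel_cochain n 0 X" for X
  have d: "d (gm X Y) = d X + d Y" if "X \<in> gset" "Y \<in> gset" for X Y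
    using k[OF that] by (simp add: bdry_cochain_def d_def algebra_simps)
  let ?j = "(0, - 1) :: ('l, real) tensor \<times> int"
  have d1: "d (0, 1) = 0" using d[of "(0, 1)" "(0, 1)"] by simp
  have dj: "d ?j + d ?j = 0" using d[of ?j ?j] by (simp add: gm_def d1)
  have dV: "d (x, 1) = 0" for x
  proof -
    have "d (- x, 1) = d ?j + (d (x, 1) + d ?j)" for x
      using d[of ?j "(x, - 1)"] d[of "(x, 1)" ?j] by (simp add: gm_def additive.zero[OF additive_zmul(1)])
    then have "d (- x, 1) = d (x, 1)" for x using dj by (metis add.assoc add.commute add.left_neutral)
    moreover have "d (x + y, 1) = d (x, 1) + d (y, 1)" for x y using d[of "(x, 1)" "(y, 1)"] by (simp add: gm_def)
    ultimately have "d (x, 1) + d (x, 1) = 0" for x using d1 by (metis add.right_inverse)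
    moreover have "d (x, 1) = d (vscale (1/2) x, 1) + d (vscale (1/2) x, 1)"
      using \<open>\<And>y x. d (x + y, 1) = d (x, 1) + d (y, 1)\<close>[of "vscale (1/2) x" "vscale (1/2) x"] by (simp only: vscale_half)
    ultimately show ?thesis by simp
  qed
  obtain \<iota> where \<iota>: "d ?j = half \<iota>" using half_torsion[OF dj] .
  have "e X = rel_cochain n \<iota> X" if "X \<in> gset" for X
    using that
  proof (cases rule: gsetE)
    case (1 x)
    then show ?thesis using dV[of x] by (simp add: d_def rel_cochain_def)
  next
    case (2 x)
    have "d (x, - 1) = half \<iota>" using d[of "(x, 1)" ?j] dV[of x] \<iota> by (simp add: gm_def)
    then have "e X = half \<iota> + rel_cochain n 0 X" by (simp add: d_def 2 algebra_simps)
    then show ?thesis by (simp add: 2 rel_cochain_def half_def abs_rmodz_simps)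
  qed
  then have \<beta>': "\<beta> = pointed_map n (rel_cochain n \<iota>)" and e_emb: "e (emb m) = rel_cochain n \<iota> (emb m)" for m
    unfolding \<beta> by (auto intro: pointed_map_eqI)
  have "even (I n m - A m m)" for m
  proof -
    \<comment> \<open>The parity condition is now extracted from the comparison of the maps on the
      lattice.\<close>
    have "real_of_int (A m m) / 2 + I n m / 4 - - I n m / 4 \<in> \<int>"
      using q[of m] unfolding e_emb lift_twist_id rel_cochain_emb abs_rmodz_eq by simp
    then obtain j where "real_of_int (A m m) / 2 + I n m / 4 - - I n m / 4 = of_int j" by (elim Ints_cases)
    then have "real_of_int (A m m + I n m) = of_int (2 * j)" by simp
    then have "A m m + I n m = 2 * j" by (simp only: of_int_eq_iff)
    then show ?thesis by presburger
  qed
  from apex_rel.intros[OF fA[unfolded f] this, of \<iota>] show ?thesis unfolding x v f \<beta>' by blast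
qed

end

section \<open>Essential surjectivity\<close>

context theta
begin

lemma V_cocycle:
  assumes "weak_aut_data J f c k q"
  shows "k (x, 1) (y, 1) + k (x + y, 1) (z, 1) = k (y, 1) (z, 1) + k (x, 1) (y + z, 1)"
  using wd_cocycle[OF assms, of "(x, 1)" "(y, 1)" "(z, 1)"] by (simp add: gm_def)

lemma V_commutator:
  assumes "weak_aut_data J f c k q"
  shows "k (tens m 1, 1) (x, 1) - k (x, 1) (tens m 1, 1) = jr J m x - jr J (f m) (tmap f x)"
  using wd_compat[OF assms, of "(x, 1)" m] by (simp add: aut_def emb_def algebra_simps)

lemma weak_aut_data_isometry:
  assumes data: "weak_aut_data J f c k q"
  shows "f \<in> isometries I"
proof -
  let ?a = "\<lambda>x y. k (x, 1) (y, 1) - k (y, 1) (x, 1)"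
  note a = cocycle_commutator_additive[of "\<lambda>x y. k (x, 1) (y, 1)", OF V_cocycle[OF data]]
  have f: "Modules.additive f" "bij f" by (rule wd_additive[OF data] wd_bij[OF data])+
  have diag: "J (f m) (f m) = J m m" for m
  proof -
    define d where "d = J m m - J (f m) (f m)"
    \<comment> \<open>A denominator larger than \<open>\<bar>d\<bar>\<close>: integrality of
      \<open>d / N\<close> then forces \<open>d = 0\<close>.\<close>
    define N where "N = \<bar>d\<bar> + 1"
    let ?u = "tens m (1 / of_int N) :: ('l, real) tensor"
    have N: "N > 0" by (simp add: N_def)
    then have "tens m 1 = zmul N ?u" by (simp add: zmul_tens)
    \<comment> \<open>The commutator is bimultiplicative and vanishes on equal arguments, hence it
      vanishes on a vector and its multiple.\<close>
    then have "?a (tens m 1) ?u = zmul N (?a ?u ?u)" using additive_zmul_hom[OF biadditive_left[OF a]] by simp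
    then have "jr J m ?u - jr J (f m) (tmap f ?u) = 0"
      unfolding V_commutator[OF data] by (simp add: additive.zero[OF additive_zmul(1)])
    then have "of_int d / real_of_int N \<in> \<int>"
      by (simp add: jr_def form_ext_eq_bform[OF J] tmap_tens[OF f(1)] bform_tens[OF J] d_def diff_divide_distrib
        abs_rmodz_eq_0 flip: abs_rmodz_simps(4))
    then obtain i where "of_int d / real_of_int N = of_int i" by (elim Ints_cases)
    then have "real_of_int d = of_int (i * N)" using N by (simp add: field_simps)
    then have "d = i * N" by (simp only: of_int_eq_iff)
    then have "N dvd d" by simp
    then have "d = 0" using zdvd_not_zless[of "\<bar>d\<bar>" N] by (cases "d = 0") (simp_all add: N_def)
    then show ?thesis by (simp add: d_def)
  qed
  have "I (f m) (f n) = I m n" for m n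
    using diag[of "m + n"] diag[of m] diag[of n] by (simp add: additive.add[OF f(1)] J_simps symm_def)
  then show ?thesis using f by (simp add: isometries_def)
qed

text \<open>For an isometry of \<open>I\<close> the form \<open>D = J - pullback f J\<close> is
  alternating. Its strictly upper triangular part with respect to an ordered basis has
  antisymmetrization \<open>D\<close>.\<close>

lemma isometry_form:
  assumes f: "f \<in> isometries I"
  obtains A where "(f, A) \<in> carrier OJ"
proof -
  define D where "D m n = J m n - J (f m) (f n)" for m n
  note fadd = isometriesD(1)[OF f]
  have D: "biadditive D" using biadditive_plus[OF J biadditive_uminus[OF biadditive_comp[OF J fadd fadd]]]
    unfolding D_def[abs_def] by simp
  have Dsym: "D n m = - D m n" for m n
    using isometriesD(3)[OF f, of m n] by (simp add: D_def symm_def)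
  have D0: "D m m = 0" for m using Dsym[of m m] by simp
  \<comment> \<open>An injection into the natural numbers serves as an order on the basis.\<close>
  obtain r :: "'l \<Rightarrow> nat" where r: "inj_on r B" using finite_imp_inj_to_nat_seg[OF finite_basis] by blast
  define U where "U m n = (\<Sum>b\<in>B. \<Sum>b'\<in>B. crd B m b * crd B n b' * (if r b < r b' then D b b' else 0))" for m n
  have "biadditive U"
    by (rule biadditiveI)
      (simp_all only: U_def crd_add distrib_left distrib_right sum.distrib)
  moreover have "U m n - U n m = D m n" for m n
  proof -
    have "U n m = (\<Sum>b\<in>B. \<Sum>b'\<in>B. crd B m b * crd B n b' * (if r b' < r b then D b' b else 0))"
      unfolding U_def by (subst sum.swap) (intro sum.cong refl, simp)
    then have "U m n - U n m = (\<Sum>b\<in>B. \<Sum>b'\<in>B. crd B m b * crd B n b' * (if r b < r b' then D b b' else 0)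
        - crd B m b * crd B n b' * (if r b' < r b then D b' b else 0))"
      by (simp add: U_def sum_subtractf)
    also have "\<dots> = (\<Sum>b\<in>B. \<Sum>b'\<in>B. crd B m b * crd B n b' * D b b')"
    proof (intro sum.cong refl)
      fix b b' assume "b \<in> B" "b' \<in> B"
      then have "r b = r b' \<Longrightarrow> b = b'" using r by (simp add: inj_on_def)
      then show "crd B m b * crd B n b' * (if r b < r b' then D b b' else 0)
        - crd B m b * crd B n b' * (if r b' < r b then D b' b else 0) = crd B m b * crd B n b' * D b b'"
        using Dsym[of b b'] D0[of b] by (cases "r b < r b'"; cases "r b' < r b") auto
    qed
    also have "\<dots> = D m n"
    proof -
      have "D m n = D (\<Sum>b\<in>B. zmul (crd B m b) b) (\<Sum>b\<in>B. zmul (crd B n b) b)" by (simp flip: crd_expand)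
      also have "\<dots> = (\<Sum>b\<in>B. \<Sum>b'\<in>B. crd B m b * crd B n b' * D b b')"
        by (simp add: additive.sum[OF biadditive_left[OF D]] additive.sum[OF biadditive_right[OF D]]
          additive_zmul_hom[OF biadditive_left[OF D]] additive_zmul_hom[OF biadditive_right[OF D]] zmul_eq_mult mult.assoc
          sum_distrib_left) (subst sum.swap, simp add: ac_simps)
      finally show ?thesis ..
    qed
    finally show ?thesis .
  qed
  ultimately have "(f, U) \<in> carrier OJ" using f by (simp add: O_carrier D_def)
  then show thesis by (rule that)
qed

end

context theta
begin

lemma tcrd_vscale: "tcrd B b (vscale r x) = r * tcrd B b (x :: ('l, real) tensor)"
  by (rule tensor_ext[of "\<lambda>x. tcrd B b (vscale r x)" "\<lambda>x. r * tcrd B b x"])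
    (simp_all add: additive_comp[OF additive_tcrd additive_vscale] tcrd_simps Modules.additive_def distrib_left additive.add[OF additive_vscale] tcrd_tens zmul_eq_mult)

lemma analytic_vscale: "analytic_map A0 A0 (\<lambda>X. (vscale r (fst X), 1) :: ('l, real) tensor \<times> int)"
proof (rule analytic_map_A0I[OF _ _ _ finite_A0])
  fix b
  have "real_analytic_on_atlas A0 (\<lambda>X. r * tcrd B b (fst X))"
    by (intro real_analytic_on_atlas_mult[OF finite_A0] real_analytic_on_atlas_const[OF finite_A0] real_analytic_tcrd)
  then show "real_analytic_on_atlas A0 (\<lambda>X. tcrd B b (fst (vscale r (fst X), 1 :: int)))" by (simp add: tcrd_vscale)
qed (auto simp: chart_constant_def)

lemma analytic_cochain1_small:
  assumes e: "analytic_cochain1 e" "e (0, 1) = 0" and b: "b \<in> B" and "\<epsilon> > 0"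
  shows "\<exists>d>0. \<forall>t. \<bar>t\<bar> < d \<longrightarrow> (\<exists>r. \<bar>r\<bar> < \<epsilon> \<and> e (tens b t, 1) = abs_rmodz r)"
proof -
  let ?p = "\<lambda>y. (\<Sum>b\<in>B. tens b (y b), 1 :: int)"
  let ?o = "\<lambda>b\<in>B. 0 :: real"
  have "(B, ?p) \<in> A0" using zbasis by (auto simp: A0_def)
  note p = this
  have "?o \<in> B \<rightarrow>\<^sub>E UNIV" by simp
  note E = analytic_map_A1E[OF finite_A0 e(1)[unfolded analytic_cochain1_def] p this]
  obtain m g r where g: "real_analytic_at B g ?o" "0 < r" "\<And>y. y \<in> near B r ?o \<Longrightarrow> (0, e (?p y)) = (m :: 'l, abs_rmodz (g y))"
    by (rule E) (rule that)
  obtain r' where r': "r' > 0" "\<forall>y\<in>near B r' ?o. \<bar>g y - g ?o\<bar> < \<epsilon>"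
    using real_analytic_at_continuous[OF finite_basis _ g(1) assms(4)] by auto
  have "?o \<in> near B r ?o" using g(2) by (auto simp: near_def)
  from g(3)[OF this] have g0: "abs_rmodz (g ?o) = 0" using e(2) by (simp add: tens_simps cong: sum.cong)
  have "\<exists>s. \<bar>s\<bar> < \<epsilon> \<and> e (tens b t, 1) = abs_rmodz s" if t: "\<bar>t\<bar> < min r r'" for t
  proof (intro exI conjI)
    let ?y = "\<lambda>b'\<in>B. if b' = b then t else 0"
    have y: "?y \<in> near B r ?o" "?y \<in> near B r' ?o" using t g(2) r'(1) by (auto simp: near_def)
    show "\<bar>g ?y - g ?o\<bar> < \<epsilon>" using r'(2) y(2) by blast
    have "(\<Sum>b'\<in>B. tens b' (?y b')) = (\<Sum>b'\<in>B. if b' = b then tens b t else 0)"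
      by (rule sum.cong) (auto simp: tens_simps)
    then have "?p ?y = (tens b t, 1)" using b finite_basis by simp
    with g(3)[OF y(1)] show "e (tens b t, 1) = abs_rmodz (g ?y - g ?o)" by (simp add: abs_rmodz_simps g0)
  qed
  then show ?thesis using g(2) r'(1) by (intro exI[of _ "min r r'"]) simp
qed

text \<open>A homomorphism from the reals to the circle that is continuous at 0 and trivial on the
  dense subgroup of rationals is trivial. Continuity is stated through small real representatives,
  so no topology on \<open>rmodz\<close> is involved.\<close>

lemma small_hom_zero:
  assumes h: "Modules.additive h" and rat: "\<And>r. r \<in> \<rat> \<Longrightarrow> h r = 0"
    and small: "\<And>\<epsilon>. \<epsilon> > 0 \<Longrightarrow> \<exists>d>0. \<forall>t. \<bar>t\<bar> < d \<longrightarrow> (\<exists>r. \<bar>r\<bar> < \<epsilon> \<and> h t = abs_rmodz r)"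
  shows "h (t :: real) = 0"
proof -
  obtain a0 where a0: "h t = abs_rmodz a0" by (rule rmodz_exhaust)
  define a where "a = frac a0"
  have a: "h t = abs_rmodz a" "0 \<le> a" "a < 1"
    by (simp_all add: a_def frac_lt_1) (simp add: a0 abs_rmodz_eq frac_def)
  have "a = 0"
  proof (rule ccontr)
    assume "a \<noteq> 0"
    \<comment> \<open>The distance from \<open>a\<close> to the integers. A rational translate of
      \<open>t\<close> near 0 has the same value and yet a representative closer to 0 than
      this.\<close>
    then have "min a (1 - a) > 0" using a by simp
    from small[OF this] obtain d where d: "d > 0" "\<And>t. \<bar>t\<bar> < d \<Longrightarrow> \<exists>r. \<bar>r\<bar> < min a (1 - a) \<and> h t = abs_rmodz r" by blast
    obtain r where r: "r \<in> \<rat>" "t < r" "r < t + d" using Rats_dense_in_real[of t "t + d"] d(1) by auto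
    have "h (t - r) = h t" by (simp add: additive.diff[OF h] rat[OF r(1)])
    moreover have "\<bar>t - r\<bar> < d" using r by simp
    ultimately obtain s where s: "\<bar>s\<bar> < min a (1 - a)" "abs_rmodz a = abs_rmodz s" using d(2)[of "t - r"] a by auto
    then have "a - s \<in> \<int>" by (simp add: abs_rmodz_eq)
    moreover have "0 < a - s" "a - s < 1" using s(1) by auto
    ultimately show False by (elim Ints_cases) simp
  qed
  then show ?thesis by (simp add: a abs_rmodz_simps)
qed

text \<open>For \<open>f = id\<close> the commutator is trivial if one argument is a lattice vector.
  Bimultiplicativity extends this to rational multiples: the pairing of \<open>b/j\<close> with
  \<open>y\<close> equals that of \<open>b\<close> with \<open>y/j\<close>. Continuity then covers
  all real multiples of basis vectors.\<close>

lemma V_symmetric: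
  assumes data: "weak_aut_data J (\<lambda>m. m) 0 k q"
  shows "k (x, 1) (y, 1) = k (y, 1) (x, 1)"
proof -
  let ?a = "\<lambda>x y. k (x, 1) (y, 1) - k (y, 1) (x, 1)"
  note a = cocycle_commutator_additive[of "\<lambda>x y. k (x, 1) (y, 1)", OF V_cocycle[OF data]]
  have lattice: "?a (tens m 1) y = 0" for m y using V_commutator[OF data, of m y] by simp
  have "?a (tens b t) y = 0" if b: "b \<in> B" for b t
  proof (rule small_hom_zero[of "\<lambda>t. ?a (tens b t) y"])
    show add: "Modules.additive (\<lambda>t. ?a (tens b t) y)"
      using additive_comp[OF biadditive_left[OF a] biadditive_right[OF biadditive_tens], of b] .
    fix r :: real assume "r \<in> \<rat>"
    then obtain i j where r: "j > 0" "r = of_int i / of_int j" by (rule Rats_cases') auto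
    let ?u = "tens b (1 / of_int j) :: ('l, real) tensor" and ?y = "vscale (1 / of_int j) y"
    have y: "y = zmul j ?y"
    proof (rule tensor_eqI)
      fix b assume "b \<in> B"
      show "tcrd B b y = tcrd B b (zmul j ?y)" using r by (simp add: additive_zmul_hom[OF additive_tcrd] tcrd_vscale zmul_eq_mult)
    qed
    have "?a ?u (zmul j ?y) = zmul j (?a ?u ?y)" by (rule additive_zmul_hom[OF biadditive_right[OF a]])
    then have "?a ?u y = zmul j (?a ?u ?y)" unfolding y[symmetric] .
    also have "\<dots> = ?a (zmul j ?u) ?y" by (rule additive_zmul_hom[OF biadditive_left[OF a], symmetric])
    also have "\<dots> = 0" using lattice[of b ?y] r by (simp add: zmul_tens)
    finally have "?a ?u y = 0" .
    moreover have "?a (zmul i ?u) y = zmul i (?a ?u y)" by (rule additive_zmul_hom[OF biadditive_left[OF a]])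
    ultimately have "?a (zmul i ?u) y = 0" by (simp only: additive.zero[OF additive_zmul(1)])
    then show "?a (tens b r) y = 0" by (simp add: zmul_tens r)
  next
    fix \<epsilon> :: real assume "\<epsilon> > 0"
    have id1: "analytic_map A0 A0 (\<lambda>X. (fst X, 1) :: ('l, real) tensor \<times> int)" using analytic_vscale[of 1] by simp
    have cy: "analytic_map A0 A0 (\<lambda>X. (y, 1) :: ('l, real) tensor \<times> int)" by (rule analytic_snd[of "\<lambda>_. (y, 1)"]) simp
    note k = wd_analytic[OF data]
    have "analytic_cochain1 (\<lambda>X. ?a (fst X) y)"
      by (rule analytic_cochain1_diff[OF analytic_cochain1_comp2[OF k id1 cy] analytic_cochain1_comp2[OF k cy id1]])
    from analytic_cochain1_small[OF this _ b \<open>\<epsilon> > 0\<close>]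
    show "\<exists>d>0. \<forall>t. \<bar>t\<bar> < d \<longrightarrow> (\<exists>r. \<bar>r\<bar> < \<epsilon> \<and> ?a (tens b t) y = abs_rmodz r)"
      by (simp add: wd_k_one[OF data])
  qed
  then have "(\<Sum>b\<in>B. ?a (tens b (tcrd B b x)) y) = 0" by simp
  then have "?a (\<Sum>b\<in>B. tens b (tcrd B b x)) y = 0" by (simp add: additive.sum[OF biadditive_left[OF a]])
  then show ?thesis by (simp flip: tensor_expand)
qed

text \<open>
  The extension of \<open>t\<close> by \<open>\<real>/\<int>\<close> with cocycle \<open>k\<close> is abelian. If \<open>\<sigma>\<close> is the conjugation with a lift of
  the reflection \<open>(0, -1)\<close> and \<open>X\<close> is a lift of \<open>x/2\<close>, then \<open>X - \<sigma>(X)\<close> is a lift of \<open>x\<close> which does not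
  depend on \<open>X\<close>, so it is a homomorphism in \<open>x\<close>. This is the section \<open>m\<close> below.
\<close>

lemma trivialize:
  assumes data: "weak_aut_data J (\<lambda>m. m) 0 k q"
  obtains e where "pointed_data e" "\<And>X Y. X \<in> gset \<Longrightarrow> Y \<in> gset \<Longrightarrow> e (gm X Y) = e X + e Y + k X Y"
proof -
  define K where "K x y = k (x, 1) (y, 1)" for x y
  define r where "r x = k (x, 1) (0, - 1)" for x
  define l where "l x = k (0, - 1) (x, 1)" for x
  \<comment> \<open>Conjugation with the lift of \<open>(0, -1)\<close> sends the lift
    \<open>(x, a)\<close> to \<open>(- x, a + s x)\<close>.\<close>
  define s where "s x = l x - r (- x)" for x
  \<comment> \<open>The circle component of the lift \<open>X - \<sigma>(X)\<close> of
    \<open>x + x\<close>, where \<open>X\<close> lies over \<open>x\<close>.\<close>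
  define L where "L x = K x x - s x - K (- x) x" for x
  define c where "c = k (0, - 1) (0, - 1)"
  have K: "K x y + K (x + y) z = K y z + K x (y + z)" for x y z
    unfolding K_def by (rule V_cocycle[OF data])
  have Ksym: "K x y = K y x" for x y unfolding K_def by (rule V_symmetric[OF data])
  have K0: "K 0 x = 0" "K x 0 = 0" for x by (simp_all add: K_def wd_k_one[OF data])
  note coc = wd_cocycle[OF data]
  have z0: "zmul \<epsilon> 0 = (0 :: ('l, real) tensor)" for \<epsilon> by (rule additive.zero[OF additive_zmul(1)])
  \<comment> \<open>The cocycle identity expresses \<open>k\<close> on all pairs of components
    through \<open>K\<close>, \<open>r\<close>, \<open>l\<close> and \<open>c\<close>.\<close>
  have c1: "k (x, 1) (y, - 1) = K x y + r (x + y) - r y" for x y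
    using coc[of "(x, 1)" "(y, 1)" "(0, - 1)"] by (simp add: gm_def K_def r_def z0 algebra_simps)
  have c2: "k (x, - 1) (y, 1) = l y + k (x, 1) (- y, - 1) - r x" for x y
    using coc[of "(x, 1)" "(0, - 1)" "(y, 1)"] by (simp add: gm_def r_def l_def z0 algebra_simps)
  have c7: "k (x, - 1) (0, - 1) = c - r x" for x
    using coc[of "(x, 1)" "(0, - 1)" "(0, - 1)"] by (simp add: gm_def c_def r_def z0 wd_k_one[OF data] algebra_simps)
  have c3: "k (x, - 1) (y, - 1) = k (x, - 1) (y, 1) + c - r (x - y) - r y" for x y
    using coc[of "(x, - 1)" "(y, 1)" "(0, - 1)"] c7[of "x - y"]
    by (simp add: gm_def r_def z0 algebra_simps)
  have c4: "l (x + y) = l x + k (- x, - 1) (y, 1) - K x y" for x y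
    using coc[of "(0, - 1)" "(x, 1)" "(y, 1)"] by (simp add: gm_def K_def l_def algebra_simps)
  have c5: "l x + k (- x, - 1) (0, - 1) = r x + k (0, - 1) (x, - 1)" for x
    using coc[of "(0, - 1)" "(x, 1)" "(0, - 1)"] by (simp add: gm_def r_def l_def z0)
  have c6: "k (0, - 1) (x, - 1) = c - l (- x)" for x
    using coc[of "(0, - 1)" "(0, - 1)" "(- x, 1)"] by (simp add: gm_def c_def l_def wd_k_one[OF data] algebra_simps)
  have s_add: "s (x + y) = s x + s y + K (- x) (- y) - K x y" for x y
    unfolding s_def c4 c2[of "- x"] c1[of "- x"] by (simp add: algebra_simps)
  have s_minus: "s (- x) = - s x" for x
    using c5[of x] unfolding c6 c7 s_def by (simp add: algebra_simps)
  have L_add: "L (x + y) = L x + L y + K (x + x) (y + y)" for x y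
  proof -
    have i1: "K (x + y) (x + y) = K x x + K y y + K (x + x) (y + y) - K x y - K x y"
      using symmetric_cocycle_interchange[OF K Ksym, of x y x y] by (simp add: eq_diff_eq add_ac)
    have i2: "K (- (x + y)) (x + y) = K (- x) x + K (- y) y - K x y - K (- x) (- y)"
      using symmetric_cocycle_interchange[OF K Ksym, of "- x" "- y" x y] by (simp add: K0 eq_diff_eq add_ac)
    show ?thesis unfolding L_def s_add i1 i2 by (simp add: algebra_simps)
  qed
  have L_minus: "L (- x) = L x + s (x + x)" for x
    unfolding L_def s_minus s_add using Ksym[of x "- x"] by (simp add: algebra_simps)
  let ?h = "vscale (1/2) :: ('l, real) tensor \<Rightarrow> _"
  define m where "m x = L (?h x)" for x
  have m_add: "m (x + y) = m x + m y + K x y" for x y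
    using L_add[of "?h x" "?h y"] by (simp only: m_def vscale_simps vscale_half)
  have m_minus: "m (- x) = m x + l x - r (- x)" for x
    using L_minus[of "?h x"] unfolding s_def m_def vscale_simps vscale_half by (simp add: algebra_simps)
  obtain c0 where c0: "c = abs_rmodz c0" by (rule rmodz_exhaust)
  \<comment> \<open>The value of the section at the reflection \<open>(0, -1)\<close>: as its square
    is the unit, \<open>a + a + c = 0\<close> is needed.\<close>
  define a where "a = abs_rmodz (- c0 / 2)"
  have a: "a + a + c = 0" unfolding a_def c0 abs_rmodz_add[symmetric] abs_rmodz_eq_0 by simp
  \<comment> \<open>The sign is written as a case distinction so that the second argument of
    \<open>k\<close> lies in \<open>gset\<close> for every integer \<open>snd X\<close>; this lets
    \<open>analytic_snd\<close> apply. On translations this term vanishes.\<close>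
  define e where "e X = m (fst X) + cs a (snd X) + k (fst X, 1) (0, if snd X = 1 then 1 else - 1)" for X
  have e1: "e (x, 1) = m x" and e2: "e (x, - 1) = m x + a + r x" for x
    by (simp_all add: e_def r_def wd_k_one[OF data])
  have "e (gm X Y) = e X + e Y + k X Y" if "X \<in> gset" "Y \<in> gset" for X Y
  proof (cases rule: gsetE[OF that(1)]; cases rule: gsetE[OF that(2)])
    fix x y assume "X = (x, 1)" "Y = (y, 1)"
    then show ?thesis by (simp add: gm_def e1 m_add K_def)
  next
    fix x y assume "X = (x, 1)" "Y = (y, - 1)"
    then show ?thesis by (simp add: gm_def e1 e2 m_add c1 algebra_simps)
  next
    fix x y assume "X = (x, - 1)" "Y = (y, 1)"
    then show ?thesis using m_add[of x "- y"] by (simp add: gm_def e1 e2 m_minus c1 c2 algebra_simps)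
  next
    fix x y assume XY: "X = (x, - 1)" "Y = (y, - 1)"
    have ca: "c = - a - a" using a by (simp add: eq_neg_iff_add_eq_0 algebra_simps)
    show ?thesis using m_add[of x "- y"] by (simp add: XY gm_def e1 e2 m_minus c1 c2 c3 ca algebra_simps)
  qed
  moreover have "pointed_data e"
  proof -
    have v: "analytic_map A0 A0 (\<lambda>X. (vscale t (fst X), 1) :: ('l, real) tensor \<times> int)" for t by (rule analytic_vscale)
    have id1: "analytic_map A0 A0 (\<lambda>X. (fst X, 1) :: ('l, real) tensor \<times> int)" using analytic_vscale[of 1] by simp
    have j: "analytic_map A0 A0 (\<lambda>X. (0, - 1) :: ('l, real) tensor \<times> int)" by (rule analytic_snd[of "\<lambda>_. (0, - 1)"]) simp
    have sg: "analytic_map A0 A0 (\<lambda>X. (0, if snd X = 1 then 1 else - 1) :: ('l, real) tensor \<times> int)"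
      by (rule analytic_snd[of "\<lambda>\<epsilon>. (0, if \<epsilon> = 1 then 1 else - 1)"]) simp
    have "vscale (-1/2) x = - vscale (1/2) x" for x :: "('l, real) tensor" using vscale_uminus_left[of "1/2" x] by simp
    \<comment> \<open>Written out, \<open>e\<close> is a sum of values of the analytic cochain
      \<open>k\<close> at analytic arguments and of a function of the sign.\<close>
    then have eq: "e = (\<lambda>X. k (vscale (1/2) (fst X), 1) (vscale (1/2) (fst X), 1)
        - (k (0, - 1) (vscale (1/2) (fst X), 1) - k (vscale (-1/2) (fst X), 1) (0, - 1))
        - k (vscale (-1/2) (fst X), 1) (vscale (1/2) (fst X), 1)
        + cs a (snd X) + k (fst X, 1) (0, if snd X = 1 then 1 else - 1))"
      unfolding e_def[abs_def] m_def L_def s_def l_def r_def K_def by simp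
    note k = wd_analytic[OF data]
    have "analytic_cochain1 e" unfolding eq
      by (rule analytic_cochain1_add[OF analytic_cochain1_add[OF analytic_cochain1_diff[OF analytic_cochain1_diff[OF
          analytic_cochain1_comp2[OF k v v] analytic_cochain1_diff[OF analytic_cochain1_comp2[OF k j v] analytic_cochain1_comp2[OF k v j]]]
          analytic_cochain1_comp2[OF k v v]] analytic_cochain1_snd[of "cs a"]] analytic_cochain1_comp2[OF k id1 sg]])
    moreover have "e (0, 1) = 0"
      using m_add[of 0 0] by (simp add: e1 K0)
    ultimately show ?thesis by (simp add: pointed_data_def)
  qed
  ultimately show thesis using that by blast
qed

end

context theta
begin

text \<open>Without \<open>k\<close> the map \<open>q\<close> is a homomorphism, and compatibility
  with the reflection gives \<open>q m = q (- m)\<close>, so its values have order at most two. They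
  are the halves of an integral linear function \<open>\<Phi>\<close>.\<close>

lemma apex_wAct_torsion:
  assumes data: "weak_aut_data J (\<lambda>m. m) 0 k q" and k: "\<And>X Y. X \<in> gset \<Longrightarrow> Y \<in> gset \<Longrightarrow> k X Y = 0"
  obtains A where "(id, A) \<in> carrier OJ" "apex_wAct (0, id, A) = weak_aut (\<lambda>m. m) 0 k q"
proof -
  have q: "Modules.additive q" using wd_q[OF data] k by (simp add: Modules.additive_def)
  have "q m + q m = 0" for m
    using wd_compat[OF data, of "(0, - 1)" m] k additive.minus[OF q, of m]
    by (simp add: aut_def eq_neg_iff_add_eq_0)
  then have "\<exists>\<iota>. q b = half \<iota>" for b by (metis half_torsion)
  then have "\<exists>j. q b = abs_rmodz (of_int j / 2)" for b by (metis bit_exhaust half_of_int)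
  then obtain \<phi> where \<phi>: "\<And>b. q b = abs_rmodz (of_int (\<phi> b) / 2)" by metis
  define \<Phi> where "\<Phi> m = (\<Sum>b\<in>B. crd B m b * \<phi> b)" for m
  have q\<Phi>: "q m = abs_rmodz (of_int (\<Phi> m) / 2)" for m
  proof -
    have "q m = q (\<Sum>b\<in>B. zmul (crd B m b) b)" by (simp flip: crd_expand)
    also have "\<dots> = (\<Sum>b\<in>B. zmul (crd B m b) (q b))" by (simp add: additive.sum[OF q] additive_zmul_hom[OF q])
    also have "\<dots> = (\<Sum>b\<in>B. abs_rmodz (of_int (crd B m b * \<phi> b) / 2))"
      by (simp add: \<phi> zmul_eq_mult flip: additive_zmul_hom[OF additive_abs_rmodz])
    also have "\<dots> = abs_rmodz (of_int (\<Phi> m) / 2)"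
      by (simp add: \<Phi>_def sum_divide_distrib flip: additive.sum[OF additive_abs_rmodz])
    finally show ?thesis .
  qed
  have \<Phi>_add: "\<Phi> (m + n) = \<Phi> m + \<Phi> n" for m n by (simp add: \<Phi>_def crd_add distrib_right sum.distrib)
  define A where "A m n = \<Phi> m * \<Phi> n" for m n
  have "biadditive A" by (rule biadditiveI) (simp_all add: A_def \<Phi>_add algebra_simps)
  then have "(id, A) \<in> carrier OJ" by (simp add: O_carrier id_isometry A_def)
  moreover have "apex_wAct (0, id, A) = weak_aut (\<lambda>m. m) 0 k q"
    unfolding apex_wAct_def prod.case
  proof (rule weak_aut_eqI)
    show "lift_twist id A 0 m = q m" for m
    proof -
      \<comment> \<open>An integer and its square have the same parity, so the diagonal of
        \<open>A\<close> reproduces the linear function \<open>\<Phi>\<close> modulo 2.\<close>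
      have "even (\<Phi> m * \<Phi> m - \<Phi> m)" by simp
      then obtain j where "\<Phi> m * \<Phi> m - \<Phi> m = 2 * j" by blast
      then have "\<Phi> m * \<Phi> m = \<Phi> m + 2 * j" by simp
      then show ?thesis
        unfolding lift_twist_def q\<Phi> A_def by (intro abs_rmodz_eqI[of _ _ j]) (simp add: BJ del: of_int_mult)
    qed
  qed (simp_all add: vscale_simps lift_cochain_def k aut_def)
  ultimately show thesis by (rule that)
qed

lemma apex_wAct_essentially_surjective:
  assumes w: "w \<in> carrier (deg0 WP)"
  shows "\<exists>x\<in>carrier apex. \<exists>\<beta>\<in>carrier (deg1 WP). apex_wAct x \<otimes>\<^bsub>deg0 WP\<^esub> bdry WP \<beta> = w"
proof -
  interpret W: xmodule WP by (rule xmodule.intro[OF crossed_module_WP])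
  have mult: "u \<otimes>\<^bsub>deg0 WP\<^esub> v = weak_comp (Theta' J) u v" for u v by (simp add: wAct_plus_simps)
  obtain f c k q where data: "weak_aut_data J f c k q" and w_eq: "w = weak_aut f c k q" using weak_autE[OF w] .
  have f: "f \<in> isometries I" by (rule weak_aut_data_isometry[OF data])
  obtain A where fA: "(f, A) \<in> carrier OJ" using isometry_form[OF f] .
  \<comment> \<open>The vector solves \<open>- 2v = c\<close>, so the apex element induces the same
    map on objects as \<open>w\<close>.\<close>
  let ?x1 = "(vscale (-1/2) c, f, A)"
  have x1: "?x1 \<in> carrier apex" using fA by (simp add: apex_carrier)
  have sx1: "apex_wAct ?x1 \<in> carrier (deg0 WP)" by (rule apex_wAct_closed[OF fA])
  define w1 where "w1 = inv\<^bsub>deg0 WP\<^esub> apex_wAct ?x1 \<otimes>\<^bsub>deg0 WP\<^esub> w"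
  have w1: "w1 \<in> carrier (deg0 WP)" "apex_wAct ?x1 \<otimes>\<^bsub>deg0 WP\<^esub> w1 = w"
    using sx1 w by (simp_all add: w1_def flip: W.G0.m_assoc)
  obtain f1 c1 k1 q1 where data1: "weak_aut_data J f1 c1 k1 q1" and w1_eq: "w1 = weak_aut f1 c1 k1 q1"
    using weak_autE[OF w1(1)] .
  have "f1 = (\<lambda>m. m)" "c1 = 0"
  proof -
    note eq = w1(2)[unfolded mult w1_eq w_eq apex_wAct_def prod.case weak_comp_eq[OF weak_aut_data_apex_wAct[OF fA] data1]]
    have "f (f1 m) = f m" for m using fun_cong[OF weak_aut_eqD(1)[OF eq]] .
    then show "f1 = (\<lambda>m. m)" using isometriesD(2)[OF f] by (auto simp: bij_def inj_def)
    have "tmap f c1 = 0" using weak_aut_eqD(2)[OF eq] by simp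
    then show "c1 = 0"
      using tmap_inv(2)[OF isometriesD(1,2)[OF f], of c1]
      by (simp add: additive.zero[OF additive_tmap[OF isometriesD(1)[OF isometries_inv(3)[OF f]]]])
  qed
  note data1 = data1[unfolded this] and w1_eq = w1_eq[unfolded this]
  obtain e where e: "pointed_data e" "\<And>X Y. X \<in> gset \<Longrightarrow> Y \<in> gset \<Longrightarrow> e (gm X Y) = e X + e Y + k1 X Y"
    using trivialize[OF data1] by blast
  \<comment> \<open>With lattice value 0 the boundary leaves objects fixed and has the plain
    coboundary of \<open>e\<close> as its cochain, which is \<open>k1\<close>.\<close>
  let ?\<beta> = "pointed_map 0 e"
  have \<beta>: "?\<beta> \<in> carrier (deg1 WP)" unfolding deg1_WP by (rule pointed_map_closed[OF e(1)])
  define w2 where "w2 = w1 \<otimes>\<^bsub>deg0 WP\<^esub> inv\<^bsub>deg0 WP\<^esub> bdry WP ?\<beta>"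
  have w2: "w2 \<in> carrier (deg0 WP)" "w2 \<otimes>\<^bsub>deg0 WP\<^esub> bdry WP ?\<beta> = w1"
    using \<beta> w1 by (simp_all add: w2_def W.G0.m_assoc)
  obtain f2 c2 k2 q2 where data2: "weak_aut_data J f2 c2 k2 q2" and w2_eq: "w2 = weak_aut f2 c2 k2 q2"
    using weak_autE[OF w2(1)] .
  note eq = w2(2)[unfolded mult w1_eq w2_eq bdry_WP weak_comp_eq[OF data2 weak_aut_data_bdry[OF e(1)]]]
  have f2: "f2 = (\<lambda>m. m)" using weak_aut_eqD(1)[OF eq] .
  have c2: "c2 = 0" using weak_aut_eqD(2)[OF eq] by (simp add: f2 tens_simps)
  have k2: "k2 X Y = 0" if "X \<in> gset" "Y \<in> gset" for X Y
    using weak_aut_eqD(4)[OF eq that] e(2)[OF that] by (simp add: bdry_cochain_def tens_simps)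
  obtain A2 where A2: "(id, A2) \<in> carrier OJ" "apex_wAct (0, id, A2) = w2"
    using apex_wAct_torsion[OF data2[unfolded f2 c2] k2] unfolding w2_eq f2 c2 by blast
  let ?x2 = "(0, id, A2)"
  have x2: "?x2 \<in> carrier apex" using A2 by (simp add: apex_carrier)
  have "w = apex_wAct ?x1 \<otimes>\<^bsub>deg0 WP\<^esub> (apex_wAct ?x2 \<otimes>\<^bsub>deg0 WP\<^esub> bdry WP ?\<beta>)" by (simp only: A2 w1 w2)
  also have "\<dots> = apex_wAct (?x1 \<otimes>\<^bsub>apex\<^esub> ?x2) \<otimes>\<^bsub>deg0 WP\<^esub> bdry WP ?\<beta>"
    using sx1 w2(1) \<beta> by (simp only: hom_mult[OF apex_wAct_hom x1 x2] A2 W.G0.m_assoc W.bdry_closed)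
  finally show ?thesis using apex.m_closed[OF x1 x2] \<beta> by blast
qed

lemma apex_Xi_surjective:
  assumes "u \<in> carrier (deg0 XI)"
  shows "\<exists>x\<in>carrier apex. apex_Xi x = u"
proof -
  obtain t f A where u: "u = (t, E_class f A)" "(f, A) \<in> carrier OJ" using assms by (auto simp: Xi0_carrier)
  obtain v where "t = torus_exp v" by (rule torus_exp_surj)
  then show ?thesis using u by (intro bexI[of _ "(v, f, A)"]) (simp_all add: apex_Xi_def apex_carrier)
qed

text \<open>By the uniqueness lemmas, \<open>apex_rel x\<close> is the graph of a bijection between
  trivializations; \<open>to_WP\<close> and \<open>to_XI\<close> are its two directions.\<close>

definition to_WP where "to_WP x \<alpha> = (THE \<beta>. apex_rel x \<alpha> \<beta>)"
definition to_XI where "to_XI x \<beta> = (THE \<alpha>. apex_rel x \<alpha> \<beta>)"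

lemma to_WP_eq: "apex_rel x \<alpha> \<beta> \<Longrightarrow> to_WP x \<alpha> = \<beta>"
  unfolding to_WP_def by (rule the_equality) (assumption, rule apex_rel_unique_right)

lemma to_XI_eq: "apex_rel x \<alpha> \<beta> \<Longrightarrow> to_XI x \<beta> = \<alpha>"
  unfolding to_XI_def by (rule the_equality) (assumption, rule apex_rel_unique_left)

lemma to_WP: "x \<in> carrier apex \<Longrightarrow> \<alpha> \<in> carrier (deg1 XI) \<Longrightarrow> apex_Xi x = bdry XI \<alpha> \<Longrightarrow> apex_rel x \<alpha> (to_WP x \<alpha>)"
  using apex_rel_exists_right to_WP_eq by metis

lemma to_XI: "x \<in> carrier apex \<Longrightarrow> \<beta> \<in> carrier (deg1 WP) \<Longrightarrow> apex_wAct x = bdry WP \<beta> \<Longrightarrow> apex_rel x (to_XI x \<beta>) \<beta>"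
  using apex_rel_exists_left to_XI_eq by metis

theorem WP_equivalent_XI: "monoidally_equivalent (cat_of_xmod WP) (cat_of_xmod XI)"
proof -
  interpret X: xmodule XI by (rule xmodule.intro[OF crossed_module_Xi])
  interpret W: xmodule WP by (rule xmodule.intro[OF crossed_module_WP])
  have "\<forall>u\<in>carrier (deg0 XI). \<exists>x. x \<in> carrier apex \<and> apex_Xi x = u" using apex_Xi_surjective by blast
  then obtain s where s: "\<forall>u\<in>carrier (deg0 XI). s u \<in> carrier apex \<and> apex_Xi (s u) = u" by (rule bchoice[THEN exE])
  have "\<forall>w\<in>carrier (deg0 WP). \<exists>p. fst p \<in> carrier apex \<and> snd p \<in> carrier (deg1 WP) \<and> apex_wAct (fst p) \<otimes>\<^bsub>deg0 WP\<^esub> bdry WP (snd p) = w"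
    using apex_wAct_essentially_surjective by (metis fst_conv snd_conv)
  then obtain r where r: "\<forall>w\<in>carrier (deg0 WP). fst (r w) \<in> carrier apex \<and> snd (r w) \<in> carrier (deg1 WP) \<and>
      apex_wAct (fst (r w)) \<otimes>\<^bsub>deg0 WP\<^esub> bdry WP (snd (r w)) = w" by (rule bchoice[THEN exE])
  \<comment> \<open>The map to \<open>T \<rtimes> E\<close> is surjective, so the correction is the
    unit; on the other side every weak automorphism is reached only up to a boundary, supplied by
    \<open>snd (r w)\<close>.\<close>
  have XW: "xspan XI WP apex apex_Xi apex_wAct to_WP s (\<lambda>_. \<one>\<^bsub>deg1 XI\<^esub>)"
  proof (intro xspan.intro xspan_axioms.intro X.xmodule_axioms W.xmodule_axioms group_apex apex_Xi_hom apex_wAct_hom)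
    fix x \<alpha> assume x: "x \<in> carrier apex" "\<alpha> \<in> carrier (deg1 XI)" "apex_Xi x = bdry XI \<alpha>"
    note R = to_WP[OF x]
    show "to_WP x \<alpha> \<in> carrier (deg1 WP)" by (rule apex_rel_closed(3)[OF R])
    show "bdry WP (to_WP x \<alpha>) = apex_wAct x" using apex_rel_S[OF R] ..
    show "act WP (to_WP x \<alpha>) (apex_wAct z) = to_WP (inv\<^bsub>apex\<^esub> z \<otimes>\<^bsub>apex\<^esub> (x \<otimes>\<^bsub>apex\<^esub> z)) (act XI \<alpha> (apex_Xi z))"
      if "z \<in> carrier apex" for z using to_WP_eq[OF apex_rel_act[OF R that]] ..
    show "to_WP x \<alpha> \<otimes>\<^bsub>deg1 WP\<^esub> to_WP x' \<alpha>' = to_WP (x \<otimes>\<^bsub>apex\<^esub> x') (\<alpha> \<otimes>\<^bsub>deg1 XI\<^esub> \<alpha>')"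
      if "x' \<in> carrier apex" "\<alpha>' \<in> carrier (deg1 XI)" "apex_Xi x' = bdry XI \<alpha>'" for x' \<alpha>'
      using to_WP_eq[OF apex_rel_mult[OF R to_WP[OF that]]] ..
  qed (use s in auto)
  have WX: "xspan WP XI apex apex_wAct apex_Xi to_XI (\<lambda>w. fst (r w)) (\<lambda>w. snd (r w))"
  proof (intro xspan.intro xspan_axioms.intro X.xmodule_axioms W.xmodule_axioms group_apex apex_Xi_hom apex_wAct_hom)
    fix x \<beta> assume x: "x \<in> carrier apex" "\<beta> \<in> carrier (deg1 WP)" "apex_wAct x = bdry WP \<beta>"
    note R = to_XI[OF x]
    show "to_XI x \<beta> \<in> carrier (deg1 XI)" by (rule apex_rel_closed(2)[OF R])
    show "bdry XI (to_XI x \<beta>) = apex_Xi x" using apex_rel_P[OF R] ..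
    show "act XI (to_XI x \<beta>) (apex_Xi z) = to_XI (inv\<^bsub>apex\<^esub> z \<otimes>\<^bsub>apex\<^esub> (x \<otimes>\<^bsub>apex\<^esub> z)) (act WP \<beta> (apex_wAct z))"
      if "z \<in> carrier apex" for z using to_XI_eq[OF apex_rel_act[OF R that]] ..
    show "to_XI x \<beta> \<otimes>\<^bsub>deg1 XI\<^esub> to_XI x' \<beta>' = to_XI (x \<otimes>\<^bsub>apex\<^esub> x') (\<beta> \<otimes>\<^bsub>deg1 WP\<^esub> \<beta>')"
      if "x' \<in> carrier apex" "\<beta>' \<in> carrier (deg1 WP)" "apex_wAct x' = bdry WP \<beta>'" for x' \<beta>'
      using to_XI_eq[OF apex_rel_mult[OF R to_XI[OF that]]] ..
  qed (use r in auto)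
  show ?thesis
  proof (rule monoidally_equivalent_span)
    show "xspan_equiv WP XI apex apex_wAct apex_Xi to_XI to_WP (\<lambda>w. fst (r w)) (\<lambda>w. snd (r w)) s (\<lambda>_. \<one>\<^bsub>deg1 XI\<^esub>)"
      by (intro xspan_equiv.intro XW WX xspan_equiv_axioms.intro) (rule to_WP_eq[OF to_XI])
    show "xspan_equiv XI WP apex apex_Xi apex_wAct to_WP to_XI s (\<lambda>_. \<one>\<^bsub>deg1 XI\<^esub>) (\<lambda>w. fst (r w)) (\<lambda>w. snd (r w))"
      by (intro xspan_equiv.intro XW WX xspan_equiv_axioms.intro) (rule to_XI_eq[OF to_WP])
  qed
qed

end

theorem theorem6p4:
  fixes J :: "'l::ab_group_add \<Rightarrow> 'l \<Rightarrow> int"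
  assumes lattice: "\<exists>B :: 'l set. zbasis B"
    and form: "biadditive J"
    and unimodular: "bij_betw (symm J) UNIV {h :: 'l \<Rightarrow> int. Modules.additive h}"
  shows "crossed_module (wAct_plus (Theta' J)) \<and>
    crossed_module (Xi' J) \<and>
    monoidally_equivalent (cat_of_xmod (wAct_plus (Theta' J))) (cat_of_xmod (Xi' J))"
proof -
  obtain B :: "'l set" where "zbasis B" using lattice ..
  then interpret theta B J using form by unfold_locales
  show ?thesis by (intro conjI crossed_module_WP crossed_module_Xi WP_equivalent_XI)
qed

end
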